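(* Let $(A,X,B)$ be a Keller admissible triple over $\Bbbk$. Then the natural projections $\pi_A:\mathrm{Hoch}_\oplus^\bullet(X)\to \mathrm{Hoch}_\oplus^\bullet(A)$ and $\pi_B:\mathrm{Hoch}_\oplus^\bullet(X)\to \mathrm{Hoch}_\oplus^\bullet(B)$ induce isomorphisms of Gerstenhaber algebras on cohomology $$\mathrm{HH}_\oplus^\bullet(A)\;\cong\;\mathrm{HH}_\oplus^\bullet(X)\;\cong\;\mathrm{HH}_\oplus^\bullet(B).$$
   Context: $\Bbbk$ is $\mathbb R$ or $\mathbb C$; graded means $\mathbb Z$-graded; dg algebras are over $\Bbbk$; $\otimes=\otimes_\Bbbk$, $\mathrm{Hom}=\mathrm{Hom}_\Bbbk$ is the graded Hom, $\mathrm{Hom}^r$ its degree $r$ part; $|x|$ is the degree of $x$; the Koszul sign rule is used. **Hochschild complex.** For a dg algebra $(A,d_A)$ and a dg $A$-$A$-bimodule $(M,d_M)$ let $\mathrm{Hoch}^{p,r}(A,M)=\mathrm{Hom}^r(A^{\otimes p},M)$, $p\ge 0$, and $\mathrm{Hoch}_\oplus^\bullet(A,M)=\bigoplus_{p+r=\bullet}\mathrm{Hoch}^{p,r}(A,M)$ (direct sum), with differential $d_{\mathcal H}+\partial$, where for $f\in\mathrm{Hoch}^{p,r}(A,M)$ $$d_{\mathcal H}(f)(a_0,\dots,a_p)=(-1)^{(p+r-1)+r|a_0|}a_0f(a_1,\dots,a_p)+\sum_{i=0}^{p-1}(-1)^{p+r+i}f(a_0,\dots,a_ia_{i+1},\dots,a_p)+(-1)^rf(a_0,\dots,a_{p-1})a_p,$$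 $$\partial(f)(a_1,\dots,a_p)=d_Mf(a_1,\dots,a_p)-(-1)^r\sum_{i=1}^p(-1)^{|a_1|+\dots+|a_{i-1}|}f(a_1,\dots,d_Aa_i,\dots,a_p).$$ $\mathrm{Hoch}_\oplus(A)=\mathrm{Hoch}_\oplus(A,A)$ and $\mathrm{HH}_\oplus$ denotes cohomology. For $f\in\mathrm{Hoch}^{p_1,r_1}(A,A)$, $g\in\mathrm{Hoch}^{p_2,r_2}(A,A)$ the cup product is $(f\cup g)(a_1,\dots,a_{p_1+p_2})=(-1)^{p_1p_2+r_2(|a_1|+\dots+|a_{p_1}|+p_1)}f(a_1,\dots,a_{p_1})g(a_{p_1+1},\dots,a_{p_1+p_2})$; with $f\circ_ig=f\circ(\mathrm{id}^{\otimes i-1}\otimes g\otimes\mathrm{id}^{\otimes p_1-i})$ the Gerstenhaber bracket is $[\![f,g]\!]=\sum_{i=1}^{p_1}(-1)^{(p_1-1)r_2+(i-1)(p_2-1)}f\circ_ig-(-1)^{(p_1+r_1-1)(p_2+r_2-1)}\sum_{j=1}^{p_2}(-1)^{(p_2-1)r_1+(j-1)(p_1-1)}g\circ_jf$. These make $\mathrm{HH}_\oplus^\bullet(A)$ a Gerstenhaber algebra. **Hochschild complex of a bimodule.** For a dg $A$-$B$-bimodule $X$, $A\ltimes X\rtimes B$ is the dg algebra with underlying space $A\oplus X\oplus B$, product $(a_1+x_1+b_1)(a_2+x_2+b_2)=a_1a_2+(a_1x_2+x_1b_2)+b_1b_2$ and differential $d_A+d_X+d_B$. Put $\mathrm{Hoch}^{p,q,r}(A,X,B)=\mathrm{Hom}^r(A^{\otimes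 p}\otimes X\otimes B^{\otimes q},X)$, $\mathrm{Hoch}_\oplus^\bullet(A,X,B)=\bigoplus_{p+q+r+1=\bullet}\mathrm{Hoch}^{p,q,r}(A,X,B)$, $\mathrm{Hoch}_\oplus^\bullet(X)=\mathrm{Hoch}_\oplus^\bullet(A)\oplus\mathrm{Hoch}_\oplus^\bullet(A,X,B)\oplus\mathrm{Hoch}_\oplus^\bullet(B)$. It is embedded in $\mathrm{Hoch}_\oplus^\bullet(A\ltimes X\rtimes B)$ by extending multilinear maps by zero (precomposing with projections onto $A,X,B$ and postcomposing with inclusions); it is closed under the differential, the bracket and the cup product, and carries the restricted structures. $\mathrm{HH}_\oplus^\bullet(X)$ is its cohomology, and $\pi_A,\pi_B$ are the projections onto the summands $\mathrm{Hoch}_\oplus(A)$, $\mathrm{Hoch}_\oplus(B)$. **Weak cone-nilpotency.** Let $M$ be an acyclic dg $A$-$A$-bimodule. A contracting homotopy is a $\Bbbk$-linear $h:M\to M$ of degree $-1$ with $d_Mh+hd_M=\mathrm{id}_M$; let $H(f)=h\circ f$ on $\mathrm{Hoch}_\oplus(A,M)$ and $\mathfrak h_k=(H\circ d_{\mathcal H})^k\circ H$, $k\ge0$. $M$ is pointwisely nilpotent if there is a contracting homotopy $h$ such that for every $f\in\mathrm{Hoch}_\oplus^\bullet(A,M)$ there is $N=N(f)$ with $\mathfrak h_k(f)=0$ for all $k>N$. The mapping cone of a morphism $\phi:M\to N$ of dg $A$-$A$-bimodules is $\mathrm{Cone}(\phi)=M[1]\oplus N$ with differential $(m,n)\mapsto(-d_Mm,\phi(m)+d_Nn)$,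 a dg $A$-$A$-bimodule (left action on $M[1]$ twisted by $(-1)^{|a|}$). A quasi-isomorphism $\phi:M\to N$ of dg $A$-$A$-bimodules is weakly cone-nilpotent if (i) $\mathrm{Cone}(\phi)$ is pointwisely nilpotent, or (ii) $\phi$ has a right inverse whose mapping cone is pointwisely nilpotent, or (iii) $\phi$ has a left inverse whose mapping cone is pointwisely nilpotent (inverses being morphisms of dg bimodules). **Keller admissible triple.** $A,B$ are dg algebras and $X$ is a dg $A$-$B$-bimodule. $\mathrm{Hom}_{B^{\mathrm{op}}}(X,X)$ (right $B$-linear maps) and $\mathrm{Hom}_A(X,X)$ (graded left $A$-linear maps) carry the differential $\partial_X=[d_X,-]$ (graded commutator). $\mathrm{Hom}_{B^{\mathrm{op}}}(X,X)$ is a dg $A$-$A$-bimodule by $(a\cdot f)(x)=a\cdot f(x)$, $(f\cdot a)(x)=f(ax)$; $\mathrm{Hom}_A(X,X)$ is a dg $B$-$B$-bimodule by $(b\cdot f)(x)=(-1)^{|b|(|f|+|x|)}f(xb)$, $(f\cdot b)(x)=(-1)^{|b||x|}f(x)b$. The triple is Keller admissible if: (i) the action maps $\rho_A:A\to\mathrm{Hom}_{B^{\mathrm{op}}}(X,X)$, $\rho_A(a)(x)=ax$, and $\rho_B:B^{\mathrm{op}}\to\mathrm{Hom}_A(X,X)$, $\rho_B(b)(x)=(-1)^{|x||b|}xb$, are weakly cone-nilpotent quasi-isomorphisms (of dg $A$-$A$-bimodules, resp. dg $B$-$B$-bimodules); (ii) the sequences $$0\to\mathrm{Hom}_{B^{\mathrm{op}}}(X,X)\hookrightarrow\mathrm{Hom}(X,X)\xrightarrow{d_R}\mathrm{Hom}(X\otimes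 B,X)\xrightarrow{d_R}\mathrm{Hom}(X\otimes B^{\otimes2},X)\xrightarrow{d_R}\cdots$$ $$0\to\mathrm{Hom}_A(X,X)\hookrightarrow\mathrm{Hom}(X,X)\xrightarrow{d_L}\mathrm{Hom}(A\otimes X,X)\xrightarrow{d_L}\mathrm{Hom}(A^{\otimes2}\otimes X,X)\xrightarrow{d_L}\cdots$$ are exact, where for $f\in\mathrm{Hom}^r(X\otimes B^{\otimes q},X)$: $d_R(f)(x;b_0,\dots,b_q)=(-1)^{q+r-1}f(xb_0;b_1,\dots,b_q)+\sum_{j=0}^{q-1}(-1)^{q+r+j}f(x;b_0,\dots,b_jb_{j+1},\dots,b_q)+(-1)^rf(x;b_0,\dots,b_{q-1})b_q$, and for $f\in\mathrm{Hom}^r(A^{\otimes p}\otimes X,X)$: $d_L(f)(a_0,\dots,a_p;x)=(-1)^{p+r+r|a_0|}a_0f(a_1,\dots,a_p;x)+\sum_{i=0}^{p-1}(-1)^{p+r+i+1}f(a_0,\dots,a_ia_{i+1},\dots,a_p;x)+(-1)^{r+1}f(a_0,\dots,a_{p-1};a_px)$. *)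

theory Defs
  imports Complex_Main "HOL-Library.Product_Plus" "HOL-Library.Function_Algebras"
begin

section \<open>The ground field\<close>

text \<open>Fields isomorphic to the real or to the complex numbers.\<close>

class real_or_complex = field +
  assumes real_or_complex:
    "(\<exists>\<phi> :: 'a \<Rightarrow> real. bij \<phi> \<and> (\<forall>x y. \<phi> (x + y) = \<phi> x + \<phi> y \<and> \<phi> (x * y) = \<phi> x * \<phi> y)) \<or>
     (\<exists>\<phi> :: 'a \<Rightarrow> complex. bij \<phi> \<and> (\<forall>x y. \<phi> (x + y) = \<phi> x + \<phi> y \<and> \<phi> (x * y) = \<phi> x * \<phi> y))"

instance real :: real_or_complex
  by standard (rule disjI1, rule exI[of _ id], simp)

instance complex :: real_or_complex
  by standard (rule disjI2, rule exI[of _ id], simp)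


section \<open>Graded vector spaces\<close>

text \<open>
  A graded vector space is an internal direct sum of subspaces \<open>G n\<close>, \<open>n :: int\<close>, of an ambient
  vector space; its underlying space \<open>gtot G\<close> may be smaller than the ambient type (this is needed
  for graded spaces of maps).
\<close>

definition is_decomp :: "(int \<Rightarrow> 'v::ab_group_add set) \<Rightarrow> 'v \<Rightarrow> (int \<Rightarrow> 'v) \<Rightarrow> bool" where
  "is_decomp G x v \<longleftrightarrow> (\<forall>n. v n \<in> G n) \<and> finite {n. v n \<noteq> 0} \<and> x = sum v {n. v n \<noteq> 0}"

definition gtot :: "(int \<Rightarrow> 'v::ab_group_add set) \<Rightarrow> 'v set" where
  "gtot G = {x. \<exists>v. is_decomp G x v}"

definition gcomp :: "(int \<Rightarrow> 'v::ab_group_add set) \<Rightarrow> 'v \<Rightarrow> int \<Rightarrow> 'v" where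
  "gcomp G x = (THE v. is_decomp G x v)"

text \<open>
  Formulas that involve the degree of \<open>x\<close> are given for homogeneous \<open>x\<close> and extended additively:
  \<open>lext G F\<close> is \<open>F n\<close> on \<open>G n\<close> (lemma \<open>lext_homogeneous\<close>).
\<close>

definition lext :: "(int \<Rightarrow> 'v::ab_group_add set) \<Rightarrow> (int \<Rightarrow> 'v \<Rightarrow> 'w::ab_group_add) \<Rightarrow> 'v \<Rightarrow> 'w" where
  "lext G F x = (\<Sum>n\<in>{n. gcomp G x n \<noteq> 0}. F n (gcomp G x n))"

definition sg :: "int \<Rightarrow> 'v::ab_group_add \<Rightarrow> 'v" where
  "sg n x = (if even n then x else - x)"

text \<open>\<open>tw G k\<close> is \<open>a \<mapsto> (-1)\<^bsup>k |a|\<^esup> a\<close>.\<close>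

definition tw :: "(int \<Rightarrow> 'v::ab_group_add set) \<Rightarrow> int \<Rightarrow> 'v \<Rightarrow> 'v" where
  "tw G k = lext G (\<lambda>n a. sg (k * n) a)"

record ('k, 'v) dgspace =
  scl :: "'k \<Rightarrow> 'v \<Rightarrow> 'v"
  grd :: "int \<Rightarrow> 'v set"
  dif :: "'v \<Rightarrow> 'v"

definition graded_space :: "('k::field, 'v::ab_group_add, 'z) dgspace_scheme \<Rightarrow> bool" where
  "graded_space V \<longleftrightarrow> vector_space (scl V) \<and>
     (\<forall>n. module.subspace (scl V) (grd V n)) \<and>
     (\<forall>v. is_decomp (grd V) 0 v \<longrightarrow> v = (\<lambda>_. 0))"

definition lin_deg :: "('k, 'v::ab_group_add, 'y) dgspace_scheme \<Rightarrow>
    ('k, 'w::ab_group_add, 'z) dgspace_scheme \<Rightarrow> int \<Rightarrow> ('v \<Rightarrow> 'w) \<Rightarrow> bool" where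
  "lin_deg V W r f \<longleftrightarrow>
     (\<forall>x\<in>gtot (grd V). \<forall>y\<in>gtot (grd V). f (x + y) = f x + f y) \<and>
     (\<forall>c. \<forall>x\<in>gtot (grd V). f (scl V c x) = scl W c (f x)) \<and>
     (\<forall>n. \<forall>x\<in>grd V n. f x \<in> grd W (n + r))"

definition bilin_deg :: "('k, 'u::ab_group_add, 'x) dgspace_scheme \<Rightarrow>
    ('k, 'v::ab_group_add, 'y) dgspace_scheme \<Rightarrow>
    ('k, 'w::ab_group_add, 'z) dgspace_scheme \<Rightarrow> ('u \<Rightarrow> 'v \<Rightarrow> 'w) \<Rightarrow> bool" where
  "bilin_deg U V W f \<longleftrightarrow>
     (\<forall>x\<in>gtot (grd U). \<forall>x'\<in>gtot (grd U). \<forall>y\<in>gtot (grd V). f (x + x') y = f x y + f x' y) \<and>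
     (\<forall>x\<in>gtot (grd U). \<forall>y\<in>gtot (grd V). \<forall>y'\<in>gtot (grd V). f x (y + y') = f x y + f x y') \<and>
     (\<forall>c. \<forall>x\<in>gtot (grd U). \<forall>y\<in>gtot (grd V).
        f (scl U c x) y = scl W c (f x y) \<and> f x (scl V c y) = scl W c (f x y)) \<and>
     (\<forall>m n. \<forall>x\<in>grd U m. \<forall>y\<in>grd V n. f x y \<in> grd W (m + n))"

lemma is_decomp_homogeneous:
  assumes "graded_space V" "x \<in> grd V n"
  shows "is_decomp (grd V) x (\<lambda>m. if m = n then x else 0)"
proof -
  interpret vector_space "scl V" using assms(1) by (simp add: graded_space_def)
  have z: "0 \<in> grd V m" for m
    using assms(1) by (simp add: graded_space_def subspace_0)
  have "{m. (if m = n then x else 0) \<noteq> 0} = (if x = 0 then {} else {n})" by auto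
  then show ?thesis using assms(2) z by (auto simp: is_decomp_def)
qed

lemma is_decomp_unique:
  assumes "graded_space V" "is_decomp (grd V) x v" "is_decomp (grd V) x w"
  shows "v = w"
proof -
  interpret vector_space "scl V" using assms(1) by (simp add: graded_space_def)
  have sub: "v n - w n \<in> grd V n" for n
    using assms by (simp add: graded_space_def is_decomp_def subspace_diff)
  let ?S = "{n. v n \<noteq> 0} \<union> {n. w n \<noteq> 0}"
  have fin: "finite ?S" using assms(2,3) by (simp add: is_decomp_def)
  have 1: "sum v {n. v n \<noteq> 0} = sum v ?S" by (rule sum.mono_neutral_left) (use fin in auto)
  have 2: "sum w {n. w n \<noteq> 0} = sum w ?S" by (rule sum.mono_neutral_left) (use fin in auto)
  have "sum (\<lambda>n. v n - w n) {n. v n - w n \<noteq> 0} = sum (\<lambda>n. v n - w n) ?S"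
    by (rule sum.mono_neutral_left) (use fin in auto)
  also have "\<dots> = 0" using 1 2 assms(2,3) by (simp add: sum_subtractf is_decomp_def)
  finally have s: "sum (\<lambda>n. v n - w n) {n. v n - w n \<noteq> 0} = 0" .
  have "finite {n. v n - w n \<noteq> 0}" by (rule finite_subset[OF _ fin]) auto
  then have "is_decomp (grd V) 0 (\<lambda>n. v n - w n)" using s sub by (simp add: is_decomp_def)
  then have "(\<lambda>n. v n - w n) = (\<lambda>_. 0)" using assms(1) by (simp add: graded_space_def)
  then show ?thesis by (auto simp: fun_eq_iff)
qed

lemma lext_homogeneous:
  assumes "graded_space V" "x \<in> grd V n" "F n 0 = 0"
  shows "lext (grd V) F x = F n x"
proof -
  have "gcomp (grd V) x = (\<lambda>m. if m = n then x else 0)"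
    unfolding gcomp_def
    by (rule the_equality)
      (auto intro: is_decomp_homogeneous[OF assms(1,2)] is_decomp_unique[OF assms(1)])
  moreover have "{m. (if m = n then x else 0) \<noteq> 0} = (if x = 0 then {} else {n})" by auto
  ultimately show ?thesis using assms(3) by (simp add: lext_def)
qed


section \<open>dg algebras and dg bimodules\<close>

definition dg_space :: "('k::field, 'v::ab_group_add, 'z) dgspace_scheme \<Rightarrow> bool" where
  "dg_space V \<longleftrightarrow> graded_space V \<and> lin_deg V V 1 (dif V) \<and>
     (\<forall>x\<in>gtot (grd V). dif V (dif V x) = 0)"

record ('k, 'a) dgalg = "('k, 'a) dgspace" +
  mul :: "'a \<Rightarrow> 'a \<Rightarrow> 'a"

text \<open>
  The underlying space of a dg algebra is a whole type. Units are not required, so unital dg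
  algebras and unital bimodules are included.
\<close>

definition dg_algebra :: "('k::field, 'a::ab_group_add) dgalg \<Rightarrow> bool" where
  "dg_algebra A \<longleftrightarrow> dg_space A \<and> gtot (grd A) = UNIV \<and> bilin_deg A A A (mul A) \<and>
     (\<forall>a b c. mul A (mul A a b) c = mul A a (mul A b c)) \<and>
     (\<forall>n. \<forall>a\<in>grd A n. \<forall>b. dif A (mul A a b) = mul A (dif A a) b + sg n (mul A a (dif A b)))"

record ('k, 'v, 'a, 'b) bimod = "('k, 'v) dgspace" +
  lact :: "'a \<Rightarrow> 'v \<Rightarrow> 'v"
  ract :: "'v \<Rightarrow> 'b \<Rightarrow> 'v"

definition dg_bimodule :: "('k::field, 'a::ab_group_add) dgalg \<Rightarrow> ('k, 'b::ab_group_add) dgalg \<Rightarrow>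
    ('k, 'v::ab_group_add, 'a, 'b) bimod \<Rightarrow> bool" where
  "dg_bimodule A B M \<longleftrightarrow> dg_space M \<and> bilin_deg A M M (lact M) \<and> bilin_deg M B M (ract M) \<and>
     (\<forall>a a'. \<forall>m\<in>gtot (grd M). lact M (mul A a a') m = lact M a (lact M a' m)) \<and>
     (\<forall>b b'. \<forall>m\<in>gtot (grd M). ract M m (mul B b b') = ract M (ract M m b) b') \<and>
     (\<forall>a b. \<forall>m\<in>gtot (grd M). ract M (lact M a m) b = lact M a (ract M m b)) \<and>
     (\<forall>n. \<forall>a\<in>grd A n. \<forall>m\<in>gtot (grd M).
        dif M (lact M a m) = lact M (dif A a) m + sg n (lact M a (dif M m))) \<and>
     (\<forall>n. \<forall>m\<in>grd M n. \<forall>b.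
        dif M (ract M m b) = ract M (dif M m) b + sg n (ract M m (dif B b)))"

definition regular_bimod :: "('k, 'a) dgalg \<Rightarrow> ('k, 'a, 'a, 'a) bimod" where
  "regular_bimod A = \<lparr>scl = scl A, grd = grd A, dif = dif A, lact = mul A, ract = mul A\<rparr>"

definition bimod_mor :: "('k, 'm::ab_group_add, 'a, 'b) bimod \<Rightarrow>
    ('k, 'n::ab_group_add, 'a, 'b) bimod \<Rightarrow> ('m \<Rightarrow> 'n) \<Rightarrow> bool" where
  "bimod_mor M N \<phi> \<longleftrightarrow> lin_deg M N 0 \<phi> \<and>
     (\<forall>m\<in>gtot (grd M). \<phi> (dif M m) = dif N (\<phi> m)) \<and>
     (\<forall>a. \<forall>m\<in>gtot (grd M). \<phi> (lact M a m) = lact N a (\<phi> m)) \<and>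
     (\<forall>b. \<forall>m\<in>gtot (grd M). \<phi> (ract M m b) = ract N (\<phi> m) b)"

definition mapping_cone :: "('k, 'a::ab_group_add) dgalg \<Rightarrow> ('m \<Rightarrow> 'n) \<Rightarrow>
    ('k, 'm::ab_group_add, 'a, 'b) bimod \<Rightarrow> ('k, 'n::ab_group_add, 'a, 'b) bimod \<Rightarrow>
    ('k, 'm \<times> 'n, 'a, 'b) bimod" where
  "mapping_cone A \<phi> M N =
     \<lparr>scl = (\<lambda>c (m, n). (scl M c m, scl N c n)),
      grd = (\<lambda>k. grd M (k + 1) \<times> grd N k),
      dif = (\<lambda>(m, n). (- dif M m, \<phi> m + dif N n)),
      lact = (\<lambda>a (m, n). (lact M (tw (grd A) 1 a) m, lact N a n)),
      ract = (\<lambda>(m, n) b. (ract M m b, ract N n b))\<rparr>"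


section \<open>Cohomology\<close>

definition cocycles :: "('k, 'v::ab_group_add, 'z) dgspace_scheme \<Rightarrow> int \<Rightarrow> 'v set" where
  "cocycles V n = {x \<in> grd V n. dif V x = 0}"

definition coboundaries :: "('k, 'v::ab_group_add, 'z) dgspace_scheme \<Rightarrow> int \<Rightarrow> 'v set" where
  "coboundaries V n = dif V ` grd V (n - 1)"

text \<open>
  Cohomology classes are cosets of coboundaries. As for cosets of a normal subgroup, operations on
  classes are defined elementwise; \<open>add_bd V n S\<close> is \<open>S\<close> plus the coboundaries of degree \<open>n\<close>.
\<close>

definition add_bd :: "('k, 'v::ab_group_add, 'z) dgspace_scheme \<Rightarrow> int \<Rightarrow> 'v set \<Rightarrow> 'v set" where
  "add_bd V n S = {x + b |x b. x \<in> S \<and> b \<in> coboundaries V n}"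

definition coh :: "('k, 'v::ab_group_add, 'z) dgspace_scheme \<Rightarrow> int \<Rightarrow> 'v set set" where
  "coh V n = (\<lambda>x. add_bd V n {x}) ` cocycles V n"

definition coh_map :: "('k, 'w::ab_group_add, 'z) dgspace_scheme \<Rightarrow> ('v \<Rightarrow> 'w) \<Rightarrow> int \<Rightarrow>
    'v set \<Rightarrow> 'w set" where
  "coh_map W \<phi> n C = add_bd W n (\<phi> ` C)"

definition cochain_map :: "('k, 'v::ab_group_add, 'y) dgspace_scheme \<Rightarrow>
    ('k, 'w::ab_group_add, 'z) dgspace_scheme \<Rightarrow> ('v \<Rightarrow> 'w) \<Rightarrow> bool" where
  "cochain_map V W \<phi> \<longleftrightarrow> lin_deg V W 0 \<phi> \<and> (\<forall>x\<in>gtot (grd V). \<phi> (dif V x) = dif W (\<phi> x))"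

definition quasi_iso :: "('k, 'v::ab_group_add, 'y) dgspace_scheme \<Rightarrow>
    ('k, 'w::ab_group_add, 'z) dgspace_scheme \<Rightarrow> ('v \<Rightarrow> 'w) \<Rightarrow> bool" where
  "quasi_iso V W \<phi> \<longleftrightarrow> (\<forall>n. bij_betw (coh_map W \<phi> n) (coh V n) (coh W n))"

definition dg_acyclic :: "('k, 'v::ab_group_add, 'z) dgspace_scheme \<Rightarrow> bool" where
  "dg_acyclic V \<longleftrightarrow> (\<forall>n. cocycles V n = coboundaries V n)"


section \<open>The Hochschild complex\<close>

text \<open>
  An element of \<open>Hom\<^sup>r(A\<^bsup>\<otimes>p\<^esup>, M)\<close> is a multilinear map, encoded as a function on lists that
  vanishes on lists of length different from \<open>p\<close>.
\<close>

definition hoch_pr :: "('k, 'a::ab_group_add, 'y) dgspace_scheme \<Rightarrow>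
    ('k, 'm::ab_group_add, 'z) dgspace_scheme \<Rightarrow> nat \<Rightarrow> int \<Rightarrow> ('a list \<Rightarrow> 'm) set" where
  "hoch_pr A M p r = {f.
     (\<forall>as. length as \<noteq> p \<longrightarrow> f as = 0) \<and>
     (\<forall>as bs x y. length as + 1 + length bs = p \<longrightarrow>
        f (as @ (x + y) # bs) = f (as @ x # bs) + f (as @ y # bs)) \<and>
     (\<forall>as bs c x. length as + 1 + length bs = p \<longrightarrow>
        f (as @ scl A c x # bs) = scl M c (f (as @ x # bs))) \<and>
     (\<forall>as ns. length as = p \<and> list_all2 (\<lambda>a n. a \<in> grd A n) as ns \<longrightarrow>
        f as \<in> grd M (sum_list ns + r))}"

text \<open>
  An element of total degree \<open>n\<close> of the direct sum is a single function on lists of all lengths: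
  its component in arity \<open>p\<close> is its restriction to lists of length \<open>p\<close>.
\<close>

definition arity_part :: "nat \<Rightarrow> ('a list \<Rightarrow> 'm::zero) \<Rightarrow> 'a list \<Rightarrow> 'm" where
  "arity_part p f = (\<lambda>as. if length as = p then f as else 0)"

definition hoch_deg :: "('k, 'a::ab_group_add, 'y) dgspace_scheme \<Rightarrow>
    ('k, 'm::ab_group_add, 'z) dgspace_scheme \<Rightarrow> int \<Rightarrow> ('a list \<Rightarrow> 'm) set" where
  "hoch_deg A M n = {f. (\<forall>p. arity_part p f \<in> hoch_pr A M p (n - int p)) \<and>
     finite {p. arity_part p f \<noteq> 0}}"

text \<open>\<open>contract \<mu> i [a\<^sub>0, \<dots>, a\<^sub>p] = [a\<^sub>0, \<dots>, \<mu> a\<^sub>i a\<^sub>i\<^sub>+\<^sub>1, \<dots>, a\<^sub>p]\<close>\<close>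

definition contract :: "('a \<Rightarrow> 'a \<Rightarrow> 'a) \<Rightarrow> nat \<Rightarrow> 'a list \<Rightarrow> 'a list" where
  "contract \<mu> i as = take i as @ \<mu> (as ! i) (as ! (i + 1)) # drop (i + 2) as"

definition hoch_dH_pr :: "('k, 'a::ab_group_add) dgalg \<Rightarrow> ('k, 'm::ab_group_add, 'a, 'a) bimod \<Rightarrow>
    nat \<Rightarrow> int \<Rightarrow> ('a list \<Rightarrow> 'm) \<Rightarrow> 'a list \<Rightarrow> 'm" where
  "hoch_dH_pr A M p r f as = (if length as = p + 1 then
       lext (grd A) (\<lambda>n a. sg ((int p + r - 1) + r * n) (lact M a (f (tl as)))) (hd as)
     + (\<Sum>i<p. sg (int p + r + int i) (f (contract (mul A) i as)))
     + sg r (ract M (f (butlast as)) (last as))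
   else 0)"

definition hoch_del_pr :: "('k, 'a::ab_group_add) dgalg \<Rightarrow> ('k, 'm::ab_group_add, 'z) dgspace_scheme \<Rightarrow>
    nat \<Rightarrow> int \<Rightarrow> ('a list \<Rightarrow> 'm) \<Rightarrow> 'a list \<Rightarrow> 'm" where
  "hoch_del_pr A M p r f as = (if length as = p then
     dif M (f as)
     - sg r (\<Sum>i<p. f (map (tw (grd A) 1) (take i as) @ dif A (as ! i) # drop (i + 1) as))
   else 0)"

definition hoch_dH :: "('k, 'a::ab_group_add) dgalg \<Rightarrow> ('k, 'm::ab_group_add, 'a, 'a) bimod \<Rightarrow>
    ('a list \<Rightarrow> 'm) \<Rightarrow> 'a list \<Rightarrow> 'm" where
  "hoch_dH A M = lext (hoch_deg A M) (\<lambda>n f as.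
     case length as of 0 \<Rightarrow> 0 | Suc p \<Rightarrow> hoch_dH_pr A M p (n - int p) (arity_part p f) as)"

definition hoch_del :: "('k, 'a::ab_group_add) dgalg \<Rightarrow> ('k, 'm::ab_group_add, 'z) dgspace_scheme \<Rightarrow>
    ('a list \<Rightarrow> 'm) \<Rightarrow> 'a list \<Rightarrow> 'm" where
  "hoch_del A M = lext (hoch_deg A M) (\<lambda>n f as.
     hoch_del_pr A M (length as) (n - int (length as)) (arity_part (length as) f) as)"

definition hoch_cup_pr :: "('k, 'a::ab_group_add) dgalg \<Rightarrow> nat \<Rightarrow> int \<Rightarrow> nat \<Rightarrow> int \<Rightarrow>
    ('a list \<Rightarrow> 'a) \<Rightarrow> ('a list \<Rightarrow> 'a) \<Rightarrow> 'a list \<Rightarrow> 'a" where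
  "hoch_cup_pr A p1 r1 p2 r2 f g as = (if length as = p1 + p2 then
     sg (int p1 * int p2 + r2 * int p1)
       (mul A (f (map (tw (grd A) r2) (take p1 as))) (g (drop p1 as)))
   else 0)"

text \<open>\<open>f \<circ>\<^sub>i g\<close> for \<open>1 \<le> i\<close>, where \<open>g\<close> has bidegree \<open>(p2, r2)\<close>; the Koszul sign is carried by \<open>tw\<close>.\<close>

definition hoch_circ :: "('k, 'a::ab_group_add) dgalg \<Rightarrow> nat \<Rightarrow> int \<Rightarrow> nat \<Rightarrow>
    ('a list \<Rightarrow> 'a) \<Rightarrow> ('a list \<Rightarrow> 'a) \<Rightarrow> 'a list \<Rightarrow> 'a" where
  "hoch_circ A p2 r2 i f g as =
     f (map (tw (grd A) r2) (take (i - 1) as) @ g (take p2 (drop (i - 1) as)) # drop (i - 1 + p2) as)"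

definition hoch_brk_pr :: "('k, 'a::ab_group_add) dgalg \<Rightarrow> nat \<Rightarrow> int \<Rightarrow> nat \<Rightarrow> int \<Rightarrow>
    ('a list \<Rightarrow> 'a) \<Rightarrow> ('a list \<Rightarrow> 'a) \<Rightarrow> 'a list \<Rightarrow> 'a" where
  "hoch_brk_pr A p1 r1 p2 r2 f g as = (if length as + 1 = p1 + p2 then
     (\<Sum>i = 1..p1. sg ((int p1 - 1) * r2 + (int i - 1) * (int p2 - 1)) (hoch_circ A p2 r2 i f g as))
     - sg ((int p1 + r1 - 1) * (int p2 + r2 - 1))
       (\<Sum>j = 1..p2. sg ((int p2 - 1) * r1 + (int j - 1) * (int p1 - 1)) (hoch_circ A p1 r1 j g f as))
   else 0)"

text \<open>The operations on elements of total degrees \<open>m\<close> and \<open>n\<close>, summed over the arities.\<close>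

definition hoch_cup :: "('k, 'a::ab_group_add) dgalg \<Rightarrow> int \<Rightarrow> int \<Rightarrow>
    ('a list \<Rightarrow> 'a) \<Rightarrow> ('a list \<Rightarrow> 'a) \<Rightarrow> 'a list \<Rightarrow> 'a" where
  "hoch_cup A m n f g as = (\<Sum>(p1, p2)\<in>{(p1, p2). p1 + p2 = length as}.
     hoch_cup_pr A p1 (m - int p1) p2 (n - int p2) (arity_part p1 f) (arity_part p2 g) as)"

definition hoch_brk :: "('k, 'a::ab_group_add) dgalg \<Rightarrow> int \<Rightarrow> int \<Rightarrow>
    ('a list \<Rightarrow> 'a) \<Rightarrow> ('a list \<Rightarrow> 'a) \<Rightarrow> 'a list \<Rightarrow> 'a" where
  "hoch_brk A m n f g as = (\<Sum>(p1, p2)\<in>{(p1, p2). p1 + p2 = length as + 1}.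
     hoch_brk_pr A p1 (m - int p1) p2 (n - int p2) (arity_part p1 f) (arity_part p2 g) as)"

text \<open>
  Cochain complexes with a product (of degree \<open>0\<close>) and a bracket (of degree \<open>-1\<close>), both given on
  homogeneous elements of the indicated degrees.
\<close>

record ('k, 'v) gcomplex = "('k, 'v) dgspace" +
  cupp :: "int \<Rightarrow> int \<Rightarrow> 'v \<Rightarrow> 'v \<Rightarrow> 'v"
  brkt :: "int \<Rightarrow> int \<Rightarrow> 'v \<Rightarrow> 'v \<Rightarrow> 'v"

definition Hoch :: "('k, 'a::ab_group_add) dgalg \<Rightarrow> ('k, 'a list \<Rightarrow> 'a) gcomplex" where
  "Hoch A =
     \<lparr>scl = (\<lambda>c f as. scl A c (f as)),
      grd = hoch_deg A A,
      dif = (\<lambda>f. hoch_dH A (regular_bimod A) f + hoch_del A A f),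
      cupp = hoch_cup A,
      brkt = hoch_brk A\<rparr>"


section \<open>The Hochschild complex of a bimodule\<close>

definition tri_alg :: "('k, 'a::ab_group_add) dgalg \<Rightarrow> ('k, 'x::ab_group_add, 'a, 'b) bimod \<Rightarrow>
    ('k, 'b::ab_group_add) dgalg \<Rightarrow> ('k, 'a \<times> 'x \<times> 'b) dgalg" where
  "tri_alg A X B =
     \<lparr>scl = (\<lambda>c (a, x, b). (scl A c a, scl X c x, scl B c b)),
      grd = (\<lambda>n. grd A n \<times> grd X n \<times> grd B n),
      dif = (\<lambda>(a, x, b). (dif A a, dif X x, dif B b)),
      mul = (\<lambda>(a1, x1, b1) (a2, x2, b2). (mul A a1 a2, lact X a1 x2 + ract X x1 b2, mul B b1 b2))\<rparr>"

text \<open>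
  \<open>Hom\<^sup>r(A\<^bsup>\<otimes>p\<^esup> \<otimes> X \<otimes> B\<^bsup>\<otimes>q\<^esup>, X)\<close>, and the total degree \<open>n\<close> part of the direct sum, with the same
  encoding as for \<open>hoch_pr\<close> and \<open>hoch_deg\<close>.
\<close>

definition hochX_pqr :: "('k, 'a::ab_group_add) dgalg \<Rightarrow> ('k, 'x::ab_group_add, 'a, 'b) bimod \<Rightarrow>
    ('k, 'b::ab_group_add) dgalg \<Rightarrow> nat \<Rightarrow> nat \<Rightarrow> int \<Rightarrow> ('a list \<Rightarrow> 'x \<Rightarrow> 'b list \<Rightarrow> 'x) set" where
  "hochX_pqr A X B p q r = {f.
     (\<forall>as x bs. length as \<noteq> p \<or> length bs \<noteq> q \<longrightarrow> f as x bs = 0) \<and>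
     (\<forall>as as' a a' x bs. length as + 1 + length as' = p \<and> length bs = q \<longrightarrow>
        f (as @ (a + a') # as') x bs = f (as @ a # as') x bs + f (as @ a' # as') x bs) \<and>
     (\<forall>as as' c a x bs. length as + 1 + length as' = p \<and> length bs = q \<longrightarrow>
        f (as @ scl A c a # as') x bs = scl X c (f (as @ a # as') x bs)) \<and>
     (\<forall>as x x' bs. length as = p \<and> length bs = q \<longrightarrow> f as (x + x') bs = f as x bs + f as x' bs) \<and>
     (\<forall>as c x bs. length as = p \<and> length bs = q \<longrightarrow> f as (scl X c x) bs = scl X c (f as x bs)) \<and>
     (\<forall>as x bs bs' b b'. length as = p \<and> length bs + 1 + length bs' = q \<longrightarrow>
        f as x (bs @ (b + b') # bs') = f as x (bs @ b # bs') + f as x (bs @ b' # bs')) \<and>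
     (\<forall>as x bs bs' c b. length as = p \<and> length bs + 1 + length bs' = q \<longrightarrow>
        f as x (bs @ scl B c b # bs') = scl X c (f as x (bs @ b # bs'))) \<and>
     (\<forall>as x bs ms k ns. length as = p \<and> length bs = q \<and> list_all2 (\<lambda>a m. a \<in> grd A m) as ms \<and>
        x \<in> grd X k \<and> list_all2 (\<lambda>b n. b \<in> grd B n) bs ns \<longrightarrow>
        f as x bs \<in> grd X (sum_list ms + k + sum_list ns + r))}"

definition arity_part2 :: "nat \<Rightarrow> nat \<Rightarrow> ('a list \<Rightarrow> 'x \<Rightarrow> 'b list \<Rightarrow> 'x::zero) \<Rightarrow>
    'a list \<Rightarrow> 'x \<Rightarrow> 'b list \<Rightarrow> 'x" where
  "arity_part2 p q f = (\<lambda>as x bs. if length as = p \<and> length bs = q then f as x bs else 0)"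

definition hochX_deg :: "('k, 'a::ab_group_add) dgalg \<Rightarrow> ('k, 'x::ab_group_add, 'a, 'b) bimod \<Rightarrow>
    ('k, 'b::ab_group_add) dgalg \<Rightarrow> int \<Rightarrow> ('a list \<Rightarrow> 'x \<Rightarrow> 'b list \<Rightarrow> 'x) set" where
  "hochX_deg A X B n = {f.
     (\<forall>p q. arity_part2 p q f \<in> hochX_pqr A X B p q (n - int p - int q - 1)) \<and>
     finite {(p, q). arity_part2 p q f \<noteq> 0}}"

text \<open>Extension by zero of multilinear maps to \<open>A \<ltimes> X \<rtimes> B\<close>.\<close>

definition embA :: "('a list \<Rightarrow> 'a) \<Rightarrow> ('a \<times> 'x::ab_group_add \<times> 'b::ab_group_add) list \<Rightarrow> 'a \<times> 'x \<times> 'b" where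
  "embA f ts = (f (map fst ts), 0, 0)"

definition embX :: "('a list \<Rightarrow> 'x \<Rightarrow> 'b list \<Rightarrow> 'x) \<Rightarrow>
    ('a::ab_group_add \<times> 'x::ab_group_add \<times> 'b::ab_group_add) list \<Rightarrow> 'a \<times> 'x \<times> 'b" where
  "embX g ts = (0, \<Sum>i<length ts. g (map fst (take i ts)) (fst (snd (ts ! i)))
                                     (map (snd \<circ> snd) (drop (i + 1) ts)), 0)"

definition embB :: "('b list \<Rightarrow> 'b) \<Rightarrow> ('a::ab_group_add \<times> 'x::ab_group_add \<times> 'b) list \<Rightarrow> 'a \<times> 'x \<times> 'b" where
  "embB h ts = (0, 0, h (map (snd \<circ> snd) ts))"

text \<open>
  \<open>Hoch_bimod A X B\<close> is the image of \<open>Hoch(A) \<oplus> Hoch(A,X,B) \<oplus> Hoch(B)\<close> in \<open>Hoch(A \<ltimes> X \<rtimes> B)\<close>,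
  with the restricted structures.
\<close>

definition Hoch_bimod :: "('k, 'a::ab_group_add) dgalg \<Rightarrow> ('k, 'x::ab_group_add, 'a, 'b) bimod \<Rightarrow>
    ('k, 'b::ab_group_add) dgalg \<Rightarrow> ('k, ('a \<times> 'x \<times> 'b) list \<Rightarrow> 'a \<times> 'x \<times> 'b) gcomplex" where
  "Hoch_bimod A X B = (Hoch (tri_alg A X B))
     \<lparr>grd := (\<lambda>n. {embA f + embX g + embB h |f g h.
                f \<in> hoch_deg A A n \<and> g \<in> hochX_deg A X B n \<and> h \<in> hoch_deg B B n})\<rparr>"

definition prA :: "(('a \<times> 'x::zero \<times> 'b::zero) list \<Rightarrow> 'a \<times> 'x \<times> 'b) \<Rightarrow> 'a list \<Rightarrow> 'a" where
  "prA F as = fst (F (map (\<lambda>a. (a, 0, 0)) as))"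

definition prB :: "(('a::zero \<times> 'x::zero \<times> 'b) list \<Rightarrow> 'a \<times> 'x \<times> 'b) \<Rightarrow> 'b list \<Rightarrow> 'b" where
  "prB F bs = snd (snd (F (map (\<lambda>b. (0, 0, b)) bs)))"

lemma prA_emb: "prA (embA f + embX g + embB h) = f"
  by (rule ext) (simp add: prA_def embA_def embX_def embB_def comp_def)

lemma prB_emb: "prB (embA f + embX g + embB h) = h"
  by (rule ext) (simp add: prB_def embA_def embX_def embB_def comp_def)


section \<open>Gerstenhaber structure on cohomology\<close>

text \<open>
  A graded vector space of cohomology classes (degreewise addition and scalar multiplication)
  with a product of degree \<open>0\<close> and a bracket of degree \<open>-1\<close>. The Gerstenhaber identities are
  conditions on a single structure and play no role in the notion of isomorphism; the product and
  the bracket in \<open>HH V\<close> are those induced on classes by the products of all representatives.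
\<close>

record ('k, 'c) gerst =
  hdeg :: "int \<Rightarrow> 'c set"
  hadd :: "int \<Rightarrow> 'c \<Rightarrow> 'c \<Rightarrow> 'c"
  hscl :: "int \<Rightarrow> 'k \<Rightarrow> 'c \<Rightarrow> 'c"
  hcup :: "int \<Rightarrow> int \<Rightarrow> 'c \<Rightarrow> 'c \<Rightarrow> 'c"
  hbrk :: "int \<Rightarrow> int \<Rightarrow> 'c \<Rightarrow> 'c \<Rightarrow> 'c"

definition HH :: "('k, 'v::ab_group_add) gcomplex \<Rightarrow> ('k, 'v set) gerst" where
  "HH V =
     \<lparr>hdeg = coh V,
      hadd = (\<lambda>n C D. add_bd V n {x + y |x y. x \<in> C \<and> y \<in> D}),
      hscl = (\<lambda>n c C. add_bd V n (scl V c ` C)),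
      hcup = (\<lambda>m n C D. add_bd V (m + n) {cupp V m n x y |x y. x \<in> C \<and> y \<in> D}),
      hbrk = (\<lambda>m n C D. add_bd V (m + n - 1) {brkt V m n x y |x y. x \<in> C \<and> y \<in> D})\<rparr>"

definition gerstenhaber_iso :: "('k, 'c) gerst \<Rightarrow> ('k, 'd) gerst \<Rightarrow> (int \<Rightarrow> 'c \<Rightarrow> 'd) \<Rightarrow> bool" where
  "gerstenhaber_iso G G' \<phi> \<longleftrightarrow>
     (\<forall>n. bij_betw (\<phi> n) (hdeg G n) (hdeg G' n)) \<and>
     (\<forall>n. \<forall>x\<in>hdeg G n. \<forall>y\<in>hdeg G n. \<phi> n (hadd G n x y) = hadd G' n (\<phi> n x) (\<phi> n y)) \<and>
     (\<forall>n c. \<forall>x\<in>hdeg G n. \<phi> n (hscl G n c x) = hscl G' n c (\<phi> n x)) \<and>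
     (\<forall>m n. \<forall>x\<in>hdeg G m. \<forall>y\<in>hdeg G n.
        \<phi> (m + n) (hcup G m n x y) = hcup G' m n (\<phi> m x) (\<phi> n y)) \<and>
     (\<forall>m n. \<forall>x\<in>hdeg G m. \<forall>y\<in>hdeg G n.
        \<phi> (m + n - 1) (hbrk G m n x y) = hbrk G' m n (\<phi> m x) (\<phi> n y))"


section \<open>Weak cone-nilpotency\<close>

definition contracting_homotopy :: "('k, 'm::ab_group_add, 'z) dgspace_scheme \<Rightarrow> ('m \<Rightarrow> 'm) \<Rightarrow> bool" where
  "contracting_homotopy M h \<longleftrightarrow> lin_deg M M (-1) h \<and>
     (\<forall>x\<in>gtot (grd M). dif M (h x) + h (dif M x) = x)"

definition hk :: "('k, 'a::ab_group_add) dgalg \<Rightarrow> ('k, 'm::ab_group_add, 'a, 'a) bimod \<Rightarrow>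
    ('m \<Rightarrow> 'm) \<Rightarrow> nat \<Rightarrow> ('a list \<Rightarrow> 'm) \<Rightarrow> 'a list \<Rightarrow> 'm" where
  "hk A M h k f = ((\<lambda>g. h \<circ> hoch_dH A M g) ^^ k) (h \<circ> f)"

definition pointwisely_nilpotent :: "('k, 'a::ab_group_add) dgalg \<Rightarrow>
    ('k, 'm::ab_group_add, 'a, 'a) bimod \<Rightarrow> bool" where
  "pointwisely_nilpotent A M \<longleftrightarrow> dg_acyclic M \<and>
     (\<exists>h. contracting_homotopy M h \<and>
        (\<forall>f\<in>gtot (hoch_deg A M). \<exists>N. \<forall>k>N. hk A M h k f = 0))"

definition weakly_cone_nilpotent :: "('k, 'a::ab_group_add) dgalg \<Rightarrow>
    ('k, 'm::ab_group_add, 'a, 'a) bimod \<Rightarrow> ('k, 'n::ab_group_add, 'a, 'a) bimod \<Rightarrow>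
    ('m \<Rightarrow> 'n) \<Rightarrow> bool" where
  "weakly_cone_nilpotent A M N \<phi> \<longleftrightarrow>
     pointwisely_nilpotent A (mapping_cone A \<phi> M N) \<or>
     (\<exists>\<psi>. bimod_mor N M \<psi> \<and> (\<forall>n\<in>gtot (grd N). \<phi> (\<psi> n) = n) \<and>
        pointwisely_nilpotent A (mapping_cone A \<psi> N M)) \<or>
     (\<exists>\<psi>. bimod_mor N M \<psi> \<and> (\<forall>m\<in>gtot (grd M). \<psi> (\<phi> m) = m) \<and>
        pointwisely_nilpotent A (mapping_cone A \<psi> N M))"


section \<open>Keller admissible triples\<close>

text \<open>\<open>end_r X\<close> is \<open>Hom(X,X)\<close> over the right action, an \<open>A\<close>-\<open>A\<close>-bimodule; \<open>end_l A X B\<close> is \<open>Hom(X,X)\<close>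
  over the left action, a \<open>B\<close>-\<open>B\<close>-bimodule.\<close>

definition end_r_deg :: "('k, 'x::ab_group_add, 'a, 'b) bimod \<Rightarrow> int \<Rightarrow> ('x \<Rightarrow> 'x) set" where
  "end_r_deg X r = {f. lin_deg X X r f \<and> (\<forall>x b. f (ract X x b) = ract X (f x) b)}"

definition end_l_deg :: "('k, 'a::ab_group_add) dgalg \<Rightarrow> ('k, 'x::ab_group_add, 'a, 'b) bimod \<Rightarrow>
    int \<Rightarrow> ('x \<Rightarrow> 'x) set" where
  "end_l_deg A X r = {f. lin_deg X X r f \<and>
     (\<forall>n. \<forall>a\<in>grd A n. \<forall>x. f (lact X a x) = sg (r * n) (lact X a (f x)))}"

definition end_r :: "('k, 'x::ab_group_add, 'a, 'b) bimod \<Rightarrow> ('k, 'x \<Rightarrow> 'x, 'a, 'a) bimod" where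
  "end_r X =
     \<lparr>scl = (\<lambda>c f x. scl X c (f x)),
      grd = end_r_deg X,
      dif = lext (end_r_deg X) (\<lambda>r f x. dif X (f x) - sg r (f (dif X x))),
      lact = (\<lambda>a f x. lact X a (f x)),
      ract = (\<lambda>f a x. f (lact X a x))\<rparr>"

definition end_l :: "('k, 'a::ab_group_add) dgalg \<Rightarrow> ('k, 'x::ab_group_add, 'a, 'b) bimod \<Rightarrow>
    ('k, 'b::ab_group_add) dgalg \<Rightarrow> ('k, 'x \<Rightarrow> 'x, 'b, 'b) bimod" where
  "end_l A X B =
     \<lparr>scl = (\<lambda>c f x. scl X c (f x)),
      grd = end_l_deg A X,
      dif = lext (end_l_deg A X) (\<lambda>r f x. dif X (f x) - sg r (f (dif X x))),
      lact = (\<lambda>b f x. lext (grd B) (\<lambda>i b'. lext (end_l_deg A X) (\<lambda>r f'. lext (grd X) (\<lambda>n x'.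
                 sg (i * (r + n)) (f' (ract X x' b'))) x) f) b),
      ract = (\<lambda>f b x. lext (grd B) (\<lambda>i b'. lext (grd X) (\<lambda>n x'.
                 sg (i * n) (ract X (f x') b')) x) b)\<rparr>"

definition rhoA :: "('k, 'x::ab_group_add, 'a, 'b) bimod \<Rightarrow> 'a \<Rightarrow> 'x \<Rightarrow> 'x" where
  "rhoA X a x = lact X a x"

definition rhoB :: "('k, 'x::ab_group_add, 'a, 'b) bimod \<Rightarrow> ('k, 'b::ab_group_add) dgalg \<Rightarrow>
    'b \<Rightarrow> 'x \<Rightarrow> 'x" where
  "rhoB X B b x =
     lext (grd B) (\<lambda>i b'. lext (grd X) (\<lambda>n x'. sg (n * i) (ract X x' b')) x) b"

text \<open>
  \<open>Hom\<^sup>r(X \<otimes> B\<^bsup>\<otimes>q\<^esup>, X)\<close> is \<open>hochX_pqr A X B 0 q r\<close> and \<open>Hom\<^sup>r(A\<^bsup>\<otimes>p\<^esup> \<otimes> X, X)\<close> is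
  \<open>hochX_pqr A X B p 0 r\<close>: the absent list of arguments is \<open>[]\<close>.
\<close>

definition dR :: "('k, 'x::ab_group_add, 'a, 'b) bimod \<Rightarrow> ('k, 'b::ab_group_add) dgalg \<Rightarrow> nat \<Rightarrow> int \<Rightarrow>
    ('a list \<Rightarrow> 'x \<Rightarrow> 'b list \<Rightarrow> 'x) \<Rightarrow> 'a list \<Rightarrow> 'x \<Rightarrow> 'b list \<Rightarrow> 'x" where
  "dR X B q r f as x bs = (if as = [] \<and> length bs = q + 1 then
       sg (int q + r - 1) (f [] (ract X x (hd bs)) (tl bs))
     + (\<Sum>j<q. sg (int q + r + int j) (f [] x (contract (mul B) j bs)))
     + sg r (ract X (f [] x (butlast bs)) (last bs))
   else 0)"

definition dL :: "('k, 'a::ab_group_add) dgalg \<Rightarrow> ('k, 'x::ab_group_add, 'a, 'b) bimod \<Rightarrow> nat \<Rightarrow> int \<Rightarrow>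
    ('a list \<Rightarrow> 'x \<Rightarrow> 'b list \<Rightarrow> 'x) \<Rightarrow> 'a list \<Rightarrow> 'x \<Rightarrow> 'b list \<Rightarrow> 'x" where
  "dL A X p r f as x bs = (if length as = p + 1 \<and> bs = [] then
       lext (grd A) (\<lambda>n a. sg (int p + r + r * n) (lact X a (f (tl as) x []))) (hd as)
     + (\<Sum>i<p. sg (int p + r + int i + 1) (f (contract (mul A) i as) x []))
     + sg (r + 1) (f (butlast as) (lact X (last as) x) [])
   else 0)"

definition incl_hom :: "('x \<Rightarrow> 'x) \<Rightarrow> 'a list \<Rightarrow> 'x \<Rightarrow> 'b list \<Rightarrow> 'x::zero" where
  "incl_hom f as x bs = (if as = [] \<and> bs = [] then f x else 0)"

text \<open>
  Exactness of the two augmented sequences, degree by degree (all maps preserve the internal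
  degree); exactness at the first term is the injectivity of \<open>incl_hom\<close>.
\<close>

definition exact_R :: "('k, 'a::ab_group_add) dgalg \<Rightarrow> ('k, 'x::ab_group_add, 'a, 'b) bimod \<Rightarrow>
    ('k, 'b::ab_group_add) dgalg \<Rightarrow> bool" where
  "exact_R A X B \<longleftrightarrow> (\<forall>r.
     inj_on (incl_hom :: _ \<Rightarrow> 'a list \<Rightarrow> 'x \<Rightarrow> 'b list \<Rightarrow> 'x) (end_r_deg X r) \<and>
     {f \<in> hochX_pqr A X B 0 0 r. dR X B 0 r f = 0} = incl_hom ` end_r_deg X r \<and>
     (\<forall>q. {f \<in> hochX_pqr A X B 0 (q + 1) r. dR X B (q + 1) r f = 0}
          = dR X B q r ` hochX_pqr A X B 0 q r))"

definition exact_L :: "('k, 'a::ab_group_add) dgalg \<Rightarrow> ('k, 'x::ab_group_add, 'a, 'b) bimod \<Rightarrow>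
    ('k, 'b::ab_group_add) dgalg \<Rightarrow> bool" where
  "exact_L A X B \<longleftrightarrow> (\<forall>r.
     inj_on (incl_hom :: _ \<Rightarrow> 'a list \<Rightarrow> 'x \<Rightarrow> 'b list \<Rightarrow> 'x) (end_l_deg A X r) \<and>
     {f \<in> hochX_pqr A X B 0 0 r. dL A X 0 r f = 0} = incl_hom ` end_l_deg A X r \<and>
     (\<forall>p. {f \<in> hochX_pqr A X B (p + 1) 0 r. dL A X (p + 1) r f = 0}
          = dL A X p r ` hochX_pqr A X B p 0 r))"

definition keller_admissible :: "('k::field, 'a::ab_group_add) dgalg \<Rightarrow>
    ('k, 'x::ab_group_add, 'a, 'b) bimod \<Rightarrow> ('k, 'b::ab_group_add) dgalg \<Rightarrow> bool" where
  "keller_admissible A X B \<longleftrightarrow>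
     dg_algebra A \<and> dg_algebra B \<and> dg_bimodule A B X \<and> gtot (grd X) = UNIV \<and>
     bimod_mor (regular_bimod A) (end_r X) (rhoA X) \<and>
     quasi_iso (regular_bimod A) (end_r X) (rhoA X) \<and>
     weakly_cone_nilpotent A (regular_bimod A) (end_r X) (rhoA X) \<and>
     bimod_mor (regular_bimod B) (end_l A X B) (rhoB X B) \<and>
     quasi_iso (regular_bimod B) (end_l A X B) (rhoB X B) \<and>
     weakly_cone_nilpotent B (regular_bimod B) (end_l A X B) (rhoB X B) \<and>
     exact_R A X B \<and> exact_L A X B"

end

theory Submission
  imports Defs
begin

text \<open>
  The projection \<open>\<pi>\<^sub>A\<close> is surjective and preserves cup products and brackets, so it suffices that its
  kernel \<open>Hoch(A,X,B) \<oplus> Hoch(B)\<close> is acyclic. Given a cocycle in the kernel, exactness of the left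
  sequence, with the arguments from \<open>B\<close> as parameters, removes all components of positive arity in
  \<open>A\<close>, from the top arity downwards. What remains is a cocycle of the cone of
  \<open>Hoch(B) \<rightarrow> Hoch(B, Hom\<^sub>A(X,X))\<close>, the map induced by \<open>\<rho>\<^sub>B\<close>, that is, of the Hochschild complex with
  coefficients in the cone of \<open>\<rho>\<^sub>B\<close>. If the cone is pointwisely nilpotent, the perturbed homotopy
  \<open>\<Sum> (-1)\<^sup>k hk k\<close> is a finite sum on each cochain and contracts this complex; if the cone of a
  one-sided inverse of \<open>\<rho>\<^sub>B\<close> is, then the inverse, hence also \<open>\<rho>\<^sub>B\<close>, is bijective on cohomology.
  The projection \<open>\<pi>\<^sub>B\<close> is treated in the same way with the right sequence and \<open>\<rho>\<^sub>A\<close>.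

  Koszul signs are expressed by the linear operators \<open>tw\<close>, so that most identities need no
  reduction to homogeneous elements.
\<close>

section \<open>Graded spaces\<close>

text \<open>Cochains form direct sums, so a quasi-isomorphism of coefficients need not induce one on
  Hochschild cohomology: inverting the internal differential produces a series whose terms have ever
  higher arity, and nilpotency is what makes it stop. In the multiplicative direction a cochain has
  a top arity; the top component of a cocycle is closed for the multiplicative differential alone,
  and subtracting a coboundary lowers that arity, so exactness of the two sequences suffices there.
  Parameters complicate exactness in two ways. The preimage must be multilinear in the parameters,
  which over a field follows by composing with a graded linear section. And the Koszul sign of the
  left action comes from the degree of the whole cochain, while its value at fixed parameters has a
  degree shifted by theirs; exactness must hence be moved to a differential with another sign. The
  differential of Hoch(A,X,B) is obtained as the middle component of the one of the triangular
  algebra, from which d^2 = 0 and the degrees are inherited.\<close>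

lemma sg_zero [simp]: "sg n 0 = 0"
  by (simp add: sg_def)

lemma sg_0 [simp]: "sg 0 x = x"
  by (simp add: sg_def)

lemma sg_sg [simp]: "sg m (sg n x) = sg (m + n) x"
  by (simp add: sg_def)

lemma sg_add: "sg n (x + y) = sg n x + sg n y"
  by (simp add: sg_def)

lemma sg_diff: "sg n (x - y) = sg n x - sg n y"
  by (simp add: sg_def)

lemma sg_minus: "sg n (- x) = - sg n x"
  by (simp add: sg_def)

lemma sg_sum: "sg n (sum f S) = (\<Sum>i\<in>S. sg n (f i))"
  by (simp add: sg_def sum_negf)

lemma sg_even: "even n \<Longrightarrow> sg n x = x"
  by (simp add: sg_def)

lemma sg_parity: "even m = even n \<Longrightarrow> sg m x = sg n x"
  by (simp add: sg_def)

lemma sg_eq_0 [simp]: "sg n x = 0 \<longleftrightarrow> x = 0"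
  by (simp add: sg_def)

lemma sg_pair: "sg n (x, y) = (sg n x, sg n y)"
  by (simp add: sg_def)

lemma sg_fun: "sg n f = (\<lambda>x. sg n (f x))"
  by (auto simp: sg_def)

lemma sum_fun_apply: "(\<Sum>i\<in>S. f i) x = (\<Sum>i\<in>S. f i x)" for f :: "_ \<Rightarrow> _ \<Rightarrow> _ :: comm_monoid_add"
  by (induction S rule: infinite_finite_induct) auto

lemma graded_spaceD:
  assumes "graded_space V"
  shows "vector_space (scl V)" "module.subspace (scl V) (grd V n)"
  using assms by (auto simp: graded_space_def)

lemma
  assumes "graded_space V"
  shows grd_0: "0 \<in> grd V n"
    and grd_add: "x \<in> grd V n \<Longrightarrow> y \<in> grd V n \<Longrightarrow> x + y \<in> grd V n"
    and grd_diff: "x \<in> grd V n \<Longrightarrow> y \<in> grd V n \<Longrightarrow> x - y \<in> grd V n"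
    and grd_minus: "x \<in> grd V n \<Longrightarrow> - x \<in> grd V n"
    and grd_scl: "x \<in> grd V n \<Longrightarrow> scl V c x \<in> grd V n"
    and grd_sg: "x \<in> grd V n \<Longrightarrow> sg k x \<in> grd V n"
proof -
  interpret vector_space "scl V" by (rule graded_spaceD[OF assms])
  note s = graded_spaceD(2)[OF assms]
  show "0 \<in> grd V n" "x \<in> grd V n \<Longrightarrow> y \<in> grd V n \<Longrightarrow> x + y \<in> grd V n"
    "x \<in> grd V n \<Longrightarrow> y \<in> grd V n \<Longrightarrow> x - y \<in> grd V n" "x \<in> grd V n \<Longrightarrow> - x \<in> grd V n"
    "x \<in> grd V n \<Longrightarrow> scl V c x \<in> grd V n" "x \<in> grd V n \<Longrightarrow> sg k x \<in> grd V n"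
    using s[of n] by (auto simp: sg_def subspace_0 subspace_add subspace_diff subspace_neg subspace_scale)
qed

lemma
  assumes "graded_space V"
  shows scl_add: "scl V c (x + y) = scl V c x + scl V c y"
    and scl_diff: "scl V c (x - y) = scl V c x - scl V c y"
    and scl_minus: "scl V c (- x) = - scl V c x"
    and scl_0: "scl V c 0 = 0"
    and scl_1: "scl V 1 x = x"
    and scl_sg: "scl V c (sg n x) = sg n (scl V c x)"
proof -
  interpret vector_space "scl V" by (rule graded_spaceD[OF assms])
  show "scl V c (x + y) = scl V c x + scl V c y" "scl V c (x - y) = scl V c x - scl V c y"
    "scl V c (- x) = - scl V c x" "scl V c 0 = 0" "scl V 1 x = x"
    "scl V c (sg n x) = sg n (scl V c x)"
    by (auto simp: scale_right_distrib scale_right_diff_distrib sg_def)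
qed

lemma is_decompI:
  assumes "\<And>n. v n \<in> G n" "finite S" "\<And>n. n \<notin> S \<Longrightarrow> v n = 0" "x = sum v S"
  shows "is_decomp G x v"
proof -
  have "{n. v n \<noteq> 0} \<subseteq> S" using assms(3) by auto
  then have "finite {n. v n \<noteq> 0}" "sum v {n. v n \<noteq> 0} = sum v S"
    using assms(2) by (auto intro: finite_subset sum.mono_neutral_left)
  then show ?thesis using assms by (simp add: is_decomp_def)
qed

lemma is_decomp_sum:
  assumes "is_decomp G x v" "finite S" "{n. v n \<noteq> 0} \<subseteq> S"
  shows "x = sum v S"
  using assms by (auto simp: is_decomp_def intro: sum.mono_neutral_left)

lemma is_decomp_add:
  assumes "graded_space V" "is_decomp (grd V) x v" "is_decomp (grd V) y w"
  shows "is_decomp (grd V) (x + y) (\<lambda>n. v n + w n)"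
proof (rule is_decompI)
  let ?S = "{n. v n \<noteq> 0} \<union> {n. w n \<noteq> 0}"
  show fin: "finite ?S" using assms by (simp add: is_decomp_def)
  show "v n + w n \<in> grd V n" for n
    using assms by (auto simp: is_decomp_def intro: grd_add)
  show "v n + w n = 0" if "n \<notin> ?S" for n using that by simp
  show "x + y = (\<Sum>n\<in>?S. v n + w n)"
    using is_decomp_sum[OF assms(2) fin] is_decomp_sum[OF assms(3) fin] by (simp add: sum.distrib)
qed

lemma is_decomp_scl:
  assumes "graded_space V" "is_decomp (grd V) x v"
  shows "is_decomp (grd V) (scl V c x) (\<lambda>n. scl V c (v n))"
proof (rule is_decompI)
  interpret vector_space "scl V" by (rule graded_spaceD[OF assms(1)])
  show "finite {n. v n \<noteq> 0}" using assms by (simp add: is_decomp_def)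
  show "scl V c (v n) \<in> grd V n" for n
    using assms by (auto simp: is_decomp_def intro: grd_scl)
  show "scl V c (v n) = 0" if "n \<notin> {n. v n \<noteq> 0}" for n using that by simp
  show "scl V c x = (\<Sum>n\<in>{n. v n \<noteq> 0}. scl V c (v n))"
    using assms(2) by (simp add: is_decomp_def scale_sum_right)
qed

lemma grd_gtot: "graded_space V \<Longrightarrow> x \<in> grd V n \<Longrightarrow> x \<in> gtot (grd V)"
  using is_decomp_homogeneous by (auto simp: gtot_def)

lemma gtot_0: "graded_space V \<Longrightarrow> 0 \<in> gtot (grd V)"
  by (rule grd_gtot[OF _ grd_0])

lemma gtot_add: "graded_space V \<Longrightarrow> x \<in> gtot (grd V) \<Longrightarrow> y \<in> gtot (grd V) \<Longrightarrow> x + y \<in> gtot (grd V)"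
  unfolding gtot_def using is_decomp_add by blast

lemma gtot_scl: "graded_space V \<Longrightarrow> x \<in> gtot (grd V) \<Longrightarrow> scl V c x \<in> gtot (grd V)"
  unfolding gtot_def using is_decomp_scl by blast

lemma gtot_minus:
  assumes "graded_space V" "x \<in> gtot (grd V)"
  shows "- x \<in> gtot (grd V)"
proof -
  interpret vector_space "scl V" by (rule graded_spaceD[OF assms(1)])
  show ?thesis using gtot_scl[OF assms, of "- 1"] by simp
qed

lemma gtot_diff: "graded_space V \<Longrightarrow> x \<in> gtot (grd V) \<Longrightarrow> y \<in> gtot (grd V) \<Longrightarrow> x - y \<in> gtot (grd V)"
  using gtot_add[of V x "- y"] gtot_minus[of V y] by simp

lemma gtot_sg: "graded_space V \<Longrightarrow> x \<in> gtot (grd V) \<Longrightarrow> sg k x \<in> gtot (grd V)"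
  by (simp add: sg_def gtot_minus)

lemma gtot_sum:
  "graded_space V \<Longrightarrow> (\<And>i. i \<in> S \<Longrightarrow> f i \<in> gtot (grd V)) \<Longrightarrow> sum f S \<in> gtot (grd V)"
  by (induction S rule: infinite_finite_induct) (auto intro: gtot_0 gtot_add)

text \<open>Reduces an additive claim on the total space to homogeneous elements; identities whose
  signs depend on degrees are proved this way.\<close>

lemma gtot_induct [consumes 2, case_names hom add]:
  assumes "graded_space V" "x \<in> gtot (grd V)"
    and hom: "\<And>n x. x \<in> grd V n \<Longrightarrow> P x"
    and add: "\<And>x y. x \<in> gtot (grd V) \<Longrightarrow> y \<in> gtot (grd V) \<Longrightarrow> P x \<Longrightarrow> P y \<Longrightarrow> P (x + y)"
  shows "P x"
proof -
  obtain v where v: "\<And>n. v n \<in> grd V n" "x = sum v {n. v n \<noteq> 0}"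
    using assms(2) by (auto simp: gtot_def is_decomp_def)
  have "sum v S \<in> gtot (grd V) \<and> P (sum v S)" for S
  proof (induction S rule: infinite_finite_induct)
    case (insert n S)
    then show ?case using v(1)[of n] by (auto intro: hom add gtot_add grd_gtot assms(1))
  qed (auto intro: hom gtot_0 grd_0 assms(1))
  then show ?thesis using v(2) by simp
qed

lemma is_decomp_gcomp:
  assumes "graded_space V" "x \<in> gtot (grd V)"
  shows "is_decomp (grd V) x (gcomp (grd V) x)"
proof -
  obtain v where v: "is_decomp (grd V) x v" using assms(2) by (auto simp: gtot_def)
  have "gcomp (grd V) x = v"
    unfolding gcomp_def using v is_decomp_unique[OF assms(1) _ v] by (rule the_equality)
  with v show ?thesis by simp
qed

lemma gcomp_eqI: "graded_space V \<Longrightarrow> is_decomp (grd V) x v \<Longrightarrow> gcomp (grd V) x = v"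
  by (rule is_decomp_unique[OF _ is_decomp_gcomp]) (auto simp: gtot_def)

lemma lext_superset:
  assumes "finite S" "{n. gcomp G x n \<noteq> 0} \<subseteq> S" "\<And>n. F n 0 = 0"
  shows "lext G F x = (\<Sum>n\<in>S. F n (gcomp G x n))"
  unfolding lext_def by (rule sum.mono_neutral_left) (use assms in auto)

lemma lext_add:
  assumes V: "graded_space V" and x: "x \<in> gtot (grd V)" and y: "y \<in> gtot (grd V)"
    and F: "\<And>n u v. u \<in> grd V n \<Longrightarrow> v \<in> grd V n \<Longrightarrow> F n (u + v) = F n u + F n v"
  shows "lext (grd V) F (x + y) = lext (grd V) F x + lext (grd V) F y"
proof -
  note dx = is_decomp_gcomp[OF V x] and dy = is_decomp_gcomp[OF V y]
  let ?S = "{n. gcomp (grd V) x n \<noteq> 0} \<union> {n. gcomp (grd V) y n \<noteq> 0}"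
  have fin: "finite ?S" using dx dy by (simp add: is_decomp_def)
  have F0: "F n 0 = 0" for n using F[OF grd_0[OF V] grd_0[OF V], of n] by simp
  have c: "gcomp (grd V) (x + y) = (\<lambda>n. gcomp (grd V) x n + gcomp (grd V) y n)"
    by (rule gcomp_eqI[OF V is_decomp_add[OF V dx dy]])
  have "lext (grd V) F (x + y) = (\<Sum>n\<in>?S. F n (gcomp (grd V) (x + y) n))"
    by (rule lext_superset) (use fin F0 in \<open>auto simp: c\<close>)
  also have "\<dots> = (\<Sum>n\<in>?S. F n (gcomp (grd V) x n)) + (\<Sum>n\<in>?S. F n (gcomp (grd V) y n))"
    using dx dy by (simp add: c sum.distrib F is_decomp_def)
  also have "\<dots> = lext (grd V) F x + lext (grd V) F y"
    using fin F0 by (simp add: lext_superset[where S = ?S])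
  finally show ?thesis .
qed

text \<open>The scalar acts on the target through an arbitrary additive map T, so the target needs
  no scalar multiplication of its own.\<close>

lemma lext_scl:
  assumes V: "graded_space V" and x: "x \<in> gtot (grd V)"
    and F: "\<And>n u. u \<in> grd V n \<Longrightarrow> F n (scl V c u) = T (F n u)"
    and T: "\<And>u v. T (u + v) = T u + T v" and F0: "\<And>n. F n 0 = 0"
  shows "lext (grd V) F (scl V c x) = T (lext (grd V) F x)"
proof -
  note dx = is_decomp_gcomp[OF V x]
  let ?S = "{n. gcomp (grd V) x n \<noteq> 0}"
  have fin: "finite ?S" using dx by (simp add: is_decomp_def)
  have T0: "T 0 = 0" using T[of 0 0] by simp
  have Ts: "T (sum g S) = (\<Sum>i\<in>S. T (g i))" if "finite S" for g :: "int \<Rightarrow> _" and S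
    using that by (induction S) (auto simp: T T0)
  have c: "gcomp (grd V) (scl V c x) = (\<lambda>n. scl V c (gcomp (grd V) x n))"
    by (rule gcomp_eqI[OF V is_decomp_scl[OF V dx]])
  have "lext (grd V) F (scl V c x) = (\<Sum>n\<in>?S. F n (gcomp (grd V) (scl V c x) n))"
    by (rule lext_superset) (use fin F0 in \<open>auto simp: c scl_0[OF V]\<close>)
  also have "\<dots> = T (lext (grd V) F x)"
    using dx fin by (simp add: c F is_decomp_def lext_def Ts)
  finally show ?thesis .
qed

lemma
  assumes V: "graded_space V"
  shows tw_hom: "x \<in> grd V n \<Longrightarrow> tw (grd V) k x = sg (k * n) x"
    and tw_add: "x \<in> gtot (grd V) \<Longrightarrow> y \<in> gtot (grd V) \<Longrightarrow>
      tw (grd V) k (x + y) = tw (grd V) k x + tw (grd V) k y"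
    and tw_scl: "x \<in> gtot (grd V) \<Longrightarrow> tw (grd V) k (scl V c x) = scl V c (tw (grd V) k x)"
    and tw_grd: "x \<in> grd V n \<Longrightarrow> tw (grd V) k x \<in> grd V n"
proof -
  show 1: "tw (grd V) k x = sg (k * n) x" if "x \<in> grd V n"
    unfolding tw_def by (rule lext_homogeneous[OF V that]) simp
  show "tw (grd V) k (x + y) = tw (grd V) k x + tw (grd V) k y"
    if "x \<in> gtot (grd V)" "y \<in> gtot (grd V)"
    unfolding tw_def by (rule lext_add[OF V that]) (simp add: sg_add)
  show "tw (grd V) k (scl V c x) = scl V c (tw (grd V) k x)" if "x \<in> gtot (grd V)"
    unfolding tw_def by (rule lext_scl[OF V that]) (simp_all add: scl_sg[OF V] scl_add[OF V])
  show "tw (grd V) k x \<in> grd V n" if "x \<in> grd V n"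
    using that by (simp add: 1 grd_sg[OF V])
qed

lemma tw_zero: "graded_space V \<Longrightarrow> tw (grd V) k 0 = 0"
  using tw_hom[of V 0 0 k] by (simp add: grd_0)

lemma
  assumes V: "graded_space V" and x: "x \<in> gtot (grd V)"
  shows tw_gtot: "tw (grd V) k x \<in> gtot (grd V)"
    and tw_tw: "tw (grd V) j (tw (grd V) k x) = tw (grd V) (j + k) x"
    and tw_parity: "even j = even k \<Longrightarrow> tw (grd V) j x = tw (grd V) k x"
    and tw_even: "even k \<Longrightarrow> tw (grd V) k x = x"
proof -
  have 1: "tw (grd V) k x \<in> gtot (grd V)" if "x \<in> gtot (grd V)" for k x
    using V that
  proof (induction x rule: gtot_induct)
    case (hom n x) then show ?case using V by (blast intro: grd_gtot tw_grd)
  qed (simp add: tw_add[OF V] gtot_add[OF V])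
  show "tw (grd V) k x \<in> gtot (grd V)" by (rule 1[OF x])
  show "tw (grd V) j (tw (grd V) k x) = tw (grd V) (j + k) x"
    using V x by (induction x rule: gtot_induct)
      (simp_all add: tw_add[OF V] 1 tw_hom[OF V] tw_hom[OF V grd_sg[OF V]] distrib_right)
  show "tw (grd V) j x = tw (grd V) k x" if "even j = even k"
    using V x by (induction x rule: gtot_induct)
      (auto simp: tw_add[OF V] tw_hom[OF V] that intro!: sg_parity)
  show "tw (grd V) k x = x" if "even k"
    using V x by (induction x rule: gtot_induct)
      (simp_all add: tw_add[OF V] tw_hom[OF V] that sg_even)
qed

lemma tw_minus: "graded_space V \<Longrightarrow> x \<in> gtot (grd V) \<Longrightarrow> tw (grd V) k (- x) = - tw (grd V) k x"
  using tw_add[of V x "- x" k] by (simp add: gtot_minus tw_zero eq_neg_iff_add_eq_0 add.commute)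

lemma tw_sg: "graded_space V \<Longrightarrow> x \<in> gtot (grd V) \<Longrightarrow> tw (grd V) k (sg n x) = sg n (tw (grd V) k x)"
  by (simp add: sg_def tw_minus)

text \<open>Bridge from signs written with degrees to operators: the degreewise sign (-1)^(k n + j)
  of the definitions becomes a twist of the argument and a constant sign, after which the degree of
  x no longer appears.\<close>

lemma lext_tw:
  assumes V: "graded_space V" and x: "x \<in> gtot (grd V)"
    and F: "\<And>u v. u \<in> gtot (grd V) \<Longrightarrow> v \<in> gtot (grd V) \<Longrightarrow> F (u + v) = F u + F v"
  shows "lext (grd V) (\<lambda>n x. sg (k * n + j) (F x)) x = sg j (F (tw (grd V) k x))"
proof -
  have F0: "F 0 = 0" using F[OF gtot_0[OF V] gtot_0[OF V]] by simp
  have Fm: "F (- u) = - F u" if "u \<in> gtot (grd V)" for u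
    using F[OF that gtot_minus[OF V that]] F0 by (simp add: eq_neg_iff_add_eq_0 add.commute)
  have Fs: "F (sg i u) = sg i (F u)" if "u \<in> gtot (grd V)" for i u
    using Fm[OF that] by (simp add: sg_def)
  show ?thesis using V x
  proof (induction x rule: gtot_induct)
    case (hom n x)
    then show ?case using grd_gtot[OF V hom]
      by (simp add: lext_homogeneous[OF V] F0 tw_hom[OF V] Fs add.commute)
  next
    case (add x y)
    have "lext (grd V) (\<lambda>n x. sg (k * n + j) (F x)) (x + y) =
      lext (grd V) (\<lambda>n x. sg (k * n + j) (F x)) x + lext (grd V) (\<lambda>n x. sg (k * n + j) (F x)) y"
      by (rule lext_add[OF V add(1,2)]) (simp add: F grd_gtot[OF V] sg_add)
    then show ?case using add by (simp add: tw_add[OF V] F tw_gtot[OF V] sg_add)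
  qed
qed

text \<open>The shift s is 1 for mapping cones and 0 for the triangular algebra. Both projections
  carry decompositions to decompositions, which reduces uniqueness to the factors.\<close>

lemma graded_space_prod:
  assumes V: "graded_space V" and W: "graded_space W"
    and s: "scl U = (\<lambda>c (x, y). (scl V c x, scl W c y))"
    and g: "grd U = (\<lambda>k. grd V (k + s) \<times> grd W k)"
  shows "graded_space U" "gtot (grd U) = gtot (grd V) \<times> gtot (grd W)"
proof -
  interpret V: vector_space "scl V" by (rule graded_spaceD[OF V])
  interpret W: vector_space "scl W" by (rule graded_spaceD[OF W])
  interpret U: vector_space "scl U"
    by standard (auto simp: s V.scale_right_distrib W.scale_right_distrib
        V.scale_left_distrib W.scale_left_distrib split: prod.splits)
  have sub: "U.subspace (grd U n)" for n
    unfolding U.subspace_def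
    by (auto simp: g s grd_0[OF V] grd_0[OF W] grd_add[OF V] grd_add[OF W] grd_scl[OF V]
        grd_scl[OF W] zero_prod_def)
  have fst_dec: "is_decomp (grd V) (fst x) (\<lambda>n. fst (v (n - s)))"
    and snd_dec: "is_decomp (grd W) (snd x) (\<lambda>n. snd (v n))" if d: "is_decomp (grd U) x v" for x v
  proof -
    let ?S = "{n. v n \<noteq> 0}"
    have fin: "finite ?S" and vn: "\<And>n. v n \<in> grd U n" and x: "x = sum v ?S"
      using d by (auto simp: is_decomp_def)
    have f: "fst (v (n - s)) \<in> grd V n" for n using vn[of "n - s"] by (auto simp: g)
    show "is_decomp (grd V) (fst x) (\<lambda>n. fst (v (n - s)))"
    proof (rule is_decompI[OF f])
      show "finite ((\<lambda>n. n + s) ` ?S)" using fin by simp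
      show "fst (v (n - s)) = 0" if "n \<notin> (\<lambda>n. n + s) ` ?S" for n
      proof (rule ccontr)
        assume "fst (v (n - s)) \<noteq> 0"
        then have "n - s \<in> ?S" by auto
        then have "(n - s) + s \<in> (\<lambda>n. n + s) ` ?S" by (rule imageI)
        then show False using that by simp
      qed
      show "fst x = (\<Sum>n\<in>(\<lambda>n. n + s) ` ?S. fst (v (n - s)))"
        by (subst sum.reindex) (auto simp: x fst_sum)
    qed
    show "is_decomp (grd W) (snd x) (\<lambda>n. snd (v n))"
    proof (rule is_decompI[OF _ fin])
      show "snd (v n) \<in> grd W n" for n using vn[of n] by (auto simp: g)
      show "snd (v n) = 0" if "n \<notin> ?S" for n using that by auto
      show "snd x = (\<Sum>n\<in>?S. snd (v n))" by (simp add: x snd_sum)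
    qed
  qed
  show gU: "graded_space U"
    unfolding graded_space_def
  proof (intro conjI allI impI)
    show "vector_space (scl U)" by unfold_locales
    show "U.subspace (grd U n)" for n by (rule sub)
    fix v assume d: "is_decomp (grd U) 0 v"
    have 1: "(\<lambda>n. fst (v (n - s))) = (\<lambda>_. 0)"
      using V fst_dec[OF d] by (auto simp: graded_space_def)
    have 2: "(\<lambda>n. snd (v n)) = (\<lambda>_. 0)"
      using W snd_dec[OF d] by (auto simp: graded_space_def)
    have "fst (v n) = 0" for n using fun_cong[OF 1, of "n + s"] by simp
    then show "v = (\<lambda>_. 0)" using fun_cong[OF 2] by (auto simp: fun_eq_iff prod_eq_iff)
  qed
  have "(x, 0) \<in> gtot (grd U)" if "x \<in> gtot (grd V)" for x
    using V that
  proof (induction x rule: gtot_induct)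
    case (hom n x)
    then have "(x, 0) \<in> grd U (n - s)" by (simp add: g grd_0[OF W])
    then show ?case by (rule grd_gtot[OF gU])
  next
    case (add x y) then show ?case using gtot_add[OF gU add(3,4)] by simp
  qed
  moreover have "(0, y) \<in> gtot (grd U)" if "y \<in> gtot (grd W)" for y
    using W that
  proof (induction y rule: gtot_induct)
    case (hom n x)
    then have "(0, x) \<in> grd U n" by (simp add: g grd_0[OF V])
    then show ?case by (rule grd_gtot[OF gU])
  next
    case (add x y) then show ?case using gtot_add[OF gU add(3,4)] by simp
  qed
  ultimately have "(x, y) \<in> gtot (grd U)" if "x \<in> gtot (grd V)" "y \<in> gtot (grd W)" for x y
    using gtot_add[OF gU, of "(x, 0)" "(0, y)"] that by simp
  moreover have "fst z \<in> gtot (grd V) \<and> snd z \<in> gtot (grd W)" if "z \<in> gtot (grd U)" for z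
    using that fst_dec snd_dec by (fastforce simp: gtot_def)
  ultimately show "gtot (grd U) = gtot (grd V) \<times> gtot (grd W)" by auto
qed

text \<open>\<open>\<delta> s\<close> is the degree of the point \<open>s\<close>; a map in \<open>G r\<close> is determined by its values on \<open>S\<close>.\<close>

lemma graded_space_fun:
  fixes W :: "('k::field, 'w::ab_group_add, 'z) dgspace_scheme" and U :: "('k, 's \<Rightarrow> 'w, 'y) dgspace_scheme"
  assumes W: "graded_space W"
    and s: "scl U = (\<lambda>c f x. scl W c (f x))"
    and sub0: "\<And>r. 0 \<in> grd U r"
    and add: "\<And>r f g. f \<in> grd U r \<Longrightarrow> g \<in> grd U r \<Longrightarrow> f + g \<in> grd U r"
    and scl: "\<And>r f c. f \<in> grd U r \<Longrightarrow> (\<lambda>x. scl W c (f x)) \<in> grd U r"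
    and deg: "\<And>r f x. f \<in> grd U r \<Longrightarrow> x \<in> S \<Longrightarrow> f x \<in> grd W (\<delta> x + r)"
    and det: "\<And>r f. f \<in> grd U r \<Longrightarrow> (\<And>x. x \<in> S \<Longrightarrow> f x = 0) \<Longrightarrow> f = 0"
  shows "graded_space U"
proof -
  interpret W: vector_space "scl W" by (rule graded_spaceD[OF W])
  interpret U: vector_space "scl U"
    by standard (auto simp: s W.scale_right_distrib W.scale_left_distrib fun_eq_iff)
  show ?thesis unfolding graded_space_def
  proof (intro conjI allI impI)
    show "vector_space (scl U)" by unfold_locales
    show "U.subspace (grd U n)" for n
      unfolding U.subspace_def by (auto simp: s sub0 add scl)
    fix v assume d: "is_decomp (grd U) 0 v"
    let ?T = "{n. v n \<noteq> 0}"
    have "v r = 0" for r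
    proof (rule det)
      show "v r \<in> grd U r" using d by (simp add: is_decomp_def)
      fix x assume x: "x \<in> S"
      \<comment> \<open>Evaluating at x turns a decomposition of the zero map into one of 0 in W,
        with all degrees raised by \<open>\<delta> x\<close>; uniqueness there kills every
        \<open>v r x\<close>.\<close>
      have "is_decomp (grd W) 0 (\<lambda>n. v (n - \<delta> x) x)"
      proof (rule is_decompI)
        show "v (n - \<delta> x) x \<in> grd W n" for n
          using deg[OF _ x, of "v (n - \<delta> x)" "n - \<delta> x"] d by (simp add: is_decomp_def)
        show "finite ((\<lambda>n. n + \<delta> x) ` ?T)" using d by (simp add: is_decomp_def)
        show "v (n - \<delta> x) x = 0" if "n \<notin> (\<lambda>n. n + \<delta> x) ` ?T" for n
        proof (rule ccontr)
          assume "v (n - \<delta> x) x \<noteq> 0"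
          then have "n - \<delta> x \<in> ?T" by auto
          then have "(n - \<delta> x) + \<delta> x \<in> (\<lambda>n. n + \<delta> x) ` ?T" by (rule imageI)
          then show False using that by simp
        qed
        have "(sum v ?T) x = (\<Sum>n\<in>?T. v n x)"
          by (rule sum_fun_apply)
        then have "0 = (\<Sum>n\<in>?T. v n x)"
          using d unfolding is_decomp_def by (metis zero_fun_apply)
        then show "0 = (\<Sum>n\<in>(\<lambda>n. n + \<delta> x) ` ?T. v (n - \<delta> x) x)"
          by (subst sum.reindex) auto
      qed
      then have "(\<lambda>n. v (n - \<delta> x) x) = (\<lambda>_. 0)" using W by (auto simp: graded_space_def)
      from fun_cong[OF this, of "r + \<delta> x"] show "v r x = 0" by simp
    qed
    then show "v = (\<lambda>_. 0)" by auto
  qed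
qed

section \<open>dg algebras and dg bimodules in terms of sign twists\<close>

lemma
  assumes V: "graded_space V"
    and F: "\<And>x y. x \<in> gtot (grd V) \<Longrightarrow> y \<in> gtot (grd V) \<Longrightarrow> F (x + y) = F x + F y"
  shows additive_0: "F 0 = 0"
    and additive_minus: "x \<in> gtot (grd V) \<Longrightarrow> F (- x) = - F x"
    and additive_diff: "x \<in> gtot (grd V) \<Longrightarrow> y \<in> gtot (grd V) \<Longrightarrow> F (x - y) = F x - F y"
    and additive_sg: "x \<in> gtot (grd V) \<Longrightarrow> F (sg n x) = sg n (F x)"
proof -
  show 0: "F 0 = 0" using F[OF gtot_0[OF V] gtot_0[OF V]] by simp
  show 1: "F (- x) = - F x" if "x \<in> gtot (grd V)" for x
    using F[OF that gtot_minus[OF V that]] 0 by (simp add: eq_neg_iff_add_eq_0 add.commute)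
  show "F (x - y) = F x - F y" if "x \<in> gtot (grd V)" "y \<in> gtot (grd V)"
    using F[OF that(1) gtot_minus[OF V that(2)]] 1[OF that(2)] by simp
  show "F (sg n x) = sg n (F x)" if "x \<in> gtot (grd V)"
    using 1[OF that] by (simp add: sg_def)
qed

lemma lin_degD:
  assumes "lin_deg V W r f"
  shows "x \<in> gtot (grd V) \<Longrightarrow> y \<in> gtot (grd V) \<Longrightarrow> f (x + y) = f x + f y"
    "x \<in> gtot (grd V) \<Longrightarrow> f (scl V c x) = scl W c (f x)"
    "x \<in> grd V n \<Longrightarrow> f x \<in> grd W (n + r)"
  using assms by (auto simp: lin_deg_def)

lemma lin_deg_gtot:
  assumes V: "graded_space V" and W: "graded_space W" and f: "lin_deg V W r f"
    and x: "x \<in> gtot (grd V)"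
  shows "f x \<in> gtot (grd W)"
  using V x
proof (induction x rule: gtot_induct)
  case (hom n x)
  then show ?case by (rule grd_gtot[OF W lin_degD(3)[OF f]])
next
  case (add x y)
  then show ?case by (simp add: lin_degD(1)[OF f] gtot_add[OF W])
qed

lemma lin_deg_tw:
  assumes V: "graded_space V" and W: "graded_space W" and f: "lin_deg V W r f"
    and x: "x \<in> gtot (grd V)"
  shows "tw (grd W) k (f x) = sg (k * r) (f (tw (grd V) k x))"
  using V x
proof (induction x rule: gtot_induct)
  case (hom n x)
  have "f (sg (k * n) x) = sg (k * n) (f x)"
    by (rule additive_sg[OF V lin_degD(1)[OF f] grd_gtot[OF V hom]])
  then show ?case using tw_hom[OF V hom, of k] tw_hom[OF W lin_degD(3)[OF f hom], of k]
    by (simp add: distrib_left add.commute)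
next
  case (add x y)
  then show ?case
    by (simp add: lin_degD(1)[OF f] tw_add[OF V] tw_add[OF W] tw_gtot[OF V] sg_add
        lin_deg_gtot[OF V W f])
qed

locale dg_alg =
  fixes A :: "('k::field, 'a::ab_group_add) dgalg"
  assumes dg_algebra: "dg_algebra A"
begin

lemma gsp: "graded_space A"
  using dg_algebra by (simp add: dg_algebra_def dg_space_def)

lemma tot [simp]: "x \<in> gtot (grd A)"
  using dg_algebra by (simp add: dg_algebra_def)

lemma tot_eq: "gtot (grd A) = UNIV"
  by auto

abbreviation tau :: "int \<Rightarrow> 'a \<Rightarrow> 'a" where "tau \<equiv> tw (grd A)"

lemma dif_lin: "lin_deg A A 1 (dif A)"
  using dg_algebra by (simp add: dg_algebra_def dg_space_def)

lemma dif_add: "dif A (a + b) = dif A a + dif A b"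
  by (rule lin_degD[OF dif_lin]) auto

lemma dif_scl: "dif A (scl A c a) = scl A c (dif A a)"
  by (rule lin_degD[OF dif_lin]) auto

lemma dif_grd: "a \<in> grd A n \<Longrightarrow> dif A a \<in> grd A (n + 1)"
  by (rule lin_degD[OF dif_lin])

lemma dif_dif: "dif A (dif A a) = 0"
  using dg_algebra by (simp add: dg_algebra_def dg_space_def)

lemma bilin: "bilin_deg A A A (mul A)"
  using dg_algebra by (simp add: dg_algebra_def)

lemma mul_add_left: "mul A (a + b) c = mul A a c + mul A b c"
  and mul_add_right: "mul A a (b + c) = mul A a b + mul A a c"
  and mul_scl_left: "mul A (scl A s a) b = scl A s (mul A a b)"
  and mul_scl_right: "mul A a (scl A s b) = scl A s (mul A a b)"
  and mul_grd: "a \<in> grd A m \<Longrightarrow> b \<in> grd A n \<Longrightarrow> mul A a b \<in> grd A (m + n)"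
  using bilin by (auto simp: bilin_deg_def)

lemma mul_assoc: "mul A (mul A a b) c = mul A a (mul A b c)"
  using dg_algebra by (simp add: dg_algebra_def)

lemmas mul_sg_left = additive_sg[OF gsp mul_add_left tot]
  and mul_sg_right = additive_sg[OF gsp mul_add_right tot]

lemmas dif_sg = additive_sg[OF gsp dif_add tot]

lemma tau_mul: "tau k (mul A a b) = mul A (tau k a) (tau k b)"
  using gsp tot[of a]
proof (induction a rule: gtot_induct)
  case (hom m a)
  show ?case using gsp tot[of b]
  proof (induction b rule: gtot_induct)
    case (hom n b)
    from \<open>a \<in> grd A m\<close> hom show ?case
      by (simp add: tw_hom[OF gsp] tw_hom[OF gsp mul_grd] mul_sg_left mul_sg_right distrib_left add.commute)
  qed (simp add: tw_add[OF gsp] mul_add_right)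
qed (simp add: tw_add[OF gsp] mul_add_left)

lemma tau_dif: "tau k (dif A a) = sg k (dif A (tau k a))"
  using lin_deg_tw[OF gsp gsp dif_lin tot, of k a] by simp

text \<open>The Leibniz sign (-1)^|a| is absorbed into the operator \<open>tau 1\<close>, so the
  rule can be used for inhomogeneous a.\<close>

lemma dif_mul: "dif A (mul A a b) = mul A (dif A a) b + mul A (tau 1 a) (dif A b)"
  using gsp tot[of a]
proof (induction a rule: gtot_induct)
  case (hom n a)
  then have "dif A (mul A a b) = mul A (dif A a) b + sg n (mul A a (dif A b))"
    using dg_algebra unfolding dg_algebra_def by blast
  then show ?case by (simp add: tw_hom[OF gsp hom] mul_sg_left)
qed (simp add: mul_add_left dif_add tw_add[OF gsp])

end

locale dg_bimod = A: dg_alg A + B: dg_alg B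
  for A :: "('k::field, 'a::ab_group_add) dgalg" and B :: "('k, 'b::ab_group_add) dgalg" +
  fixes M :: "('k, 'm::ab_group_add, 'a, 'b) bimod"
  assumes dg_bimodule: "dg_bimodule A B M"
begin

abbreviation C :: "'m set" where "C \<equiv> gtot (grd M)"

lemma gspM: "graded_space M"
  using dg_bimodule by (simp add: dg_bimodule_def dg_space_def)

lemma
  assumes "m \<in> C"
  shows lact_mul: "lact M (mul A a a') m = lact M a (lact M a' m)"
    and ract_mul: "ract M m (mul B b b') = ract M (ract M m b) b'"
    and lact_ract: "ract M (lact M a m) b = lact M a (ract M m b)"
  using dg_bimodule assms by (auto simp: dg_bimodule_def)

lemma difM_lin: "lin_deg M M 1 (dif M)"
  using dg_bimodule by (simp add: dg_bimodule_def dg_space_def)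

lemmas difM_add = lin_degD(1)[OF difM_lin]
  and difM_scl = lin_degD(2)[OF difM_lin]
  and difM_grd = lin_degD(3)[OF difM_lin]
  and difM_C = lin_deg_gtot[OF gspM gspM difM_lin]

lemmas difM_0 = additive_0[OF gspM difM_add]
  and difM_diff = additive_diff[OF gspM difM_add]
  and difM_sg = additive_sg[OF gspM difM_add]

lemma difM_difM: "m \<in> C \<Longrightarrow> dif M (dif M m) = 0"
  using dg_bimodule by (simp add: dg_bimodule_def dg_space_def)

lemma bilinM: "bilin_deg A M M (lact M)" "bilin_deg M B M (ract M)"
  using dg_bimodule by (auto simp: dg_bimodule_def)

lemma
  assumes "m \<in> C"
  shows lact_add_left: "lact M (a + a') m = lact M a m + lact M a' m"
    and lact_add_right: "m' \<in> C \<Longrightarrow> lact M a (m + m') = lact M a m + lact M a m'"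
    and lact_scl_left: "lact M (scl A c a) m = scl M c (lact M a m)"
    and lact_scl_right: "lact M a (scl M c m) = scl M c (lact M a m)"
    and ract_add_left: "m' \<in> C \<Longrightarrow> ract M (m + m') b = ract M m b + ract M m' b"
    and ract_add_right: "ract M m (b + b') = ract M m b + ract M m b'"
    and ract_scl_left: "ract M (scl M c m) b = scl M c (ract M m b)"
    and ract_scl_right: "ract M m (scl B c b) = scl M c (ract M m b)"
  using bilinM assms by (auto simp: bilin_deg_def)

lemma lact_grd: "a \<in> grd A i \<Longrightarrow> m \<in> grd M j \<Longrightarrow> lact M a m \<in> grd M (i + j)"
  and ract_grd: "m \<in> grd M j \<Longrightarrow> b \<in> grd B i \<Longrightarrow> ract M m b \<in> grd M (j + i)"
  using bilinM by (auto simp: bilin_deg_def)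

lemma lact_C: "m \<in> C \<Longrightarrow> lact M a m \<in> C"
proof -
  assume "m \<in> C"
  with gspM show ?thesis
  proof (induction m rule: gtot_induct)
    case (hom j m)
    show ?case using A.gsp A.tot[of a]
    proof (induction a rule: gtot_induct)
      case (hom i a) then show ?case using grd_gtot[OF gspM lact_grd[OF hom \<open>m \<in> grd M j\<close>]] by simp
    next
      case (add x y) then show ?case using hom by (simp add: lact_add_left grd_gtot[OF gspM hom] gtot_add[OF gspM])
    qed
  qed (simp add: lact_add_right gtot_add[OF gspM])
qed

lemma ract_C: "m \<in> C \<Longrightarrow> ract M m b \<in> C"
proof -
  assume "m \<in> C"
  with gspM show ?thesis
  proof (induction m rule: gtot_induct)
    case (hom j m)
    show ?case using B.gsp B.tot[of b]
    proof (induction b rule: gtot_induct)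
      case (hom i a) then show ?case using grd_gtot[OF gspM ract_grd[OF \<open>m \<in> grd M j\<close> hom]] by simp
    next
      case (add x y) then show ?case using hom by (simp add: ract_add_right grd_gtot[OF gspM hom] gtot_add[OF gspM])
    qed
  qed (simp add: ract_add_left gtot_add[OF gspM])
qed

lemmas lact_0 = additive_0[OF gspM lact_add_right]
  and lact_diff = additive_diff[OF gspM lact_add_right]
  and lact_sg = additive_sg[OF gspM lact_add_right]
  and lact_sg_left = additive_sg[OF A.gsp lact_add_left A.tot]
  and ract_0 = additive_0[OF gspM ract_add_left]
  and ract_diff = additive_diff[OF gspM ract_add_left]
  and ract_sg = additive_sg[OF gspM ract_add_left]
  and ract_sg_right = additive_sg[OF B.gsp ract_add_right B.tot]

lemma lact_0_left: "m \<in> C \<Longrightarrow> lact M 0 m = 0"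
  by (rule additive_0[OF A.gsp lact_add_left])

lemma ract_0_right: "m \<in> C \<Longrightarrow> ract M m 0 = 0"
  by (rule additive_0[OF B.gsp ract_add_right])

lemma lact_minus_left: "m \<in> C \<Longrightarrow> lact M (- a) m = - lact M a m"
  by (rule additive_minus[OF A.gsp lact_add_left A.tot])

lemma lact_minus: "m \<in> C \<Longrightarrow> lact M a (- m) = - lact M a m"
  by (rule additive_minus[OF gspM lact_add_right])

lemma ract_minus: "m \<in> C \<Longrightarrow> ract M (- m) b = - ract M m b"
  by (rule additive_minus[OF gspM ract_add_left])

lemma difM_minus: "m \<in> C \<Longrightarrow> dif M (- m) = - dif M m"
  by (rule additive_minus[OF gspM difM_add])

lemmas CI = gtot_0[OF gspM] gtot_add[OF gspM] gtot_diff[OF gspM] gtot_sg[OF gspM]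
  gtot_scl[OF gspM] gtot_minus[OF gspM] difM_C lact_C ract_C tw_gtot[OF gspM]

lemma tw_lact:
  assumes "m \<in> C" shows "tw (grd M) k (lact M a m) = lact M (A.tau k a) (tw (grd M) k m)"
  using gspM assms
proof (induction m rule: gtot_induct)
  case (hom j m)
  note m = grd_gtot[OF gspM hom]
  show ?case using A.gsp A.tot[of a]
  proof (induction a rule: gtot_induct)
    case (hom i a)
    from \<open>m \<in> grd M j\<close> hom m show ?case
      by (simp add: tw_hom[OF A.gsp] tw_hom[OF gspM] tw_hom[OF gspM lact_grd] lact_sg CI
          lact_sg_left distrib_left add.commute)
  qed (simp add: tw_add[OF A.gsp] tw_add[OF gspM] lact_add_left m CI)
qed (simp add: tw_add[OF gspM] lact_add_right CI)

lemma tw_ract: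
  assumes "m \<in> C" shows "tw (grd M) k (ract M m b) = ract M (tw (grd M) k m) (B.tau k b)"
  using gspM assms
proof (induction m rule: gtot_induct)
  case (hom j m)
  note m = grd_gtot[OF gspM hom]
  show ?case using B.gsp B.tot[of b]
  proof (induction b rule: gtot_induct)
    case (hom i a)
    from \<open>m \<in> grd M j\<close> hom m show ?case
      by (simp add: tw_hom[OF B.gsp] tw_hom[OF gspM] tw_hom[OF gspM ract_grd] ract_sg CI
          ract_sg_right distrib_left add.commute)
  qed (simp add: tw_add[OF B.gsp] tw_add[OF gspM] ract_add_right m CI)
qed (simp add: tw_add[OF gspM] ract_add_left CI)

lemma tw_difM: "m \<in> C \<Longrightarrow> tw (grd M) k (dif M m) = sg k (dif M (tw (grd M) k m))"
  using lin_deg_tw[OF gspM gspM difM_lin, of m k] by simp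

lemma dif_lact:
  assumes m: "m \<in> C"
  shows "dif M (lact M a m) = lact M (dif A a) m + lact M (A.tau 1 a) (dif M m)"
  using A.gsp A.tot[of a]
proof (induction a rule: gtot_induct)
  case (hom n a)
  then have "dif M (lact M a m) = lact M (dif A a) m + sg n (lact M a (dif M m))"
    using dg_bimodule m unfolding dg_bimodule_def by blast
  then show ?case using m by (simp add: tw_hom[OF A.gsp hom] lact_sg_left CI)
qed (simp add: lact_add_left difM_add m CI A.dif_add tw_add[OF A.gsp])

lemma dif_ract:
  assumes m: "m \<in> C"
  shows "dif M (ract M m b) = ract M (dif M m) b + ract M (tw (grd M) 1 m) (dif B b)"
  using gspM m
proof (induction m rule: gtot_induct)
  case (hom n m)
  then have "dif M (ract M m b) = ract M (dif M m) b + sg n (ract M m (dif B b))"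
    using dg_bimodule unfolding dg_bimodule_def by blast
  then show ?case using grd_gtot[OF gspM hom] by (simp add: tw_hom[OF gspM hom] ract_sg CI)
qed (simp add: ract_add_left difM_add CI tw_add[OF gspM])

end

section \<open>Multilinear maps on lists\<close>

text \<open>Linearity in each slot as a single equation, imposed for all lengths at once because a
  cochain is one function on lists of every length.\<close>

definition multilin :: "('k \<Rightarrow> 'a \<Rightarrow> 'a) \<Rightarrow> ('k \<Rightarrow> 'm \<Rightarrow> 'm) \<Rightarrow> ('a::plus list \<Rightarrow> 'm::plus) \<Rightarrow> bool" where
  "multilin s s' f \<longleftrightarrow> (\<forall>as c x y bs. f (as @ (s c x + y) # bs) = s' c (f (as @ x # bs)) + f (as @ y # bs))"

text \<open>The index of \<open>shdeg\<close> is the total degree after shifting each entry down by one.\<close>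

inductive shdeg :: "(int \<Rightarrow> 'a set) \<Rightarrow> int \<Rightarrow> 'a list \<Rightarrow> bool" for G where
  Nil: "shdeg G 0 []"
| Cons: "a \<in> G m \<Longrightarrow> shdeg G k as \<Longrightarrow> shdeg G (k + m - 1) (a # as)"

text \<open>In total degree n the component of arity p has internal degree n - p. Once every entry
  is shifted down by one, it raises degrees by n whatever p is, so no arity appears in the
  condition.\<close>

definition has_deg :: "(int \<Rightarrow> 'a set) \<Rightarrow> (int \<Rightarrow> 'm set) \<Rightarrow> int \<Rightarrow> ('a list \<Rightarrow> 'm) \<Rightarrow> bool" where
  "has_deg G H n f \<longleftrightarrow> (\<forall>k as. shdeg G k as \<longrightarrow> f as \<in> H (k + n))"

definition bounded_arity :: "('a list \<Rightarrow> 'm::zero) \<Rightarrow> bool" where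
  "bounded_arity f \<longleftrightarrow> (\<exists>P. \<forall>as. length as > P \<longrightarrow> f as = 0)"

lemma shdeg_list_all2: "list_all2 (\<lambda>a n. a \<in> G n) as ns \<Longrightarrow> shdeg G (sum_list ns - int (length as)) as"
proof (induction as ns rule: list_all2_induct)
  case Nil then show ?case by (simp add: shdeg.Nil)
next
  case (Cons a as n ns)
  then show ?case using shdeg.Cons[of a G n "sum_list ns - int (length as)" as] by (simp add: algebra_simps)
qed

lemma shdegE:
  assumes "shdeg G k as"
  obtains ns where "list_all2 (\<lambda>a n. a \<in> G n) as ns" "k = sum_list ns - int (length as)"
proof -
  have "\<exists>ns. list_all2 (\<lambda>a n. a \<in> G n) as ns \<and> k = sum_list ns - int (length as)"
    using assms
  proof induction
    case (Cons a m k as)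
    then obtain ns where "list_all2 (\<lambda>a n. a \<in> G n) as ns" "k = sum_list ns - int (length as)" by auto
    then show ?case using Cons(1) by (intro exI[of _ "m # ns"]) simp
  qed simp
  then show ?thesis using that by blast
qed

lemma shdeg_append: "shdeg G k as \<Longrightarrow> shdeg G l bs \<Longrightarrow> shdeg G (k + l) (as @ bs)"
proof (induction rule: shdeg.induct)
  case (Cons a m k as)
  then show ?case using shdeg.Cons[of a G m "k + l" "as @ bs"] by (simp add: algebra_simps)
qed simp

lemma shdeg_single: "a \<in> G m \<Longrightarrow> shdeg G (m - 1) [a]"
  using shdeg.Cons[OF _ shdeg.Nil, of a G m] by simp

text \<open>Entries are made homogeneous from left to right: the induction runs over the remaining
  suffix, for all prefixes that are already homogeneous.\<close>

lemma homog_list_induct [consumes 2, case_names hom add]: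
  assumes "graded_space V" "gtot (grd V) = UNIV"
    and hom: "\<And>k as. shdeg (grd V) k as \<Longrightarrow> P as"
    and add: "\<And>as x y bs. P (as @ x # bs) \<Longrightarrow> P (as @ y # bs) \<Longrightarrow> P (as @ (x + y) # bs)"
  shows "P as"
proof -
  have "\<forall>k pre. shdeg (grd V) k pre \<longrightarrow> P (pre @ as)"
  proof (induction as)
    case Nil then show ?case using hom by auto
  next
    case (Cons a as)
    have a: "a \<in> gtot (grd V)" by (simp add: assms(2))
    have "\<forall>k pre. shdeg (grd V) k pre \<longrightarrow> P (pre @ a # as)"
      using assms(1) a
    proof (induction a rule: gtot_induct)
      case (hom n a)
      show ?case
      proof (intro allI impI)
        fix k pre assume "shdeg (grd V) k pre"
        then have "shdeg (grd V) (k + (n - 1)) (pre @ [a])"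
          by (rule shdeg_append[OF _ shdeg_single[where G = "grd V", OF hom]])
        then have "P ((pre @ [a]) @ as)" using Cons.IH by blast
        then show "P (pre @ a # as)" by simp
      qed
    next
      case (add x y)
      then show ?case using assms(4) by blast
    qed
    then show ?case .
  qed
  then show ?thesis using shdeg.Nil[of "grd V"] by (metis append_Nil)
qed

lemma multilin_tail: "multilin s s' f \<Longrightarrow> multilin s s' (\<lambda>bs. f (a # bs))"
  unfolding multilin_def by (metis append_Cons)

lemma has_degD: "has_deg G H n f \<Longrightarrow> shdeg G k as \<Longrightarrow> f as \<in> H (k + n)"
  by (simp add: has_deg_def)

lemma has_deg_tail:
  assumes "has_deg G H n f" "a \<in> G m"
  shows "has_deg G H (n + m - 1) (\<lambda>bs. f (a # bs))"
  unfolding has_deg_def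
proof (intro allI impI)
  fix k as assume "shdeg G k as"
  from has_degD[OF assms(1) shdeg.Cons[OF assms(2) this]]
  show "f (a # as) \<in> H (k + (n + m - 1))" by (simp add: algebra_simps)
qed

lemma has_deg_Nil: "has_deg G H n f \<Longrightarrow> f [] \<in> H n"
  using has_degD[OF _ shdeg.Nil] by fastforce

section \<open>Multilinear cochains of a given total degree\<close>

locale two_graded =
  fixes V :: "('k::field, 'a::ab_group_add, 'y) dgspace_scheme"
    and W :: "('k, 'm::ab_group_add, 'z) dgspace_scheme"
  assumes gV: "graded_space V" and gW: "graded_space W" and totV: "gtot (grd V) = UNIV"
begin

definition hoch :: "int \<Rightarrow> ('a list \<Rightarrow> 'm) \<Rightarrow> bool" where
  "hoch n f \<longleftrightarrow> multilin (scl V) (scl W) f \<and> has_deg (grd V) (grd W) n f \<and> bounded_arity f"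

lemma multilin_add:
  "multilin (scl V) (scl W) f \<Longrightarrow> f (as @ (x + y) # bs) = f (as @ x # bs) + f (as @ y # bs)"
  unfolding multilin_def using scl_1[OF gV] scl_1[OF gW] by metis

lemma multilin_0: "multilin (scl V) (scl W) f \<Longrightarrow> f (as @ 0 # bs) = 0"
  using multilin_add[of f as 0 0 bs] by simp

lemma multilin_scl:
  "multilin (scl V) (scl W) f \<Longrightarrow> f (as @ scl V c x # bs) = scl W c (f (as @ x # bs))"
  unfolding multilin_def using multilin_0[unfolded multilin_def, of f as bs] by (metis add.right_neutral)

lemma multilin_minus:
  "multilin (scl V) (scl W) f \<Longrightarrow> f (as @ (- x) # bs) = - f (as @ x # bs)"
  using multilin_add[of f as x "- x" bs] by (simp add: multilin_0 eq_neg_iff_add_eq_0 add.commute)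

lemma multilin_sg:
  "multilin (scl V) (scl W) f \<Longrightarrow> f (as @ sg k x # bs) = sg k (f (as @ x # bs))"
  by (simp add: sg_def multilin_minus)

lemmas multilin_add_hd = multilin_add[where as = "[]", simplified]
  and multilin_0_hd = multilin_0[where as = "[]", simplified]
  and multilin_minus_hd = multilin_minus[where as = "[]", simplified]
  and multilin_sg_hd = multilin_sg[where as = "[]", simplified]

lemma multilin_lin_hd:
  "multilin (scl V) (scl W) f \<Longrightarrow> f ((scl V c x + y) # bs) = scl W c (f (x # bs)) + f (y # bs)"
  unfolding multilin_def by (metis append_Nil)

lemma multilinI:
  assumes "\<And>as x y bs. f (as @ (x + y) # bs) = f (as @ x # bs) + f (as @ y # bs)"
    "\<And>as c x bs. f (as @ scl V c x # bs) = scl W c (f (as @ x # bs))"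
  shows "multilin (scl V) (scl W) f"
  unfolding multilin_def by (simp add: assms)

lemma multilin_eqI:
  assumes f: "multilin (scl V) (scl W) f" and g: "multilin (scl V) (scl W) g"
    and eq: "\<And>k as. shdeg (grd V) k as \<Longrightarrow> f as = g as"
  shows "f as = g as"
  by (induction as rule: homog_list_induct[OF gV totV]) (simp_all add: eq multilin_add[OF f] multilin_add[OF g])

lemma multilin_gtot:
  assumes f: "multilin (scl V) (scl W) f" and d: "has_deg (grd V) (grd W) n f"
  shows "f as \<in> gtot (grd W)"
  by (induction as rule: homog_list_induct[OF gV totV])
    (use d in \<open>auto simp: multilin_add[OF f] has_deg_def intro: gtot_add[OF gW] grd_gtot[OF gW]\<close>)

lemma hoch_gtot: "hoch n f \<Longrightarrow> f as \<in> gtot (grd W)"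
  unfolding hoch_def using multilin_gtot by blast

text \<open>Replaces the arity-by-arity description of the complex by one condition on the whole
  function. A list of length p with entry degrees ns has shifted degree \<open>sum_list ns\<close> -
  p, which absorbs the n - p of each arity.\<close>

lemma hoch_deg_iff: "f \<in> hoch_deg V W n \<longleftrightarrow> hoch n f"
proof
  assume f: "f \<in> hoch_deg V W n"
  then have pr: "arity_part p f \<in> hoch_pr V W p (n - int p)" for p by (simp add: hoch_deg_def)
  have "f (as @ (x + y) # bs) = f (as @ x # bs) + f (as @ y # bs)" for as x y bs
    using pr[of "length as + 1 + length bs"] by (simp add: hoch_pr_def arity_part_def)
  moreover have "f (as @ scl V c x # bs) = scl W c (f (as @ x # bs))" for as c x bs
    using pr[of "length as + 1 + length bs"] by (simp add: hoch_pr_def arity_part_def)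
  ultimately have "multilin (scl V) (scl W) f" by (rule multilinI)
  moreover have "has_deg (grd V) (grd W) n f"
    unfolding has_deg_def
  proof (intro allI impI)
    fix k as assume "shdeg (grd V) k as"
    then obtain ns where ns: "list_all2 (\<lambda>a n. a \<in> grd V n) as ns" "k = sum_list ns - int (length as)"
      by (rule shdegE)
    have "\<forall>as' ns. length as' = length as \<and> list_all2 (\<lambda>a n. a \<in> grd V n) as' ns \<longrightarrow>
        arity_part (length as) f as' \<in> grd W (sum_list ns + (n - int (length as)))"
      using pr[of "length as"] by (simp add: hoch_pr_def)
    with ns(1) have "arity_part (length as) f as \<in> grd W (sum_list ns + (n - int (length as)))" by blast
    then show "f as \<in> grd W (k + n)" by (simp add: ns(2) arity_part_def algebra_simps)
  qed
  moreover have "bounded_arity f"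
  proof -
    let ?S = "{p. arity_part p f \<noteq> 0}"
    have fin: "finite ?S" using f by (simp add: hoch_deg_def)
    show ?thesis unfolding bounded_arity_def
    proof (intro exI allI impI)
      fix as :: "'a list" assume "length as > Max (insert 0 ?S)"
      then have "length as \<notin> ?S" using fin Max_ge[of "insert 0 ?S"] by fastforce
      then have "arity_part (length as) f as = 0" by (simp add: fun_eq_iff)
      then show "f as = 0" by (simp add: arity_part_def)
    qed
  qed
  ultimately show "hoch n f" by (simp add: hoch_def)
next
  assume f: "hoch n f"
  then have ml: "multilin (scl V) (scl W) f" by (simp add: hoch_def)
  obtain P where P: "\<And>as. length as > P \<Longrightarrow> f as = 0" using f by (auto simp: hoch_def bounded_arity_def)
  have "arity_part p f \<in> hoch_pr V W p (n - int p)" for p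
    unfolding hoch_pr_def
  proof (intro CollectI conjI allI impI)
    fix as ns assume as: "length as = p \<and> list_all2 (\<lambda>a n. a \<in> grd V n) as ns"
    then have "shdeg (grd V) (sum_list ns - int p) as" using shdeg_list_all2[of "grd V" as ns] by simp
    then have "f as \<in> grd W (sum_list ns - int p + n)" using f by (simp add: hoch_def has_deg_def)
    then show "arity_part p f as \<in> grd W (sum_list ns + (n - int p))"
      using as by (simp add: arity_part_def algebra_simps)
  qed (auto simp: arity_part_def multilin_add[OF ml] multilin_scl[OF ml])
  moreover have "{p. arity_part p f \<noteq> 0} \<subseteq> {..P}"
    using P by (auto simp: arity_part_def fun_eq_iff not_le[symmetric] split: if_splits)
  then have "finite {p. arity_part p f \<noteq> 0}" by (rule finite_subset) simp
  ultimately show "f \<in> hoch_deg V W n" by (simp add: hoch_deg_def)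
qed

text \<open>The unshifted degree of the list is \<open>l + int (length as)\<close>, and every entry
  contributes the sign of its own degree by linearity.\<close>

lemma multilin_map_tw:
  assumes "shdeg (grd V) l as" "multilin (scl V) (scl W) g"
  shows "g (map (tw (grd V) k) as) = sg (k * (l + int (length as))) (g as)"
  using assms
proof (induction arbitrary: g rule: shdeg.induct)
  case (Cons a m l as)
  have "g (map (tw (grd V) k) (a # as)) = sg (k * m) (g (a # map (tw (grd V) k) as))"
    using multilin_sg_hd[OF Cons.prems] by (simp add: tw_hom[OF gV Cons.hyps(1)])
  then show ?case using Cons.IH[OF multilin_tail[OF Cons.prems], of a] by (simp add: algebra_simps)
qed simp

text \<open>Trades a sign on the value of f for signs on its arguments. The two differ by the
  internal degree of the component in question, which is n minus the arity.\<close>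

lemma hoch_map_tw:
  assumes f: "hoch n f"
  shows "tw (grd W) k (f as) = sg (k * (n - int (length as))) (f (map (tw (grd V) k) as))"
  using gV totV
proof (induction as rule: homog_list_induct)
  case (hom l as)
  have ml: "multilin (scl V) (scl W) f" using f by (simp add: hoch_def)
  have "f as \<in> grd W (l + n)" using f hom by (simp add: hoch_def has_deg_def)
  from tw_hom[OF gW this, of k] show ?case
    unfolding multilin_map_tw[OF hom ml] by (auto intro: sg_parity)
next
  case (add as x y bs)
  have ml: "multilin (scl V) (scl W) f" using f by (simp add: hoch_def)
  show ?case using add
    by (simp add: multilin_add[OF ml] tw_add[OF gW] hoch_gtot[OF f] sg_add tw_add[OF gV] totV)
qed

lemma hoch_zero: "hoch n (\<lambda>_. 0)"
  by (auto simp: hoch_def multilin_def has_deg_def bounded_arity_def grd_0[OF gW] scl_0[OF gW])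

lemma hoch_add: "hoch n f \<Longrightarrow> hoch n g \<Longrightarrow> hoch n (\<lambda>as. f as + g as)"
proof -
  assume a: "hoch n f" "hoch n g"
  from a obtain P Q where "\<forall>as. length as > P \<longrightarrow> f as = 0" "\<forall>as. length as > Q \<longrightarrow> g as = 0"
    by (auto simp: hoch_def bounded_arity_def)
  then have "bounded_arity (\<lambda>as. f as + g as)"
    unfolding bounded_arity_def by (intro exI[of _ "max P Q"]) auto
  with a show ?thesis
    by (auto simp: hoch_def multilin_def has_deg_def grd_add[OF gW] scl_add[OF gW])
qed

lemma hoch_scl: "hoch n f \<Longrightarrow> hoch n (\<lambda>as. scl W c (f as))"
proof -
  interpret W: vector_space "scl W" by (rule graded_spaceD[OF gW])
  assume a: "hoch n f"
  then show ?thesis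
    by (auto simp: hoch_def multilin_def has_deg_def grd_scl[OF gW] bounded_arity_def W.scale_right_distrib mult.commute)
qed

lemma hoch_minus: "hoch n f \<Longrightarrow> hoch n (\<lambda>as. - f as)"
proof -
  interpret W: vector_space "scl W" by (rule graded_spaceD[OF gW])
  assume "hoch n f" from hoch_scl[OF this, of "- 1"] show ?thesis by simp
qed

lemma hoch_diff: "hoch n f \<Longrightarrow> hoch n g \<Longrightarrow> hoch n (\<lambda>as. f as - g as)"
  using hoch_add[of n f "\<lambda>as. - g as"] hoch_minus[of n g] by simp

lemma hoch_sg: "hoch n f \<Longrightarrow> hoch n (\<lambda>as. sg k (f as))"
  using hoch_minus[of n f] by (cases "even k") (simp_all add: sg_def)

text \<open>The sign is constant on each arity, and the conditions on a cochain never compare lists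
  of different lengths.\<close>

lemma hoch_sg_length:
  assumes "hoch n f" shows "hoch n (\<lambda>as. sg (int (length as)) (f as))"
  using assms unfolding hoch_def multilin_def has_deg_def bounded_arity_def
  by (auto simp: sg_add scl_sg[OF gW] grd_sg[OF gW])

lemma graded_space_hoch:
  assumes "scl U = (\<lambda>c f as. scl W c (f as))" "grd U = hoch_deg V W"
  shows "graded_space (U :: ('k, 'a list \<Rightarrow> 'm, 'w) dgspace_scheme)"
\<comment> \<open>A list containing 0 has many degrees, so \<open>\<delta>\<close> chooses one; any
  choice works because a cochain has the right degree for each of them.\<close>
proof (rule graded_space_fun[OF gW assms(1), where S = "{as. \<exists>k. shdeg (grd V) k as}"
      and \<delta> = "\<lambda>as. SOME k. shdeg (grd V) k as"])
  show "0 \<in> grd U r" for r using hoch_zero by (simp add: assms(2) hoch_deg_iff zero_fun_def)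
  show "f + g \<in> grd U r" if "f \<in> grd U r" "g \<in> grd U r" for r f g
    using that hoch_add by (auto simp: assms(2) hoch_deg_iff plus_fun_def)
  show "(\<lambda>x. scl W c (f x)) \<in> grd U r" if "f \<in> grd U r" for r f c
    using that hoch_scl by (auto simp: assms(2) hoch_deg_iff)
  show "f x \<in> grd W ((SOME k. shdeg (grd V) k x) + r)"
    if f: "f \<in> grd U r" and x: "x \<in> {as. \<exists>k. shdeg (grd V) k as}" for r f x
  proof -
    have "\<exists>k. shdeg (grd V) k x" using x by simp
    then have "shdeg (grd V) (SOME k. shdeg (grd V) k x) x" by (rule someI_ex)
    then show ?thesis using f by (simp add: assms(2) hoch_deg_iff hoch_def has_deg_def)
  qed
  show "f = 0" if f: "f \<in> grd U r" and z: "\<And>x. x \<in> {as. \<exists>k. shdeg (grd V) k as} \<Longrightarrow> f x = 0" for r f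
  proof
    fix as
    have ml: "multilin (scl V) (scl W) f" using f by (simp add: assms(2) hoch_deg_iff hoch_def)
    have "multilin (scl V) (scl W) (\<lambda>_. 0)" using hoch_zero[of 0] by (simp add: hoch_def)
    from multilin_eqI[OF ml this] show "f as = 0 as" using z by auto
  qed
qed

end

section \<open>The Hochschild differential by recursion on lists\<close>

text \<open>The contribution of a leading entry a: it is merged into its right neighbour or, having
  none, acts from the right on the value.\<close>

definition hmu :: "('a \<Rightarrow> 'a \<Rightarrow> 'a) \<Rightarrow> ('m \<Rightarrow> 'a \<Rightarrow> 'm) \<Rightarrow> 'a \<Rightarrow> ('a list \<Rightarrow> 'm) \<Rightarrow> 'a list \<Rightarrow> 'm" where
  "hmu \<mu> \<rho> a f as = (case as of [] \<Rightarrow> \<rho> (f []) a | b # bs \<Rightarrow> f (\<mu> a b # bs))"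

text \<open>
  \<open>hE\<close> collects the inner terms and the right action term of the Hochschild differential:
  \<open>hE \<mu> \<rho> f [a\<^sub>0, \<dots>, a\<^sub>p]\<close> is the sum of \<open>(-1)\<^sup>i f [\<dots>, \<mu> a\<^sub>i a\<^sub>i\<^sub>+\<^sub>1, \<dots>]\<close>, \<open>i < p\<close>, plus \<open>(-1)\<^sup>p \<rho> (f [\<dots>]) a\<^sub>p\<close>.
\<close>

primrec hE :: "('a \<Rightarrow> 'a \<Rightarrow> 'a) \<Rightarrow> ('m \<Rightarrow> 'a \<Rightarrow> 'm) \<Rightarrow> ('a list \<Rightarrow> 'm::ab_group_add) \<Rightarrow> 'a list \<Rightarrow> 'm" where
  "hE \<mu> \<rho> f [] = 0"
| "hE \<mu> \<rho> f (a # as) = hmu \<mu> \<rho> a f as - hE \<mu> \<rho> (\<lambda>bs. f (a # bs)) as"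

text \<open>The operator d is applied to one entry at a time and t to all entries before it; with t
  = \<open>tau 1\<close> this is the Koszul sign of moving a differential past them.\<close>

primrec hD :: "('a \<Rightarrow> 'a) \<Rightarrow> ('a \<Rightarrow> 'a) \<Rightarrow> ('a list \<Rightarrow> 'm::ab_group_add) \<Rightarrow> 'a list \<Rightarrow> 'm" where
  "hD t d f [] = 0"
| "hD t d f (a # as) = f (d a # as) + hD t d (\<lambda>bs. f (t a # bs)) as"

lemma hmu_simps [simp]: "hmu \<mu> \<rho> a f [] = \<rho> (f []) a" "hmu \<mu> \<rho> a f (b # bs) = f (\<mu> a b # bs)"
  by (simp_all add: hmu_def)

text \<open>Values are confined to a subset S because module actions are controlled only on the
  total space of a graded space; for X and for maps from X to X it is the whole type.\<close>

locale right_action =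
  fixes S :: "'m::ab_group_add set" and \<rho> :: "'m \<Rightarrow> 'a \<Rightarrow> 'm"
  assumes S_0: "0 \<in> S" and S_diff: "x \<in> S \<Longrightarrow> y \<in> S \<Longrightarrow> x - y \<in> S"
    and S_rho: "x \<in> S \<Longrightarrow> \<rho> x a \<in> S"
    and rho_add: "x \<in> S \<Longrightarrow> y \<in> S \<Longrightarrow> \<rho> (x + y) a = \<rho> x a + \<rho> y a"
begin

lemma S_add: "x \<in> S \<Longrightarrow> y \<in> S \<Longrightarrow> x + y \<in> S"
  using S_diff[OF _ S_diff[OF S_0], of x y] by simp

lemma rho_0: "\<rho> 0 a = 0"
  using rho_add[OF S_0 S_0, of a] by simp

lemma hmu_S: "(\<And>as. f as \<in> S) \<Longrightarrow> hmu \<mu> \<rho> a f as \<in> S"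
  by (cases as) (auto intro: S_rho)

lemma hE_S: "(\<And>as. f as \<in> S) \<Longrightarrow> hE \<mu> \<rho> f as \<in> S"
  by (induction as arbitrary: f) (auto intro!: S_0 S_diff hmu_S)

lemma hD_S: "(\<And>as. f as \<in> S) \<Longrightarrow> hD t d f as \<in> S"
  by (induction as arbitrary: f) (auto intro!: S_0 S_add)

lemma hE_add:
  "(\<And>as. f as \<in> S) \<Longrightarrow> (\<And>as. g as \<in> S) \<Longrightarrow>
    hE \<mu> \<rho> (\<lambda>as. f as + g as) as = hE \<mu> \<rho> f as + hE \<mu> \<rho> g as"
proof (induction as arbitrary: f g)
  case (Cons a as)
  show ?case
    using Cons.IH[of "\<lambda>bs. f (a # bs)" "\<lambda>bs. g (a # bs)"] Cons.prems
    by (cases as) (simp_all add: rho_add algebra_simps)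
qed simp

lemma hE_diff:
  "(\<And>as. f as \<in> S) \<Longrightarrow> (\<And>as. g as \<in> S) \<Longrightarrow>
    hE \<mu> \<rho> (\<lambda>as. f as - g as) as = hE \<mu> \<rho> f as - hE \<mu> \<rho> g as"
  using hE_add[of "\<lambda>as. f as - g as" g \<mu> as] by (simp add: S_diff)

text \<open>Pulls a map T of the values out of the sum. T may depend on the arity, since signs and
  twists do; the right-hand index is \<open>length as\<close> - 1 because \<open>hE\<close> feeds f
  with lists that are one entry shorter.\<close>

lemma hE_post:
  assumes "\<And>as. f as \<in> S"
    and "\<And>k x y. x \<in> S \<Longrightarrow> y \<in> S \<Longrightarrow> T k (x - y) = T k x - T k y"
    and "\<And>k x a. x \<in> S \<Longrightarrow> T k (\<rho> x a) = \<rho>' (T k x) a"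
  shows "hE \<mu> \<rho>' (\<lambda>bs. T (int (length bs)) (f bs)) as = T (int (length as) - 1) (hE \<mu> \<rho> f as)"
  using assms
proof (induction as arbitrary: f T)
  case Nil
  show ?case using Nil(2)[OF S_0 S_0] by simp
next
  case (Cons a as)
  have "hE \<mu> \<rho>' (\<lambda>bs. T (int (length bs) + 1) (f (a # bs))) as = T (int (length as)) (hE \<mu> \<rho> (\<lambda>bs. f (a # bs)) as)"
    using Cons.IH[of "\<lambda>bs. f (a # bs)" "\<lambda>k. T (k + 1)"] Cons.prems by simp
  moreover have "hmu \<mu> \<rho>' a (\<lambda>bs. T (int (length bs)) (f bs)) as = T (int (length as)) (hmu \<mu> \<rho> a f as)"
    using Cons.prems by (cases as) (simp_all add: add.commute)
  ultimately show ?case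
    using Cons.prems by (simp add: hmu_S hE_S add.commute)
qed

text \<open>Associativity makes merging the first entry commute with \<open>hE\<close>. These two
  terms cancel, and what remains is the same square for f with its first argument fixed.\<close>

lemma hE_hE:
  assumes "\<And>a b c. \<mu> (\<mu> a b) c = \<mu> a (\<mu> b c)" "\<And>x a b. x \<in> S \<Longrightarrow> \<rho> x (\<mu> a b) = \<rho> (\<rho> x a) b"
    and "\<And>as. f as \<in> S"
  shows "hE \<mu> \<rho> (hE \<mu> \<rho> f) as = 0"
  using assms(3)
proof (induction as arbitrary: f)
  case (Cons a as)
  have 1: "hmu \<mu> \<rho> a (hE \<mu> \<rho> f) as = hE \<mu> \<rho> (hmu \<mu> \<rho> a f) as"
  proof (cases as)
    case Nil then show ?thesis by (simp add: rho_0)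
  next
    case (Cons b bs)
    have "hmu \<mu> \<rho> (\<mu> a b) f bs = hmu \<mu> \<rho> b (hmu \<mu> \<rho> a f) bs"
      by (cases bs) (simp_all add: assms(1,2) \<open>\<And>as. f as \<in> S\<close>)
    then show ?thesis by (simp add: Cons)
  qed
  have 2: "(\<lambda>bs. hE \<mu> \<rho> f (a # bs)) = (\<lambda>bs. hmu \<mu> \<rho> a f bs - hE \<mu> \<rho> (\<lambda>bs. f (a # bs)) bs)"
    by simp
  have "hE \<mu> \<rho> (\<lambda>bs. hE \<mu> \<rho> f (a # bs)) as = hE \<mu> \<rho> (hmu \<mu> \<rho> a f) as - hE \<mu> \<rho> (hE \<mu> \<rho> (\<lambda>bs. f (a # bs))) as"
    unfolding 2 by (rule hE_diff) (auto intro!: hmu_S hE_S Cons.prems)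
  then show ?case using Cons.IH[of "\<lambda>bs. f (a # bs)"] Cons.prems by (simp add: 1)
qed simp

lemma hE_eq_0:
  "(\<And>bs. length bs + 1 = length as \<Longrightarrow> f bs = 0) \<Longrightarrow> hE \<mu> \<rho> f as = 0"
proof (induction as arbitrary: f)
  case (Cons a as)
  then show ?case using Cons.IH[of "\<lambda>bs. f (a # bs)"] by (cases as) (simp_all add: rho_0)
qed simp

end

lemma hD_eq_0: "(\<And>bs. length bs = length as \<Longrightarrow> f bs = 0) \<Longrightarrow> hD t d f as = 0"
proof (induction as arbitrary: f)
  case (Cons a as)
  then show ?case using Cons.IH[of "\<lambda>bs. f (t a # bs)"] by simp
qed simp

lemma hD_add: "hD t d (\<lambda>as. f as + g as) as = hD t d f as + hD t d g as"
  by (induction as arbitrary: f g) (simp_all add: algebra_simps)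

lemma hD_diff: "hD t d (\<lambda>as. f as - g as) as = hD t d f as - hD t d g as"
  by (induction as arbitrary: f g) (simp_all add: algebra_simps)

lemma hD_post:
  assumes "0 \<in> S" "\<And>x y. x \<in> S \<Longrightarrow> y \<in> S \<Longrightarrow> x + y \<in> S" "\<And>as. f as \<in> S"
    and "\<And>k x y. x \<in> S \<Longrightarrow> y \<in> S \<Longrightarrow> T k (x + y) = T k x + T k y"
  shows "hD t d (\<lambda>bs. T (int (length bs)) (f bs)) as = T (int (length as)) (hD t d f as)"
  using assms(3,4)
proof (induction as arbitrary: f T)
  case Nil
  have "T 0 (0 + 0) = T 0 0 + T 0 0" by (rule Nil(2)) (rule assms(1))+
  then show ?case by simp
next
  case (Cons a as)
  have S: "hD t d f as \<in> S" if "\<And>as. f as \<in> S" for f as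
    using that by (induction as arbitrary: f) (auto intro!: assms(1,2))
  show ?case
    using Cons.IH[of "\<lambda>bs. f (t a # bs)" "\<lambda>k. T (k + 1)"] Cons.prems by (simp add: S add.commute)
qed

locale hoch_coeff = dg_bimod A A M
  for A :: "('k::field, 'a::ab_group_add) dgalg" and M :: "('k, 'm::ab_group_add, 'a, 'a) bimod"
begin

sublocale two_graded A M
  by standard (rule A.gsp, rule gspM, rule A.tot_eq)

sublocale R: right_action C "ract M"
  by standard (auto intro: CI simp: ract_add_left)

abbreviation (input) hEM where "hEM \<equiv> hE (mul A) (ract M)"
abbreviation (input) hDM :: "('a list \<Rightarrow> 'm) \<Rightarrow> 'a list \<Rightarrow> 'm" where "hDM \<equiv> hD (A.tau 1) (dif A)"

text \<open>The left action term of d_H without its overall sign. On \<open>bs\<close> the map f has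
  internal degree \<open>n - int (length bs)\<close>, and the sign (-1)^(r |a|) is a twist of
  a.\<close>

definition lam :: "int \<Rightarrow> ('a list \<Rightarrow> 'm) \<Rightarrow> 'a list \<Rightarrow> 'm" where
  "lam n f as = (case as of [] \<Rightarrow> 0 | a # bs \<Rightarrow> lact M (A.tau (n - int (length bs)) a) (f bs))"

lemma lam_simps [simp]: "lam n f [] = 0"
  "lam n f (a # bs) = lact M (A.tau (n - int (length bs)) a) (f bs)"
  by (simp_all add: lam_def)

text \<open>With p + r = n every sign of d_H contains (-1)^(n - 1); dividing by it leaves minus the
  alternating sum \<open>hE\<close> for the inner terms and the right action.\<close>

definition dH :: "int \<Rightarrow> ('a list \<Rightarrow> 'm) \<Rightarrow> 'a list \<Rightarrow> 'm" where
  "dH n f as = sg (n - 1) (lam n f as - hEM f as)"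

definition del :: "int \<Rightarrow> ('a list \<Rightarrow> 'm) \<Rightarrow> 'a list \<Rightarrow> 'm" where
  "del n f as = dif M (f as) - sg (n - int (length as)) (hDM f as)"

definition dT :: "int \<Rightarrow> ('a list \<Rightarrow> 'm) \<Rightarrow> 'a list \<Rightarrow> 'm" where
  "dT n f as = dH n f as + del n f as"

lemma lam_C: "(\<And>as. f as \<in> C) \<Longrightarrow> lam n f as \<in> C"
  by (cases as) (auto intro: CI)

lemma dH_C: "(\<And>as. f as \<in> C) \<Longrightarrow> dH n f as \<in> C"
  by (auto simp: dH_def intro!: CI lam_C R.hE_S)

lemma del_C: "(\<And>as. f as \<in> C) \<Longrightarrow> del n f as \<in> C"
  by (auto simp: del_def intro!: CI R.hD_S)

lemma hE_sg: "(\<And>as. f as \<in> C) \<Longrightarrow> hEM (\<lambda>bs. sg k (f bs)) as = sg k (hEM f as)"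
  using R.hE_post[of f "\<lambda>_. sg k" "ract M" "mul A" as] by (simp add: sg_diff ract_sg)

lemma hE_scl: "(\<And>as. f as \<in> C) \<Longrightarrow> hEM (\<lambda>bs. scl M c (f bs)) as = scl M c (hEM f as)"
  using R.hE_post[of f "\<lambda>_. scl M c" "ract M" "mul A" as]
  by (simp add: scl_diff[OF gspM] ract_scl_left)

lemma hD_sg: "hDM (\<lambda>bs. sg k (f bs)) as = sg k (hDM f as)"
  using hD_post[of UNIV f "\<lambda>_. sg k" "A.tau 1" "dif A" as] by (simp add: sg_add)

lemma hD_scl: "hDM (\<lambda>bs. scl M c (f bs)) as = scl M c (hDM f as)"
  using hD_post[of UNIV f "\<lambda>_. scl M c" "A.tau 1" "dif A" as] by (simp add: scl_add[OF gspM])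

subsection \<open>The differentials preserve the Hochschild complex\<close>

lemma multilin_lam:
  assumes f: "multilin (scl A) (scl M) f" and C: "\<And>as. f as \<in> C"
  shows "multilin (scl A) (scl M) (lam n f)"
  unfolding multilin_def
proof (intro allI)
  fix as c x y bs
  show "lam n f (as @ (scl A c x + y) # bs) = scl M c (lam n f (as @ x # bs)) + lam n f (as @ y # bs)"
    using f[unfolded multilin_def]
    by (cases as) (simp_all add: C tw_add[OF A.gsp] tw_scl[OF A.gsp] lact_add_left lact_scl_left
        lact_add_right lact_scl_right CI)
qed

lemma multilin_hE:
  assumes f: "multilin (scl A) (scl M) f" and C: "\<And>as. f as \<in> C"
  shows "multilin (scl A) (scl M) (hEM f)"
  unfolding multilin_def
proof (intro allI)
  fix as c x y bs
  show "hEM f (as @ (scl A c x + y) # bs) = scl M c (hEM f (as @ x # bs)) + hEM f (as @ y # bs)"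
    using f C
  proof (induction as arbitrary: f)
    case Nil
    have 1: "hmu (mul A) (ract M) (scl A c x + y) f bs
        = scl M c (hmu (mul A) (ract M) x f bs) + hmu (mul A) (ract M) y f bs"
      by (cases bs) (simp_all add: ract_add_right ract_scl_right Nil(2) A.mul_add_left A.mul_scl_left
          multilin_lin_hd[OF Nil(1)])
    have "hEM (\<lambda>bs. f ((scl A c x + y) # bs)) bs = scl M c (hEM (\<lambda>bs. f (x # bs)) bs) + hEM (\<lambda>bs. f (y # bs)) bs"
      by (simp add: multilin_lin_hd[OF Nil(1)] R.hE_add hE_scl Nil(2) CI)
    then show ?case by (simp add: 1 scl_diff[OF gspM])
  next
    case (Cons a as)
    have "hmu (mul A) (ract M) a f (as @ (scl A c x + y) # bs)
        = scl M c (hmu (mul A) (ract M) a f (as @ x # bs)) + hmu (mul A) (ract M) a f (as @ y # bs)"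
    proof (cases as)
      case Nil
      then show ?thesis by (simp add: A.mul_add_right A.mul_scl_right multilin_lin_hd[OF Cons.prems(1)])
    next
      case (Cons a' as')
      then show ?thesis using \<open>multilin (scl A) (scl M) f\<close>[unfolded multilin_def] by (metis append_Cons hmu_simps(2))
    qed
    then show ?case using Cons.IH[OF multilin_tail[OF Cons.prems(1)]] Cons.prems(2)
      by (simp add: scl_diff[OF gspM])
  qed
qed

lemma multilin_hD:
  assumes f: "multilin (scl A) (scl M) f"
  shows "multilin (scl A) (scl M) (hDM f)"
  unfolding multilin_def
proof (intro allI)
  fix as c x y bs
  show "hDM f (as @ (scl A c x + y) # bs) = scl M c (hDM f (as @ x # bs)) + hDM f (as @ y # bs)"
    using f
  proof (induction as arbitrary: f)
    case Nil
    show ?case by (simp add: multilin_lin_hd[OF Nil(1)] A.dif_add A.dif_scl tw_add[OF A.gsp]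
        tw_scl[OF A.gsp] hD_add hD_scl scl_add[OF gspM])
  next
    case (Cons a as)
    have "f (dif A a # as @ (scl A c x + y) # bs) = scl M c (f (dif A a # as @ x # bs)) + f (dif A a # as @ y # bs)"
      using Cons.prems[unfolded multilin_def] by (metis append_Cons)
    then show ?case using Cons.IH[OF multilin_tail[OF Cons.prems]] by (simp add: scl_add[OF gspM])
  qed
qed

lemma has_deg_lam:
  assumes "has_deg (grd A) (grd M) n f" shows "has_deg (grd A) (grd M) (n + 1) (lam m f)"
  unfolding has_deg_def
proof (intro allI impI)
  fix k as assume "shdeg (grd A) k as"
  then show "lam m f as \<in> grd M (k + (n + 1))"
  proof cases
    case Nil then show ?thesis by (simp add: grd_0[OF gspM])
  next
    case (Cons a j k' bs)
    show ?thesis using lact_grd[OF tw_grd[OF A.gsp Cons(3)] has_degD[OF assms Cons(4)], of "m - int (length bs)"]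
      by (simp add: Cons algebra_simps)
  qed
qed

lemma has_deg_hE:
  assumes "has_deg (grd A) (grd M) n f" shows "has_deg (grd A) (grd M) (n + 1) (hEM f)"
  unfolding has_deg_def
proof (intro allI impI)
  fix k as assume "shdeg (grd A) k as"
  then show "hEM f as \<in> grd M (k + (n + 1))"
    using assms
  proof (induction arbitrary: f n)
    case Nil then show ?case by (simp add: grd_0[OF gspM])
  next
    case (Cons a m k as)
    have "hEM (\<lambda>bs. f (a # bs)) as \<in> grd M (k + m - 1 + (n + 1))"
      using Cons.IH[OF has_deg_tail[OF Cons.prems Cons.hyps(1)]] by (simp add: algebra_simps)
    moreover have "hmu (mul A) (ract M) a f as \<in> grd M (k + m - 1 + (n + 1))"
      using Cons.hyps(2)
    proof cases
      case Nil
      then show ?thesis using ract_grd[OF has_deg_Nil[OF Cons.prems] Cons.hyps(1)] by (simp add: algebra_simps)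
    next
      case (Cons b j k' bs)
      show ?thesis
        using has_degD[OF \<open>has_deg _ _ n f\<close> shdeg.Cons[where G = "grd A", OF A.mul_grd[OF \<open>a \<in> grd A m\<close> Cons(3)] Cons(4)]]
        by (simp add: Cons algebra_simps)
    qed
    ultimately show ?case by (simp add: grd_diff[OF gspM])
  qed
qed

lemma has_deg_hD:
  assumes "has_deg (grd A) (grd M) n f" shows "has_deg (grd A) (grd M) (n + 1) (hDM f)"
  unfolding has_deg_def
proof (intro allI impI)
  fix k as assume "shdeg (grd A) k as"
  then show "hDM f as \<in> grd M (k + (n + 1))"
    using assms
  proof (induction arbitrary: f n)
    case Nil then show ?case by (simp add: grd_0[OF gspM])
  next
    case (Cons a m k as)
    have "hDM (\<lambda>bs. f (A.tau 1 a # bs)) as \<in> grd M (k + m - 1 + (n + 1))"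
      using Cons.IH[OF has_deg_tail[OF Cons.prems tw_grd[OF A.gsp Cons.hyps(1)]]] by (simp add: algebra_simps)
    moreover have "f (dif A a # as) \<in> grd M (k + m - 1 + (n + 1))"
      using has_degD[OF Cons.prems shdeg.Cons[where G = "grd A", OF A.dif_grd[OF Cons.hyps(1)] Cons.hyps(2)]]
      by (simp add: algebra_simps)
    ultimately show ?case by (simp add: grd_add[OF gspM])
  qed
qed

lemma hoch_dH: assumes f: "hoch n f" shows "hoch (n + 1) (dH n f)"
proof -
  have C: "\<And>as. f as \<in> C" by (rule hoch_gtot[OF f])
  obtain P where P: "\<And>as. length as > P \<Longrightarrow> f as = 0" using f by (auto simp: hoch_def bounded_arity_def)
  have "lam n f as - hEM f as = 0" if "length as > P + 1" for as
  proof -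
    have "hEM f as = 0" by (rule R.hE_eq_0) (use that P in auto)
    moreover have "lam n f as = 0" using that P by (cases as) (auto simp: lact_0)
    ultimately show ?thesis by simp
  qed
  then have b: "bounded_arity (\<lambda>as. lam n f as - hEM f as)"
    unfolding bounded_arity_def by blast
  have ml: "multilin (scl A) (scl M) (\<lambda>as. lam n f as - hEM f as)"
    using multilin_lam[of f n] multilin_hE[of f] f C
    by (auto simp: multilin_def hoch_def scl_diff[OF gspM])
  have "has_deg (grd A) (grd M) (n + 1) (\<lambda>as. lam n f as - hEM f as)"
    using has_deg_lam[of n f n] has_deg_hE[of n f] f by (auto simp: hoch_def has_deg_def grd_diff[OF gspM])
  with b ml have "hoch (n + 1) (\<lambda>as. lam n f as - hEM f as)" by (simp add: hoch_def)
  from hoch_sg[OF this, of "n - 1"] show ?thesis by (simp add: dH_def[abs_def])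
qed

lemma hoch_del: assumes f: "hoch n f" shows "hoch (n + 1) (del n f)"
proof -
  have C: "\<And>as. f as \<in> C" by (rule hoch_gtot[OF f])
  obtain P where P: "\<And>as. length as > P \<Longrightarrow> f as = 0" using f by (auto simp: hoch_def bounded_arity_def)
  have "hDM f as = 0" if "length as > P" for as
    using that P by (auto intro!: hD_eq_0)
  then have "bounded_arity (hDM f)" unfolding bounded_arity_def by blast
  then have 1: "hoch (n + 1) (hDM f)"
    using multilin_hD[of f] has_deg_hD[of n f] f by (simp add: hoch_def)
  have "bounded_arity (\<lambda>as. dif M (f as))" unfolding bounded_arity_def using P difM_0 by (intro exI[of _ P]) auto
  moreover have "multilin (scl A) (scl M) (\<lambda>as. dif M (f as))"
    using f C by (auto simp: hoch_def multilin_def difM_add difM_scl CI)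
  moreover have "has_deg (grd A) (grd M) (n + 1) (\<lambda>as. dif M (f as))"
    unfolding has_deg_def
  proof (intro allI impI)
    fix k as assume "shdeg (grd A) k as"
    then have "f as \<in> grd M (k + n)" using f by (simp add: hoch_def has_deg_def)
    from difM_grd[OF this] show "dif M (f as) \<in> grd M (k + (n + 1))" by (simp add: algebra_simps)
  qed
  ultimately have "hoch (n + 1) (\<lambda>as. dif M (f as))" by (simp add: hoch_def)
  from hoch_diff[OF this hoch_sg[OF hoch_sg_length[OF 1], of n]]
  have "hoch (n + 1) (\<lambda>as. dif M (f as) - sg (n + int (length as)) (hDM f as))" by simp
  moreover have "(\<lambda>as. dif M (f as) - sg (n + int (length as)) (hDM f as)) = del n f"
    by (auto simp: del_def fun_eq_iff intro!: arg_cong2[where f = "(-)"] sg_parity)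
  ultimately show ?thesis by simp
qed

lemma hoch_dT: "hoch n f \<Longrightarrow> hoch (n + 1) (dT n f)"
  using hoch_add[OF hoch_dH hoch_del] by (simp add: dT_def[abs_def])

subsection \<open>The square of the differential\<close>

lemma lam_sg: "(\<And>as. f as \<in> C) \<Longrightarrow> lam n (\<lambda>bs. sg k (f bs)) as = sg k (lam n f as)"
  by (cases as) (simp_all add: lact_sg)

lemma lam_diff: "(\<And>as. f as \<in> C) \<Longrightarrow> (\<And>as. g as \<in> C) \<Longrightarrow>
    lam n (\<lambda>bs. f bs - g bs) as = lam n f as - lam n g as"
  by (cases as) (simp_all add: lact_diff)

text \<open>Merging the first two entries gives the left action by a product, which is the left
  action iterated; all other terms of \<open>hE\<close> commute with the left action.\<close>

lemma hE_lam:
  assumes C: "\<And>as. f as \<in> C"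
  shows "hEM (lam n f) as = lam (n + 1) (lam n f) as - lam (n + 1) (hEM f) as"
proof (cases as)
  case (Cons a as')
  have "hEM (\<lambda>bs. lact M (A.tau (n - int (length bs)) a) (f bs)) as'
      = lact M (A.tau (n - (int (length as') - 1)) a) (hEM f as')"
    by (rule R.hE_post[where T = "\<lambda>k. lact M (A.tau (n - k) a)"])
      (simp_all add: C lact_diff lact_ract)
  moreover have "hmu (mul A) (ract M) a (lam n f) as' = lam (n + 1) (lam n f) (a # as')"
    by (cases as') (simp_all add: ract_0 lact_0 A.tau_mul lact_mul C)
  ultimately show ?thesis by (simp add: Cons algebra_simps)
qed simp

text \<open>Write L for \<open>lam\<close> and E for \<open>hE\<close>. Up to sign the square is LL
  - LE - EL + EE, where EE = 0 and EL = LL - LE.\<close>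

lemma dH_dH:
  assumes C: "\<And>as. f as \<in> C"
  shows "dH (n + 1) (dH n f) as = 0"
proof -
  have "hEM (hEM f) as = 0" by (rule R.hE_hE) (simp_all add: A.mul_assoc ract_mul C)
  then show ?thesis
    by (simp add: dH_def[abs_def] lam_sg hE_sg lam_C R.hE_S C CI lam_diff R.hE_diff hE_lam)
qed

text \<open>Differentiating one entry twice gives 0. For two different entries the two orders
  cancel, because \<open>tau 1\<close> anticommutes with the differential.\<close>

lemma hD_hD:
  assumes "multilin (scl A) (scl M) f"
  shows "hDM (hDM f) as = 0"
  using assms
proof (induction as arbitrary: f)
  case (Cons a as)
  have "hDM (\<lambda>bs. f (A.tau 1 (dif A a) # bs)) as = - hDM (\<lambda>bs. f (dif A (A.tau 1 a) # bs)) as"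
    using hD_post[of UNIV "\<lambda>bs. f (dif A (A.tau 1 a) # bs)" "\<lambda>_ x. - x" "A.tau 1" "dif A" as]
    by (simp add: A.tau_dif multilin_minus_hd[OF Cons.prems] sg_def)
  then show ?case using Cons.IH[OF multilin_tail[OF Cons.prems], of "A.tau 1 (A.tau 1 a)"]
    by (simp add: A.dif_dif multilin_0_hd[OF Cons.prems] hD_add)
qed simp

lemma hD_sgl: "hDM (\<lambda>as. sg (n - int (length as)) (f as)) as = sg (n - int (length as)) (hDM f as)"
  using hD_post[of UNIV f "\<lambda>k. sg (n - k)" "A.tau 1" "dif A" as] by (simp add: sg_add)

lemma hD_dif: "(\<And>as. f as \<in> C) \<Longrightarrow> hDM (\<lambda>as. dif M (f as)) as = dif M (hDM f as)"
  using hD_post[of C f "\<lambda>_. dif M" "A.tau 1" "dif A" as] by (simp add: CI difM_add)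

lemma del_del:
  assumes ml: "multilin (scl A) (scl M) f" and C: "\<And>as. f as \<in> C"
  shows "del (n + 1) (del n f) as = 0"
  by (simp add: del_def[abs_def] hD_diff hD_dif hD_sgl C CI R.hD_S difM_diff difM_sg difM_difM
      hD_hD[OF ml] sg_diff) (simp add: sg_def)

text \<open>By the Leibniz rule \<open>hD\<close> passes through every merge. The only term of
  \<open>hD (hEM f)\<close> without a counterpart is the one where the last entry acts from the
  right and is itself differentiated.\<close>

lemma hD_hE:
  assumes "multilin (scl A) (scl M) f" "\<And>as. f as \<in> C"
  shows "hDM (hEM f) as - hEM (hDM f) as =
    (if as = [] then 0 else sg (int (length as) - 1) (ract M (f (map (A.tau 1) (butlast as))) (dif A (last as))))"
  using assms
proof (induction as arbitrary: f)
  case (Cons a as)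
  note ml = Cons.prems(1) and C = Cons.prems(2)
  have 1: "hDM (hEM f) (a # as) = hmu (mul A) (ract M) (dif A a) f as - hEM (\<lambda>bs. f (dif A a # bs)) as
      + hDM (hmu (mul A) (ract M) (A.tau 1 a) f) as - hDM (hEM (\<lambda>bs. f (A.tau 1 a # bs))) as"
    by (simp add: hD_diff)
  have 2: "hEM (hDM f) (a # as) = hmu (mul A) (ract M) a (hDM f) as - hEM (\<lambda>bs. f (dif A a # bs)) as
      - hEM (hDM (\<lambda>bs. f (A.tau 1 a # bs))) as"
    by (simp add: R.hE_add C R.hD_S)
  have 3: "hmu (mul A) (ract M) (dif A a) f as + hDM (hmu (mul A) (ract M) (A.tau 1 a) f) as
      - hmu (mul A) (ract M) a (hDM f) as = (if as = [] then ract M (f []) (dif A a) else 0)"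
    by (cases as) (simp_all add: ract_0 A.dif_mul A.tau_mul multilin_add_hd[OF ml])
  have IH: "hDM (hEM (\<lambda>bs. f (A.tau 1 a # bs))) as - hEM (hDM (\<lambda>bs. f (A.tau 1 a # bs))) as =
    (if as = [] then 0 else sg (int (length as) - 1)
      (ract M (f (map (A.tau 1) (a # butlast as))) (dif A (last as))))"
    using Cons.IH[OF multilin_tail[OF ml]] C by simp
  have "hDM (hEM f) (a # as) - hEM (hDM f) (a # as) =
      (if as = [] then ract M (f []) (dif A a) else 0) -
      (hDM (hEM (\<lambda>bs. f (A.tau 1 a # bs))) as - hEM (hDM (\<lambda>bs. f (A.tau 1 a # bs))) as)"
    unfolding 1 2 3[symmetric] by (simp add: algebra_simps)
  then show ?case unfolding IH by (auto simp: sg_def)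
qed simp

text \<open>The differential of M sees only the value of f, so the inner terms commute with it; the
  Leibniz rule for the right action leaves the derivative of the last entry as a defect.\<close>

lemma dif_hE:
  assumes "\<And>as. f as \<in> C"
  shows "dif M (hEM f as) - hEM (\<lambda>bs. dif M (f bs)) as =
    (if as = [] then 0 else sg (int (length as) - 1) (ract M (tw (grd M) 1 (f (butlast as))) (dif A (last as))))"
  using assms
proof (induction as arbitrary: f)
  case (Cons a as)
  note C = Cons.prems
  have 1: "dif M (hEM f (a # as)) = dif M (hmu (mul A) (ract M) a f as) - dif M (hEM (\<lambda>bs. f (a # bs)) as)"
    by (simp add: difM_diff R.hmu_S R.hE_S C)
  have 2: "dif M (hmu (mul A) (ract M) a f as) - hmu (mul A) (ract M) a (\<lambda>bs. dif M (f bs)) as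
      = (if as = [] then ract M (tw (grd M) 1 (f [])) (dif A a) else 0)"
    by (cases as) (simp_all add: dif_ract C)
  have IH: "dif M (hEM (\<lambda>bs. f (a # bs)) as) - hEM (\<lambda>bs. dif M (f (a # bs))) as =
    (if as = [] then 0 else sg (int (length as) - 1)
      (ract M (tw (grd M) 1 (f (a # butlast as))) (dif A (last as))))"
    using Cons.IH[of "\<lambda>bs. f (a # bs)"] C by simp
  have "dif M (hEM f (a # as)) - hEM (\<lambda>bs. dif M (f bs)) (a # as) =
     (if as = [] then ract M (tw (grd M) 1 (f [])) (dif A a) else 0) -
     (dif M (hEM (\<lambda>bs. f (a # bs)) as) - hEM (\<lambda>bs. dif M (f (a # bs))) as)"
    unfolding 1 2[symmetric] by (simp add: algebra_simps)
  then show ?case unfolding IH by (auto simp: sg_def)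
qed (simp add: difM_0)

text \<open>The defects in \<open>dif_hE\<close> and \<open>hD_hE\<close> are one and the same term,
  once \<open>hoch_map_tw\<close> moves the twist from the value of f to its arguments.\<close>

lemma del_hE:
  assumes f: "hoch n f"
  shows "del (n + 1) (hEM f) as = hEM (del n f) as"
proof -
  have ml: "multilin (scl A) (scl M) f" using f by (simp add: hoch_def)
  have C: "\<And>as. f as \<in> C" by (rule hoch_gtot[OF f])
  have "hEM (\<lambda>bs. sg (n - int (length bs)) (hDM f bs)) as = sg (n - (int (length as) - 1)) (hEM (hDM f) as)"
    by (rule R.hE_post[where T = "\<lambda>k. sg (n - k)"]) (simp_all add: R.hD_S C sg_diff ract_sg)
  then have 1: "hEM (del n f) as = hEM (\<lambda>bs. dif M (f bs)) as - sg (n - int (length as) + 1) (hEM (hDM f) as)"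
    by (simp add: del_def[abs_def] R.hE_diff C CI R.hD_S algebra_simps)
  have 2: "dif M (hEM f as) - hEM (\<lambda>bs. dif M (f bs)) as
      = sg (n - int (length as) + 1) (hDM (hEM f) as - hEM (hDM f) as)"
    unfolding dif_hE[of f as, OF C] hD_hE[OF ml C]
    by (auto simp: hoch_map_tw[OF f] ract_sg C intro!: sg_parity)
  show ?thesis unfolding 1 using 2 by (simp add: del_def sg_diff algebra_simps)
qed

text \<open>Differentiating the product of a with the value of f produces a term with the derivative
  of a, which the first summand of \<open>hD\<close> cancels.\<close>

lemma del_lam:
  assumes C: "\<And>as. f as \<in> C"
  shows "del (n + 1) (lam n f) as = lam (n + 1) (del n f) as"
proof (cases as)
  case (Cons a bs)
  let ?r = "n - int (length bs)"
  have "hDM (\<lambda>bs. lact M (A.tau (n - int (length bs)) (A.tau 1 a)) (f bs)) bs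
      = lact M (A.tau ?r (A.tau 1 a)) (hDM f bs)"
    by (rule hD_post[where S = C and T = "\<lambda>k. lact M (A.tau (n - k) (A.tau 1 a))"])
      (simp_all add: CI C lact_add_right)
  moreover have "A.tau 1 (A.tau ?r a) = A.tau ?r (A.tau 1 a)"
    by (simp add: tw_tw[OF A.gsp] add.commute)
  moreover have "A.tau (?r + 1) a = A.tau ?r (A.tau 1 a)" by (simp add: tw_tw[OF A.gsp])
  ultimately show ?thesis
    by (simp add: Cons del_def dif_lact C A.tau_dif lact_sg_left CI lact_diff lact_sg R.hD_S sg_add sg_even algebra_simps)
qed (simp add: del_def difM_0)

lemma del_sg: "(\<And>as. f as \<in> C) \<Longrightarrow> del n (\<lambda>bs. sg k (f bs)) as = sg k (del n f as)"
  by (simp add: del_def difM_sg hD_sg sg_diff add.commute)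

lemma del_diff: "(\<And>as. f as \<in> C) \<Longrightarrow> (\<And>as. g as \<in> C) \<Longrightarrow>
    del n (\<lambda>bs. f bs - g bs) as = del n f as - del n g as"
  by (simp add: del_def difM_diff hD_diff sg_diff)

text \<open>Since \<open>del\<close> commutes with both \<open>lam\<close> and \<open>hE\<close>,
  anticommutation comes entirely from the prefactor (-1)^(n - 1), which changes with the
  degree.\<close>

lemma dH_del:
  assumes f: "hoch n f"
  shows "del (n + 1) (dH n f) as + dH (n + 1) (del n f) as = 0"
proof -
  have C: "\<And>as. f as \<in> C" by (rule hoch_gtot[OF f])
  have "del (n + 1) (dH n f) as = sg (n - 1) (del (n + 1) (lam n f) as - del (n + 1) (hEM f) as)"
    by (simp add: dH_def[abs_def] del_sg del_diff CI lam_C R.hE_S C)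
  then show ?thesis unfolding del_hE[OF f] del_lam[of f n as, OF C] by (simp add: dH_def sg_def)
qed

lemma lam_add: "(\<And>as. f as \<in> C) \<Longrightarrow> (\<And>as. g as \<in> C) \<Longrightarrow>
    lam n (\<lambda>bs. f bs + g bs) as = lam n f as + lam n g as"
  by (cases as) (simp_all add: lact_add_right)

lemma dH_add: "(\<And>as. f as \<in> C) \<Longrightarrow> (\<And>as. g as \<in> C) \<Longrightarrow>
    dH n (\<lambda>bs. f bs + g bs) as = dH n f as + dH n g as"
  by (simp add: dH_def lam_add R.hE_add sg_diff sg_add)

lemma del_add: "(\<And>as. f as \<in> C) \<Longrightarrow> (\<And>as. g as \<in> C) \<Longrightarrow>
    del n (\<lambda>bs. f bs + g bs) as = del n f as + del n g as"
  by (simp add: del_def difM_add hD_add sg_add)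

lemma dT_add: "(\<And>as. f as \<in> C) \<Longrightarrow> (\<And>as. g as \<in> C) \<Longrightarrow>
    dT n (\<lambda>bs. f bs + g bs) as = dT n f as + dT n g as"
  by (simp add: dT_def dH_add del_add)

lemma dT_dT:
  assumes f: "hoch n f"
  shows "dT (n + 1) (dT n f) as = 0"
proof -
  have ml: "multilin (scl A) (scl M) f" using f by (simp add: hoch_def)
  have C: "\<And>as. f as \<in> C" by (rule hoch_gtot[OF f])
  have "dT (n + 1) (dT n f) as = dH (n + 1) (dH n f) as + dH (n + 1) (del n f) as
      + (del (n + 1) (dH n f) as + del (n + 1) (del n f) as)"
    unfolding dT_def[abs_def] by (simp add: dH_add del_add dH_C del_C C)
  moreover have "dH (n + 1) (del n f) as + del (n + 1) (dH n f) as = 0"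
    using dH_del[OF f, of as] by (subst add.commute)
  ultimately show ?thesis by (simp add: dH_dH C del_del[OF ml])
qed

end

subsection \<open>Comparison with the differential given by sums\<close>

lemma sg_Suc: "sg (1 + n) x = - sg n x"
  by (simp add: sg_def)

lemma contract_0 [simp]: "contract \<mu> 0 (a # b # as) = \<mu> a b # as"
  by (simp add: contract_def)

lemma contract_Suc [simp]: "contract \<mu> (Suc i) (a # as) = a # contract \<mu> i as"
  by (simp add: contract_def)

lemma hE_sum:
  "as \<noteq> [] \<Longrightarrow> hE \<mu> \<rho> f as = (\<Sum>i<length as - 1. sg (int i) (f (contract \<mu> i as)))
     + sg (int (length as) - 1) (\<rho> (f (butlast as)) (last as))"
proof (induction as arbitrary: f)
  case (Cons a as)
  show ?case
  proof (cases as)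
    case (Cons b bs)
    have "(\<Sum>i<length bs. sg (int (Suc i)) (f (a # contract \<mu> i as)))
        = - (\<Sum>i<length bs. sg (int i) (f (a # contract \<mu> i as)))"
      by (simp add: sg_Suc sum_negf)
    moreover have "sg (int (length bs)) x = - sg (1 + int (length bs)) x" for x :: 'b
      by (simp add: sg_Suc)
    ultimately show ?thesis using Cons.IH[of "\<lambda>bs. f (a # bs)"]
      by (simp add: Cons sum.lessThan_Suc_shift sg_Suc del: sum.lessThan_Suc)
  qed simp
qed simp

lemma hD_sum: "hD t d f as = (\<Sum>i<length as. f (map t (take i as) @ d (as ! i) # drop (i + 1) as))"
  by (induction as arbitrary: f) (simp_all add: sum.lessThan_Suc_shift del: sum.lessThan_Suc)

context hoch_coeff
begin

lemma dH_sum: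
  assumes C: "\<And>as. f as \<in> C"
  shows "(case length as of 0 \<Rightarrow> 0 | Suc p \<Rightarrow> hoch_dH_pr A M p (n - int p) (arity_part p f) as) = dH n f as"
proof (cases as)
  case (Cons a bs)
  let ?p = "length bs"
  have 1: "lext (grd A) (\<lambda>m a. sg (n - 1 + (n - int ?p) * m) (lact M a (f bs))) a
      = sg (n - 1) (lact M (A.tau (n - int ?p) a) (f bs))"
    using lext_tw[OF A.gsp A.tot, of "\<lambda>a. lact M a (f bs)" "n - int ?p" "n - 1" a]
    by (simp add: lact_add_left C add.commute)
  have "(\<Sum>i<?p. sg (n + int i) (f (contract (mul A) i as))) + sg (n - int ?p) (ract M (f (butlast as)) (last as))
      = - sg (n - 1) (hEM f as)"
  proof -
    have "(\<Sum>i<?p. sg (n + int i) (f (contract (mul A) i as))) = - sg (n - 1) (\<Sum>i<?p. sg (int i) (f (contract (mul A) i as)))"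
      unfolding sg_sum sum_negf[symmetric] by (rule sum.cong) (simp_all add: sg_def)
    moreover have "sg (n - int ?p) (ract M (f (butlast as)) (last as))
        = - sg (n - 1) (sg (int ?p) (ract M (f (butlast as)) (last as)))"
      by (simp add: sg_def)
    ultimately show ?thesis using hE_sum[of as "mul A" "ract M" f] by (simp add: Cons sg_add)
  qed
  moreover have "arity_part ?p f (contract (mul A) i as) = f (contract (mul A) i as)" if "i < ?p" for i
    using that by (auto simp: arity_part_def contract_def Cons min_def)
  moreover have "arity_part ?p f (butlast as) = f (butlast as)" "arity_part ?p f bs = f bs"
    by (simp_all add: arity_part_def Cons)
  ultimately have "hoch_dH_pr A M ?p (n - int ?p) (arity_part ?p f) as
      = sg (n - 1) (lact M (A.tau (n - int ?p) a) (f bs)) + - sg (n - 1) (hEM f as)"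
    unfolding hoch_dH_pr_def using 1 by (simp add: Cons add.assoc del: butlast.simps last.simps hE.simps)
  then show ?thesis by (simp add: Cons dH_def sg_diff)
qed (simp add: dH_def)

lemma del_sum:
  "hoch_del_pr A M (length as) (n - int (length as)) (arity_part (length as) f) as = del n f as"
proof -
  have "(\<Sum>i<length as. arity_part (length as) f (map (A.tau 1) (take i as) @ dif A (as ! i) # drop (i + 1) as))
      = hDM f as"
    unfolding hD_sum by (rule sum.cong) (auto simp: arity_part_def)
  moreover have "arity_part (length as) f as = f as" by (simp add: arity_part_def)
  ultimately show ?thesis unfolding hoch_del_pr_def del_def by (simp only: simp_thms if_True)
qed

lemma
  assumes f: "hoch n f"
  shows hoch_dH_eq: "hoch_dH A M f = dH n f"
    and hoch_del_eq: "hoch_del A M f = del n f"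
proof -
  \<comment> \<open>Evaluating \<open>lext\<close> at a homogeneous cochain involves only the graded
    linear structure, so no differential has to be specified.\<close>
  let ?V = "\<lparr>scl = (\<lambda>c f as. scl M c (f as)), grd = hoch_deg A M, dif = undefined\<rparr>"
  have V: "graded_space ?V" by (rule graded_space_hoch) simp_all
  have f': "f \<in> grd ?V n" using f by (simp add: hoch_deg_iff)
  have C: "\<And>as. f as \<in> C" by (rule hoch_gtot[OF f])
  have "hoch_dH A M f = (\<lambda>as. case length as of 0 \<Rightarrow> 0 | Suc p \<Rightarrow> hoch_dH_pr A M p (n - int p) (arity_part p f) as)"
    unfolding hoch_dH_def
  proof (rule lext_homogeneous[OF V f', unfolded dgspace.simps])
    have "(\<lambda>as. dH n 0 as) = 0"
    proof
      fix as
      have "hEM 0 as = 0" by (rule R.hE_eq_0) simp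
      then show "dH n 0 as = 0 as" by (cases as) (simp_all add: dH_def lact_0)
    qed
    then show "(\<lambda>as. case length as of 0 \<Rightarrow> 0 | Suc p \<Rightarrow> hoch_dH_pr A M p (n - int p) (arity_part p 0) as) = 0"
      by (subst dH_sum) (simp_all add: gtot_0[OF gspM])
  qed
  then show "hoch_dH A M f = dH n f" by (simp add: dH_sum C)
  have "hoch_del A M f = (\<lambda>as. hoch_del_pr A M (length as) (n - int (length as)) (arity_part (length as) f) as)"
    unfolding hoch_del_def
  proof (rule lext_homogeneous[OF V f', unfolded dgspace.simps])
    have "(\<lambda>as. del n 0 as) = 0"
      by (rule ext) (simp add: del_def difM_0 hD_eq_0)
    then show "(\<lambda>as. hoch_del_pr A M (length as) (n - int (length as)) (arity_part (length as) 0) as) = 0"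
      by (subst del_sum) simp
  qed
  then show "hoch_del A M f = del n f" by (simp add: del_sum)
qed

section \<open>The perturbed contracting homotopy\<close>

lemma hoch_comp:
  assumes h: "lin_deg M M r h" and f: "hoch n f"
  shows "hoch (n + r) (h \<circ> f)"
proof -
  have C: "\<And>as. f as \<in> C" by (rule hoch_gtot[OF f])
  have "h 0 = 0" by (rule additive_0[OF gspM lin_degD(1)[OF h]])
  then have "bounded_arity (h \<circ> f)"
    using f unfolding hoch_def bounded_arity_def by (metis comp_apply)
  moreover have "multilin (scl A) (scl M) (h \<circ> f)"
    unfolding multilin_def
  proof (intro allI)
    fix as c x y bs
    have "f (as @ (scl A c x + y) # bs) = scl M c (f (as @ x # bs)) + f (as @ y # bs)"
      using f by (simp add: hoch_def multilin_def)
    then show "(h \<circ> f) (as @ (scl A c x + y) # bs) = scl M c ((h \<circ> f) (as @ x # bs)) + (h \<circ> f) (as @ y # bs)"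
      by (simp add: lin_degD(1)[OF h gtot_scl[OF gspM C] C] lin_degD(2)[OF h C])
  qed
  moreover have "has_deg (grd A) (grd M) (n + r) (h \<circ> f)"
    unfolding has_deg_def
  proof (intro allI impI)
    fix k as assume "shdeg (grd A) k as"
    then have "f as \<in> grd M (k + n)" using f by (simp add: hoch_def has_deg_def)
    from lin_degD(3)[OF h this] show "(h \<circ> f) as \<in> grd M (k + (n + r))" by (simp add: algebra_simps)
  qed
  ultimately show ?thesis by (simp add: hoch_def)
qed

text \<open>Composition with h lowers the degree by one and so flips the sign in front of
  \<open>hD\<close>; those parts cancel and the homotopy identity of M is left.\<close>

lemma del_homotopy:
  assumes h: "contracting_homotopy M h" and C: "\<And>as. f as \<in> C"
  shows "del (n - 1) (h \<circ> f) as + h (del n f as) = f as"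
proof -
  have l: "lin_deg M M (-1) h" using h by (simp add: contracting_homotopy_def)
  note hC = lin_deg_gtot[OF gspM gspM l]
  note hs = lin_degD(1)[OF l]
  have 1: "hDM (h \<circ> f) as = h (hDM f as)"
    using hD_post[of C f "\<lambda>_. h" "A.tau 1" "dif A" as] by (simp add: CI C hs comp_def)
  have 2: "h (del n f as) = h (dif M (f as)) - sg (n - int (length as)) (h (hDM f as))"
    by (simp add: del_def additive_diff[OF gspM hs] additive_sg[OF gspM hs] CI C R.hD_S)
  have "dif M (h (f as)) + h (dif M (f as)) = f as"
    using h C by (simp add: contracting_homotopy_def)
  moreover have "del (n - 1) (h \<circ> f) as = dif M (h (f as)) - sg (n - 1 - int (length as)) (h (hDM f as))"
    by (simp add: del_def 1)
  ultimately show ?thesis unfolding 2 by (simp add: sg_def)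
qed

lemma dH_0: "dH n (\<lambda>_. 0) as = 0"
proof -
  have "hEM (\<lambda>_. 0) as = 0" by (rule R.hE_eq_0) simp
  then show ?thesis by (cases as) (simp_all add: dH_def lact_0)
qed

lemma dH_sg: "(\<And>as. f as \<in> C) \<Longrightarrow> dH n (\<lambda>bs. sg k (f bs)) as = sg k (dH n f as)"
  by (simp add: dH_def lam_sg hE_sg sg_diff add.commute)

lemma dH_diff: "(\<And>as. f as \<in> C) \<Longrightarrow> (\<And>as. g as \<in> C) \<Longrightarrow>
    dH n (\<lambda>bs. f bs - g bs) as = dH n f as - dH n g as"
  by (simp add: dH_def lam_diff R.hE_diff sg_diff)

lemma dT_diff: "(\<And>as. f as \<in> C) \<Longrightarrow> (\<And>as. g as \<in> C) \<Longrightarrow>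
    dT n (\<lambda>bs. f bs - g bs) as = dT n f as - dT n g as"
  by (simp add: dT_def dH_diff del_diff)

lemma dT_sg: "(\<And>as. f as \<in> C) \<Longrightarrow> dT n (\<lambda>bs. sg k (f bs)) as = sg k (dT n f as)"
  by (simp add: dT_def dH_sg del_sg sg_add)

lemma dT_0: "dT n (\<lambda>_. 0) as = 0"
  by (simp add: dT_def dH_0 del_def difM_0 hD_eq_0)

text \<open>
  With \<open>w = \<Sum> (-1)\<^sup>k hk k z\<close> the cocycle \<open>y = z - D w\<close> satisfies \<open>y = - h \<circ> dH y\<close>; iterating, \<open>y\<close>
  is up to sign \<open>hk k (dH y)\<close> for every \<open>k\<close>, so it vanishes by nilpotency.
\<close>

lemma pointwisely_nilpotent_exact:
  assumes nil: "pointwisely_nilpotent A M" and z: "hoch n z" and dz: "\<And>as. dT n z as = 0"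
  shows "\<exists>w. hoch (n - 1) w \<and> (\<forall>as. dT (n - 1) w as = z as)"
proof -
  obtain h where h: "contracting_homotopy M h"
    and ex: "\<And>f. f \<in> gtot (hoch_deg A M) \<Longrightarrow> \<exists>N. \<forall>k>N. hk A M h k f = 0"
    using nil by (auto simp: pointwisely_nilpotent_def)
  have l: "lin_deg M M (-1) h" using h by (simp add: contracting_homotopy_def)
  note hadd = lin_degD(1)[OF l]
  note h0 = additive_0[OF gspM hadd] and hdiff = additive_diff[OF gspM hadd]
    and hsg = additive_sg[OF gspM hadd] and hminus = additive_minus[OF gspM hadd]
  let ?V = "\<lparr>scl = (\<lambda>c f as. scl M c (f as)), grd = hoch_deg A M, dif = undefined\<rparr>"
  have V: "graded_space ?V" by (rule graded_space_hoch) simp_all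
  have tot: "f \<in> gtot (hoch_deg A M)" if "hoch m f" for m f
    using grd_gtot[OF V, of f m] that by (simp add: hoch_deg_iff)
  have hk0: "hk A M h 0 f = h \<circ> f" for f by (simp add: hk_def)
  have hkS: "hk A M h (Suc k) f = h \<circ> hoch_dH A M (hk A M h k f)" for k f by (simp add: hk_def)
  have hkd: "hoch (m - 1) (hk A M h k f)" if "hoch m f" for m k f
  proof (induction k)
    case 0 show ?case using hoch_comp[OF l that] by (simp add: hk0 comp_def)
  next
    case (Suc k)
    show ?case using hoch_comp[OF l hoch_dH[OF Suc]] by (simp add: hkS hoch_dH_eq[OF Suc] comp_def)
  qed
  let ?q = "\<lambda>k. hk A M h k z"
  obtain N where N: "\<And>k. k > N \<Longrightarrow> ?q k = 0" using ex[OF tot[OF z]] by blast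
  \<comment> \<open>Partial sums of the geometric series for the inverse of 1 + h dH, applied to h
    z.\<close>
  define w where "w = (\<lambda>K as. \<Sum>k<K. sg (int k) (?q k as))"
  have w0: "w 0 = (\<lambda>_. 0)" by (simp add: w_def)
  have wS: "w (Suc K) = (\<lambda>as. w K as + sg (int K) (?q K as))" for K by (simp add: w_def)
  have wd: "hoch (n - 1) (w K)" for K
    by (induction K) (auto simp: w0 wS hoch_zero intro!: hoch_add hoch_sg hkd[OF z])
  note wC = hoch_gtot[OF wd] and qC = hoch_gtot[OF hkd[OF z]]
  \<comment> \<open>Telescoping: h after dH carries each term of the series to the next one, and the
    signs alternate.\<close>
  have tel: "w (Suc K) as + h (dH (n - 1) (w K) as) = h (z as)" for K as
  proof (induction K)
    case 0
    show ?case by (simp add: wS w0 dH_0 h0 hk0)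
  next
    case (Suc K)
    have "dH (n - 1) (w (Suc K)) as = dH (n - 1) (w K) as + sg (int K) (dH (n - 1) (?q K) as)"
      unfolding wS[of K] by (simp add: dH_add wC qC CI dH_sg)
    then have "h (dH (n - 1) (w (Suc K)) as) = h (dH (n - 1) (w K) as) + sg (int K) (?q (Suc K) as)"
      by (simp add: hadd hsg CI dH_C wC qC hkS hoch_dH_eq[OF hkd[OF z]])
    then show ?case using Suc by (simp add: wS[of "Suc K"]) (simp add: sg_def)
  qed
  \<comment> \<open>All terms with index above N vanish, so one further summand changes nothing and
    W solves the telescoped equation exactly.\<close>
  define W where "W = w (Suc N)"
  have Wd: "hoch (n - 1) W" by (simp add: W_def wd)
  note WC = hoch_gtot[OF Wd] and zC = hoch_gtot[OF z]
  have W: "W as + h (dH (n - 1) W as) = h (z as)" for as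
    using tel[of "Suc N" as] N[of "Suc N"] by (simp add: W_def wS[of "Suc N"])
  define y where "y = (\<lambda>as. z as - dT (n - 1) W as)"
  have yd: "hoch n y" unfolding y_def using hoch_diff[OF z] hoch_dT[OF Wd] by simp
  note yC = hoch_gtot[OF yd]
  have dTC: "dT (n - 1) W as \<in> C" for as using hoch_gtot[OF hoch_dT[OF Wd]] by simp
  have dy: "dT n y as = 0" for as
    unfolding y_def using dT_dT[OF Wd, of as] by (simp add: dT_diff zC dTC dz)
  \<comment> \<open>By the equation for W, h y equals W - h (del W), which the homotopy identity
    turns into a boundary for \<open>del\<close>; hence h y is closed for
    \<open>del\<close>.\<close>
  have hy: "h (y as) = del (n - 1 - 1) (h \<circ> W) as" for as
  proof -
    have "h (y as) = h (z as) - (h (dH (n - 1) W as) + h (del (n - 1) W as))"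
      unfolding y_def by (simp add: dT_def hdiff hadd zC dH_C del_C WC CI)
    also have "\<dots> = W as - h (del (n - 1) W as)" using W[of as] by (simp add: algebra_simps)
    also have "\<dots> = del (n - 1 - 1) (h \<circ> W) as" using del_homotopy[OF h, of W "n - 1" as, symmetric] WC
      by (simp only: diff_eq_eq)
    finally show ?thesis .
  qed
  have hyD: "del (n - 1) (h \<circ> y) as = 0" for as
  proof -
    have hW: "hoch (n - 1 - 1) (h \<circ> W)" using hoch_comp[OF l Wd] by simp
    then have "multilin (scl A) (scl M) (h \<circ> W)" by (simp add: hoch_def)
    from del_del[OF this, of "n - 1 - 1" as] show ?thesis
      using hoch_gtot[OF hW] by (simp add: comp_def hy)
  qed
  \<comment> \<open>The homotopy identity gives y = h (del y), because h y is closed for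
    \<open>del\<close>; and del y = - dH y, because y is a cocycle.\<close>
  have y: "y as = - h (dH n y as)" for as
  proof -
    have "del n y as = - dH n y as" using dy[of as] by (simp add: dT_def eq_neg_iff_add_eq_0 add.commute)
    then have "h (del n y as) = - h (dH n y as)" by (simp add: hminus dH_C yC)
    then show ?thesis using del_homotopy[OF h, of y n as] yC hyD[of as] by simp
  qed
  have hH: "h (dH n y as) = - y as" for as using y[of as] by simp
  have hyk: "hk A M h k (dH n y) = (\<lambda>as. sg (int k + 1) (y as))" for k
  proof (induction k)
    case 0
    show ?case by (auto simp: hk0 hH sg_def)
  next
    case (Suc k)
    have "hoch n (\<lambda>as. sg (int k + 1) (y as))" by (rule hoch_sg[OF yd])
    from hoch_dH_eq[OF this] have "hk A M h (Suc k) (dH n y) = (\<lambda>as. sg (int k + 1) (h (dH n y as)))"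
      by (auto simp: hkS Suc dH_sg yC hsg dH_C)
    then show ?case by (auto simp: hH sg_def)
  qed
  \<comment> \<open>Nilpotency enters a second time, now for \<open>dH n y\<close>: for z it made
    the series finite, here it removes the error y.\<close>
  obtain K where K: "\<And>k. k > K \<Longrightarrow> hk A M h k (dH n y) = 0"
    using ex[OF tot[OF hoch_dH[OF yd]]] by blast
  have "y as = 0" for as
    using fun_cong[OF K[of "Suc K", unfolded hyk], of as] by simp
  then have "dT (n - 1) W as = z as" for as by (simp add: y_def)
  with Wd show ?thesis by blast
qed

end

section \<open>Mapping cones\<close>

text \<open>The twist of the left action compensates the sign of the differential of M in the left
  Leibniz rule. On the right the shift of degrees by one already does so.\<close>

lemma dg_bimodule_mapping_cone:
  assumes M: "dg_bimod A B M" and N: "dg_bimod A B N" and mor: "bimod_mor M N \<phi>"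
  shows "dg_bimod A B (mapping_cone A \<phi> M N)"
proof -
  interpret M: dg_bimod A B M by (rule M)
  interpret N: dg_bimod A B N by (rule N)
  let ?K = "mapping_cone A \<phi> M N"
  have lin: "lin_deg M N 0 \<phi>"
    and cd: "\<And>m. m \<in> M.C \<Longrightarrow> \<phi> (dif M m) = dif N (\<phi> m)"
    and cl: "\<And>a m. m \<in> M.C \<Longrightarrow> \<phi> (lact M a m) = lact N a (\<phi> m)"
    and cr: "\<And>b m. m \<in> M.C \<Longrightarrow> \<phi> (ract M m b) = ract N (\<phi> m) b"
    using mor by (auto simp: bimod_mor_def)
  note ph = lin_degD[OF lin]
  note phC = lin_deg_gtot[OF M.gspM N.gspM lin]
  note phsg = additive_sg[OF M.gspM ph(1)] and phm = additive_minus[OF M.gspM ph(1)]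
  have K: "graded_space ?K" "gtot (grd ?K) = M.C \<times> N.C"
    by (rule graded_space_prod[OF M.gspM N.gspM, where s = 1]; simp add: mapping_cone_def)+
  have g: "(m, n) \<in> grd ?K k \<longleftrightarrow> m \<in> grd M (k + 1) \<and> n \<in> grd N k" for m n k
    by (simp add: mapping_cone_def)
  have d: "dif ?K (m, n) = (- dif M m, \<phi> m + dif N n)"
    and s: "scl ?K c (m, n) = (scl M c m, scl N c n)"
    and la: "lact ?K a (m, n) = (lact M (M.A.tau 1 a) m, lact N a n)"
    and ra: "ract ?K (m, n) b = (ract M m b, ract N n b)" for m n a b c
    by (simp_all add: mapping_cone_def)
  note gC = grd_gtot[OF M.gspM] grd_gtot[OF N.gspM]
  have "dg_space ?K"
    unfolding dg_space_def lin_deg_def K(2)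
  proof (intro conjI ballI allI)
    show "graded_space ?K" by (rule K(1))
    fix x assume x: "x \<in> M.C \<times> N.C"
    show "dif ?K (dif ?K x) = 0"
      using x by (auto simp: d M.difM_difM N.difM_difM cd M.difM_minus
        phm M.CI N.CI phC N.difM_add zero_prod_def)
    show "dif ?K (scl ?K c x) = scl ?K c (dif ?K x)" for c
      using x by (auto simp: d s M.difM_scl N.difM_scl ph phC N.CI scl_add[OF N.gspM] scl_minus[OF M.gspM])
    fix y assume "y \<in> M.C \<times> N.C"
    then show "dif ?K (x + y) = dif ?K x + dif ?K y"
      using x by (auto simp: d M.difM_add N.difM_add ph algebra_simps)
  next
    fix n x assume "x \<in> grd ?K n"
    then show "dif ?K x \<in> grd ?K (n + 1)"
      using M.difM_grd N.difM_grd ph(3)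
      by (cases x) (fastforce simp: d g intro: grd_minus[OF M.gspM] grd_add[OF N.gspM])
  qed
  moreover have "bilin_deg A ?K ?K (lact ?K)"
    unfolding bilin_deg_def K(2) M.A.tot_eq
    using M.lact_grd[OF tw_grd[OF M.A.gsp]] N.lact_grd
    by (auto simp: la s g tw_add[OF M.A.gsp] tw_scl[OF M.A.gsp] M.lact_add_left N.lact_add_left
      M.lact_add_right N.lact_add_right M.lact_scl_left N.lact_scl_left M.lact_scl_right N.lact_scl_right
      add.assoc)
  moreover have "bilin_deg ?K B ?K (ract ?K)"
    unfolding bilin_deg_def K(2) M.B.tot_eq
  proof (intro conjI allI ballI)
    fix i j x b assume "x \<in> grd ?K i" "b \<in> grd B j"
    then show "ract ?K x b \<in> grd ?K (i + j)"
      using M.ract_grd[of "fst x" "i + 1" b j] N.ract_grd[of "snd x" i b j]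
      by (cases x) (simp add: g ra algebra_simps)
  qed (auto simp: ra s M.ract_add_left N.ract_add_left M.ract_add_right N.ract_add_right
      M.ract_scl_left N.ract_scl_left M.ract_scl_right N.ract_scl_right)
  moreover have "lact ?K (mul A a a') m = lact ?K a (lact ?K a' m)"
    "ract ?K m (mul B b b') = ract ?K (ract ?K m b) b'"
    "ract ?K (lact ?K a m) b = lact ?K a (ract ?K m b)" if "m \<in> gtot (grd ?K)" for a a' b b' m
    using that unfolding K(2) by (auto simp: la ra M.A.tau_mul M.lact_mul N.lact_mul M.ract_mul
      N.ract_mul M.lact_ract N.lact_ract)
  moreover have "dif ?K (lact ?K a m) = lact ?K (dif A a) m + sg n (lact ?K a (dif ?K m))"
    if ha: "a \<in> grd A n" and hm: "m \<in> gtot (grd ?K)" for a n m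
  proof -
    obtain x y where m: "m = (x, y)" "x \<in> M.C" "y \<in> N.C" using hm unfolding K(2) by auto
    have t: "M.A.tau 1 a = sg n a" using tw_hom[OF M.A.gsp ha, of 1] by simp
    have "dif M (lact M (sg n a) x) = sg n (lact M (dif A a) x) + lact M a (dif M x)"
      using M.dif_lact[OF m(2), of "sg n a"] m(2) t
      by (simp add: M.A.dif_sg M.lact_sg_left M.CI tw_sg[OF M.A.gsp] t sg_even)
    moreover have "lact M (M.A.tau 1 (dif A a)) x = - sg n (lact M (dif A a) x)"
      using m(2) by (simp add: M.A.tau_dif t M.A.dif_sg M.lact_sg_left sg_Suc
        M.lact_minus_left)
    moreover have "sg n (lact M (sg n a) (- dif M x)) = - lact M a (dif M x)"
      using m(2) by (simp add: M.lact_sg_left M.CI M.lact_minus sg_even sg_minus)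
    moreover have "\<phi> (lact M (sg n a) x) = sg n (lact N a (\<phi> x))"
      using m(2) by (simp add: cl phC N.lact_sg_left)
    moreover have "dif N (lact N a y) = lact N (dif A a) y + sg n (lact N a (dif N y))"
      using N.dif_lact[OF m(3), of a] m(3) t by (simp add: N.lact_sg_left N.CI)
    ultimately show ?thesis using m
      by (simp add: la d sg_pair t N.lact_add_right phC N.CI sg_add algebra_simps)
  qed
  moreover have "dif ?K (ract ?K m b) = ract ?K (dif ?K m) b + sg n (ract ?K m (dif B b))"
    if hm: "m \<in> grd ?K n" for b n m
  proof -
    obtain x y where m: "m = (x, y)" "x \<in> grd M (n + 1)" "y \<in> grd N n"
      using hm by (cases m) (simp add: g)
    have C: "x \<in> M.C" "y \<in> N.C" using m gC by auto
    have "dif M (ract M x b) = ract M (dif M x) b - sg n (ract M x (dif B b))"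
      using M.dif_ract[OF C(1), of b] C tw_hom[OF M.gspM m(2), of 1]
      by (simp add: M.ract_sg add.commute[of n 1] sg_Suc M.ract_minus M.CI)
    moreover have "dif N (ract N y b) = ract N (dif N y) b + sg n (ract N y (dif B b))"
      using N.dif_ract[OF C(2), of b] C tw_hom[OF N.gspM m(3), of 1] by (simp add: N.ract_sg)
    ultimately show ?thesis using m(1) C
      by (simp add: ra d sg_pair cr phC M.CI N.CI N.ract_add_left M.ract_minus)
  qed
  ultimately have "dg_bimodule A B ?K" unfolding dg_bimodule_def by blast
  then show ?thesis by unfold_locales
qed

locale hoch_morphism = M: hoch_coeff A M + N: hoch_coeff A N
  for A :: "('k::field, 'a::ab_group_add) dgalg" and M :: "('k, 'm::ab_group_add, 'a, 'a) bimod"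
    and N :: "('k, 'n::ab_group_add, 'a, 'a) bimod" +
  fixes \<phi> :: "'m \<Rightarrow> 'n"
  assumes mor: "bimod_mor M N \<phi>"
begin

lemma
  shows lin: "lin_deg M N 0 \<phi>"
    and mor_dif: "\<And>m. m \<in> M.C \<Longrightarrow> \<phi> (dif M m) = dif N (\<phi> m)"
    and mor_lact: "\<And>a m. m \<in> M.C \<Longrightarrow> \<phi> (lact M a m) = lact N a (\<phi> m)"
    and mor_ract: "\<And>b m. m \<in> M.C \<Longrightarrow> \<phi> (ract M m b) = ract N (\<phi> m) b"
  using mor by (auto simp: bimod_mor_def)

lemmas mor_add = lin_degD(1)[OF lin]
lemmas mor_diff = additive_diff[OF M.gspM mor_add]
  and mor_sg = additive_sg[OF M.gspM mor_add]
  and mor_0 = additive_0[OF M.gspM mor_add]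

lemma hoch_mor: "M.hoch n f \<Longrightarrow> N.hoch n (\<lambda>as. \<phi> (f as))"
proof -
  assume f: "M.hoch n f"
  note C = M.hoch_gtot[OF f]
  have "bounded_arity (\<lambda>as. \<phi> (f as))"
    using f mor_0 unfolding M.hoch_def bounded_arity_def by metis
  moreover have "multilin (scl A) (scl N) (\<lambda>as. \<phi> (f as))"
    unfolding multilin_def
  proof (intro allI)
    fix as c x y bs
    have "f (as @ (scl A c x + y) # bs) = scl M c (f (as @ x # bs)) + f (as @ y # bs)"
      using f by (simp add: M.hoch_def multilin_def)
    then show "\<phi> (f (as @ (scl A c x + y) # bs)) = scl N c (\<phi> (f (as @ x # bs))) + \<phi> (f (as @ y # bs))"
      by (simp add: mor_add[OF gtot_scl[OF M.gspM C] C] lin_degD(2)[OF lin C])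
  qed
  moreover have "has_deg (grd A) (grd N) n (\<lambda>as. \<phi> (f as))"
    using f lin_degD(3)[OF lin] by (fastforce simp: M.hoch_def has_deg_def)
  ultimately show ?thesis by (simp add: N.hoch_def)
qed

lemma dT_mor:
  assumes C: "\<And>as. f as \<in> M.C"
  shows "N.dT n (\<lambda>as. \<phi> (f as)) as = \<phi> (M.dT n f as)"
proof -
  have "N.hEM (\<lambda>as. \<phi> (f as)) as = \<phi> (M.hEM f as)"
    using M.R.hE_post[of f "\<lambda>_. \<phi>" "ract N" "mul A" as] by (simp add: C mor_diff mor_ract)
  moreover have "N.hDM (\<lambda>as. \<phi> (f as)) as = \<phi> (M.hDM f as)"
    using hD_post[of M.C f "\<lambda>_. \<phi>" "M.A.tau 1" "dif A" as] by (simp add: C mor_add M.CI)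
  moreover have "N.lam n (\<lambda>as. \<phi> (f as)) as = \<phi> (M.lam n f as)"
    by (cases as) (simp_all add: mor_lact C mor_0)
  ultimately show ?thesis
    by (simp add: N.dT_def M.dT_def N.dH_def M.dH_def N.del_def M.del_def mor_add mor_diff mor_sg
      mor_dif C M.CI M.lam_C M.R.hE_S M.R.hD_S)
qed

text \<open>Acyclicity of the cone of Hoch(A,M) -> Hoch(A,N) in terms of pairs. The hypotheses say
  that (u, -v) is a cocycle with values in the mapping cone, of degree n - 1 there; u' and v' come
  from the two components of a primitive.\<close>

lemma cone_exact:
  assumes nil: "pointwisely_nilpotent A (mapping_cone A \<phi> M N)"
    and u: "M.hoch n u" "\<And>as. M.dT n u as = 0"
    and v: "N.hoch (n - 1) v" "\<And>as. \<phi> (u as) = N.dT (n - 1) v as"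
  shows "\<exists>u' v'. M.hoch (n - 1) u' \<and> N.hoch (n - 2) v' \<and> (\<forall>as. M.dT (n - 1) u' as = u as) \<and>
    (\<forall>as. \<phi> (u' as) = v as + N.dT (n - 2) v' as)"
proof -
  let ?K = "mapping_cone A \<phi> M N"
  interpret K: dg_bimod A A ?K
    by (rule dg_bimodule_mapping_cone[OF M.dg_bimod_axioms N.dg_bimod_axioms mor])
  interpret K: hoch_coeff A ?K ..
  have KC: "K.C = M.C \<times> N.C"
    by (rule graded_space_prod[OF M.gspM N.gspM, where s = 1]; simp add: mapping_cone_def)+
  have hK: "K.hoch m z \<longleftrightarrow> M.hoch (m + 1) (\<lambda>as. fst (z as)) \<and> N.hoch m (\<lambda>as. snd (z as))" for m z
  proof -
    have "multilin (scl A) (scl ?K) z \<longleftrightarrow> multilin (scl A) (scl M) (\<lambda>as. fst (z as)) \<and>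
        multilin (scl A) (scl N) (\<lambda>as. snd (z as))"
      by (auto simp: multilin_def mapping_cone_def prod_eq_iff split: prod.splits)
    moreover have "has_deg (grd A) (grd ?K) m z \<longleftrightarrow> has_deg (grd A) (grd M) (m + 1) (\<lambda>as. fst (z as)) \<and>
        has_deg (grd A) (grd N) m (\<lambda>as. snd (z as))"
      by (auto simp: has_deg_def mapping_cone_def mem_Times_iff add.assoc)
    moreover have "bounded_arity z \<longleftrightarrow> bounded_arity (\<lambda>as. fst (z as)) \<and> bounded_arity (\<lambda>as. snd (z as))"
    proof
      assume "bounded_arity (\<lambda>as. fst (z as)) \<and> bounded_arity (\<lambda>as. snd (z as))"
      then obtain P Q where "\<forall>as. length as > P \<longrightarrow> fst (z as) = 0" "\<forall>as. length as > Q \<longrightarrow> snd (z as) = 0"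
        by (auto simp: bounded_arity_def)
      then show "bounded_arity z" unfolding bounded_arity_def
        by (intro exI[of _ "max P Q"]) (auto simp: prod_eq_iff)
    qed (metis bounded_arity_def fst_zero snd_zero)
    ultimately show ?thesis by (auto simp: K.hoch_def M.hoch_def N.hoch_def)
  qed
  \<comment> \<open>The twist by 1 in the left action of the cone raises the exponent in
    \<open>lam\<close> from m to m + 1, the degree of the first component as a cochain with values
    in M.\<close>
  have dK: "K.dT m z as = (- M.dT (m + 1) (\<lambda>as. fst (z as)) as, \<phi> (fst (z as)) + N.dT m (\<lambda>as. snd (z as)) as)"
    if C: "\<And>as. z as \<in> K.C" for m z as
  proof -
    have 1: "M.hEM (\<lambda>as. fst (z as)) as = fst (K.hEM z as)" "N.hEM (\<lambda>as. snd (z as)) as = snd (K.hEM z as)"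
      by (rule K.R.hE_post[of z "\<lambda>_. fst" "ract M" "mul A" as]
          K.R.hE_post[of z "\<lambda>_. snd" "ract N" "mul A" as];
        use C in \<open>auto simp: mapping_cone_def\<close>)+
    have 2: "M.hDM (\<lambda>as. fst (z as)) as = fst (K.hDM z as)" "N.hDM (\<lambda>as. snd (z as)) as = snd (K.hDM z as)"
      using hD_post[of UNIV z "\<lambda>_. fst" "M.A.tau 1" "dif A" as] hD_post[of UNIV z "\<lambda>_. snd" "M.A.tau 1" "dif A" as]
      by auto
    have t: "M.A.tau 1 (M.A.tau (m - i) a) = M.A.tau (m + 1 - i) a" for i a
      by (simp add: tw_tw[OF M.A.gsp] algebra_simps)
    have la: "lact ?K a x = (lact M (M.A.tau 1 a) (fst x), lact N a (snd x))" for a x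
      by (simp add: mapping_cone_def split_beta)
    have 3: "M.lam (m + 1) (\<lambda>as. fst (z as)) as = fst (K.lam m z as)" "N.lam m (\<lambda>as. snd (z as)) as = snd (K.lam m z as)"
      by (cases as; simp add: la t)+
    have 4: "dif ?K (z as) = (- dif M (fst (z as)), \<phi> (fst (z as)) + dif N (snd (z as)))"
      by (simp add: mapping_cone_def split: prod.splits)
    show ?thesis
      unfolding K.dT_def M.dT_def N.dT_def K.dH_def M.dH_def N.dH_def K.del_def M.del_def N.del_def 1 2 3 4
      by (simp add: prod_eq_iff sg_def)
  qed
  let ?z = "\<lambda>as. (u as, - v as)"
  note uC = M.hoch_gtot[OF u(1)] and vC = N.hoch_gtot[OF v(1)]
  have z: "K.hoch (n - 1) ?z" using u v N.hoch_minus by (simp add: hK)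
  have "N.dT (n - 1) (\<lambda>as. - v as) as = - N.dT (n - 1) v as" for as
    using N.dT_sg[of v "n - 1" 1 as] vC by (simp add: sg_def)
  then have "K.dT (n - 1) ?z as = 0" for as
    by (subst dK) (auto simp: KC uC vC N.CI u v(2) zero_prod_def)
  from K.pointwisely_nilpotent_exact[OF nil z this] obtain w where
    w: "K.hoch (n - 1 - 1) w" "\<And>as. K.dT (n - 1 - 1) w as = ?z as" by blast
  let ?u = "\<lambda>as. - fst (w as)" and ?v = "\<lambda>as. snd (w as)"
  have w': "M.hoch (n - 1) (\<lambda>as. fst (w as))" "N.hoch (n - 2) ?v" using w(1) by (simp_all add: hK)
  note wC = M.hoch_gtot[OF w'(1)]
  have e: "- M.dT (n - 1) (\<lambda>as. fst (w as)) as = u as" "\<phi> (fst (w as)) + N.dT (n - 2) ?v as = - v as" for as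
    using w(2)[of as] by (simp_all add: dK[OF K.hoch_gtot[OF w(1)]])
  have "M.dT (n - 1) ?u as = u as" for as
    using M.dT_sg[of "\<lambda>as. fst (w as)" "n - 1" 1 as] wC e(1)[of as] by (simp add: sg_def)
  moreover have "\<phi> (?u as) = v as + N.dT (n - 2) ?v as" for as
  proof -
    have "\<phi> (fst (w as)) = - v as - N.dT (n - 2) ?v as" using e(2)[of as] by (simp only: eq_diff_eq)
    then show ?thesis by (simp add: additive_minus[OF M.gspM mor_add] wC)
  qed
  ultimately show ?thesis using w' M.hoch_minus by blast
qed

text \<open>In the last two cases \<open>cone_exact\<close> applies to \<open>\<psi>\<close> only.
  It yields surjectivity, respectively injectivity, of \<open>\<psi>\<close> on cohomology, and the
  one-sided inverse relation converts this into the statement for \<open>\<phi>\<close>.\<close>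

theorem weakly_cone_nilpotent_exact:
  assumes nil: "weakly_cone_nilpotent A M N \<phi>"
    and u: "M.hoch n u" "\<And>as. M.dT n u as = 0"
    and v: "N.hoch (n - 1) v" "\<And>as. \<phi> (u as) = N.dT (n - 1) v as"
  shows "\<exists>u' v'. M.hoch (n - 1) u' \<and> N.hoch (n - 2) v' \<and> (\<forall>as. M.dT (n - 1) u' as = u as) \<and>
    (\<forall>as. \<phi> (u' as) = v as + N.dT (n - 2) v' as)"
proof -
  note uC = M.hoch_gtot[OF u(1)] and vC = N.hoch_gtot[OF v(1)]
  consider "pointwisely_nilpotent A (mapping_cone A \<phi> M N)"
    | \<psi> where "bimod_mor N M \<psi>" "\<And>n. n \<in> N.C \<Longrightarrow> \<phi> (\<psi> n) = n" "pointwisely_nilpotent A (mapping_cone A \<psi> N M)"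
    | \<psi> where "bimod_mor N M \<psi>" "\<And>m. m \<in> M.C \<Longrightarrow> \<psi> (\<phi> m) = m" "pointwisely_nilpotent A (mapping_cone A \<psi> N M)"
    using nil unfolding weakly_cone_nilpotent_def by blast
  then show ?thesis
  proof cases
    case 1
    then show ?thesis by (rule cone_exact[OF _ u v])
  next
    case (2 \<psi>)
    interpret P: hoch_morphism A N M \<psi> by unfold_locales (rule 2(1))
    \<comment> \<open>Surjectivity of \<open>\<psi>\<close> on cohomology: exactness for the pair
      (0, u), one degree higher, represents the class of u by \<open>\<psi>\<close> of a cocycle
      w.\<close>
    have "\<exists>u' v'. N.hoch (n + 1 - 1) u' \<and> M.hoch (n + 1 - 2) v' \<and> (\<forall>as. N.dT (n + 1 - 1) u' as = 0) \<and>
        (\<forall>as. \<psi> (u' as) = u as + M.dT (n + 1 - 2) v' as)"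
      by (rule P.cone_exact[OF 2(3) N.hoch_zero]) (use u in \<open>simp_all add: N.dT_0 P.mor_0\<close>)
    then obtain w m where w: "N.hoch n w" "\<And>as. N.dT n w as = 0" and m: "M.hoch (n - 1) m"
      and wm: "\<And>as. \<psi> (w as) = u as + M.dT (n - 1) m as" by auto
    note wC = N.hoch_gtot[OF w(1)] and mC = M.hoch_gtot[OF m]
    have dmC: "M.dT (n - 1) m as \<in> M.C" for as using M.hoch_gtot[OF M.hoch_dT[OF m]] by simp
    let ?x = "\<lambda>as. v as + \<phi> (m as)"
    have x: "N.hoch (n - 1) ?x" by (rule N.hoch_add[OF v(1) hoch_mor[OF m]])
    note xC = N.hoch_gtot[OF x]
    have phC: "\<phi> (m as) \<in> N.C" for as by (rule N.hoch_gtot[OF hoch_mor[OF m]])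
    \<comment> \<open>Applying \<open>\<phi>\<close> to the relation for w recovers w on the left
      and makes the right side the boundary of v plus the image of m.\<close>
    have dx: "N.dT (n - 1) ?x as = w as" for as
    proof -
      have "w as = \<phi> (\<psi> (w as))" by (simp add: 2(2) wC)
      also have "\<dots> = N.dT (n - 1) v as + \<phi> (M.dT (n - 1) m as)"
        unfolding wm by (simp add: mor_add uC dmC v(2))
      finally show ?thesis by (simp add: N.dT_add vC phC dT_mor mC)
    qed
    let ?u = "\<lambda>as. \<psi> (?x as) - m as"
    have "M.hoch (n - 1) ?u" by (rule M.hoch_diff[OF P.hoch_mor[OF x] m])
    moreover have "M.dT (n - 1) ?u as = u as" for as
      using M.dT_diff[of "\<lambda>as. \<psi> (?x as)" m "n - 1" as] M.hoch_gtot[OF P.hoch_mor[OF x]] mC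
      by (simp add: P.dT_mor[OF xC] dx wm)
    moreover have "\<phi> (?u as) = v as" for as
      by (simp add: mor_diff M.hoch_gtot[OF P.hoch_mor[OF x]] mC 2(2) xC)
    ultimately show ?thesis
      by (intro exI[of _ ?u] exI[of _ "\<lambda>_. 0"]) (simp add: N.hoch_zero N.dT_0)
  next
    case (3 \<psi>)
    interpret P: hoch_morphism A N M \<psi> by unfold_locales (rule 3(1))
    let ?u = "\<lambda>as. \<psi> (v as)"
    have u': "M.hoch (n - 1) ?u" by (rule P.hoch_mor[OF v(1)])
    have du': "M.dT (n - 1) ?u as = u as" for as
      by (simp add: P.dT_mor vC v(2)[symmetric] 3(2) uC)
    \<comment> \<open>The error of the candidate \<open>\<psi>\<close> v. It is a cocycle killed by
      \<open>\<psi>\<close>, so injectivity of \<open>\<psi>\<close> on cohomology makes it a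
      coboundary.\<close>
    let ?e = "\<lambda>as. \<phi> (?u as) - v as"
    have e: "N.hoch (n - 1) ?e" by (rule N.hoch_diff[OF hoch_mor[OF u'] v(1)])
    note pC = N.hoch_gtot[OF hoch_mor[OF u']]
    have "N.dT (n - 1) ?e as = 0" for as
      by (simp add: N.dT_diff pC vC dT_mor M.hoch_gtot[OF u'] du' v(2))
    moreover have "\<psi> (?e as) = M.dT (n - 1 - 1) (\<lambda>_. 0) as" for as
      by (simp add: P.mor_diff pC vC 3(2) M.hoch_gtot[OF u'] M.dT_0)
    ultimately obtain v' where "N.hoch (n - 1 - 1) v'" "\<And>as. N.dT (n - 1 - 1) v' as = ?e as"
      using P.cone_exact[OF 3(3) e _ M.hoch_zero] by blast
    then show ?thesis using u' du' by (intro exI[of _ ?u] exI[of _ v']) simp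
  qed
qed

end

section \<open>The triangular algebra\<close>

lemma multilinD:
  "multilin s s' f \<Longrightarrow> f (as @ (s c x + y) # bs) = s' c (f (as @ x # bs)) + f (as @ y # bs)"
  by (simp add: multilin_def)

lemma regular_simps [simp]:
  "scl (regular_bimod A) = scl A" "grd (regular_bimod A) = grd A" "dif (regular_bimod A) = dif A"
  "lact (regular_bimod A) = mul A" "ract (regular_bimod A) = mul A"
  by (simp_all add: regular_bimod_def)

lemma (in dg_alg) hoch_coeff_regular: "hoch_coeff A (regular_bimod A)"
proof -
  have "dg_space (regular_bimod A)"
    using dg_algebra by (simp add: dg_algebra_def dg_space_def graded_space_def lin_deg_def)
  then have "dg_bimodule A A (regular_bimod A)"
    using dg_algebra by (auto simp: dg_bimodule_def dg_algebra_def bilin_deg_def)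
  then show ?thesis by unfold_locales
qed

text \<open>Stated for a relation R, not a map, so that it covers projections
  (\<open>\<pi> x = y\<close>), inclusions (\<open>y = inX z\<close>) and evaluation at a point
  (\<open>y = z x\<close>) alike.\<close>

lemma hE_rel:
  assumes "\<And>a b. p (\<mu> a b) = \<mu>' (p a) (p b)" "R 0 0"
    "\<And>x x' y y'. R x x' \<Longrightarrow> R y y' \<Longrightarrow> R (x - y) (x' - y')"
    "\<And>x x' a. R x x' \<Longrightarrow> R (\<rho> x a) (\<rho>' x' (p a))"
    and "\<And>as. R (F as) (f (map p as))"
  shows "R (hE \<mu> \<rho> F as) (hE \<mu>' \<rho>' f (map p as))"
  using assms(5)
proof (induction as arbitrary: F f)
  case (Cons a as)
  have "R (hmu \<mu> \<rho> a F as) (hmu \<mu>' \<rho>' (p a) f (map p as))"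
  proof (cases as)
    case Nil
    then show ?thesis using assms(4)[OF Cons.prems[of "[]"]] by simp
  next
    case (Cons b bs)
    then show ?thesis using \<open>\<And>as. R (F as) (f (map p as))\<close>[of "\<mu> a b # bs"] by (simp add: assms(1))
  qed
  moreover have "R (hE \<mu> \<rho> (\<lambda>bs. F (a # bs)) as) (hE \<mu>' \<rho>' (\<lambda>bs. f (p a # bs)) (map p as))"
    by (rule Cons.IH) (use Cons.prems[of "a # _"] in simp)
  ultimately show ?case by (simp add: assms(3))
qed (simp add: assms(2))

lemma hD_rel:
  assumes "\<And>a. p (t a) = t' (p a)" "\<And>a. p (d a) = d' (p a)" "R 0 0"
    "\<And>x x' y y'. R x x' \<Longrightarrow> R y y' \<Longrightarrow> R (x + y) (x' + y')"
    and "\<And>as. R (F as) (f (map p as))"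
  shows "R (hD t d F as) (hD t' d' f (map p as))"
  using assms(5)
proof (induction as arbitrary: F f)
  case (Cons a as)
  have "R (hD t d (\<lambda>bs. F (t a # bs)) as) (hD t' d' (\<lambda>bs. f (t' (p a) # bs)) (map p as))"
    by (rule Cons.IH) (use Cons.prems[of "t a # _"] in \<open>simp add: assms(1)\<close>)
  then show ?case using Cons.prems[of "d a # as"] by (simp add: assms(2,4))
qed (simp add: assms(3))

text \<open>Cochains cannot be pushed forward along an algebra morphism. What the lemmas here
  propagate is the relation \<open>\<pi> (F ts) = f (map \<pi> ts)\<close> between a cochain F of T
  and a cochain f of A.\<close>

locale alg_morphism = T: dg_alg T + A: dg_alg A
  for T :: "('k::field, 't::ab_group_add) dgalg" and A :: "('k, 'a::ab_group_add) dgalg" +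
  fixes \<pi> :: "'t \<Rightarrow> 'a"
  assumes pi_lin: "lin_deg T A 0 \<pi>"
    and pi_mul: "\<pi> (mul T s t) = mul A (\<pi> s) (\<pi> t)"
    and pi_dif: "\<pi> (dif T t) = dif A (\<pi> t)"
begin

sublocale HT: hoch_coeff T "regular_bimod T" by (rule T.hoch_coeff_regular)
sublocale HA: hoch_coeff A "regular_bimod A" by (rule A.hoch_coeff_regular)

lemma pi_add: "\<pi> (s + t) = \<pi> s + \<pi> t"
  by (rule lin_degD[OF pi_lin]) auto

lemmas pi_0 = additive_0[OF T.gsp pi_add]
  and pi_diff = additive_diff[OF T.gsp pi_add T.tot T.tot]
  and pi_sg = additive_sg[OF T.gsp pi_add T.tot]

lemma pi_tw: "\<pi> (T.tau k t) = A.tau k (\<pi> t)"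
  using lin_deg_tw[OF T.gsp A.gsp pi_lin T.tot, of k t] by simp

lemma pi_sum: "\<pi> (sum F S) = (\<Sum>i\<in>S. \<pi> (F i))"
  by (induction S rule: infinite_finite_induct) (simp_all add: pi_0 pi_add)

lemma pi_dT:
  assumes F: "\<And>ts. \<pi> (F ts) = f (map \<pi> ts)"
  shows "\<pi> (HT.dT n F ts) = HA.dT n f (map \<pi> ts)"
proof -
  have 1: "\<pi> (hE (mul T) (mul T) F ts) = hE (mul A) (mul A) f (map \<pi> ts)"
    by (rule hE_rel[where R = "\<lambda>x y. \<pi> x = y"]) (simp_all add: pi_mul pi_0 pi_diff F)
  have 2: "\<pi> (hD (T.tau 1) (dif T) F ts) = hD (A.tau 1) (dif A) f (map \<pi> ts)"
    by (rule hD_rel[where R = "\<lambda>x y. \<pi> x = y"]) (simp_all add: pi_tw pi_dif pi_0 pi_add F)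
  have 3: "\<pi> (HT.lam n F ts) = HA.lam n f (map \<pi> ts)"
    by (cases ts) (simp_all add: pi_0 pi_mul pi_tw F)
  show ?thesis
    by (simp add: HT.dT_def HA.dT_def HT.dH_def HA.dH_def HT.del_def HA.del_def pi_add pi_diff pi_sg
      1 2 3 pi_dif F)
qed

lemma pi_arity_part:
  "(\<And>ts. \<pi> (F ts) = f (map \<pi> ts)) \<Longrightarrow> \<pi> (arity_part p F ts) = arity_part p f (map \<pi> ts)"
  by (simp add: arity_part_def pi_0)

lemma pi_cup:
  assumes F: "\<And>ts. \<pi> (F ts) = f (map \<pi> ts)" and G: "\<And>ts. \<pi> (G ts) = g (map \<pi> ts)"
  shows "\<pi> (hoch_cup T m n F G ts) = hoch_cup A m n f g (map \<pi> ts)"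
  unfolding hoch_cup_def hoch_cup_pr_def
  by (simp add: pi_sum pi_0 pi_sg pi_mul pi_arity_part[of F f] pi_arity_part[of G g] F G
    take_map drop_map comp_def pi_tw split_beta if_distrib[of \<pi>])

lemma pi_circ:
  assumes "\<And>ts. \<pi> (F ts) = f (map \<pi> ts)" "\<And>ts. \<pi> (G ts) = g (map \<pi> ts)"
  shows "\<pi> (hoch_circ T p r i F G ts) = hoch_circ A p r i f g (map \<pi> ts)"
  unfolding hoch_circ_def by (simp add: assms take_map drop_map comp_def pi_tw)

lemma pi_brk:
  assumes F: "\<And>ts. \<pi> (F ts) = f (map \<pi> ts)" and G: "\<And>ts. \<pi> (G ts) = g (map \<pi> ts)"
  shows "\<pi> (hoch_brk T m n F G ts) = hoch_brk A m n f g (map \<pi> ts)"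
proof -
  have 1: "\<pi> (hoch_circ T k r i (arity_part p F) (arity_part q G) ts)
      = hoch_circ A k r i (arity_part p f) (arity_part q g) (map \<pi> ts)" for k r i p q
    by (rule pi_circ) (simp_all add: pi_arity_part[of F f] pi_arity_part[of G g] F G)
  have 2: "\<pi> (hoch_circ T k r i (arity_part p G) (arity_part q F) ts)
      = hoch_circ A k r i (arity_part p g) (arity_part q f) (map \<pi> ts)" for k r i p q
    by (rule pi_circ) (simp_all add: pi_arity_part[of F f] pi_arity_part[of G g] F G)
  show ?thesis
    unfolding hoch_brk_def hoch_brk_pr_def
    by (simp add: pi_sum pi_0 pi_sg pi_diff split_beta if_distrib[of \<pi>] 1 2)
qed

end

section \<open>The triangular algebra as a dg algebra with projections to A and B\<close>

locale triple = dg_bimod A B X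
  for A :: "('k::field, 'a::ab_group_add) dgalg" and B :: "('k, 'b::ab_group_add) dgalg"
    and X :: "('k, 'x::ab_group_add, 'a, 'b) bimod" +
  assumes totX: "gtot (grd X) = UNIV"
begin

lemma CX [simp]: "x \<in> C"
  by (simp add: totX)

abbreviation T :: "('k, 'a \<times> 'x \<times> 'b) dgalg" where "T \<equiv> tri_alg A X B"

lemma tri_simps [simp]:
  "scl T c (a, x, b) = (scl A c a, scl X c x, scl B c b)"
  "dif T (a, x, b) = (dif A a, dif X x, dif B b)"
  "mul T (a, x, b) (a', x', b') = (mul A a a', lact X a x' + ract X x b', mul B b b')"
  "(a, x, b) \<in> grd T n \<longleftrightarrow> a \<in> grd A n \<and> x \<in> grd X n \<and> b \<in> grd B n"
  by (simp_all add: tri_alg_def)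

lemma gsp_tri: "graded_space T" and tot_tri: "gtot (grd T) = UNIV"
proof -
  \<comment> \<open>The product construction is binary, so the triple is nested; neither factor is
    shifted.\<close>
  let ?U = "\<lparr>scl = (\<lambda>c (x, b). (scl X c x, scl B c b)), grd = (\<lambda>k. grd X (k + 0) \<times> grd B k), dif = undefined\<rparr>"
  have U: "graded_space ?U" "gtot (grd ?U) = gtot (grd X) \<times> gtot (grd B)"
    by (rule graded_space_prod[OF gspM B.gsp, where s = 0]; simp)+
  have s: "scl T = (\<lambda>c (x, y). (scl A c x, scl ?U c y))" "grd T = (\<lambda>k. grd A (k + 0) \<times> grd ?U k)"
    by (auto simp: tri_alg_def fun_eq_iff)
  show "graded_space T" by (rule graded_space_prod(1)[OF A.gsp U(1) s])
  show "gtot (grd T) = UNIV"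
    using graded_space_prod(2)[OF A.gsp U(1) s] U(2) by (simp add: totX A.tot_eq B.tot_eq)
qed

lemma dg_alg_tri: "dg_alg T"
proof -
  have "lin_deg T T 1 (dif T)"
    unfolding lin_deg_def
    by (auto simp: A.dif_add B.dif_add difM_add A.dif_scl B.dif_scl difM_scl A.dif_grd B.dif_grd difM_grd)
  moreover have "dif T (dif T t) = 0" for t
    by (cases t) (simp add: A.dif_dif B.dif_dif difM_difM zero_prod_def)
  ultimately have 1: "dg_space T" by (simp add: dg_space_def gsp_tri)
  have 2: "bilin_deg T T T (mul T)"
    unfolding bilin_deg_def
    by (auto simp: A.mul_add_left A.mul_add_right B.mul_add_left B.mul_add_right A.mul_scl_left
      A.mul_scl_right B.mul_scl_left B.mul_scl_right A.mul_grd B.mul_grd lact_add_left lact_add_right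
      ract_add_left ract_add_right lact_scl_left lact_scl_right ract_scl_left ract_scl_right
      scl_add[OF gspM] lact_grd ract_grd grd_add[OF gspM] algebra_simps)
  have 3: "mul T (mul T s t) u = mul T s (mul T t u)" for s t u
    by (cases s; cases t; cases u) (simp add: A.mul_assoc B.mul_assoc lact_mul ract_mul lact_ract
      lact_add_right ract_add_left add.assoc)
  have 4: "dif T (mul T s t) = mul T (dif T s) t + sg n (mul T s (dif T t))" if "s \<in> grd T n" for s t n
  proof -
    obtain a x b a' x' b' where st: "s = (a, x, b)" "t = (a', x', b')" by (cases s; cases t)
    have h: "a \<in> grd A n" "x \<in> grd X n" "b \<in> grd B n" using that by (simp_all add: st)
    show ?thesis
      using h by (simp add: st sg_pair A.dif_mul B.dif_mul difM_add dif_lact dif_ract tw_hom[OF A.gsp h(1)]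
        tw_hom[OF B.gsp h(3)] tw_hom[OF gspM h(2)] A.mul_sg_left B.mul_sg_left lact_sg_left ract_sg sg_add)
  qed
  show ?thesis by unfold_locales (auto simp: dg_algebra_def 1 2 3 4 tot_tri)
qed

sublocale T: dg_alg T by (rule dg_alg_tri)

sublocale PA: alg_morphism T A fst
  by unfold_locales (auto simp: lin_deg_def split_beta tri_alg_def)

sublocale PB: alg_morphism T B "\<lambda>t. snd (snd t)"
  by unfold_locales (auto simp: lin_deg_def split_beta tri_alg_def)

lemma tau_tri: "T.tau k (a, x, b) = (A.tau k a, tw (grd X) k x, B.tau k b)"
proof -
  have "lin_deg T X 0 (\<lambda>t. fst (snd t))" by (auto simp: lin_deg_def split_beta tri_alg_def)
  from lin_deg_tw[OF T.gsp gspM this T.tot, of k "(a, x, b)"]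
  show ?thesis using PA.pi_tw[of k "(a, x, b)"] PB.pi_tw[of k "(a, x, b)"] by (simp add: prod_eq_iff)
qed

section \<open>The Hochschild complex of a bimodule\<close>

text \<open>The entries of \<open>as\<close> and \<open>bs\<close> are counted with degree shifted
  down by one, but x is not. With p + q + r + 1 = n the value then has degree k + m + l + n -
  1.\<close>

definition hochX :: "int \<Rightarrow> ('a list \<Rightarrow> 'x \<Rightarrow> 'b list \<Rightarrow> 'x) \<Rightarrow> bool" where
  "hochX n g \<longleftrightarrow>
     (\<forall>x bs. multilin (scl A) (scl X) (\<lambda>as. g as x bs)) \<and>
     (\<forall>as c x y bs. g as (scl X c x + y) bs = scl X c (g as x bs) + g as y bs) \<and>
     (\<forall>as x. multilin (scl B) (scl X) (g as x)) \<and>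
     (\<forall>k as m x l bs. shdeg (grd A) k as \<and> x \<in> grd X m \<and> shdeg (grd B) l bs \<longrightarrow>
        g as x bs \<in> grd X (k + m + l + n - 1)) \<and>
     (\<exists>P. \<forall>as x bs. length as + length bs > P \<longrightarrow> g as x bs = 0)"

lemma hochXI:
  assumes "\<And>x bs. multilin (scl A) (scl X) (\<lambda>as. g as x bs)"
    "\<And>as x. multilin (scl B) (scl X) (g as x)"
    "\<And>as c x y bs. g as (scl X c x + y) bs = scl X c (g as x bs) + g as y bs"
    "\<And>k as m x l bs. shdeg (grd A) k as \<Longrightarrow> x \<in> grd X m \<Longrightarrow> shdeg (grd B) l bs \<Longrightarrow>
      g as x bs \<in> grd X (k + m + l + n - 1)"
    "\<exists>P. \<forall>as x bs. length as + length bs > P \<longrightarrow> g as x bs = 0"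
  shows "hochX n g"
  unfolding hochX_def using assms by simp

lemma hochXD:
  assumes "hochX n g"
  shows "multilin (scl A) (scl X) (\<lambda>as. g as x bs)"
    "g as (scl X c x + y) bs = scl X c (g as x bs) + g as y bs"
    "multilin (scl B) (scl X) (g as x)"
    "shdeg (grd A) k as \<Longrightarrow> x \<in> grd X m \<Longrightarrow> shdeg (grd B) l bs \<Longrightarrow> g as x bs \<in> grd X (k + m + l + n - 1)"
  using assms unfolding hochX_def by blast+

lemma hochX_bounded:
  assumes "hochX n g"
  obtains P where "\<And>as x bs. length as + length bs > P \<Longrightarrow> g as x bs = 0"
  using assms unfolding hochX_def by blast

sublocale HAX: two_graded A X by standard (rule A.gsp, rule gspM, rule A.tot_eq)
sublocale HBX: two_graded B X by standard (rule B.gsp, rule gspM, rule B.tot_eq)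

lemma hochX_add_x: "hochX n g \<Longrightarrow> g as (x + y) bs = g as x bs + g as y bs"
  using hochXD(2)[of n g as 1 x y bs] by (simp add: scl_1[OF gspM])

lemma hochX_0_x: "hochX n g \<Longrightarrow> g as 0 bs = 0"
  using hochX_add_x[of n g as 0 0 bs] by simp

lemma hochX_scl_x: "hochX n g \<Longrightarrow> g as (scl X c x) bs = scl X c (g as x bs)"
  using hochXD(2)[of n g as c x 0 bs] by (simp add: hochX_0_x)

lemma hochX_pqr_iff:
  "g \<in> hochX_pqr A X B p q r \<longleftrightarrow> hochX (r + int p + int q + 1) g \<and>
     (\<forall>as x bs. length as \<noteq> p \<or> length bs \<noteq> q \<longrightarrow> g as x bs = 0)"
proof
  assume g: "g \<in> hochX_pqr A X B p q r"
  have z: "g as x bs = 0" if "length as \<noteq> p \<or> length bs \<noteq> q" for as x bs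
    using g that by (simp add: hochX_pqr_def)
  have "multilin (scl A) (scl X) (\<lambda>as. g as x bs)" for x bs
  proof (rule HAX.multilinI)
    fix as a a' as' c
    show "g (as @ (a + a') # as') x bs = g (as @ a # as') x bs + g (as @ a' # as') x bs"
      using g by (cases "length as + 1 + length as' = p \<and> length bs = q") (simp add: hochX_pqr_def, auto simp: z)
    show "g (as @ scl A c a # as') x bs = scl X c (g (as @ a # as') x bs)"
      using g by (cases "length as + 1 + length as' = p \<and> length bs = q")
        (simp add: hochX_pqr_def, auto simp: z scl_0[OF gspM])
  qed
  moreover have "multilin (scl B) (scl X) (g as x)" for as x
  proof (rule HBX.multilinI)
    fix bs b b' bs' c
    show "g as x (bs @ (b + b') # bs') = g as x (bs @ b # bs') + g as x (bs @ b' # bs')"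
      using g by (cases "length as = p \<and> length bs + 1 + length bs' = q") (simp add: hochX_pqr_def, auto simp: z)
    show "g as x (bs @ scl B c b # bs') = scl X c (g as x (bs @ b # bs'))"
      using g by (cases "length as = p \<and> length bs + 1 + length bs' = q")
        (simp add: hochX_pqr_def, auto simp: z scl_0[OF gspM])
  qed
  moreover have "g as (scl X c x + y) bs = scl X c (g as x bs) + g as y bs" for as c x y bs
  proof (cases "length as = p \<and> length bs = q")
    case True
    then show ?thesis using g by (simp add: hochX_pqr_def)
  qed (auto simp: z scl_0[OF gspM])
  moreover have "g as x bs \<in> grd X (k + m + l + (r + int p + int q + 1) - 1)"
    if ka: "shdeg (grd A) k as" and xm: "x \<in> grd X m" and lb: "shdeg (grd B) l bs" for k as m x l bs
  proof (cases "length as = p \<and> length bs = q")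
    case True
    obtain ms where ms: "list_all2 (\<lambda>a n. a \<in> grd A n) as ms" "k = sum_list ms - int (length as)"
      using ka by (rule shdegE)
    obtain ns where ns: "list_all2 (\<lambda>a n. a \<in> grd B n) bs ns" "l = sum_list ns - int (length bs)"
      using lb by (rule shdegE)
    have "g as x bs \<in> grd X (sum_list ms + m + sum_list ns + r)" using g True ms(1) ns(1) xm unfolding hochX_pqr_def by blast
    moreover have "sum_list ms + m + sum_list ns + r = k + m + l + (r + int p + int q + 1) - 1"
      using True ms(2) ns(2) by simp
    ultimately show ?thesis by simp
  qed (auto simp: z grd_0[OF gspM])
  moreover have "\<exists>P. \<forall>as x bs. length as + length bs > P \<longrightarrow> g as x bs = 0"
    by (rule exI[of _ "p + q"]) (auto intro!: z)
  ultimately have "hochX (r + int p + int q + 1) g" by (rule hochXI)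
  then show "hochX (r + int p + int q + 1) g \<and> (\<forall>as x bs. length as \<noteq> p \<or> length bs \<noteq> q \<longrightarrow> g as x bs = 0)"
    using z by simp
next
  assume g: "hochX (r + int p + int q + 1) g \<and> (\<forall>as x bs. length as \<noteq> p \<or> length bs \<noteq> q \<longrightarrow> g as x bs = 0)"
  then have h: "hochX (r + int p + int q + 1) g" by simp
  show "g \<in> hochX_pqr A X B p q r"
    unfolding hochX_pqr_def mem_Collect_eq
  proof (intro conjI allI impI)
    fix as x bs ms k ns
    assume a: "length as = p \<and> length bs = q \<and> list_all2 (\<lambda>a m. a \<in> grd A m) as ms \<and>
        x \<in> grd X k \<and> list_all2 (\<lambda>b n. b \<in> grd B n) bs ns"
    then have "shdeg (grd A) (sum_list ms - int p) as" "shdeg (grd B) (sum_list ns - int q) bs"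
      using shdeg_list_all2[of "grd A" as ms] shdeg_list_all2[of "grd B" bs ns] by simp_all
    from hochXD(4)[OF h this(1) _ this(2), of x k] a
    show "g as x bs \<in> grd X (sum_list ms + k + sum_list ns + r)" by (simp add: algebra_simps)
  qed (use g h in \<open>auto simp: HAX.multilin_add[OF hochXD(1)[OF h]] HAX.multilin_scl[OF hochXD(1)[OF h]]
    HBX.multilin_add[OF hochXD(3)[OF h]] HBX.multilin_scl[OF hochXD(3)[OF h]] hochX_add_x[OF h] hochX_scl_x[OF h]\<close>)
qed

text \<open>Cutting a cochain down to a set of arities keeps it a cochain; this isolates components
  such as the one of top arity.\<close>

lemma hochX_part:
  "hochX n g \<Longrightarrow> hochX n (\<lambda>as x bs. if Q (length as) (length bs) then g as x bs else 0)"
proof -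
  assume g: "hochX n g"
  obtain P where P: "\<And>as x bs. length as + length bs > P \<Longrightarrow> g as x bs = 0" by (rule hochX_bounded[OF g]) blast
  have "\<exists>P. \<forall>as x bs. length as + length bs > P \<longrightarrow> (if Q (length as) (length bs) then g as x bs else 0) = 0"
    using P by (intro exI[of _ P]) simp
  with g show ?thesis unfolding hochX_def multilin_def by (simp add: scl_0[OF gspM] grd_0[OF gspM])
qed

lemma hochX_deg_iff: "g \<in> hochX_deg A X B n \<longleftrightarrow> hochX n g"
proof
  assume g: "g \<in> hochX_deg A X B n"
  have pr: "hochX n (arity_part2 p q g)" for p q
    using g hochX_pqr_iff[of "arity_part2 p q g" p q "n - int p - int q - 1"] by (simp add: hochX_deg_def)
  note e = arity_part2_def
  have "multilin (scl A) (scl X) (\<lambda>as. g as x bs)" for x bs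
    unfolding multilin_def
  proof (intro allI)
    fix as c a a' as'
    show "g (as @ (scl A c a + a') # as') x bs = scl X c (g (as @ a # as') x bs) + g (as @ a' # as') x bs"
      using multilinD[OF hochXD(1)[OF pr[of "length as + 1 + length as'" "length bs"], of x bs], of as c a a' as']
      by (simp add: e)
  qed
  moreover have "multilin (scl B) (scl X) (g as x)" for as x
    unfolding multilin_def
  proof (intro allI)
    fix bs c b b' bs'
    show "g as x (bs @ (scl B c b + b') # bs') = scl X c (g as x (bs @ b # bs')) + g as x (bs @ b' # bs')"
      using multilinD[OF hochXD(3)[OF pr[of "length as" "length bs + 1 + length bs'"], of as x], of bs c b b' bs']
      by (simp add: e)
  qed
  moreover have "g as (scl X c x + y) bs = scl X c (g as x bs) + g as y bs" for as c x y bs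
    using hochXD(2)[OF pr[of "length as" "length bs"], of as c x y bs] by (simp add: e)
  moreover have "g as x bs \<in> grd X (k + m + l + n - 1)"
    if "shdeg (grd A) k as" "x \<in> grd X m" "shdeg (grd B) l bs" for k as m x l bs
    using hochXD(4)[OF pr[of "length as" "length bs"] that] by (simp add: e)
  moreover have "\<exists>P. \<forall>as x bs. length as + length bs > P \<longrightarrow> g as x bs = 0"
  proof -
    let ?S = "{(p, q). arity_part2 p q g \<noteq> 0}"
    have fin: "finite ((\<lambda>(p, q). p + q) ` ?S)" using g by (simp add: hochX_deg_def)
    show ?thesis
    proof (intro exI allI impI)
      fix as :: "'a list" and x and bs :: "'b list"
      assume l: "length as + length bs > Max (insert 0 ((\<lambda>(p, q). p + q) ` ?S))"
      have "(length as, length bs) \<notin> ?S"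
      proof
        assume "(length as, length bs) \<in> ?S"
        then have "length as + length bs \<in> (\<lambda>(p, q). p + q) ` ?S" by (rule rev_image_eqI) simp
        then have "length as + length bs \<le> Max (insert 0 ((\<lambda>(p, q). p + q) ` ?S))" using fin by simp
        with l show False by simp
      qed
      then have "arity_part2 (length as) (length bs) g as x bs = 0" by simp
      then show "g as x bs = 0" by (simp add: e)
    qed
  qed
  ultimately show "hochX n g" by (rule hochXI)
next
  assume g: "hochX n g"
  obtain P where P: "\<And>as x bs. length as + length bs > P \<Longrightarrow> g as x bs = 0" by (rule hochX_bounded[OF g]) blast
  have "arity_part2 p q g \<in> hochX_pqr A X B p q (n - int p - int q - 1)" for p q
    using hochX_part[OF g, of "\<lambda>i j. i = p \<and> j = q"] by (simp add: hochX_pqr_iff arity_part2_def)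
  moreover have "{(p, q). arity_part2 p q g \<noteq> 0} \<subseteq> {..P} \<times> {..P}"
  proof clarify
    fix p q assume "arity_part2 p q g \<noteq> 0"
    then obtain as x bs where "arity_part2 p q g as x bs \<noteq> 0" by (auto simp: fun_eq_iff)
    then have "g as x bs \<noteq> 0" "length as = p" "length bs = q" by (auto simp: arity_part2_def split: if_splits)
    then have "\<not> p + q > P" using P by blast
    then show "p \<in> {..P} \<and> q \<in> {..P}" by simp
  qed
  then have "finite {(p, q). arity_part2 p q g \<noteq> 0}" by (rule finite_subset) simp
  ultimately show "g \<in> hochX_deg A X B n" by (simp add: hochX_deg_def)
qed

lemma hochX_zero: "hochX n (\<lambda>_ _ _. 0)"
  by (auto simp: hochX_def multilin_def grd_0[OF gspM] scl_0[OF gspM])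

lemma hochX_add:
  assumes f: "hochX n f" and g: "hochX n g" shows "hochX n (\<lambda>as x bs. f as x bs + g as x bs)"
proof -
  obtain P where P: "\<And>as x bs. length as + length bs > P \<Longrightarrow> f as x bs = 0" by (rule hochX_bounded[OF f]) blast
  obtain Q where Q: "\<And>as x bs. length as + length bs > Q \<Longrightarrow> g as x bs = 0" by (rule hochX_bounded[OF g]) blast
  have "\<exists>P. \<forall>as x bs. length as + length bs > P \<longrightarrow> f as x bs + g as x bs = 0"
    using P Q by (intro exI[of _ "max P Q"]) simp
  with f g show ?thesis unfolding hochX_def multilin_def by (simp add: scl_add[OF gspM] grd_add[OF gspM])
qed

lemma hochX_minus:
  assumes g: "hochX n g" shows "hochX n (\<lambda>as x bs. - g as x bs)"
proof -
  obtain P where P: "\<And>as x bs. length as + length bs > P \<Longrightarrow> g as x bs = 0" by (rule hochX_bounded[OF g]) blast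
  have "\<exists>P. \<forall>as x bs. length as + length bs > P \<longrightarrow> - g as x bs = 0"
    using P by (intro exI[of _ P]) simp
  with g show ?thesis unfolding hochX_def multilin_def by (simp add: scl_minus[OF gspM] grd_minus[OF gspM])
qed

lemma hochX_diff: "hochX n f \<Longrightarrow> hochX n g \<Longrightarrow> hochX n (\<lambda>as x bs. f as x bs - g as x bs)"
  using hochX_add[of n f "\<lambda>as x bs. - g as x bs"] hochX_minus[of n g] by simp

lemma hochX_sg: "hochX n g \<Longrightarrow> hochX n (\<lambda>as x bs. sg k (g as x bs))"
  using hochX_minus[of n g] by (cases "even k") (simp_all add: sg_def)

end

section \<open>Cochains extended by zero and the differential on them\<close>

text \<open>Middle component of \<open>embX\<close>: a sum over the position of the entry that
  supplies x. Peeling entries from the left makes it match the recursions of \<open>hE\<close> and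
  \<open>hD\<close>.\<close>

primrec emx :: "('a list \<Rightarrow> 'x \<Rightarrow> 'b list \<Rightarrow> 'x::ab_group_add) \<Rightarrow> ('a \<times> 'x \<times> 'b) list \<Rightarrow> 'x" where
  "emx g [] = 0"
| "emx g (t # ts) = g [] (fst (snd t)) (map (snd \<circ> snd) ts) + emx (\<lambda>as. g (fst t # as)) ts"

lemma embX_emx: "embX g ts = (0, emx g ts, 0)"
proof -
  have "(\<Sum>i<length ts. g (map fst (take i ts)) (fst (snd (ts ! i))) (map (snd \<circ> snd) (drop (i + 1) ts))) = emx g ts"
    by (induction ts arbitrary: g) (simp_all add: sum.lessThan_Suc_shift del: sum.lessThan_Suc)
  then show ?thesis by (simp add: embX_def)
qed

lemma emx_cong:
  "(\<And>as x bs. length as + 1 + length bs = length ts \<Longrightarrow> g as x bs = g' as x bs) \<Longrightarrow> emx g ts = emx g' ts"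
proof (induction ts arbitrary: g g')
  case (Cons t ts)
  have "emx (\<lambda>as. g (fst t # as)) ts = emx (\<lambda>as. g' (fst t # as)) ts"
    by (rule Cons.IH) (use Cons.prems in simp)
  then show ?case using Cons.prems[of "[]" "map (snd \<circ> snd) ts"] by simp
qed simp

lemma emx_0 [simp]: "emx (\<lambda>_ _ _. 0) ts = 0"
  by (induction ts) simp_all

lemma emx_add: "emx (\<lambda>as x bs. g as x bs + g' as x bs) ts = emx g ts + emx g' ts"
  by (induction ts arbitrary: g g') (simp_all add: algebra_simps)

lemma emx_diff: "emx (\<lambda>as x bs. g as x bs - g' as x bs) ts = emx g ts - emx g' ts"
  by (induction ts arbitrary: g g') (simp_all add: algebra_simps)

lemma emx_post:
  assumes "\<And>x y. T (x + y) = T x + T y"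
  shows "emx (\<lambda>as x bs. T (g as x bs)) ts = T (emx g ts)"
proof -
  have "T 0 = 0" using assms[of 0 0] by simp
  then show ?thesis by (induction ts arbitrary: g) (simp_all add: assms)
qed

text \<open>A list with one slot for x has length p + 1 + q, so an operation depending on the two
  arities becomes one depending on the length of the list.\<close>

lemma emx_post_length:
  fixes g :: "'a list \<Rightarrow> 'x::ab_group_add \<Rightarrow> 'c list \<Rightarrow> 'x"
  assumes "\<And>k x y. T k (x + y) = T k x + T k y"
  shows "emx (\<lambda>as x bs. T (int (length as) + 1 + int (length bs)) (g as x bs)) ts = T (int (length ts)) (emx g ts)"
proof -
  have "emx (\<lambda>as x bs. T (int (length as) + 1 + int (length bs)) (g as x bs)) ts
      = emx (\<lambda>as x bs. T (int (length ts)) (g as x bs)) ts"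
  proof (rule emx_cong)
    fix as :: "'a list" and x and bs :: "'c list"
    assume "length as + 1 + length bs = length ts"
    then have "int (length as) + 1 + int (length bs) = int (length ts)" by simp
    then show "T (int (length as) + 1 + int (length bs)) (g as x bs) = T (int (length ts)) (g as x bs)" by simp
  qed
  then show ?thesis by (simp add: emx_post assms)
qed

text \<open>On a list with a single nonzero X component only one position survives, because g
  vanishes at x = 0.\<close>

lemma emx_pure:
  fixes g :: "'a::zero list \<Rightarrow> 'x::ab_group_add \<Rightarrow> 'b::zero list \<Rightarrow> 'x"
  assumes "\<And>as bs. g as 0 bs = 0"
  shows "emx g (map (\<lambda>a. (a, 0, 0)) as @ (0, x, 0) # map (\<lambda>b. (0, 0, b)) bs) = g as x bs"
  using assms
proof (induction as arbitrary: g)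
  case Nil
  have "emx g (map (\<lambda>b. (0, 0, b)) bs) = 0" if "\<And>as bs. g as 0 bs = 0" for g :: "'a list \<Rightarrow> 'x \<Rightarrow> 'b list \<Rightarrow> 'x"
    using that by (induction bs arbitrary: g) simp_all
  then show ?case using Nil by (simp add: comp_def)
qed simp

context triple
begin

abbreviation "sb \<equiv> (\<lambda>t :: 'a \<times> 'x \<times> 'b. snd (snd t))"

lemma snd_comp_snd: "snd \<circ> snd = sb"
  by auto

text \<open>Only an entry from A can act from the left on a value in X, hence 0 for empty
  \<open>as\<close>. The exponent is the internal degree of g on the remaining arguments.\<close>

definition lamX :: "int \<Rightarrow> ('a list \<Rightarrow> 'x \<Rightarrow> 'b list \<Rightarrow> 'x) \<Rightarrow> 'a list \<Rightarrow> 'x \<Rightarrow> 'b list \<Rightarrow> 'x" where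
  "lamX n g as x bs = (case as of [] \<Rightarrow> 0
     | a # as' \<Rightarrow> lact X (A.tau (n - (int (length as') + 1 + int (length bs))) a) (g as' x bs))"

text \<open>\<open>hE\<close> for functions with values in maps from X to X, on which A acts from
  the right by precomposition; so the term where the last entry of \<open>as\<close> multiplies x is
  the right action term.\<close>

definition exL :: "('a list \<Rightarrow> 'x \<Rightarrow> 'b list \<Rightarrow> 'x) \<Rightarrow> 'a list \<Rightarrow> 'x \<Rightarrow> 'b list \<Rightarrow> 'x" where
  "exL g as x bs = hE (mul A) (\<lambda>\<phi> a x. \<phi> (lact X a x)) (\<lambda>as x. g as x bs) as x"

text \<open>The part of the inner sum to the right of \<open>as\<close>: first the merge of x with
  the head of \<open>bs\<close>, then the merges inside \<open>bs\<close> and the right action,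
  whose signs start one position later.\<close>

definition exR :: "('a list \<Rightarrow> 'x \<Rightarrow> 'b list \<Rightarrow> 'x) \<Rightarrow> 'a list \<Rightarrow> 'x \<Rightarrow> 'b list \<Rightarrow> 'x" where
  "exR g as x bs = (case bs of [] \<Rightarrow> 0 | b # bs' \<Rightarrow> g as (ract X x b) bs') - hE (mul B) (ract X) (g as x) bs"

definition exX :: "('a list \<Rightarrow> 'x \<Rightarrow> 'b list \<Rightarrow> 'x) \<Rightarrow> 'a list \<Rightarrow> 'x \<Rightarrow> 'b list \<Rightarrow> 'x" where
  "exX g as x bs = exL g as x bs + sg (int (length as)) (exR g as x bs)"

definition DX :: "('a list \<Rightarrow> 'x \<Rightarrow> 'b list \<Rightarrow> 'x) \<Rightarrow> 'a list \<Rightarrow> 'x \<Rightarrow> 'b list \<Rightarrow> 'x" where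
  "DX g as x bs = hD (A.tau 1) (dif A) (\<lambda>as. g as x bs) as + g (map (A.tau 1) as) (dif X x) bs
     + hD (B.tau 1) (dif B) (g (map (A.tau 1) as) (tw (grd X) 1 x)) bs"

definition delX :: "int \<Rightarrow> ('a list \<Rightarrow> 'x \<Rightarrow> 'b list \<Rightarrow> 'x) \<Rightarrow> 'a list \<Rightarrow> 'x \<Rightarrow> 'b list \<Rightarrow> 'x" where
  "delX n g as x bs = dif X (g as x bs) - sg (n - (int (length as) + 1 + int (length bs))) (DX g as x bs)"

definition dX :: "int \<Rightarrow> ('a list \<Rightarrow> 'x \<Rightarrow> 'b list \<Rightarrow> 'x) \<Rightarrow> 'a list \<Rightarrow> 'x \<Rightarrow> 'b list \<Rightarrow> 'x" where
  "dX n g as x bs = sg (n - 1) (lamX n g as x bs - exX g as x bs) + delX n g as x bs"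

text \<open>The map Hoch(A) -> Hoch(A,X,B): a value of f in A multiplies a last entry x. The sign
  (-1)^p is the position sign of the right action term.\<close>

definition actA :: "('a list \<Rightarrow> 'a) \<Rightarrow> 'a list \<Rightarrow> 'x \<Rightarrow> 'b list \<Rightarrow> 'x" where
  "actA f as x bs = (if bs = [] then sg (int (length as)) (lact X (f as) x) else 0)"

text \<open>The map Hoch(B) -> Hoch(A,X,B): a leading entry x multiplies a value of h, with the
  Koszul sign for moving h past x as a twist of x.\<close>

definition actB :: "int \<Rightarrow> ('b list \<Rightarrow> 'b) \<Rightarrow> 'a list \<Rightarrow> 'x \<Rightarrow> 'b list \<Rightarrow> 'x" where
  "actB n h as x bs = (if as = [] then ract X (tw (grd X) (n - int (length bs)) x) (h bs) else 0)"

lemma mul_zero: "mul A 0 a = 0" "mul A a 0 = 0" "mul B 0 b = 0" "mul B b 0 = 0"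
  using A.mul_add_left[of 0 0 a] A.mul_add_right[of a 0 0] B.mul_add_left[of 0 0 b] B.mul_add_right[of b 0 0]
  by simp_all

lemmas act_zero = lact_0[where a = a for a] ract_0[where b = b for b] lact_0_left[OF CX] ract_0_right[OF CX]

lemma dif_zero: "dif A 0 = 0" "dif B 0 = 0" "dif X 0 = 0"
  using A.dif_add[of 0 0] B.dif_add[of 0 0] difM_0 by simp_all

lemma tau_zero: "A.tau k 0 = 0" "B.tau k 0 = 0" "tw (grd X) k 0 = 0"
  by (simp_all add: tw_zero A.gsp B.gsp gspM)

abbreviation "inX y \<equiv> (0 :: 'a, y :: 'x, 0 :: 'b)"

lemma hE_inX_right: "hE (mul T) (mul T) (\<lambda>ts. inX (k (map sb ts))) ts = inX (hE (mul B) (ract X) k (map sb ts))"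
  by (rule hE_rel[where R = "\<lambda>y z. y = inX z"])
    (auto simp: mul_zero act_zero zero_prod_def tri_alg_def split_beta)

lemma hD_inX_right: "hD (T.tau 1) (dif T) (\<lambda>ts. inX (k (map sb ts))) ts = inX (hD (B.tau 1) (dif B) k (map sb ts))"
  by (rule hD_rel[where R = "\<lambda>y z. y = inX z"]) (auto simp: zero_prod_def PB.pi_tw PB.pi_dif)

lemma exX_Cons:
  "exX g (a # as) x bs = hmu (mul A) (\<lambda>\<phi> a x. \<phi> (lact X a x)) a (\<lambda>as x. g as x bs) as x - exX (\<lambda>as. g (a # as)) as x bs"
  by (simp add: exX_def exL_def exR_def sg_Suc)

text \<open>Induction on the first entry of the list: either it supplies x and the rest is a cochain
  in entries of B, or it lies in A and is fixed as an argument of g.\<close>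

lemma hE_embX:
  assumes "\<And>as x y bs. g as (x + y) bs = g as x bs + g as y bs"
  shows "hE (mul T) (mul T) (\<lambda>ts. inX (emx g ts)) ts = inX (emx (exX g) ts)"
  using assms
proof (induction ts arbitrary: g)
  case (Cons t ts)
  obtain a x b where t: "t = (a, x, b)" by (cases t)
  let ?gl = "\<lambda>as. g (a # as)"
  have "hE (mul T) (mul T) (\<lambda>us. inX (emx g (t # us))) ts
      = hE (mul T) (mul T) (\<lambda>us. inX (g [] x (map sb us)) + inX (emx ?gl us)) ts"
    by (simp add: t snd_comp_snd)
  also have "\<dots> = inX (hE (mul B) (ract X) (g [] x) (map sb ts)) + inX (emx (exX ?gl) ts)"
    using PA.HT.R.hE_add[of "\<lambda>us. inX (g [] x (map sb us))" "\<lambda>us. inX (emx ?gl us)" "mul T" ts]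
    by (simp add: hE_inX_right Cons)
  finally have 1: "hE (mul T) (mul T) (\<lambda>us. inX (emx g (t # us))) ts =
      inX (hE (mul B) (ract X) (g [] x) (map sb ts) + emx (exX ?gl) ts)" by simp
  have 2: "hmu (mul T) (mul T) t (\<lambda>ts. inX (emx g ts)) ts = inX (case ts of [] \<Rightarrow> 0
      | t' # us \<Rightarrow> g [] (lact X a (fst (snd t'))) (map sb us) + g [] (ract X x (sb t')) (map sb us) + emx (\<lambda>as. g (mul A a (fst t') # as)) us)"
    by (cases ts) (auto simp: t mul_zero act_zero snd_comp_snd Cons.prems tri_alg_def split_beta)
  have 3: "emx (\<lambda>as x bs. hmu (mul A) (\<lambda>\<phi> a x. \<phi> (lact X a x)) a (\<lambda>as x. g as x bs) as x) ts =
      (case ts of [] \<Rightarrow> 0 | t' # us \<Rightarrow> g [] (lact X a (fst (snd t'))) (map sb us) + emx (\<lambda>as. g (mul A a (fst t') # as)) us)"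
    by (cases ts) (simp_all add: snd_comp_snd)
  have 4: "exX g [] x (map sb ts) = (case ts of [] \<Rightarrow> 0 | t' # us \<Rightarrow> g [] (ract X x (sb t')) (map sb us))
      - hE (mul B) (ract X) (g [] x) (map sb ts)"
    by (cases ts) (simp_all add: exX_def exL_def exR_def)
  have "(\<lambda>as. exX g (a # as)) = (\<lambda>as x bs.
      hmu (mul A) (\<lambda>\<phi> a x. \<phi> (lact X a x)) a (\<lambda>as x. g as x bs) as x - exX ?gl as x bs)"
    by (intro ext) (rule exX_Cons)
  then have "emx (exX g) (t # ts) = exX g [] x (map sb ts)
     + (emx (\<lambda>as x bs. hmu (mul A) (\<lambda>\<phi> a x. \<phi> (lact X a x)) a (\<lambda>as x. g as x bs) as x) ts - emx (exX ?gl) ts)"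
    by (simp add: t snd_comp_snd emx_diff)
  then show ?case unfolding hE.simps(2) 1 2 3 4
    by (cases ts) (simp_all add: algebra_simps zero_prod_def)
qed (simp add: zero_prod_def)

lemma hD_embX: "hD (T.tau 1) (dif T) (\<lambda>ts. inX (emx g ts)) ts = inX (emx (DX g) ts)"
proof (induction ts arbitrary: g)
  case (Cons t ts)
  obtain a x b where t: "t = (a, x, b)" by (cases t)
  let ?gl = "\<lambda>as. g (A.tau 1 a # as)"
  have "hD (T.tau 1) (dif T) (\<lambda>us. inX (emx g (T.tau 1 t # us))) ts
      = hD (T.tau 1) (dif T) (\<lambda>us. inX (g [] (tw (grd X) 1 x) (map sb us)) + inX (emx ?gl us)) ts"
    by (simp add: t snd_comp_snd tau_tri)
  also have "\<dots> = inX (hD (B.tau 1) (dif B) (g [] (tw (grd X) 1 x)) (map sb ts)) + inX (emx (DX ?gl) ts)"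
    by (simp only: hD_add hD_inX_right Cons)
  finally have 1: "hD (T.tau 1) (dif T) (\<lambda>us. inX (emx g (T.tau 1 t # us))) ts =
      inX (hD (B.tau 1) (dif B) (g [] (tw (grd X) 1 x)) (map sb ts) + emx (DX ?gl) ts)" by simp
  have 2: "emx (\<lambda>as. DX g (a # as)) ts = emx (\<lambda>as. g (dif A a # as)) ts + emx (DX ?gl) ts"
    unfolding emx_add[symmetric] by (rule emx_cong) (simp add: DX_def)
  show ?case unfolding hD.simps(2) 1
    by (simp add: t snd_comp_snd 2) (simp add: DX_def)
qed (simp add: zero_prod_def)

lemma lam_embX: "PA.HT.lam n (\<lambda>ts. inX (emx g ts)) ts = inX (emx (lamX n g) ts)"
proof (cases ts)
  case (Cons t us)
  obtain a x b where t: "t = (a, x, b)" by (cases t)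
  have "emx (\<lambda>as x bs. lact X (A.tau (n - (int (length as) + 1 + int (length bs))) a) (g as x bs)) us
      = lact X (A.tau (n - int (length us)) a) (emx g us)"
    using emx_post_length[of "\<lambda>k. lact X (A.tau (n - k) a)" g us] by (simp add: lact_add_right)
  then show ?thesis
    by (simp add: Cons t tau_tri mul_zero act_zero) (simp add: lamX_def[abs_def])
qed (simp add: zero_prod_def)

lemma dT_embX:
  assumes "\<And>as x y bs. g as (x + y) bs = g as x bs + g as y bs"
  shows "PA.HT.dT n (\<lambda>ts. inX (emx g ts)) ts = inX (emx (dX n g) ts)"
proof -
  have "emx (delX n g) ts = dif X (emx g ts) - sg (n - int (length ts)) (emx (DX g) ts)"
    unfolding delX_def[abs_def] emx_diff
    using emx_post_length[of "\<lambda>k. sg (n - k)" "DX g" ts] emx_post[of "dif X" g ts]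
    by (simp add: sg_add difM_add)
  moreover have "emx (\<lambda>as x bs. sg (n - 1) (lamX n g as x bs - exX g as x bs)) ts =
      sg (n - 1) (emx (lamX n g) ts - emx (exX g) ts)"
    using emx_post[of "sg (n - 1)" "\<lambda>as x bs. lamX n g as x bs - exX g as x bs" ts]
    by (simp add: sg_add emx_diff)
  ultimately show ?thesis
    by (simp add: PA.HT.dT_def PA.HT.dH_def PA.HT.del_def hE_embX[OF assms] hD_embX lam_embX sg_pair
      dX_def[abs_def] emx_add dif_zero)
qed

text \<open>Extension by zero does not commute with the differential: in the right action term a
  value of f in A meets an entry x of X, and this is the only way into the middle component.\<close>

lemma mid_dT_embA: "fst (snd (PA.HT.dT n (\<lambda>ts. (f (map fst ts), 0, 0)) ts)) = - sg (n - 1) (emx (actA f) ts)"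
proof -
  let ?F = "\<lambda>f ts. (f (map fst ts), 0, 0) :: 'a \<times> 'x \<times> 'b"
  have 1: "fst (snd (hE (mul T) (mul T) (?F f) ts)) = emx (actA f) ts" for f
  proof (induction ts arbitrary: f)
    case (Cons t ts)
    obtain a x b where t: "t = (a, x, b)" by (cases t)
    have "fst (snd (hE (mul T) (mul T) (?F f) (t # ts))) = fst (snd (hmu (mul T) (mul T) t (?F f) ts))
       - fst (snd (hE (mul T) (mul T) (?F (\<lambda>as. f (a # as))) ts))"
      by (simp add: t)
    also have "fst (snd (hmu (mul T) (mul T) t (?F f) ts)) = actA f [] x (map sb ts)"
      by (cases ts) (simp_all add: t actA_def act_zero)
    also have "fst (snd (hE (mul T) (mul T) (?F (\<lambda>as. f (a # as))) ts)) = emx (actA (\<lambda>as. f (a # as))) ts"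
      by (rule Cons.IH)
    also have "emx (\<lambda>as. actA f (a # as)) ts = - emx (actA (\<lambda>as. f (a # as))) ts"
      using emx_diff[of "\<lambda>_ _ _. 0" "actA (\<lambda>as. f (a # as))" ts]
      by (simp add: actA_def[abs_def] sg_Suc if_distrib[of uminus] cong: if_cong)
    then have "actA f [] x (map sb ts) - emx (actA (\<lambda>as. f (a # as))) ts = emx (actA f) (t # ts)"
      by (simp add: t snd_comp_snd)
    finally show ?case .
  qed simp
  have 2: "fst (snd (hD (T.tau 1) (dif T) (?F f) ts)) = 0" for f
  proof (induction ts arbitrary: f)
    case (Cons t ts)
    then show ?case using Cons[of "\<lambda>as. f (fst (T.tau 1 t) # as)"] by simp
  qed simp
  have 3: "fst (snd (PA.HT.lam n (?F f) ts)) = 0"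
  proof (cases ts)
    case (Cons t us)
    then show ?thesis by (cases t) (simp add: tau_tri act_zero)
  qed simp
  have "snd (sg k y) = sg k (snd y)" "fst (sg k z) = sg k (fst z)" for k and y :: "'a \<times> 'x \<times> 'b" and z :: "'x \<times> 'b"
    by (simp_all add: sg_def)
  then show ?thesis
    by (simp add: PA.HT.dT_def PA.HT.dH_def PA.HT.del_def 1 2 3 dif_zero sg_diff)
qed

text \<open>Here the middle component comes from the left action term alone, in which a leading
  entry x meets a value of h in B.\<close>

lemma mid_dT_embB: "fst (snd (PA.HT.dT n (\<lambda>ts. (0, 0, h (map sb ts))) ts)) = sg (n - 1) (emx (actB n h) ts)"
proof -
  let ?F = "\<lambda>ts. (0, 0, h (map sb ts)) :: 'a \<times> 'x \<times> 'b"
  have 1: "hE (mul T) (mul T) ?F ts = (0, 0, hE (mul B) (mul B) h (map sb ts))"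
    by (rule hE_rel[where R = "\<lambda>y z. y = (0, 0, z)"])
      (auto simp: mul_zero act_zero zero_prod_def tri_alg_def split_beta)
  have 2: "hD (T.tau 1) (dif T) ?F ts = (0, 0, hD (B.tau 1) (dif B) h (map sb ts))"
    by (rule hD_rel[where R = "\<lambda>y z. y = (0, 0, z)"]) (auto simp: zero_prod_def PB.pi_tw PB.pi_dif)
  have 3: "fst (snd (PA.HT.lam n ?F ts)) = emx (actB n h) ts"
  proof (cases ts)
    case (Cons t us)
    obtain a x b where t: "t = (a, x, b)" by (cases t)
    have "emx (\<lambda>as. actB n h (a # as)) us = 0" by (simp add: actB_def[abs_def])
    then show ?thesis by (simp add: Cons t tau_tri act_zero snd_comp_snd) (simp add: actB_def)
  qed simp
  have "snd (sg k y) = sg k (snd y)" "fst (sg k z) = sg k (fst z)" for k and y :: "'a \<times> 'x \<times> 'b" and z :: "'x \<times> 'b"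
    by (simp_all add: sg_def)
  then show ?thesis
    by (simp add: PA.HT.dT_def PA.HT.dH_def PA.HT.del_def 1 2 3 dif_zero)
qed

definition emb :: "('a list \<Rightarrow> 'a) \<Rightarrow> ('a list \<Rightarrow> 'x \<Rightarrow> 'b list \<Rightarrow> 'x) \<Rightarrow> ('b list \<Rightarrow> 'b) \<Rightarrow>
    ('a \<times> 'x \<times> 'b) list \<Rightarrow> 'a \<times> 'x \<times> 'b" where
  "emb f g h ts = (f (map fst ts), emx g ts, h (map sb ts))"

lemma emb_eq: "embA f + embX g + embB h = emb f g h"
  by (rule ext) (simp add: emb_def embA_def embX_emx embB_def snd_comp_snd)

text \<open>The differential in matrix form: Hoch(A) and Hoch(B) each map into the middle summand,
  and nothing leaves it. This is why both projections are cochain maps.\<close>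

lemma dT_emb:
  assumes "\<And>as x y bs. g as (x + y) bs = g as x bs + g as y bs"
  shows "PA.HT.dT n (emb f g h) = emb (PA.HA.dT n f)
    (\<lambda>as x bs. dX n g as x bs + sg (n - 1) (actB n h as x bs - actA f as x bs)) (PB.HA.dT n h)"
proof
  fix ts
  let ?D = "PA.HT.dT n"
  have "?D (emb f g h) ts = ?D (\<lambda>ts. (f (map fst ts), 0, 0) + inX (emx g ts) + (0, 0, h (map sb ts))) ts"
    by (simp add: emb_def[abs_def])
  also have "\<dots> = ?D (\<lambda>ts. (f (map fst ts), 0, 0)) ts + ?D (\<lambda>ts. inX (emx g ts)) ts + ?D (\<lambda>ts. (0, 0, h (map sb ts))) ts"
    by (simp only: PA.HT.dT_add regular_simps T.tot)
  finally have "fst (snd (?D (emb f g h) ts)) = - sg (n - 1) (emx (actA f) ts) + emx (dX n g) ts + sg (n - 1) (emx (actB n h) ts)"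
    by (simp add: mid_dT_embA mid_dT_embB dT_embX[OF assms])
  also have "\<dots> = emx (\<lambda>as x bs. dX n g as x bs + sg (n - 1) (actB n h as x bs - actA f as x bs)) ts"
    using emx_post[of "sg (n - 1)" "\<lambda>as x bs. actB n h as x bs - actA f as x bs" ts]
    by (simp add: emx_add emx_diff sg_add sg_diff)
  finally show "?D (emb f g h) ts = emb (PA.HA.dT n f)
    (\<lambda>as x bs. dX n g as x bs + sg (n - 1) (actB n h as x bs - actA f as x bs)) (PB.HA.dT n h) ts"
    using PA.pi_dT[of "emb f g h" f n ts] PB.pi_dT[of "emb f g h" h n ts]
    by (simp add: emb_def prod_eq_iff)
qed

section \<open>Recovering the components of an embedded cochain\<close>

definition prX :: "(('a \<times> 'x \<times> 'b) list \<Rightarrow> 'a \<times> 'x \<times> 'b) \<Rightarrow> 'a list \<Rightarrow> 'x \<Rightarrow> 'b list \<Rightarrow> 'x" where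
  "prX F as x bs = fst (snd (F (map (\<lambda>a. (a, 0, 0)) as @ (0, x, 0) # map (\<lambda>b. (0, 0, b)) bs)))"

lemma prX_emb: "(\<And>as bs. g as 0 bs = 0) \<Longrightarrow> prX (emb f g h) = g"
  by (intro ext) (simp add: prX_def emb_def emx_pure)

lemma prA_emb': "prA (emb f g h) = f"
  by (simp add: emb_eq[symmetric] prA_emb)

lemma prB_emb': "prB (emb f g h) = h"
  by (simp add: emb_eq[symmetric] prB_emb)

abbreviation "hochT \<equiv> PA.HT.hoch"

lemma shdeg_map:
  assumes "\<And>s n. s \<in> G n \<Longrightarrow> p s \<in> H n"
  shows "shdeg G k ts \<Longrightarrow> shdeg H k (map p ts)"
  by (induction rule: shdeg.induct) (auto intro: shdeg.intros assms)

text \<open>Lets the middle component inherit multilinearity, degree and bounded arity from a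
  cochain of the triangular algebra.\<close>

lemma hochT_prX:
  assumes F: "hochT n F"
  shows "hochX n (prX F)"
proof (rule hochXI)
  have ml: "multilin (scl T) (scl T) F" using F by (simp add: PA.HT.hoch_def)
  show "multilin (scl A) (scl X) (\<lambda>as. prX F as x bs)" for x bs
    unfolding multilin_def
  proof (intro allI)
    fix as c a a' as'
    have "(scl A c a + a', 0, 0) = scl T c (a, 0, 0) + (a', 0, 0)"
      by (simp add: scl_0[OF gspM] scl_0[OF B.gsp])
    then show "prX F (as @ (scl A c a + a') # as') x bs = scl X c (prX F (as @ a # as') x bs) + prX F (as @ a' # as') x bs"
      using multilinD[OF ml, of "map (\<lambda>a. (a, 0, 0)) as" c "(a, 0, 0)" "(a', 0, 0)"]
      by (simp add: prX_def) (simp add: tri_alg_def split_beta)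
  qed
  show "multilin (scl B) (scl X) (prX F as x)" for as x
    unfolding multilin_def
  proof (intro allI)
    fix bs c b b' bs'
    have "(0, 0, scl B c b + b') = scl T c (0, 0, b) + (0, 0, b')"
      by (simp add: scl_0[OF gspM] scl_0[OF A.gsp])
    then show "prX F as x (bs @ (scl B c b + b') # bs') = scl X c (prX F as x (bs @ b # bs')) + prX F as x (bs @ b' # bs')"
      using multilinD[OF ml, of "map (\<lambda>a. (a, 0, 0)) as @ (0, x, 0) # map (\<lambda>b. (0, 0, b)) bs" c "(0, 0, b)" "(0, 0, b')"]
      by (simp add: prX_def) (simp add: tri_alg_def split_beta)
  qed
  show "prX F as (scl X c x + y) bs = scl X c (prX F as x bs) + prX F as y bs" for as c x y bs
  proof -
    have "(0, scl X c x + y, 0) = scl T c (0, x, 0) + (0, y, 0)"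
      by (simp add: scl_0[OF A.gsp] scl_0[OF B.gsp])
    then show ?thesis
      using multilinD[OF ml, of "map (\<lambda>a. (a, 0, 0)) as" c "(0, x, 0)" "(0, y, 0)"]
      by (simp add: prX_def) (simp add: tri_alg_def split_beta)
  qed
  show "prX F as x bs \<in> grd X (k + m + l + n - 1)"
    if "shdeg (grd A) k as" "x \<in> grd X m" "shdeg (grd B) l bs" for k as m x l bs
  proof -
    have "shdeg (grd T) k (map (\<lambda>a. (a, 0, 0)) as)" "shdeg (grd T) l (map (\<lambda>b. (0, 0, b)) bs)"
      using that by (auto intro!: shdeg_map[where G = "grd A"] shdeg_map[where G = "grd B"]
        simp: grd_0[OF A.gsp] grd_0[OF B.gsp] grd_0[OF gspM])
    moreover have "(0, x, 0) \<in> grd T m" using that by (simp add: grd_0[OF A.gsp] grd_0[OF B.gsp])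
    ultimately have "shdeg (grd T) (k + (l + m - 1)) (map (\<lambda>a. (a, 0, 0)) as @ (0, x, 0) # map (\<lambda>b. (0, 0, b)) bs)"
      by (intro shdeg_append shdeg.Cons)
    moreover have "has_deg (grd T) (grd T) n F" using F by (simp add: PA.HT.hoch_def)
    ultimately have "F (map (\<lambda>a. (a, 0, 0)) as @ (0, x, 0) # map (\<lambda>b. (0, 0, b)) bs) \<in> grd T (k + (l + m - 1) + n)"
      by (simp add: has_deg_def)
    then show ?thesis by (simp add: prX_def tri_alg_def mem_Times_iff algebra_simps)
  qed
  obtain P where P: "\<And>ts. length ts > P \<Longrightarrow> F ts = 0" using F by (auto simp: PA.HT.hoch_def bounded_arity_def)
  show "\<exists>P. \<forall>as x bs. length as + length bs > P \<longrightarrow> prX F as x bs = 0"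
    by (rule exI[of _ P]) (auto simp: prX_def P)
qed

lemma hochT_prA: "hochT n F \<Longrightarrow> PA.HA.hoch n (prA F)"
proof -
  assume F: "hochT n F"
  have ml: "multilin (scl T) (scl T) F" using F by (simp add: PA.HT.hoch_def)
  have "multilin (scl A) (scl A) (prA F)"
    unfolding multilin_def
  proof (intro allI)
    fix as c a a' as'
    have "(scl A c a + a', 0, 0) = scl T c (a, 0, 0) + (a', 0, 0)"
      by (simp add: scl_0[OF gspM] scl_0[OF B.gsp])
    then show "prA F (as @ (scl A c a + a') # as') = scl A c (prA F (as @ a # as')) + prA F (as @ a' # as')"
      using multilinD[OF ml, of "map (\<lambda>a. (a, 0, 0)) as" c "(a, 0, 0)" "(a', 0, 0)"]
      by (simp add: prA_def) (simp add: tri_alg_def split_beta)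
  qed
  moreover have "has_deg (grd A) (grd A) n (prA F)"
    unfolding has_deg_def
  proof (intro allI impI)
    fix k as assume "shdeg (grd A) k as"
    then have "shdeg (grd T) k (map (\<lambda>a. (a, 0, 0)) as)"
      by (intro shdeg_map) (auto simp: grd_0[OF A.gsp] grd_0[OF B.gsp] grd_0[OF gspM])
    then have "F (map (\<lambda>a. (a, 0, 0)) as) \<in> grd T (k + n)" using F by (simp add: PA.HT.hoch_def has_deg_def)
    then show "prA F as \<in> grd A (k + n)" by (simp add: prA_def tri_alg_def mem_Times_iff)
  qed
  moreover have "bounded_arity (prA F)"
  proof -
    obtain P where P: "\<And>ts. length ts > P \<Longrightarrow> F ts = 0" using F by (auto simp: PA.HT.hoch_def bounded_arity_def)
    show ?thesis unfolding bounded_arity_def by (rule exI[of _ P]) (simp add: prA_def P)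
  qed
  ultimately show ?thesis by (simp add: PA.HA.hoch_def)
qed

lemma hochT_prB: "hochT n F \<Longrightarrow> PB.HA.hoch n (prB F)"
proof -
  assume F: "hochT n F"
  have ml: "multilin (scl T) (scl T) F" using F by (simp add: PA.HT.hoch_def)
  have "multilin (scl B) (scl B) (prB F)"
    unfolding multilin_def
  proof (intro allI)
    fix bs c b b' bs'
    have "(0, 0, scl B c b + b') = scl T c (0, 0, b) + (0, 0, b')"
      by (simp add: scl_0[OF gspM] scl_0[OF A.gsp])
    then show "prB F (bs @ (scl B c b + b') # bs') = scl B c (prB F (bs @ b # bs')) + prB F (bs @ b' # bs')"
      using multilinD[OF ml, of "map (\<lambda>b. (0, 0, b)) bs" c "(0, 0, b)" "(0, 0, b')"]
      by (simp add: prB_def) (simp add: tri_alg_def split_beta)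
  qed
  moreover have "has_deg (grd B) (grd B) n (prB F)"
    unfolding has_deg_def
  proof (intro allI impI)
    fix k bs assume "shdeg (grd B) k bs"
    then have "shdeg (grd T) k (map (\<lambda>b. (0, 0, b)) bs)"
      by (intro shdeg_map) (auto simp: grd_0[OF A.gsp] grd_0[OF B.gsp] grd_0[OF gspM])
    then have "F (map (\<lambda>b. (0, 0, b)) bs) \<in> grd T (k + n)" using F by (simp add: PA.HT.hoch_def has_deg_def)
    then show "prB F bs \<in> grd B (k + n)" by (simp add: prB_def tri_alg_def mem_Times_iff)
  qed
  moreover have "bounded_arity (prB F)"
  proof -
    obtain P where P: "\<And>ts. length ts > P \<Longrightarrow> F ts = 0" using F by (auto simp: PA.HT.hoch_def bounded_arity_def)
    show ?thesis unfolding bounded_arity_def by (rule exI[of _ P]) (simp add: prB_def P)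
  qed
  ultimately show ?thesis by (simp add: PB.HA.hoch_def)
qed

text \<open>In each summand the varied entry enters through only one of its three components, and
  the summand is linear in that component.\<close>

lemma multilin_emx:
  assumes "\<And>x bs. multilin (scl A) (scl X) (\<lambda>as. g as x bs)" "\<And>as x. multilin (scl B) (scl X) (g as x)"
    "\<And>as c x y bs. g as (scl X c x + y) bs = scl X c (g as x bs) + g as y bs"
  shows "emx g (ts @ (scl T c s + t) # us) = scl X c (emx g (ts @ s # us)) + emx g (ts @ t # us)"
  using assms
proof (induction ts arbitrary: g)
  case Nil
  obtain a x b where s: "s = (a, x, b)" by (cases s)
  obtain a' x' b' where t: "t = (a', x', b')" by (cases t)
  have "g ((scl A c a + a') # as) = (\<lambda>x bs. scl X c (g (a # as) x bs) + g (a' # as) x bs)" for as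
    using HAX.multilin_lin_hd[OF Nil.prems(1)] by blast
  then show ?case
    using emx_post[of "scl X c" "\<lambda>as. g (a # as)" us]
    by (simp add: s t Nil(3) emx_add scl_add[OF gspM])
next
  case (Cons u ts)
  have "g [] x (map sb (ts @ (scl T c s + t) # us)) = scl X c (g [] x (map sb (ts @ s # us))) + g [] x (map sb (ts @ t # us))" for x
    using multilinD[OF Cons.prems(2)[of "[]" x], of "map sb ts" c "sb s" "sb t" "map sb us"]
    by (simp add: tri_alg_def split_beta)
  moreover have "emx (\<lambda>as. g (fst u # as)) (ts @ (scl T c s + t) # us)
      = scl X c (emx (\<lambda>as. g (fst u # as)) (ts @ s # us)) + emx (\<lambda>as. g (fst u # as)) (ts @ t # us)"
    by (rule Cons.IH) (use Cons.prems multilin_tail in blast)+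
  ultimately show ?case by (simp add: snd_comp_snd scl_add[OF gspM])
qed

text \<open>An entry of A standing before x becomes a fixed argument of g and raises the degree of
  the remaining cochain by its shifted degree, hence the generalisation over n.\<close>

lemma emx_grd:
  assumes "shdeg (grd T) k ts"
    and "\<And>k as m x l bs. shdeg (grd A) k as \<Longrightarrow> x \<in> grd X m \<Longrightarrow> shdeg (grd B) l bs \<Longrightarrow>
        g as x bs \<in> grd X (k + m + l + n - 1)"
  shows "emx g ts \<in> grd X (k + n)"
  using assms
proof (induction arbitrary: g n rule: shdeg.induct)
  case Nil then show ?case by (simp add: grd_0[OF gspM])
next
  case (Cons t m k ts)
  obtain a x b where t: "t = (a, x, b)" by (cases t)
  have h: "a \<in> grd A m" "x \<in> grd X m" using Cons.hyps(1) by (simp_all add: t)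
  have "shdeg (grd B) k (map sb ts)"
    by (rule shdeg_map[OF _ Cons.hyps(2)]) (auto simp: tri_alg_def)
  from Cons.prems[OF shdeg.Nil h(2) this]
  have 1: "g [] x (map sb ts) \<in> grd X (k + m - 1 + n)" by (simp add: algebra_simps)
  have "emx (\<lambda>as. g (a # as)) ts \<in> grd X (k + (n + m - 1))"
  proof (rule Cons.IH)
    fix k as j y l bs
    assume "shdeg (grd A) k as" "y \<in> grd X j" "shdeg (grd B) l bs"
    from Cons.prems[OF shdeg.Cons[where G = "grd A", OF h(1) this(1)] this(2,3)]
    show "g (a # as) y bs \<in> grd X (k + j + l + (n + m - 1) - 1)" by (simp add: algebra_simps)
  qed
  with 1 show ?case by (simp add: t snd_comp_snd grd_add[OF gspM] algebra_simps)
qed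

lemma hochT_emb:
  assumes f: "PA.HA.hoch n f" and g: "hochX n g" and h: "PB.HA.hoch n h"
  shows "hochT n (emb f g h)"
proof -
  have "multilin (scl T) (scl T) (emb f g h)"
    unfolding multilin_def
  proof (intro allI)
    fix ts c s t us
    have "f (map fst (ts @ (scl T c s + t) # us)) = scl A c (f (map fst (ts @ s # us))) + f (map fst (ts @ t # us))"
      using f multilinD[of "scl A" "scl A" f "map fst ts" c "fst s" "fst t" "map fst us"]
      by (simp add: PA.HA.hoch_def tri_alg_def split_beta)
    moreover have "h (map sb (ts @ (scl T c s + t) # us)) = scl B c (h (map sb (ts @ s # us))) + h (map sb (ts @ t # us))"
      using h multilinD[of "scl B" "scl B" h "map sb ts" c "sb s" "sb t" "map sb us"]
      by (simp add: PB.HA.hoch_def tri_alg_def split_beta)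
    moreover note multilin_emx[OF hochXD(1)[OF g] hochXD(3)[OF g] hochXD(2)[OF g], of ts c s t us]
    ultimately show "emb f g h (ts @ (scl T c s + t) # us) = scl T c (emb f g h (ts @ s # us)) + emb f g h (ts @ t # us)"
      unfolding emb_def by (simp only: tri_simps add_Pair)
  qed
  moreover have "has_deg (grd T) (grd T) n (emb f g h)"
    unfolding has_deg_def
  proof (intro allI impI)
    fix k ts assume k: "shdeg (grd T) k ts"
    have "shdeg (grd A) k (map fst ts)" "shdeg (grd B) k (map sb ts)"
      by (rule shdeg_map[OF _ k], auto simp: tri_alg_def)+
    then have "f (map fst ts) \<in> grd A (k + n)" "h (map sb ts) \<in> grd B (k + n)"
      using f h by (simp_all add: PA.HA.hoch_def PB.HA.hoch_def has_deg_def)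
    then show "emb f g h ts \<in> grd T (k + n)"
      by (simp add: emb_def emx_grd[OF k hochXD(4)[OF g]])
  qed
  moreover have "bounded_arity (emb f g h)"
  proof -
    obtain P where P: "\<And>as. length as > P \<Longrightarrow> f as = 0" using f by (auto simp: PA.HA.hoch_def bounded_arity_def)
    obtain Q where Q: "\<And>as. length as > Q \<Longrightarrow> h as = 0" using h by (auto simp: PB.HA.hoch_def bounded_arity_def)
    obtain R where R: "\<And>as x bs. length as + length bs > R \<Longrightarrow> g as x bs = 0" by (rule hochX_bounded[OF g]) blast
    have "emx g ts = 0" if "length ts > R + 1" for ts
      using emx_cong[of ts g "\<lambda>_ _ _. 0"] R that by simp
    then show ?thesis
      unfolding bounded_arity_def using P Q
      by (intro exI[of _ "max (max P Q) (R + 1)"]) (auto simp: emb_def zero_prod_def)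
  qed
  ultimately show ?thesis by (simp add: PA.HT.hoch_def)
qed

end

section \<open>Surjections with acyclic kernel\<close>

text \<open>Bijectivity is a diagram chase. Since \<open>\<pi>\<close> maps coboundaries onto
  coboundaries, the image of a class is a whole class, so operations defined by all representatives
  are respected as soon as \<open>\<pi>\<close> respects them on cochains.\<close>

lemma gerstenhaber_iso_of_acyclic_kernel:
  fixes V :: "('k, 'v::ab_group_add) gcomplex" and W :: "('k, 'w::ab_group_add) gcomplex"
  assumes V0: "\<And>n. 0 \<in> grd V n" and Vdiff: "\<And>n x y. x \<in> grd V n \<Longrightarrow> y \<in> grd V n \<Longrightarrow> x - y \<in> grd V n"
    and dV: "\<And>n x. x \<in> grd V n \<Longrightarrow> dif V x \<in> grd V (n + 1)"
    and dVdiff: "\<And>n x y. x \<in> grd V n \<Longrightarrow> y \<in> grd V n \<Longrightarrow> dif V (x - y) = dif V x - dif V y"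
    and ddV: "\<And>n x. x \<in> grd V n \<Longrightarrow> dif V (dif V x) = 0"
    and pdiff: "\<And>x y. \<pi> (x - y) = \<pi> x - \<pi> y"
    and pscl: "\<And>c x. \<pi> (scl V c x) = scl W c (\<pi> x)"
    and pgrd: "\<And>n. \<pi> ` grd V n = grd W n"
    and pdif: "\<And>n x. x \<in> grd V n \<Longrightarrow> \<pi> (dif V x) = dif W (\<pi> x)"
    and pcup: "\<And>m n x y. x \<in> grd V m \<Longrightarrow> y \<in> grd V n \<Longrightarrow> \<pi> (cupp V m n x y) = cupp W m n (\<pi> x) (\<pi> y)"
    and pbrk: "\<And>m n x y. x \<in> grd V m \<Longrightarrow> y \<in> grd V n \<Longrightarrow> \<pi> (brkt V m n x y) = brkt W m n (\<pi> x) (\<pi> y)"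
    and ker: "\<And>n x. x \<in> grd V n \<Longrightarrow> \<pi> x = 0 \<Longrightarrow> dif V x = 0 \<Longrightarrow>
      \<exists>y\<in>grd V (n - 1). \<pi> y = 0 \<and> dif V y = x"
  shows "gerstenhaber_iso (HH V) (HH W) (coh_map W \<pi>)"
proof -
  have p0: "\<pi> 0 = 0" using pdiff[of 0 0] by simp
  have padd: "\<pi> (x + y) = \<pi> x + \<pi> y" for x y
    using pdiff[of "x + y" y] by (simp add: algebra_simps)
  have pgrdI: "\<pi> x \<in> grd W n" if "x \<in> grd V n" for x n using pgrd[of n] that by blast
  have dWdiff: "dif W (x - y) = dif W x - dif W y" if xy: "x \<in> grd W n" "y \<in> grd W n" for n x y
  proof -
    obtain x' y' where "x' \<in> grd V n" "y' \<in> grd V n" "x = \<pi> x'" "y = \<pi> y'"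
      using xy pgrd[of n] by blast
    then show ?thesis using dVdiff[of x' n y'] pdif[of x' n] pdif[of y' n] pdif[of "x' - y'" n] Vdiff[of x' n y']
      by (simp add: pdiff)
  qed
  have Wdiff: "x - y \<in> grd W n" if xy: "x \<in> grd W n" "y \<in> grd W n" for n x y
  proof -
    obtain x' y' where "x' \<in> grd V n" "y' \<in> grd V n" "x = \<pi> x'" "y = \<pi> y'"
      using xy pgrd[of n] by blast
    then show ?thesis using Vdiff[of x' n y'] by (simp add: pdiff[symmetric] pgrdI)
  qed
  have W0: "0 \<in> grd W n" for n using pgrdI[OF V0] by (simp add: p0)
  have bd: "\<pi> ` coboundaries V n = coboundaries W n" for n
  proof -
    have "\<pi> ` coboundaries V n = dif W ` \<pi> ` grd V (n - 1)"
      unfolding coboundaries_def image_image by (intro image_cong) (simp_all add: pdif)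
    then show ?thesis by (simp add: pgrd coboundaries_def)
  qed
  have bW0: "0 \<in> coboundaries W n" for n
    using dWdiff[OF W0 W0] W0[of "n - 1"] by (auto simp: coboundaries_def image_iff intro!: bexI[of _ 0])
  have bV0: "0 \<in> coboundaries V n" for n
    using dVdiff[OF V0 V0] V0[of "n - 1"] by (auto simp: coboundaries_def image_iff intro!: bexI[of _ 0])
  have bWd: "x - y \<in> coboundaries W n" if xy: "x \<in> coboundaries W n" "y \<in> coboundaries W n" for x y n
  proof -
    obtain x' y' where h: "x' \<in> grd W (n - 1)" "y' \<in> grd W (n - 1)" "x = dif W x'" "y = dif W y'"
      using xy unfolding coboundaries_def by blast
    then have "x - y = dif W (x' - y')" by (simp add: dWdiff)
    then show ?thesis unfolding coboundaries_def using Wdiff[OF h(1,2)] by blast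
  qed
  have bVd: "x - y \<in> coboundaries V n" if xy: "x \<in> coboundaries V n" "y \<in> coboundaries V n" for x y n
  proof -
    obtain x' y' where h: "x' \<in> grd V (n - 1)" "y' \<in> grd V (n - 1)" "x = dif V x'" "y = dif V y'"
      using xy unfolding coboundaries_def by blast
    then have "x - y = dif V (x' - y')" by (simp add: dVdiff)
    then show ?thesis unfolding coboundaries_def using Vdiff[OF h(1,2)] by blast
  qed
  have bWa: "x + y \<in> coboundaries W n" if "x \<in> coboundaries W n" "y \<in> coboundaries W n" for x y n
    using bWd[OF that(1) bWd[OF bW0 that(2)]] by simp
  have bVg: "x \<in> grd V n" if "x \<in> coboundaries V n" for x n
    using that dV[of _ "n - 1"] by (auto simp: coboundaries_def)
  have sub: "S \<subseteq> add_bd W n S" for n S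
  proof
    fix x assume "x \<in> S"
    then have "x + 0 \<in> add_bd W n S" using bW0[of n] unfolding add_bd_def by blast
    then show "x \<in> add_bd W n S" by simp
  qed
  have idem: "add_bd W n (add_bd W n S) = add_bd W n S" for n S
  proof
    show "add_bd W n (add_bd W n S) \<subseteq> add_bd W n S"
    proof
      fix z assume "z \<in> add_bd W n (add_bd W n S)"
      then obtain x b c where z: "x \<in> S" "b \<in> coboundaries W n" "c \<in> coboundaries W n" "z = x + b + c"
        unfolding add_bd_def by blast
      then have "z = x + (b + c)" "b + c \<in> coboundaries W n" using bWa by (simp_all add: add.assoc)
      then show "z \<in> add_bd W n S" using z(1) unfolding add_bd_def by blast
    qed
    show "add_bd W n S \<subseteq> add_bd W n (add_bd W n S)"
      by (rule sub)
  qed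
  have img: "\<pi> ` add_bd V n S = add_bd W n (\<pi> ` S)" for n S
    unfolding add_bd_def bd[symmetric] by (force simp: padd image_iff)
  have cm: "coh_map W \<pi> n (add_bd V n S) = add_bd W n (\<pi> ` S)" for n S
    by (simp add: coh_map_def img idem)
  have cmC: "coh_map W \<pi> n C = \<pi> ` C" and Cg: "C \<subseteq> grd V n" if C: "C \<in> coh V n" for C n
  proof -
    obtain x where x: "x \<in> cocycles V n" "C = add_bd V n {x}" using C by (auto simp: coh_def)
    show "coh_map W \<pi> n C = \<pi> ` C" by (simp add: x(2) cm img)
    have "x + b \<in> grd V n" if "b \<in> coboundaries V n" for b
      using Vdiff[of x n "0 - b"] Vdiff[OF V0 bVg[OF that]] x(1) by (simp add: cocycles_def)
    then show "C \<subseteq> grd V n" by (auto simp: x(2) add_bd_def)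
  qed
  have mem: "z \<in> add_bd U n {x} \<longleftrightarrow> z - x \<in> coboundaries U n"
    for z x n and U :: "('k, 'u::ab_group_add) gcomplex"
  proof
    assume "z - x \<in> coboundaries U n"
    moreover have "z = x + (z - x)" by simp
    ultimately show "z \<in> add_bd U n {x}" unfolding add_bd_def by blast
  qed (auto simp: add_bd_def)
  have cls: "add_bd W n {x} = add_bd W n {y} \<longleftrightarrow> x - y \<in> coboundaries W n" for x y n
  proof
    assume "add_bd W n {x} = add_bd W n {y}"
    moreover have "x \<in> add_bd W n {x}" using bW0 by (simp add: mem)
    ultimately show "x - y \<in> coboundaries W n" by (simp add: mem)
  next
    assume a: "x - y \<in> coboundaries W n"
    have "z - x \<in> coboundaries W n \<longleftrightarrow> z - y \<in> coboundaries W n" for z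
      using bWa[OF _ a, of "z - x"] bWd[OF _ a, of "z - y"] by auto
    then show "add_bd W n {x} = add_bd W n {y}" by (auto simp: mem)
  qed
  have clsV: "add_bd V n {x} = add_bd V n {y}" if a: "x - y \<in> coboundaries V n" for x y n
  proof -
    have "z - x \<in> coboundaries V n \<longleftrightarrow> z - y \<in> coboundaries V n" for z
      using bVd[OF _ bVd[OF bV0 a], of "z - x"] bVd[OF _ a, of "z - y"] by auto
    then show ?thesis by (auto simp: mem)
  qed
  have bij: "bij_betw (coh_map W \<pi> n) (coh V n) (coh W n)" for n
    unfolding bij_betw_def
  proof
    show "inj_on (coh_map W \<pi> n) (coh V n)"
    proof (rule inj_onI)
      fix C D assume CD: "C \<in> coh V n" "D \<in> coh V n" "coh_map W \<pi> n C = coh_map W \<pi> n D"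
      obtain x y where x: "x \<in> cocycles V n" "C = add_bd V n {x}" and y: "y \<in> cocycles V n" "D = add_bd V n {y}"
        using CD(1,2) by (auto simp: coh_def)
      have g: "x \<in> grd V n" "y \<in> grd V n" "dif V x = 0" "dif V y = 0" using x y by (simp_all add: cocycles_def)
      have "\<pi> x - \<pi> y \<in> coboundaries W n" using CD(3) by (simp add: x(2) y(2) cm cls)
      then obtain w where w: "w \<in> grd V (n - 1)" "\<pi> x - \<pi> y = dif W (\<pi> w)"
        unfolding coboundaries_def pgrd[symmetric] by blast
      have dw: "dif V w \<in> grd V n" using dV[OF w(1)] by simp
      \<comment> \<open>The images of x and y differ by a coboundary, which lifts along the
        surjection to the boundary of w; what is left is a cocycle in the kernel.\<close>
      let ?u = "x - y - dif V w"
      have "?u \<in> grd V n" by (intro Vdiff g dw)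
      moreover have "\<pi> ?u = 0" using w by (simp add: pdiff pdif)
      moreover have "dif V ?u = 0"
        using dVdiff[OF Vdiff[OF g(1,2)] dw] dVdiff[OF g(1,2)] g ddV[OF w(1)] by simp
      ultimately obtain z where z: "z \<in> grd V (n - 1)" "dif V z = ?u" using ker by blast
      have "x - y = dif V (w - (0 - z))"
        using dVdiff[OF w(1) Vdiff[OF V0 z(1)]] dVdiff[OF V0 z(1)] dVdiff[OF V0 V0] z(2) by simp
      moreover have "w - (0 - z) \<in> grd V (n - 1)" by (intro Vdiff V0 w z)
      ultimately have "x - y \<in> coboundaries V n" unfolding coboundaries_def by blast
      then show "C = D" by (simp add: x(2) y(2) clsV)
    qed
    show "coh_map W \<pi> n ` coh V n = coh W n"
    proof
      show "coh_map W \<pi> n ` coh V n \<subseteq> coh W n"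
      proof clarify
        fix C assume "C \<in> coh V n"
        then obtain x where x: "x \<in> cocycles V n" "C = add_bd V n {x}" by (auto simp: coh_def)
        have "\<pi> x \<in> cocycles W n" using x(1) pdif[of x n] by (simp add: cocycles_def pgrdI p0)
        then show "coh_map W \<pi> n C \<in> coh W n" by (simp add: x(2) cm coh_def)
      qed
      show "coh W n \<subseteq> coh_map W \<pi> n ` coh V n"
      proof
        fix D assume "D \<in> coh W n"
        then obtain y where y: "y \<in> grd W n" "dif W y = 0" "D = add_bd W n {y}" by (auto simp: coh_def cocycles_def)
        obtain x where x: "x \<in> grd V n" "y = \<pi> x" using y(1) pgrd[of n] by blast
        \<comment> \<open>The lift x need not be a cocycle, but its differential is a cocycle in the
          kernel; subtracting a kernel element with the same differential repairs it.\<close>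
        have "\<pi> (dif V x) = 0" using y(2) x by (simp add: pdif)
        then obtain z where z: "z \<in> grd V n" "\<pi> z = 0" "dif V z = dif V x"
          using ker[OF dV[OF x(1)] _ ddV[OF x(1)]] by auto
        have "x - z \<in> cocycles V n" using dVdiff[OF x(1) z(1)] z x by (simp add: cocycles_def Vdiff)
        moreover have "coh_map W \<pi> n (add_bd V n {x - z}) = D" by (simp add: cm pdiff z(2) y(3) x(2))
        ultimately show "D \<in> coh_map W \<pi> n ` coh V n" unfolding coh_def by blast
      qed
    qed
  qed
  have img2: "\<pi> ` {F x y |x y. x \<in> C \<and> y \<in> D} = {G x y |x y. x \<in> \<pi> ` C \<and> y \<in> \<pi> ` D}"
    if "\<And>x y. x \<in> C \<Longrightarrow> y \<in> D \<Longrightarrow> \<pi> (F x y) = G (\<pi> x) (\<pi> y)" for F G C D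
  proof
    show "\<pi> ` {F x y |x y. x \<in> C \<and> y \<in> D} \<subseteq> {G x y |x y. x \<in> \<pi> ` C \<and> y \<in> \<pi> ` D}" using that by fastforce
    show "{G x y |x y. x \<in> \<pi> ` C \<and> y \<in> \<pi> ` D} \<subseteq> \<pi> ` {F x y |x y. x \<in> C \<and> y \<in> D}"
    proof clarify
      fix x y assume "x \<in> C" "y \<in> D"
      then have "G (\<pi> x) (\<pi> y) = \<pi> (F x y)" "F x y \<in> {F x y |x y. x \<in> C \<and> y \<in> D}" using that by auto
      then show "G (\<pi> x) (\<pi> y) \<in> \<pi> ` {F x y |x y. x \<in> C \<and> y \<in> D}" by (rule image_eqI)
    qed
  qed
  show ?thesis
    unfolding gerstenhaber_iso_def HH_def gerst.simps
  proof (intro conjI allI ballI)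
    show "bij_betw (coh_map W \<pi> n) (coh V n) (coh W n)" for n by (rule bij)
    fix n C D assume C: "C \<in> coh V n" and D: "D \<in> coh V n"
    have "\<pi> ` {x + y |x y. x \<in> C \<and> y \<in> D} = {x + y |x y. x \<in> \<pi> ` C \<and> y \<in> \<pi> ` D}"
      by (rule img2) (simp add: padd)
    then show "coh_map W \<pi> n (add_bd V n {x + y |x y. x \<in> C \<and> y \<in> D}) =
        add_bd W n {x + y |x y. x \<in> coh_map W \<pi> n C \<and> y \<in> coh_map W \<pi> n D}"
      unfolding cm cmC[OF C] cmC[OF D] by simp
  next
    fix n c C assume C: "C \<in> coh V n"
    show "coh_map W \<pi> n (add_bd V n (scl V c ` C)) = add_bd W n (scl W c ` coh_map W \<pi> n C)"
      unfolding cm cmC[OF C] by (simp add: image_image pscl)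
  next
    fix m n C D assume C: "C \<in> coh V m" and D: "D \<in> coh V n"
    have "\<pi> ` {cupp V m n x y |x y. x \<in> C \<and> y \<in> D} = {cupp W m n x y |x y. x \<in> \<pi> ` C \<and> y \<in> \<pi> ` D}"
      by (rule img2) (rule pcup[OF subsetD[OF Cg[OF C]] subsetD[OF Cg[OF D]]])
    then show "coh_map W \<pi> (m + n) (add_bd V (m + n) {cupp V m n x y |x y. x \<in> C \<and> y \<in> D}) =
        add_bd W (m + n) {cupp W m n x y |x y. x \<in> coh_map W \<pi> m C \<and> y \<in> coh_map W \<pi> n D}"
      unfolding cm cmC[OF C] cmC[OF D] by simp
    have "\<pi> ` {brkt V m n x y |x y. x \<in> C \<and> y \<in> D} = {brkt W m n x y |x y. x \<in> \<pi> ` C \<and> y \<in> \<pi> ` D}"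
      by (rule img2) (rule pbrk[OF subsetD[OF Cg[OF C]] subsetD[OF Cg[OF D]]])
    then show "coh_map W \<pi> (m + n - 1) (add_bd V (m + n - 1) {brkt V m n x y |x y. x \<in> C \<and> y \<in> D}) =
        add_bd W (m + n - 1) {brkt W m n x y |x y. x \<in> coh_map W \<pi> m C \<and> y \<in> coh_map W \<pi> n D}"
      unfolding cm cmC[OF C] cmC[OF D] by simp
  qed
qed

section \<open>The projections\<close>

context alg_morphism
begin

lemma hoch_deg_self: "hoch_deg A A n = {f. HA.hoch n f}"
  using HA.hoch_deg_iff by (auto simp: hoch_deg_def hoch_pr_def)

lemma hoch_del_self: "hoch_del A A = hoch_del A (regular_bimod A)"
  by (simp add: fun_eq_iff hoch_del_def hoch_del_pr_def hoch_deg_def[abs_def] hoch_pr_def)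

lemma grd_Hoch: "grd (Hoch A) n = {f. HA.hoch n f}"
  by (simp add: Hoch_def hoch_deg_self)

lemma dif_Hoch: "HA.hoch n f \<Longrightarrow> dif (Hoch A) f = HA.dT n f"
  by (simp add: Hoch_def hoch_del_self HA.hoch_dH_eq HA.hoch_del_eq HA.dT_def[abs_def] plus_fun_def)

text \<open>A cochain map is tested on the whole total space, while the differential is defined
  degree by degree; its additivity across degrees comes from \<open>lext_add\<close>.\<close>

lemma dif_Hoch_add:
  assumes x: "x \<in> gtot (grd (Hoch A))" and y: "y \<in> gtot (grd (Hoch A))"
  shows "dif (Hoch A) (x + y) = dif (Hoch A) x + dif (Hoch A) y"
proof -
  let ?V = "\<lparr>scl = (\<lambda>c f as. scl (regular_bimod A) c (f as)), grd = hoch_deg A (regular_bimod A), dif = undefined\<rparr>"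
  have V: "graded_space ?V" by (rule HA.graded_space_hoch) simp_all
  have g: "grd (Hoch A) = grd ?V" by (auto simp: grd_Hoch HA.hoch_deg_iff)
  note xy = x[unfolded g] y[unfolded g]
  have 1: "hoch_dH A (regular_bimod A) (x + y) = hoch_dH A (regular_bimod A) x + hoch_dH A (regular_bimod A) y"
    unfolding hoch_dH_def
    by (rule lext_add[OF V xy, unfolded dgspace.simps])
      (simp add: fun_eq_iff HA.dH_sum HA.dH_add plus_fun_def)
  have 2: "hoch_del A (regular_bimod A) (x + y) = hoch_del A (regular_bimod A) x + hoch_del A (regular_bimod A) y"
    unfolding hoch_del_def
    by (rule lext_add[OF V xy, unfolded dgspace.simps])
      (simp add: fun_eq_iff HA.del_sum HA.del_add plus_fun_def)
  show ?thesis by (simp add: Hoch_def hoch_del_self 1 2)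
qed

lemma dif_Hoch_sum:
  assumes "\<And>i. i \<in> S \<Longrightarrow> v i \<in> gtot (grd (Hoch A))"
  shows "dif (Hoch A) (sum v S) = (\<Sum>i\<in>S. dif (Hoch A) (v i))"
proof -
  let ?V = "\<lparr>scl = (\<lambda>c f as. scl (regular_bimod A) c (f as)), grd = hoch_deg A (regular_bimod A), dif = undefined\<rparr>"
  have V: "graded_space ?V" by (rule HA.graded_space_hoch) simp_all
  have g: "grd (Hoch A) = grd ?V" by (auto simp: grd_Hoch HA.hoch_deg_iff)
  have 0: "dif (Hoch A) 0 = 0"
    using dif_Hoch_add[of 0 0] gtot_0[OF V] by (simp add: g)
  show ?thesis using assms
  proof (induction S rule: infinite_finite_induct)
    case (insert i S)
    have "sum v S \<in> gtot (grd (Hoch A))"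
      unfolding g by (rule gtot_sum[OF V]) (rule insert.prems[unfolded g], simp)
    then have "dif (Hoch A) (v i + sum v S) = dif (Hoch A) (v i) + dif (Hoch A) (sum v S)"
      by (intro dif_Hoch_add insert.prems) simp
    moreover have "dif (Hoch A) (sum v S) = (\<Sum>i\<in>S. dif (Hoch A) (v i))"
      by (rule insert.IH) (simp add: insert.prems)
    ultimately show ?case by (simp only: sum.insert[OF insert.hyps])
  qed (simp_all add: 0)
qed

lemma Hoch_gtot: "f \<in> grd (Hoch A) n \<Longrightarrow> f \<in> gtot (grd (Hoch A))"
proof -
  let ?V = "\<lparr>scl = (\<lambda>c f as. scl (regular_bimod A) c (f as)), grd = hoch_deg A (regular_bimod A), dif = undefined\<rparr>"
  have V: "graded_space ?V" by (rule HA.graded_space_hoch) simp_all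
  have g: "grd (Hoch A) = grd ?V" by (auto simp: grd_Hoch HA.hoch_deg_iff)
  show "f \<in> grd (Hoch A) n \<Longrightarrow> f \<in> gtot (grd (Hoch A))" unfolding g by (rule grd_gtot[OF V])
qed

end

lemma (in dg_alg) alg_morphism_id: "alg_morphism A A (\<lambda>a. a)"
  by unfold_locales (simp_all add: lin_deg_def)

section \<open>The bimodule complex inside the Hochschild complex of the triangular algebra\<close>

context triple
begin

sublocale TT: alg_morphism T T "\<lambda>t. t" by (rule T.alg_morphism_id)

abbreviation V :: "('k, ('a \<times> 'x \<times> 'b) list \<Rightarrow> 'a \<times> 'x \<times> 'b) gcomplex" where
  "V \<equiv> Hoch_bimod A X B"

lemma V_simps: "scl V = scl (Hoch T)" "dif V = dif (Hoch T)" "cupp V = cupp (Hoch T)" "brkt V = brkt (Hoch T)"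
  by (simp_all add: Hoch_bimod_def)

lemma grd_V: "F \<in> grd V n \<longleftrightarrow> (\<exists>f g h. PA.HA.hoch n f \<and> hochX n g \<and> PB.HA.hoch n h \<and> F = emb f g h)"
  by (auto simp: Hoch_bimod_def PA.hoch_deg_self PB.hoch_deg_self hochX_deg_iff emb_eq)

lemma grd_V_T: "F \<in> grd V n \<Longrightarrow> hochT n F"
  unfolding grd_V using hochT_emb by blast

text \<open>A homogeneous cochain of the triangular algebra of embedded shape has homogeneous
  components, since the projections recover them. Closure under the differential then needs only the
  shape given by \<open>dT_emb\<close>.\<close>

lemma grd_V_iff: "F \<in> grd V n \<longleftrightarrow> hochT n F \<and> (\<exists>f g h. F = emb f g h \<and> (\<forall>as bs. g as 0 bs = 0))"
proof
  assume F: "F \<in> grd V n"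
  then obtain f g h where "hochX n g" "F = emb f g h" unfolding grd_V by blast
  then show "hochT n F \<and> (\<exists>f g h. F = emb f g h \<and> (\<forall>as bs. g as 0 bs = 0))"
    using grd_V_T[OF F] hochX_0_x by blast
next
  assume "hochT n F \<and> (\<exists>f g h. F = emb f g h \<and> (\<forall>as bs. g as 0 bs = 0))"
  then obtain f g h where F: "hochT n F" "F = emb f g h" "\<And>as bs. g as 0 bs = 0" by blast
  then have "f = prA F" "g = prX F" "h = prB F" by (simp_all add: prA_emb' prB_emb' prX_emb)
  then show "F \<in> grd V n" unfolding grd_V using F hochT_prA hochT_prB hochT_prX by metis
qed

lemma dif_V: "F \<in> grd V n \<Longrightarrow> dif V F = PA.HT.dT n F"
  using TT.dif_Hoch grd_V_T by (simp add: V_simps)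

text \<open>Vanishing at x = 0 is the condition under which \<open>prX\<close> recovers the middle
  component.\<close>

lemma dX_0_x:
  assumes "\<And>as bs. g as 0 bs = 0" shows "dX n g as 0 bs = 0"
proof -
  interpret RX: right_action UNIV "ract X" by standard (simp_all add: ract_add_left)
  have "lamX n g as 0 bs = 0" by (cases as) (simp_all add: lamX_def assms act_zero)
  moreover have "exL g as 0 bs = 0"
    using assms unfolding exL_def
  proof (induction as arbitrary: g)
    case (Cons a as)
    have "hmu (mul A) (\<lambda>\<phi> a x. \<phi> (lact X a x)) a (\<lambda>as x. g as x bs) as 0 = 0"
      by (cases as) (simp_all add: act_zero Cons.prems)
    then show ?case using Cons.IH[of "\<lambda>as. g (a # as)"] Cons.prems by simp
  qed simp
  moreover have "exR g as 0 bs = 0"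
    using RX.hE_eq_0[of bs "g as 0" "mul B"] by (cases bs) (simp_all add: exR_def assms act_zero)
  moreover have "DX g as 0 bs = 0"
    by (simp add: DX_def assms hD_eq_0 dif_zero tau_zero)
  ultimately show ?thesis by (simp add: dX_def delX_def exX_def assms dif_zero)
qed

lemma dT_V:
  assumes "F \<in> grd V n" shows "PA.HT.dT n F \<in> grd V (n + 1)"
proof -
  obtain f g h where F: "hochX n g" "F = emb f g h" using assms unfolding grd_V by blast
  note add = hochX_add_x[OF F(1)]
  have "hochT (n + 1) (PA.HT.dT n F)" by (rule PA.HT.hoch_dT[OF grd_V_T[OF assms]])
  moreover have "dX n g as 0 bs + sg (n - 1) (actB n h as 0 bs - actA f as 0 bs) = 0" for as bs
    using dX_0_x[of g n as bs] by (simp add: hochX_0_x[OF F(1)] actA_def actB_def act_zero tau_zero)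
  ultimately show ?thesis unfolding grd_V_iff F(2) dT_emb[OF add] by blast
qed

lemma dif_V_grd: "F \<in> grd V n \<Longrightarrow> dif V F \<in> grd V (n + 1)"
  by (simp add: dif_V dT_V)

lemma grd_V_0: "0 \<in> grd V n"
proof -
  have "emb (\<lambda>_. 0) (\<lambda>_ _ _. 0) (\<lambda>_. 0) = 0" by (rule ext) (simp add: emb_def zero_prod_def)
  then show ?thesis unfolding grd_V using PA.HA.hoch_zero hochX_zero PB.HA.hoch_zero by metis
qed

lemma emb_diff: "emb f g h - emb f' g' h' = emb (\<lambda>as. f as - f' as) (\<lambda>as x bs. g as x bs - g' as x bs) (\<lambda>bs. h bs - h' bs)"
  by (rule ext) (simp add: emb_def emx_diff)

lemma grd_V_diff: "F \<in> grd V n \<Longrightarrow> G \<in> grd V n \<Longrightarrow> F - G \<in> grd V n"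
proof -
  assume "F \<in> grd V n" "G \<in> grd V n"
  then obtain f g h f' g' h' where F: "PA.HA.hoch n f" "hochX n g" "PB.HA.hoch n h" "F = emb f g h"
    and G: "PA.HA.hoch n f'" "hochX n g'" "PB.HA.hoch n h'" "G = emb f' g' h'" unfolding grd_V by blast
  show ?thesis
    unfolding grd_V F(4) G(4) emb_diff
    using PA.HA.hoch_diff[OF F(1) G(1)] hochX_diff[OF F(2) G(2)] PB.HA.hoch_diff[OF F(3) G(3)] by blast
qed

lemma dif_V_diff: "F \<in> grd V n \<Longrightarrow> G \<in> grd V n \<Longrightarrow> dif V (F - G) = dif V F - dif V G"
proof
  fix ts
  assume F: "F \<in> grd V n" and G: "G \<in> grd V n"
  have "dif V (F - G) = PA.HT.dT n (\<lambda>ts. F ts - G ts)"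
    using dif_V[OF grd_V_diff[OF F G]] by (simp only: fun_diff_def)
  then show "dif V (F - G) ts = (dif V F - dif V G) ts"
    by (simp add: PA.HT.dT_diff dif_V[OF F] dif_V[OF G])
qed

lemma dif_V_dif_V: "F \<in> grd V n \<Longrightarrow> dif V (dif V F) = 0"
proof
  fix ts assume F: "F \<in> grd V n"
  show "dif V (dif V F) ts = 0 ts"
    using PA.HT.dT_dT[OF grd_V_T[OF F], of ts] by (simp add: dif_V[OF F] dif_V[OF dT_V[OF F]])
qed

text \<open>Common part of the two projections. The map \<open>\<iota>\<close> includes the factor
  into the triangular algebra, and evaluating F on entries from the factor gives the cochain related
  to F along \<open>\<pi>\<close>.\<close>

lemma projection_iso:
  fixes A' :: "('k, 'c::ab_group_add) dgalg"
  assumes mor: "alg_morphism T A' \<pi>" and pr: "pr = (\<lambda>F as. \<pi> (F (map \<iota> as)))" and iota: "\<And>a. \<pi> (\<iota> a) = a"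
    and rel: "\<And>n F ts. F \<in> grd V n \<Longrightarrow> \<pi> (F ts) = pr F (map \<pi> ts)"
    and img: "\<And>n. pr ` grd V n = grd (Hoch A') n"
    and ker: "\<And>n F. F \<in> grd V n \<Longrightarrow> pr F = 0 \<Longrightarrow> dif V F = 0 \<Longrightarrow>
      \<exists>G\<in>grd V (n - 1). pr G = 0 \<and> dif V G = F"
  shows "cochain_map V (Hoch A') pr \<and> gerstenhaber_iso (HH V) (HH (Hoch A')) (coh_map (Hoch A') pr)"
proof -
  interpret P: alg_morphism T A' \<pi> by (rule mor)
  have io: "map \<pi> (map \<iota> as) = as" for as by (simp add: comp_def iota)
  have d: "pr (dif V F) = dif (Hoch A') (pr F)" if F: "F \<in> grd V n" for F n
  proof -
    have "P.HA.hoch n (pr F)" using img[of n] F P.grd_Hoch by blast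
    then have "dif (Hoch A') (pr F) = P.HA.dT n (pr F)" by (rule P.dif_Hoch)
    moreover have "pr (dif V F) as = P.HA.dT n (pr F) as" for as
      using P.pi_dT[of F "pr F" n "map \<iota> as", OF rel[OF F]] by (simp only: dif_V[OF F] pr io)
    ultimately show ?thesis by auto
  qed
  have padd: "pr (F + G) = pr F + pr G" for F G by (simp add: pr fun_eq_iff P.pi_add)
  have p0: "pr 0 = 0" by (simp add: pr fun_eq_iff P.pi_0)
  have psum: "pr (sum v S) = (\<Sum>i\<in>S. pr (v i))" for v and S :: "int set"
    by (induction S rule: infinite_finite_induct) (simp_all only: padd p0 sum.infinite sum.empty sum.insert simp_thms)
  have pscl: "pr (scl V c F) = scl (Hoch A') c (pr F)" for c F
    using lin_degD(2)[OF P.pi_lin T.tot] by (simp add: pr Hoch_bimod_def Hoch_def)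
  have gV: "grd V n \<subseteq> grd (Hoch T) n" for n using grd_V_T TT.grd_Hoch by blast
  have "pr (dif V F) = dif (Hoch A') (pr F)" if F: "F \<in> gtot (grd V)" for F
  proof -
    obtain v where v: "\<And>n. v n \<in> grd V n" "F = sum v {n. v n \<noteq> 0}"
      using F by (auto simp: gtot_def is_decomp_def)
    let ?S = "{n. v n \<noteq> 0}"
    have "dif V (sum v ?S) = (\<Sum>n\<in>?S. dif V (v n))"
      unfolding V_simps by (rule TT.dif_Hoch_sum) (rule TT.Hoch_gtot[OF subsetD[OF gV v(1)]])
    then have "pr (dif V F) = (\<Sum>n\<in>?S. pr (dif V (v n)))"
      by (simp only: v(2)[symmetric] psum)
    also have "\<dots> = (\<Sum>n\<in>{n. v n \<noteq> 0}. dif (Hoch A') (pr (v n)))" by (simp add: d[OF v(1)])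
    also have "\<dots> = dif (Hoch A') (\<Sum>n\<in>{n. v n \<noteq> 0}. pr (v n))"
      by (rule P.dif_Hoch_sum[symmetric]) (use v(1) img P.Hoch_gtot in blast)
    finally show ?thesis using v(2) psum by simp
  qed
  moreover have "lin_deg V (Hoch A') 0 pr"
    unfolding lin_deg_def using padd pscl img by fastforce
  moreover have "gerstenhaber_iso (HH V) (HH (Hoch A')) (coh_map (Hoch A') pr)"
  proof (rule gerstenhaber_iso_of_acyclic_kernel)
    fix m n F G assume F: "F \<in> grd V m" and G: "G \<in> grd V n"
    show "pr (cupp V m n F G) = cupp (Hoch A') m n (pr F) (pr G)"
    proof
      fix as
      show "pr (cupp V m n F G) as = cupp (Hoch A') m n (pr F) (pr G) as"
        using P.pi_cup[of F "pr F" G "pr G" m n "map \<iota> as", OF rel[OF F] rel[OF G]] io[of as]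
        by (simp add: V_simps Hoch_def) (simp add: pr)
    qed
    show "pr (brkt V m n F G) = brkt (Hoch A') m n (pr F) (pr G)"
    proof
      fix as
      show "pr (brkt V m n F G) as = brkt (Hoch A') m n (pr F) (pr G) as"
        using P.pi_brk[of F "pr F" G "pr G" m n "map \<iota> as", OF rel[OF F] rel[OF G]] io[of as]
        by (simp add: V_simps Hoch_def) (simp add: pr)
    qed
  next
    show "pr (F - G) = pr F - pr G" for F G by (simp add: pr fun_eq_iff P.pi_diff)
  qed (rule grd_V_0 grd_V_diff dif_V_grd dif_V_diff dif_V_dif_V pscl img d ker; assumption)+
  ultimately show ?thesis by (simp add: cochain_map_def)
qed

lemma fst_V: "F \<in> grd V n \<Longrightarrow> fst (F ts) = prA F (map fst ts)"
  unfolding grd_V by (auto simp: prA_emb') (simp add: emb_def)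

lemma sb_V: "F \<in> grd V n \<Longrightarrow> sb (F ts) = prB F (map sb ts)"
  unfolding grd_V by (auto simp: prB_emb') (simp add: emb_def)

lemma prA_iso:
  assumes "\<And>n F. F \<in> grd V n \<Longrightarrow> prA F = 0 \<Longrightarrow> dif V F = 0 \<Longrightarrow> \<exists>G\<in>grd V (n - 1). prA G = 0 \<and> dif V G = F"
  shows "cochain_map V (Hoch A) prA \<and> gerstenhaber_iso (HH V) (HH (Hoch A)) (coh_map (Hoch A) prA)"
proof (rule projection_iso[OF PA.alg_morphism_axioms, of prA "\<lambda>a. (a, 0, 0)"])
  show "prA = (\<lambda>F as. fst (F (map (\<lambda>a. (a, 0, 0)) as)))" by (simp add: prA_def fun_eq_iff)
  show "prA ` grd V n = grd (Hoch A) n" for n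
  proof
    show "prA ` grd V n \<subseteq> grd (Hoch A) n" using hochT_prA grd_V_T PA.grd_Hoch by blast
    show "grd (Hoch A) n \<subseteq> prA ` grd V n"
    proof
      fix f assume "f \<in> grd (Hoch A) n"
      then have "emb f (\<lambda>_ _ _. 0) (\<lambda>_. 0) \<in> grd V n"
        unfolding grd_V PA.grd_Hoch using hochX_zero PB.HA.hoch_zero by blast
      then show "f \<in> prA ` grd V n" by (rule rev_image_eqI) (simp add: prA_emb')
    qed
  qed
qed (use assms fst_V in auto)

lemma prB_iso:
  assumes "\<And>n F. F \<in> grd V n \<Longrightarrow> prB F = 0 \<Longrightarrow> dif V F = 0 \<Longrightarrow> \<exists>G\<in>grd V (n - 1). prB G = 0 \<and> dif V G = F"
  shows "cochain_map V (Hoch B) prB \<and> gerstenhaber_iso (HH V) (HH (Hoch B)) (coh_map (Hoch B) prB)"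
proof (rule projection_iso[OF PB.alg_morphism_axioms, of prB "\<lambda>b. (0, 0, b)"])
  show "prB = (\<lambda>F bs. sb (F (map (\<lambda>b. (0, 0, b)) bs)))" by (simp add: prB_def fun_eq_iff)
  show "prB ` grd V n = grd (Hoch B) n" for n
  proof
    show "prB ` grd V n \<subseteq> grd (Hoch B) n" using hochT_prB grd_V_T PB.grd_Hoch by blast
    show "grd (Hoch B) n \<subseteq> prB ` grd V n"
    proof
      fix h assume "h \<in> grd (Hoch B) n"
      then have "emb (\<lambda>_. 0) (\<lambda>_ _ _. 0) h \<in> grd V n"
        unfolding grd_V PB.grd_Hoch using hochX_zero PA.HA.hoch_zero by blast
      then show "h \<in> prB ` grd V n" by (rule rev_image_eqI) (simp add: prB_emb')
    qed
  qed
qed (use assms sb_V in auto)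

end

section \<open>Endomorphism bimodules\<close>

context triple
begin

lemma X_additive_eqI:
  assumes f: "\<And>x y. f (x + y) = f x + f y" and g: "\<And>x y. g (x + y) = g x + g y"
    and eq: "\<And>n x. x \<in> grd X n \<Longrightarrow> f x = g x"
  shows "f = (g :: 'x \<Rightarrow> 'y::ab_group_add)"
proof
  fix x
  show "f x = g x" using gspM CX[of x] by (induction x rule: gtot_induct) (simp_all add: eq f g)
qed

lemmas tau_X_add = tw_add[OF gspM CX CX] and tau_X_scl = tw_scl[OF gspM CX]
  and tau_X_tau = tw_tw[OF gspM CX] and tau_X_dif = tw_difM[OF CX] and tau_X_ract = tw_ract[OF CX]
  and tau_X_lact = tw_lact[OF CX]

definition comm :: "int \<Rightarrow> ('x \<Rightarrow> 'x) \<Rightarrow> 'x \<Rightarrow> 'x" where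
  "comm r f x = dif X (f x) - sg r (f (dif X x))"

lemma lin_degX:
  assumes "lin_deg X X r f"
  shows "f (x + y) = f x + f y" "f (scl X c x) = scl X c (f x)" "x \<in> grd X n \<Longrightarrow> f x \<in> grd X (n + r)"
    "f 0 = 0" "f (- x) = - f x" "f (x - y) = f x - f y" "f (sg k x) = sg k (f x)"
    "tw (grd X) k (f x) = sg (k * r) (f (tw (grd X) k x))"
  using lin_degD[OF assms] additive_0[OF gspM lin_degD(1)[OF assms]]
    additive_minus[OF gspM lin_degD(1)[OF assms] CX] additive_diff[OF gspM lin_degD(1)[OF assms] CX CX]
    additive_sg[OF gspM lin_degD(1)[OF assms] CX] lin_deg_tw[OF gspM gspM assms CX]
  by simp_all

lemma lin_deg_comm: assumes f: "lin_deg X X r f" shows "lin_deg X X (r + 1) (comm r f)"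
  unfolding lin_deg_def
proof (intro conjI ballI allI)
  fix n x assume x: "x \<in> grd X n"
  have "dif X (f x) \<in> grd X (n + (r + 1))" "f (dif X x) \<in> grd X (n + (r + 1))"
    using difM_grd[OF lin_degX(3)[OF f x]] lin_degX(3)[OF f difM_grd[OF x]] by (simp_all add: algebra_simps)
  then show "comm r f x \<in> grd X (n + (r + 1))"
    by (simp add: comm_def grd_diff[OF gspM] grd_sg[OF gspM])
qed (simp_all add: comm_def lin_degX[OF f] difM_add difM_scl sg_add scl_diff[OF gspM] scl_sg[OF gspM])

lemma comm_comm: assumes f: "lin_deg X X r f" shows "comm (r + 1) (comm r f) = 0"
  by (rule ext) (simp add: comm_def lin_degX[OF f] difM_diff difM_sg difM_difM sg_diff, simp add: sg_def)

lemma lin_deg_add: "lin_deg X X r f \<Longrightarrow> lin_deg X X r g \<Longrightarrow> lin_deg X X r (f + g)"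
  unfolding lin_deg_def by (auto simp: algebra_simps scl_add[OF gspM] grd_add[OF gspM])

lemma lin_deg_zero: "lin_deg X X r 0"
  unfolding lin_deg_def by (auto simp: scl_0[OF gspM] grd_0[OF gspM])

lemma lin_deg_scl: assumes "lin_deg X X r f" shows "lin_deg X X r (\<lambda>x. scl X c (f x))"
proof -
  interpret vector_space "scl X" by (rule graded_spaceD[OF gspM])
  show ?thesis using assms unfolding lin_deg_def
    by (auto simp: scale_right_distrib grd_scl[OF gspM] mult.commute)
qed

end

text \<open>What right linear and left linear endomorphisms share: graded spaces of linear maps on X
  that are closed under the commutator with its differential.\<close>

locale endo_space = triple A B X
  for A :: "('k::field, 'a::ab_group_add) dgalg" and B :: "('k, 'b::ab_group_add) dgalg"
    and X :: "('k, 'x::ab_group_add, 'a, 'b) bimod" +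
  fixes U :: "('k, 'x \<Rightarrow> 'x, 'c, 'c) bimod"
  assumes U_scl: "scl U = (\<lambda>c f x. scl X c (f x))"
    and U_lin: "\<And>r f. f \<in> grd U r \<Longrightarrow> lin_deg X X r f"
    and U_0: "\<And>r. 0 \<in> grd U r"
    and U_add: "\<And>r f g. f \<in> grd U r \<Longrightarrow> g \<in> grd U r \<Longrightarrow> f + g \<in> grd U r"
    and U_scale: "\<And>r c f. f \<in> grd U r \<Longrightarrow> (\<lambda>x. scl X c (f x)) \<in> grd U r"
    and U_comm: "\<And>r f. f \<in> grd U r \<Longrightarrow> comm r f \<in> grd U (r + 1)"
    and U_dif: "dif U = lext (grd U) (\<lambda>r f x. dif X (f x) - sg r (f (dif X x)))"
begin

lemma gspU: "graded_space U"
proof (rule graded_space_fun[OF gspM U_scl U_0 U_add U_scale, where S = "{x. \<exists>n. x \<in> grd X n}"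
      and \<delta> = "\<lambda>x. SOME n. x \<in> grd X n"])
  fix r f x assume f: "f \<in> grd U r" and "x \<in> {x. \<exists>n. x \<in> grd X n}"
  then have "x \<in> grd X (SOME n. x \<in> grd X n)" by (auto intro: someI)
  then show "f x \<in> grd X ((SOME n. x \<in> grd X n) + r)" by (rule lin_degX(3)[OF U_lin[OF f]])
next
  fix r f assume f: "f \<in> grd U r" and z: "\<And>x. x \<in> {x. \<exists>n. x \<in> grd X n} \<Longrightarrow> f x = 0"
  show "f = 0" by (rule X_additive_eqI) (use z lin_degX(1)[OF U_lin[OF f]] in auto)
qed

lemma U_additive: "f \<in> gtot (grd U) \<Longrightarrow> f (x + y) = f x + f y"
  using gspU by (induction f arbitrary: x y rule: gtot_induct) (simp_all add: lin_degX(1)[OF U_lin] algebra_simps)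

lemma U_linear: "f \<in> gtot (grd U) \<Longrightarrow> f (scl X c x) = scl X c (f x)"
  using gspU by (induction f arbitrary: x rule: gtot_induct) (simp_all add: lin_degX(2)[OF U_lin] scl_add[OF gspM])

lemma U_sg: "f \<in> gtot (grd U) \<Longrightarrow> f (sg k x) = sg k (f x)"
  by (rule additive_sg[OF gspM _ CX]) (rule U_additive)

lemma U_eqI:
  "f \<in> gtot (grd U) \<Longrightarrow> g \<in> gtot (grd U) \<Longrightarrow> (\<And>n x. x \<in> grd X n \<Longrightarrow> f x = g x) \<Longrightarrow> f = g"
  by (rule X_additive_eqI) (simp_all add: U_additive)

lemma U_dif_hom: "f \<in> grd U r \<Longrightarrow> dif U f = comm r f"
proof -
  assume f: "f \<in> grd U r"
  have "dif U f = (\<lambda>x. dif X (f x) - sg r (f (dif X x)))"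
    unfolding U_dif by (rule lext_homogeneous[OF gspU f]) (simp add: fun_eq_iff difM_0)
  then show ?thesis by (simp add: comm_def[abs_def])
qed

lemma dg_space_U: "dg_space U"
proof -
  have add: "dif U (f + g) = dif U f + dif U g" if "f \<in> gtot (grd U)" "g \<in> gtot (grd U)" for f g
    unfolding U_dif by (rule lext_add[OF gspU that]) (simp add: fun_eq_iff difM_add sg_add)
  have scl: "dif U (scl U c f) = scl U c (dif U f)" if "f \<in> gtot (grd U)" for c f
    unfolding U_dif
    by (rule lext_scl[OF gspU that])
      (simp_all add: fun_eq_iff U_scl difM_scl scl_diff[OF gspM] scl_sg[OF gspM] scl_add[OF gspM] difM_0)
  have grd: "dif U f \<in> grd U (r + 1)" if "f \<in> grd U r" for f r
    using that by (simp add: U_dif_hom U_comm)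
  have lin: "lin_deg U U 1 (dif U)" unfolding lin_deg_def using add scl grd by blast
  have "dif U (dif U f) = 0" if "f \<in> gtot (grd U)" for f
    using gspU that
  proof (induction f rule: gtot_induct)
    case (hom r f)
    then show ?case by (simp add: U_dif_hom U_dif_hom[OF U_comm[OF hom]] comm_comm[OF U_lin[OF hom]])
  next
    case (add f g)
    have "dif U (dif U (f + g)) = dif U (dif U f) + dif U (dif U g)"
      unfolding \<open>\<And>f g. f \<in> gtot (grd U) \<Longrightarrow> g \<in> gtot (grd U) \<Longrightarrow> dif U (f + g) = dif U f + dif U g\<close>[OF add(1,2)]
      by (rule \<open>\<And>f g. f \<in> gtot (grd U) \<Longrightarrow> g \<in> gtot (grd U) \<Longrightarrow> dif U (f + g) = dif U f + dif U g\<close>;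
        rule lin_deg_gtot[OF gspU gspU lin]; rule add)
    then show ?case by (simp add: add(3,4) del: plus_fun_apply zero_fun_apply)
  qed
  then show ?thesis by (simp add: dg_space_def gspU lin)
qed

lemma U_dif_lin: "lin_deg U U 1 (dif U)"
  using dg_space_U by (simp add: dg_space_def)

lemmas U_dif_add = lin_degD(1)[OF U_dif_lin]
  and U_dif_gtot = lin_deg_gtot[OF gspU gspU U_dif_lin]

lemma grd_gtotU: "f \<in> grd U r \<Longrightarrow> f \<in> gtot (grd U)"
  by (rule grd_gtot[OF gspU])

lemma U_tw_hom: "f \<in> grd U r \<Longrightarrow> tw (grd U) k f x = sg (k * r) (f x)"
  by (simp add: tw_hom[OF gspU] sg_fun)

end

context triple
begin

subsection \<open>Right linear endomorphisms\<close>

abbreviation "ER \<equiv> end_r X"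

lemma ER_simps: "scl ER = (\<lambda>c f x. scl X c (f x))" "grd ER = end_r_deg X"
  "lact ER a f = (\<lambda>x. lact X a (f x))" "ract ER f a = (\<lambda>x. f (lact X a x))"
  by (simp_all add: end_r_def)

lemma endo_space_ER: "endo_space A B X ER"
proof
  fix r f assume f: "f \<in> grd ER r"
  then show l: "lin_deg X X r f" by (simp add: ER_simps end_r_deg_def)
  note l' = lin_degX[OF l]
  have rl: "f (ract X x b) = ract X (f x) b" for x b using f by (simp add: ER_simps end_r_deg_def)
  have "comm r f (ract X x b) = ract X (comm r f x) b" for x b
    by (simp add: comm_def rl dif_ract l' ract_diff ract_sg sg_add)
  then show "comm r f \<in> grd ER (r + 1)" using lin_deg_comm[OF l] by (simp add: ER_simps end_r_deg_def)
  show "(\<lambda>x. scl X c (f x)) \<in> grd ER r" for c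
    using lin_deg_scl[OF l] by (simp add: ER_simps end_r_deg_def rl ract_scl_left)
next
  fix r f g assume "f \<in> grd ER r" "g \<in> grd ER r"
  then show "f + g \<in> grd ER r" using lin_deg_add by (simp add: ER_simps end_r_deg_def ract_add_left)
qed (simp_all add: end_r_def end_r_deg_def lin_deg_zero act_zero)

sublocale ER: endo_space A B X ER by (rule endo_space_ER)

lemma ER_ract: "f \<in> grd ER r \<Longrightarrow> f (ract X x b) = ract X (f x) b"
  by (simp add: ER_simps end_r_deg_def)

lemma ER_lact_grd: assumes "a \<in> grd A i" "f \<in> grd ER r" shows "lact ER a f \<in> grd ER (i + r)"
proof -
  note l = ER.U_lin[OF assms(2)]
  have "lin_deg X X (i + r) (\<lambda>x. lact X a (f x))"
    unfolding lin_deg_def using lact_grd[OF assms(1) lin_degX(3)[OF l]]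
    by (auto simp: lin_degX[OF l] lact_add_right lact_scl_right algebra_simps)
  then show ?thesis by (simp add: ER_simps end_r_deg_def ER_ract[OF assms(2), unfolded ER_simps] lact_ract)
qed

lemma ER_ract_grd: assumes "f \<in> grd ER r" "a \<in> grd A i" shows "ract ER f a \<in> grd ER (r + i)"
proof -
  note l = ER.U_lin[OF assms(1)]
  have "lin_deg X X (r + i) (\<lambda>x. f (lact X a x))"
    unfolding lin_deg_def using lin_degX(3)[OF l lact_grd[OF assms(2)]]
    by (auto simp: lin_degX[OF l] lact_add_right lact_scl_right algebra_simps)
  then show ?thesis by (simp add: ER_simps end_r_deg_def lact_ract[symmetric] ER_ract[OF assms(1), unfolded ER_simps])
qed

text \<open>As rewrite rules, these two \<open>\<eta>\<close>-expand every sum of functions.\<close>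

declare plus_fun_apply [simp del] zero_fun_apply [simp del]

lemma dg_bimod_ER: "dg_bimod A A ER"
proof -
  have b1: "bilin_deg A ER ER (lact ER)"
    unfolding bilin_deg_def A.tot_eq using ER_lact_grd
    by (auto simp: ER_simps(1,3) fun_eq_iff plus_fun_apply lact_add_left lact_add_right lact_scl_left lact_scl_right)
  have b2: "bilin_deg ER A ER (ract ER)"
    unfolding bilin_deg_def A.tot_eq using ER_ract_grd
    by (auto simp: ER_simps(1,4) fun_eq_iff plus_fun_apply lact_add_left lact_scl_left ER.U_additive ER.U_linear)
  have l: "dif ER (lact ER a f) = lact ER (dif A a) f + sg n (lact ER a (dif ER f))"
    if a: "a \<in> grd A n" and f: "f \<in> gtot (grd ER)" for a f n
    using ER.gspU f
  proof (induction f rule: gtot_induct)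
    case (hom r f)
    have "comm (n + r) (lact ER a f) x = lact X (dif A a) (f x) + sg n (lact X a (comm r f x))" for x
      using tw_hom[OF A.gsp a, of 1]
      by (simp add: comm_def ER_simps dif_lact lact_sg_left lact_diff lact_sg sg_diff)
    then show ?case
      unfolding ER.U_dif_hom[OF hom] ER.U_dif_hom[OF ER_lact_grd[OF a hom]]
      by (intro ext) (simp add: plus_fun_apply sg_fun ER_simps(3))
  next
    case (add f g)
    have "lact ER a (f + g) = lact ER a f + lact ER a g" for a f g
      by (simp add: ER_simps(3) fun_eq_iff plus_fun_apply lact_add_right)
    moreover have "lact ER a f \<in> gtot (grd ER)" if "f \<in> gtot (grd ER)" for f
      using ER.gspU that
      by (induction f rule: gtot_induct)
        (auto simp: \<open>\<And>a f g. lact ER a (f + g) = lact ER a f + lact ER a g\<close>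
          intro: ER.grd_gtotU[OF ER_lact_grd[OF a]] gtot_add[OF ER.gspU])
    ultimately show ?case using add
      by (simp add: ER.U_dif_add sg_add)
  qed
  have r: "dif ER (ract ER f a) = ract ER (dif ER f) a + sg r (ract ER f (dif A a))"
    if f: "f \<in> grd ER r" for a f r
    using A.gsp A.tot[of a]
  proof (induction a rule: gtot_induct)
    case (hom n a)
    note l = ER.U_lin[OF f]
    have "comm (r + n) (ract ER f a) x = comm r f (lact X a x) + sg r (f (lact X (dif A a) x))" for x
      using tw_hom[OF A.gsp hom, of 1]
      by (simp add: comm_def ER_simps dif_lact lact_sg_left lin_degX[OF l] sg_add)
    then show ?case
      unfolding ER.U_dif_hom[OF f] ER.U_dif_hom[OF ER_ract_grd[OF f hom]]
      by (intro ext) (simp add: plus_fun_apply sg_fun ER_simps(4))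
  next
    case (add a a')
    note l = ER.U_lin[OF f]
    have e: "ract ER f (a + a') = ract ER f a + ract ER f a'" for a a'
      by (simp add: ER_simps(4) fun_eq_iff plus_fun_apply lact_add_left lin_degX[OF l])
    have "ract ER f a \<in> gtot (grd ER)" for a
      using A.gsp A.tot[of a]
      by (induction a rule: gtot_induct)
        (auto simp: e intro: ER.grd_gtotU[OF ER_ract_grd[OF f]] gtot_add[OF ER.gspU])
    moreover have "ract ER (dif ER f) (a + a') = ract ER (dif ER f) a + ract ER (dif ER f) a'"
      by (simp add: ER_simps(4) fun_eq_iff plus_fun_apply lact_add_left ER.U_additive ER.U_dif_gtot[OF ER.grd_gtotU[OF f]])
    ultimately show ?case using add by (simp only: e ER.U_dif_add A.dif_add sg_add) (simp add: algebra_simps)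
  qed
  have "dg_bimodule A A ER"
    unfolding dg_bimodule_def
    using b1 b2 l r ER.dg_space_U by (auto simp: ER_simps(3,4) lact_mul)
  then show ?thesis by unfold_locales
qed

subsection \<open>Left linear endomorphisms\<close>

abbreviation "EL \<equiv> end_l A X B"

lemma EL_simps: "scl EL = (\<lambda>c f x. scl X c (f x))" "grd EL = end_l_deg A X"
  by (simp_all add: end_l_def)

lemma EL_lact: "f \<in> grd EL r \<Longrightarrow> a \<in> grd A n \<Longrightarrow> f (lact X a x) = sg (r * n) (lact X a (f x))"
  by (simp add: EL_simps end_l_deg_def)

lemma endo_space_EL: "endo_space A B X EL"
proof
  fix r f assume f: "f \<in> grd EL r"
  then show l: "lin_deg X X r f" by (simp add: EL_simps end_l_deg_def)
  note l' = lin_degX[OF l] and rl = EL_lact[OF f]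
  have "comm r f (lact X a x) = sg ((r + 1) * n) (lact X a (comm r f x))" if a: "a \<in> grd A n" for a n x
    using tw_hom[OF A.gsp a, of 1]
    by (simp add: comm_def rl[OF a] rl[OF A.dif_grd[OF a]] dif_lact lact_sg_left l' lact_diff lact_sg difM_sg
        sg_add sg_diff) (simp add: sg_def)
  then show "comm r f \<in> grd EL (r + 1)" using lin_deg_comm[OF l] by (simp add: EL_simps end_l_deg_def)
  show "(\<lambda>x. scl X c (f x)) \<in> grd EL r" for c
    using lin_deg_scl[OF l] rl by (simp add: EL_simps end_l_deg_def lact_scl_right scl_sg[OF gspM])
next
  fix r f g assume "f \<in> grd EL r" "g \<in> grd EL r"
  then show "f + g \<in> grd EL r" using lin_deg_add by (simp add: EL_simps end_l_deg_def lact_add_right sg_add plus_fun_apply)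
qed (simp_all add: end_l_def end_l_deg_def lin_deg_zero act_zero zero_fun_apply)

sublocale EL: endo_space A B X EL by (rule endo_space_EL)

text \<open>The sign depends jointly on the degrees of b, f and x. For b of degree i the dependence
  on f and x turns into two twists; b stays under \<open>lext\<close> because its degree is their
  exponent.\<close>

lemma EL_lact_lext:
  assumes f: "f \<in> gtot (grd EL)"
  shows "lact EL b f x = lext (grd B) (\<lambda>i b'. tw (grd EL) i f (ract X (tw (grd X) i x) b')) b"
proof -
  have "lext (grd EL) (\<lambda>r f'. lext (grd X) (\<lambda>n x'. sg (i * (r + n)) (f' (ract X x' b'))) x) f
      = tw (grd EL) i f (ract X (tw (grd X) i x) b')" for i b'
  proof -
    let ?F = "\<lambda>r f'. lext (grd X) (\<lambda>n x'. sg (i * (r + n)) (f' (ract X x' b'))) x"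
    have 1: "?F r f' = sg (i * r) (f' (ract X (tw (grd X) i x) b'))" if "f' \<in> gtot (grd EL)" for r f'
      using lext_tw[OF gspM CX, of "\<lambda>x'. f' (ract X x' b')" i "i * r" x]
      by (simp add: ract_add_left EL.U_additive[OF that] distrib_left add.commute)
    show ?thesis using EL.gspU f
    proof (induction f rule: gtot_induct)
      case (hom r f)
      have "lext (grd EL) ?F f = ?F r f"
        by (rule lext_homogeneous[OF EL.gspU hom]) (subst 1, auto simp: gtot_0[OF EL.gspU] zero_fun_apply)
      then show ?case by (simp add: 1 EL.grd_gtotU[OF hom] EL.U_tw_hom[OF hom])
    next
      case (add f g)
      have "lext (grd EL) ?F (f + g) = lext (grd EL) ?F f + lext (grd EL) ?F g"
        by (rule lext_add[OF EL.gspU add(1,2)]) (simp add: 1 EL.grd_gtotU gtot_add[OF EL.gspU] sg_add plus_fun_apply[where x = "ract X (tw (grd X) i x) b'"])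
      then show ?case using add
        by (simp add: tw_add[OF EL.gspU] plus_fun_apply[where x = "ract X (tw (grd X) i x) b'"])
    qed
  qed
  then show ?thesis by (simp add: end_l_def EL_simps)
qed

lemma EL_ract_lext:
  assumes f: "f \<in> gtot (grd EL)"
  shows "ract EL f b x = lext (grd B) (\<lambda>i b'. ract X (f (tw (grd X) i x)) b') b"
proof -
  have "lext (grd X) (\<lambda>n x'. sg (i * n) (ract X (f x') b')) x = ract X (f (tw (grd X) i x)) b'" for i b'
    using lext_tw[OF gspM CX, of "\<lambda>x'. ract X (f x') b'" i 0 x]
    by (simp add: EL.U_additive[OF f] ract_add_left)
  then show ?thesis by (simp add: end_l_def)
qed

lemma
  assumes f: "f \<in> gtot (grd EL)"
  shows EL_lact_hom: "b \<in> grd B i \<Longrightarrow> lact EL b f = (\<lambda>x. tw (grd EL) i f (ract X (tw (grd X) i x) b))"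
    and EL_ract_hom: "b \<in> grd B i \<Longrightarrow> ract EL f b = (\<lambda>x. ract X (f (tw (grd X) i x)) b)"
    and EL_lact_add: "lact EL (b + b') f = lact EL b f + lact EL b' f"
    and EL_ract_add: "ract EL f (b + b') = ract EL f b + ract EL f b'"
    and EL_lact_scl: "lact EL (scl B c b) f = scl EL c (lact EL b f)"
    and EL_ract_scl: "ract EL f (scl B c b) = scl EL c (ract EL f b)"
proof -
  have t: "tw (grd EL) i f \<in> gtot (grd EL)" for i by (rule tw_gtot[OF EL.gspU f])
  note tl = EL.U_additive[OF t] EL.U_linear[OF t]
  have t0: "tw (grd EL) i f 0 = 0" for i using tl(1)[of i 0 0] by simp
  note e = EL_lact_lext[OF f] EL_ract_lext[OF f]
  show "lact EL b f = (\<lambda>x. tw (grd EL) i f (ract X (tw (grd X) i x) b))" if "b \<in> grd B i"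
    by (rule ext) (simp add: e lext_homogeneous[OF B.gsp that] act_zero t0)
  show "ract EL f b = (\<lambda>x. ract X (f (tw (grd X) i x)) b)" if "b \<in> grd B i"
    by (rule ext) (simp add: e lext_homogeneous[OF B.gsp that] act_zero)
  show "lact EL (b + b') f = lact EL b f + lact EL b' f"
    by (rule ext) (simp add: e plus_fun_apply, rule lext_add[OF B.gsp B.tot B.tot], simp add: ract_add_right tl)
  show "ract EL f (b + b') = ract EL f b + ract EL f b'"
    by (rule ext) (simp add: e plus_fun_apply, rule lext_add[OF B.gsp B.tot B.tot], simp add: ract_add_right)
  show "lact EL (scl B c b) f = scl EL c (lact EL b f)"
    by (rule ext) (simp add: e EL_simps(1), rule lext_scl[OF B.gsp B.tot],
      simp_all add: ract_scl_right tl scl_add[OF gspM] act_zero t0)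
  show "ract EL f (scl B c b) = scl EL c (ract EL f b)"
    by (rule ext) (simp add: e EL_simps(1), rule lext_scl[OF B.gsp B.tot],
      simp_all add: ract_scl_right scl_add[OF gspM] act_zero)
qed

lemma EL_lact_hom2: "b \<in> grd B i \<Longrightarrow> f \<in> grd EL r \<Longrightarrow>
    lact EL b f = (\<lambda>x. sg (i * r) (f (ract X (tw (grd X) i x) b)))"
  by (simp add: EL_lact_hom EL.grd_gtotU EL.U_tw_hom)

lemma EL_lact_grd: assumes b: "b \<in> grd B i" and f: "f \<in> grd EL r" shows "lact EL b f \<in> grd EL (i + r)"
proof -
  note l = EL.U_lin[OF f]
  have 1: "lin_deg X X (i + r) (lact EL b f)"
    unfolding lin_deg_def
  proof (intro conjI ballI allI)
    fix n x assume x: "x \<in> grd X n"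
    have "f (ract X (tw (grd X) i x) b) \<in> grd X (n + (i + r))"
      using lin_degX(3)[OF l ract_grd[OF tw_grd[OF gspM x] b]] by (simp add: add.assoc)
    then show "lact EL b f x \<in> grd X (n + (i + r))" by (simp add: EL_lact_hom2[OF b f] grd_sg[OF gspM])
  qed (simp_all add: EL_lact_hom2[OF b f] tau_X_add tau_X_scl ract_add_left ract_scl_left lin_degX[OF l] sg_add
    scl_sg[OF gspM])
  have "lact EL b f (lact X a x) = sg ((i + r) * n) (lact X a (lact EL b f x))" if a: "a \<in> grd A n" for a n x
    by (simp add: EL_lact_hom2[OF b f] tau_X_lact tw_hom[OF A.gsp a] lact_sg_left lact_ract ract_sg
      lin_degX[OF l] EL_lact[OF f a] lact_sg algebra_simps)
  with 1 show ?thesis by (simp add: EL_simps end_l_deg_def)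
qed

lemma EL_ract_grd: assumes f: "f \<in> grd EL r" and b: "b \<in> grd B i" shows "ract EL f b \<in> grd EL (r + i)"
proof -
  note l = EL.U_lin[OF f] and e = EL_ract_hom[OF EL.grd_gtotU[OF f] b]
  have 1: "lin_deg X X (r + i) (ract EL f b)"
    unfolding lin_deg_def
  proof (intro conjI ballI allI)
    fix n x assume x: "x \<in> grd X n"
    show "ract EL f b x \<in> grd X (n + (r + i))"
      using ract_grd[OF lin_degX(3)[OF l tw_grd[OF gspM x]] b] by (simp add: e add.assoc)
  qed (simp_all add: e tau_X_add tau_X_scl ract_add_left ract_scl_left lin_degX[OF l])
  have "ract EL f b (lact X a x) = sg ((r + i) * n) (lact X a (ract EL f b x))" if a: "a \<in> grd A n" for a n x
    by (simp add: e tau_X_lact tw_hom[OF A.gsp a] lact_sg_left lact_ract ract_sg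
      lin_degX[OF l] EL_lact[OF f a] lact_sg algebra_simps)
  with 1 show ?thesis by (simp add: EL_simps end_l_deg_def)
qed

lemma EL_lact_add_right:
  assumes f: "f \<in> gtot (grd EL)" and g: "g \<in> gtot (grd EL)"
  shows "lact EL b (f + g) = lact EL b f + lact EL b g"
  using B.gsp B.tot[of b]
proof (induction b rule: gtot_induct)
  case (hom i b)
  show ?case
    unfolding EL_lact_hom[OF f hom] EL_lact_hom[OF g hom] EL_lact_hom[OF gtot_add[OF EL.gspU f g] hom]
      tw_add[OF EL.gspU f g] by (rule ext) (simp add: plus_fun_apply)
next
  case (add b b')
  then show ?case by (simp add: EL_lact_add f g gtot_add[OF EL.gspU] algebra_simps)
qed

lemma EL_ract_add_left:
  assumes f: "f \<in> gtot (grd EL)" and g: "g \<in> gtot (grd EL)"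
  shows "ract EL (f + g) b = ract EL f b + ract EL g b"
  using B.gsp B.tot[of b]
proof (induction b rule: gtot_induct)
  case (hom i b)
  show ?case
    unfolding EL_ract_hom[OF f hom] EL_ract_hom[OF g hom] EL_ract_hom[OF gtot_add[OF EL.gspU f g] hom]
    by (rule ext) (simp add: plus_fun_apply ract_add_left)
next
  case (add b b')
  then show ?case by (simp add: EL_ract_add f g gtot_add[OF EL.gspU] algebra_simps)
qed

lemma EL_lact_scl_right:
  assumes f: "f \<in> gtot (grd EL)"
  shows "lact EL b (scl EL c f) = scl EL c (lact EL b f)"
  using B.gsp B.tot[of b]
proof (induction b rule: gtot_induct)
  case (hom i b)
  show ?case
    unfolding EL_lact_hom[OF f hom] EL_lact_hom[OF gtot_scl[OF EL.gspU f] hom] tw_scl[OF EL.gspU f]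
    by (simp add: EL_simps(1))
next
  case (add b b')
  then show ?case by (simp add: EL_lact_add f gtot_scl[OF EL.gspU] scl_add[OF EL.gspU])
qed

lemma EL_ract_scl_left:
  assumes f: "f \<in> gtot (grd EL)"
  shows "ract EL (scl EL c f) b = scl EL c (ract EL f b)"
  using B.gsp B.tot[of b]
proof (induction b rule: gtot_induct)
  case (hom i b)
  show ?case
    unfolding EL_ract_hom[OF f hom] EL_ract_hom[OF gtot_scl[OF EL.gspU f] hom]
    by (simp add: EL_simps(1) ract_scl_left)
next
  case (add b b')
  then show ?case by (simp add: EL_ract_add f gtot_scl[OF EL.gspU] scl_add[OF EL.gspU])
qed

lemma EL_lact_gtot: assumes f: "f \<in> gtot (grd EL)" shows "lact EL b f \<in> gtot (grd EL)"
  using EL.gspU f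
proof (induction f rule: gtot_induct)
  case (hom r f)
  show ?case using B.gsp B.tot[of b]
    by (induction b rule: gtot_induct)
      (auto simp: EL_lact_add EL.grd_gtotU[OF hom] intro: EL.grd_gtotU[OF EL_lact_grd[OF _ hom]] gtot_add[OF EL.gspU])
qed (simp add: EL_lact_add_right gtot_add[OF EL.gspU])

lemma EL_ract_gtot: assumes f: "f \<in> gtot (grd EL)" shows "ract EL f b \<in> gtot (grd EL)"
  using EL.gspU f
proof (induction f rule: gtot_induct)
  case (hom r f)
  show ?case using B.gsp B.tot[of b]
    by (induction b rule: gtot_induct)
      (auto simp: EL_ract_add EL.grd_gtotU[OF hom] intro: EL.grd_gtotU[OF EL_ract_grd[OF hom]] gtot_add[OF EL.gspU])
qed (simp add: EL_ract_add_left gtot_add[OF EL.gspU])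

text \<open>The actions twist by the degree of the acting element, so the bimodule identities are
  verified on homogeneous triples and extended additively in each variable.\<close>

lemma EL_triple_induct:
  assumes f: "f \<in> gtot (grd EL)"
    and hom: "\<And>i j r b b' f. b \<in> grd B i \<Longrightarrow> b' \<in> grd B j \<Longrightarrow> f \<in> grd EL r \<Longrightarrow> P b b' f"
    and add1: "\<And>b1 b2 b' f. f \<in> gtot (grd EL) \<Longrightarrow> P b1 b' f \<Longrightarrow> P b2 b' f \<Longrightarrow> P (b1 + b2) b' f"
    and add2: "\<And>b b1 b2 f. f \<in> gtot (grd EL) \<Longrightarrow> P b b1 f \<Longrightarrow> P b b2 f \<Longrightarrow> P b (b1 + b2) f"
    and add3: "\<And>b b' f g. f \<in> gtot (grd EL) \<Longrightarrow> g \<in> gtot (grd EL) \<Longrightarrow> P b b' f \<Longrightarrow> P b b' g \<Longrightarrow> P b b' (f + g)"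
  shows "P b b' f"
  using EL.gspU f
proof (induction f rule: gtot_induct)
  case f: (hom r f)
  note g = EL.grd_gtotU[OF f]
  show ?case using B.gsp B.tot[of b]
  proof (induction b rule: gtot_induct)
    case b: (hom i b)
    show ?case using B.gsp B.tot[of b']
    proof (induction b' rule: gtot_induct)
      case (hom j b') show ?case by (rule assms(2)[OF b hom f])
    qed (rule add2[OF g])
  qed (rule add1[OF g])
qed (rule add3)

lemma dg_bimod_EL: "dg_bimod B B EL"
proof -
  note g = EL.grd_gtotU and gI = EL_lact_gtot EL_ract_gtot gtot_add[OF EL.gspU] EL.U_dif_gtot
  have b1: "bilin_deg B EL EL (lact EL)"
    unfolding bilin_deg_def B.tot_eq
    by (simp add: EL_lact_add EL_lact_add_right EL_lact_scl EL_lact_scl_right EL_lact_grd)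
  have b2: "bilin_deg EL B EL (ract EL)"
    unfolding bilin_deg_def B.tot_eq
    by (simp add: EL_ract_add EL_ract_add_left EL_ract_scl EL_ract_scl_left EL_ract_grd)
  have a1: "lact EL (mul B b b') f = lact EL b (lact EL b' f)" if "f \<in> gtot (grd EL)" for b b' f
    using that
  proof (rule EL_triple_induct[where P = "\<lambda>b b' f. lact EL (mul B b b') f = lact EL b (lact EL b' f)"])
    fix i j r b b' f assume h: "b \<in> grd B i" "b' \<in> grd B j" "f \<in> grd EL r"
    note l = lin_degX[OF EL.U_lin[OF h(3)]]
    show "lact EL (mul B b b') f = lact EL b (lact EL b' f)"
      unfolding EL_lact_hom2[OF B.mul_grd[OF h(1,2)] h(3)] EL_lact_hom2[OF h(1) EL_lact_grd[OF h(2,3)]]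
      unfolding EL_lact_hom2[OF h(2,3)]
      by (rule ext) (simp add: tau_X_ract tw_hom[OF B.gsp h(1)] ract_sg_right ract_sg tau_X_tau ract_mul l
        add.commute[of j i], auto simp: sg_def)
  qed (simp_all add: B.mul_add_left B.mul_add_right EL_lact_add EL_lact_add_right gI)
  have a2: "ract EL f (mul B b b') = ract EL (ract EL f b) b'" if "f \<in> gtot (grd EL)" for b b' f
    using that
  proof (rule EL_triple_induct[where P = "\<lambda>b b' f. ract EL f (mul B b b') = ract EL (ract EL f b) b'"])
    fix i j r b b' f assume h: "b \<in> grd B i" "b' \<in> grd B j" "f \<in> grd EL r"
    show "ract EL f (mul B b b') = ract EL (ract EL f b) b'"
      unfolding EL_ract_hom[OF g[OF h(3)] B.mul_grd[OF h(1,2)]] EL_ract_hom[OF g[OF EL_ract_grd[OF h(3,1)]] h(2)]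
      unfolding EL_ract_hom[OF g[OF h(3)] h(1)]
      by (rule ext) (simp add: tau_X_tau ract_mul)
  qed (simp_all add: B.mul_add_left B.mul_add_right EL_ract_add EL_ract_add_left gI)
  have a3: "ract EL (lact EL b f) b' = lact EL b (ract EL f b')" if "f \<in> gtot (grd EL)" for b b' f
    using that
  proof (rule EL_triple_induct[where P = "\<lambda>b b' f. ract EL (lact EL b f) b' = lact EL b (ract EL f b')"])
    fix i j r b b' f assume h: "b \<in> grd B i" "b' \<in> grd B j" "f \<in> grd EL r"
    note l = lin_degX[OF EL.U_lin[OF h(3)]]
    show "ract EL (lact EL b f) b' = lact EL b (ract EL f b')"
      unfolding EL_ract_hom[OF g[OF EL_lact_grd[OF h(1,3)]] h(2)] EL_lact_hom2[OF h(1) EL_ract_grd[OF h(3,2)]]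
      unfolding EL_lact_hom2[OF h(1,3)] EL_ract_hom[OF g[OF h(3)] h(2)]
      by (rule ext) (simp add: tau_X_ract tw_hom[OF B.gsp h(1)] ract_sg_right ract_sg tau_X_tau l
        add.commute[of j i], auto simp: sg_def)
  qed (simp_all add: EL_ract_add EL_ract_add_left EL_lact_add EL_lact_add_right gI)
  have l: "dif EL (lact EL b f) = lact EL (dif B b) f + sg n (lact EL b (dif EL f))"
    if b: "b \<in> grd B n" and f: "f \<in> gtot (grd EL)" for b f n
    using EL.gspU f
  proof (induction f rule: gtot_induct)
    case (hom r f)
    note l = lin_degX[OF EL.U_lin[OF hom]]
    show ?case
      unfolding EL.U_dif_hom[OF hom] EL.U_dif_hom[OF EL_lact_grd[OF b hom]]
      unfolding EL_lact_hom2[OF b hom]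
        EL_lact_hom2[OF B.dif_grd[OF b] hom] EL_lact_hom2[OF b EL.U_comm[OF hom]]
      by (rule ext) (simp add: comm_def plus_fun_apply sg_fun dif_ract tau_X_dif l difM_sg ract_sg tau_X_tau sg_add sg_diff
        add.commute[of n 1], simp add: sg_def)
  next
    case (add f g)
    then show ?case
      by (simp only: EL_lact_add_right EL.U_dif_add gI sg_add) (simp add: algebra_simps)
  qed
  have r: "dif EL (ract EL f b) = ract EL (dif EL f) b + sg r (ract EL f (dif B b))"
    if f: "f \<in> grd EL r" for b f r
    using B.gsp B.tot[of b]
  proof (induction b rule: gtot_induct)
    case (hom n b)
    note l = lin_degX[OF EL.U_lin[OF f]]
    show ?case
      unfolding EL.U_dif_hom[OF f] EL.U_dif_hom[OF EL_ract_grd[OF f hom]]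
      unfolding EL_ract_hom[OF g[OF f] hom]
        EL_ract_hom[OF g[OF f] B.dif_grd[OF hom]] EL_ract_hom[OF g[OF EL.U_comm[OF f]] hom]
      by (rule ext) (simp add: comm_def plus_fun_apply sg_fun dif_ract tau_X_dif l ract_sg ract_diff tau_X_tau sg_add sg_diff
        add.commute[of n 1], simp add: sg_def)
  next
    case (add b b')
    then show ?case
      by (simp only: EL_ract_add EL.U_dif_add gI g[OF f] B.dif_add sg_add) (simp add: algebra_simps)
  qed
  have "dg_bimodule B B EL"
    unfolding dg_bimodule_def using b1 b2 a1 a2 a3 l r EL.dg_space_U by blast
  then show ?thesis by unfold_locales
qed

end

section \<open>Exact sequences with parameters\<close>

text \<open>The images are graded pieces by themselves: uniqueness of decompositions is inherited
  from W'. They form the domain of a graded section of d.\<close>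

lemma graded_space_image:
  fixes W :: "('k::field, 'v::ab_group_add, 'y) dgspace_scheme"
    and W' :: "('k, 'w::ab_group_add, 'z) dgspace_scheme"
  assumes W: "graded_space W" and W': "graded_space W'"
    and add: "\<And>x y. d (x + y) = d x + d y" and scl: "\<And>c x. d (scl W c x) = scl W' c (d x)"
    and im: "\<And>m x. x \<in> grd W m \<Longrightarrow> d x \<in> grd W' m"
  shows "graded_space \<lparr>scl = scl W', grd = (\<lambda>m. d ` grd W m), dif = undefined\<rparr>"
proof -
  interpret W': vector_space "scl W'" by (rule graded_spaceD[OF W'])
  have d0: "d 0 = 0" using add[of 0 0] by simp
  have "W'.subspace (d ` grd W m)" for m
    unfolding W'.subspace_def
  proof (intro conjI ballI allI)
    show "0 \<in> d ` grd W m" by (rule image_eqI[where x = 0]) (simp_all add: d0 grd_0[OF W])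
    fix x y c assume "x \<in> d ` grd W m"
    then obtain x' where x': "x = d x'" "x' \<in> grd W m" by (rule imageE)
    show "scl W' c x \<in> d ` grd W m" unfolding x'(1) scl[symmetric] by (rule imageI[OF grd_scl[OF W x'(2)]])
    assume "y \<in> d ` grd W m"
    then obtain y' where y': "y = d y'" "y' \<in> grd W m" by (rule imageE)
    show "x + y \<in> d ` grd W m" unfolding x'(1) y'(1) add[symmetric] by (rule imageI[OF grd_add[OF W x'(2) y'(2)]])
  qed
  moreover have "v = (\<lambda>_. 0)" if "is_decomp (\<lambda>m. d ` grd W m) 0 v" for v
  proof -
    have "v n \<in> d ` grd W n" for n using that by (simp add: is_decomp_def)
    then have "v n \<in> grd W' n" for n using im[of _ n] by (metis imageE)
    then have "is_decomp (grd W') 0 v" using that by (simp add: is_decomp_def)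
    then show ?thesis using W' by (auto simp: graded_space_def)
  qed
  ultimately show ?thesis by (simp add: graded_space_def W'.vector_space_axioms)
qed

text \<open>Pieced together from linear sections in every degree.\<close>

lemma graded_section:
  fixes W :: "('k::field, 'v::ab_group_add, 'y) dgspace_scheme"
    and W' :: "('k, 'w::ab_group_add, 'z) dgspace_scheme"
  assumes W: "graded_space W" and W': "graded_space W'"
    and add: "\<And>x y. d (x + y) = d x + d y" and scl: "\<And>c x. d (scl W c x) = scl W' c (d x)"
    and im: "\<And>m x. x \<in> grd W m \<Longrightarrow> d x \<in> grd W' m"
  shows "\<exists>S. (\<forall>z\<in>gtot (\<lambda>m. d ` grd W m). \<forall>z'\<in>gtot (\<lambda>m. d ` grd W m). S (z + z') = S z + S z') \<and>
    (\<forall>c. \<forall>z\<in>gtot (\<lambda>m. d ` grd W m). S (scl W' c z) = scl W c (S z)) \<and>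
    (\<forall>m. \<forall>z\<in>d ` grd W m. S z \<in> grd W m) \<and> (\<forall>z\<in>gtot (\<lambda>m. d ` grd W m). d (S z) = z)"
proof -
  let ?Z = "\<lparr>scl = scl W', grd = (\<lambda>m. d ` grd W m), dif = undefined\<rparr>"
  have Z: "graded_space ?Z" by (rule graded_space_image[OF W W' add scl im])
  interpret P: vector_space_pair "scl W" "scl W'"
    by (rule vector_space_pair.intro[OF graded_spaceD(1)[OF W] graded_spaceD(1)[OF W']])
  have "Vector_Spaces.linear (scl W) (scl W') d"
    unfolding Vector_Spaces.linear_iff using graded_spaceD(1)[OF W] graded_spaceD(1)[OF W'] add scl by blast
  then have "\<exists>g. g ` UNIV \<subseteq> grd W m \<and> Vector_Spaces.linear (scl W') (scl W) g \<and> (\<forall>v\<in>d ` grd W m. d (g v) = v)" for m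
    by (rule P.linear_exists_right_inverse_on[OF _ graded_spaceD(2)[OF W]])
  then have "\<forall>m. \<exists>g. g ` UNIV \<subseteq> grd W m \<and> Vector_Spaces.linear (scl W') (scl W) g \<and> (\<forall>v\<in>d ` grd W m. d (g v) = v)" by (rule allI)
  from choice[OF this] obtain s where s: "\<And>m. s m ` UNIV \<subseteq> grd W m \<and> Vector_Spaces.linear (scl W') (scl W) (s m)
      \<and> (\<forall>v\<in>d ` grd W m. d (s m v) = v)" by (elim exE) (rule that, erule spec)
  have s1: "s m z \<in> grd W m" and s2: "Vector_Spaces.linear (scl W') (scl W) (s m)" for m z using s[of m] by blast+
  have s3: "d (s m z) = z" if "z \<in> d ` grd W m" for m z using s[of m] that by blast
  have sadd: "s m (x + y) = s m x + s m y" and sscl: "s m (scl W' c x) = scl W c (s m x)" for m x y c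
    using s2[of m] unfolding Vector_Spaces.linear_iff by blast+
  have s0: "s m 0 = 0" for m using sadd[of m 0 0] by simp
  let ?S = "lext (grd ?Z) s"
  have Shom: "?S z = s m z" if "z \<in> d ` grd W m" for m z
    by (rule lext_homogeneous[OF Z]) (use that s0 in simp_all)
  have Sadd: "?S (z + z') = ?S z + ?S z'" if "z \<in> gtot (grd ?Z)" "z' \<in> gtot (grd ?Z)" for z z'
    by (rule lext_add[OF Z that]) (rule sadd)
  have Sscl: "?S (scl W' c z) = scl W c (?S z)" if "z \<in> gtot (grd ?Z)" for c z
    using lext_scl[OF Z that, of s c "scl W c"] by (simp add: sscl scl_add[OF W] s0)
  have "d (?S z) = z" if "z \<in> gtot (grd ?Z)" for z
    using Z that
  proof (induction z rule: gtot_induct)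
    case (hom n x)
    then have z: "x \<in> d ` grd W n" by simp
    show ?case unfolding Shom[OF z] by (rule s3[OF z])
  qed (simp_all only: Sadd assms(3))
  moreover have "?S z \<in> grd W m" if "z \<in> d ` grd W m" for m z
    using Shom[OF that] s1 by simp
  ultimately show ?thesis using Sadd Sscl by (intro exI[of _ ?S]) simp
qed

text \<open>Multilinear dependence on parameters preserves exactness over a field: compose F with a
  graded linear section of d. The map d may vary with the number q of parameters because a Koszul
  sign will.\<close>

lemma lift_with_parameters:
  fixes V :: "('k::field, 'a::ab_group_add, 'x) dgspace_scheme"
    and W :: "('k, 'v::ab_group_add, 'y) dgspace_scheme" and W' :: "('k, 'w::ab_group_add, 'z) dgspace_scheme"
  assumes V: "graded_space V" "gtot (grd V) = UNIV" and W: "graded_space W" and W': "graded_space W'"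
    and add: "\<And>q x y. d q (x + y) = d q x + d q y" and scl: "\<And>q c x. d q (scl W c x) = scl W' c (d q x)"
    and im: "\<And>q m x. x \<in> grd W m \<Longrightarrow> d q x \<in> grd W' m"
    and F: "two_graded.hoch V W' n F"
    and ex: "\<And>k bs. shdeg (grd V) k bs \<Longrightarrow> F bs \<in> d (length bs) ` grd W (k + n)"
  shows "\<exists>G. two_graded.hoch V W n G \<and> (\<forall>bs. d (length bs) (G bs) = F bs)"
proof -
  interpret VW: two_graded V W by (rule two_graded.intro[OF V(1) W V(2)])
  interpret VW': two_graded V W' by (rule two_graded.intro[OF V(1) W' V(2)])
  let ?Z = "\<lambda>q m. d q ` grd W m"
  have Z: "graded_space \<lparr>scl = scl W', grd = ?Z q, dif = undefined\<rparr>" for q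
    by (rule graded_space_image[where d = "d q", OF W W' add scl im])
  have "\<forall>q. \<exists>S. (\<forall>z\<in>gtot (?Z q). \<forall>z'\<in>gtot (?Z q). S (z + z') = S z + S z') \<and>
    (\<forall>c. \<forall>z\<in>gtot (?Z q). S (scl W' c z) = scl W c (S z)) \<and>
    (\<forall>m. \<forall>z\<in>?Z q m. S z \<in> grd W m) \<and> (\<forall>z\<in>gtot (?Z q). d q (S z) = z)"
    by (rule allI, rule graded_section[where d = "d q" for q, OF W W' add scl im])
  from choice[OF this] obtain S where SS: "\<forall>q. (\<forall>z\<in>gtot (?Z q). \<forall>z'\<in>gtot (?Z q). S q (z + z') = S q z + S q z') \<and>
    (\<forall>c. \<forall>z\<in>gtot (?Z q). S q (scl W' c z) = scl W c (S q z)) \<and>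
    (\<forall>m. \<forall>z\<in>?Z q m. S q z \<in> grd W m) \<and> (\<forall>z\<in>gtot (?Z q). d q (S q z) = z)" by (rule exE)
  note S = SS[THEN spec, THEN conjunct1, rule_format] SS[THEN spec, THEN conjunct2, THEN conjunct1, rule_format]
    SS[THEN spec, THEN conjunct2, THEN conjunct2, THEN conjunct1, rule_format]
    SS[THEN spec, THEN conjunct2, THEN conjunct2, THEN conjunct2, rule_format]
  have ml: "multilin (scl V) (scl W') F" and b: "bounded_arity F" using F by (simp_all add: VW'.hoch_def)
  \<comment> \<open>The hypothesis covers homogeneous lists only; elsewhere F is a sum of such
    values, so the section still applies to it.\<close>
  have Fz: "F bs \<in> gtot (?Z (length bs))" for bs
    using V
  proof (induction bs rule: homog_list_induct)
    case (hom k bs)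
    then show ?case using grd_gtot[OF Z, of "F bs" "length bs" "k + n"] ex by simp
  next
    case (add as x y bs)
    then show ?case using gtot_add[OF Z, of "F (as @ x # bs)" _ "F (as @ y # bs)"]
      by (simp add: VW'.multilin_add[OF ml])
  qed
  let ?G = "\<lambda>bs. S (length bs) (F bs)"
  have S0: "S q 0 = 0" for q using S(1)[of 0 q 0] gtot_0[OF Z, of q] by simp
  have "multilin (scl V) (scl W) ?G"
    unfolding multilin_def
  proof (intro allI)
    fix as bs :: "'a list" and c x y
    let ?l = "length (as @ x # bs)"
    have l: "F (as @ x # bs) \<in> gtot (?Z ?l)" "F (as @ y # bs) \<in> gtot (?Z ?l)"
      using Fz[of "as @ x # bs"] Fz[of "as @ y # bs"] by simp_all
    have "scl W' c (F (as @ x # bs)) \<in> gtot (?Z ?l)" using gtot_scl[OF Z] l(1) by simp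
    then show "?G (as @ (scl V c x + y) # bs) = scl W c (?G (as @ x # bs)) + ?G (as @ y # bs)"
      using S(1)[OF _ l(2)] S(2)[OF l(1)] by (simp add: multilinD[OF ml])
  qed
  moreover have "has_deg (grd V) (grd W) n ?G"
    unfolding has_deg_def using ex S(3) by blast
  moreover have "bounded_arity ?G"
  proof -
    obtain P where "\<And>as. length as > P \<Longrightarrow> F as = 0" using b by (auto simp: bounded_arity_def)
    then show ?thesis unfolding bounded_arity_def by (intro exI[of _ P]) (simp add: S0)
  qed
  ultimately have "VW.hoch n ?G" by (simp add: VW.hoch_def)
  moreover have "d (length bs) (?G bs) = F bs" for bs by (rule S(4)[OF Fz])
  ultimately show ?thesis by blast
qed

section \<open>Cochains on A, X and B with one list of arguments as parameters\<close>

context triple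
begin

lemma hochX_eq_0I:
  assumes g: "hochX n g"
    and z: "\<And>k m l as x bs. shdeg (grd A) k as \<Longrightarrow> x \<in> grd X m \<Longrightarrow> shdeg (grd B) l bs \<Longrightarrow> g as x bs = 0"
  shows "g as x bs = 0"
proof -
  have 0: "g as x bs = 0" if "shdeg (grd A) k as" "x \<in> grd X m" for k m as x bs
    using B.gsp B.tot_eq
    by (induction bs rule: homog_list_induct) (simp_all add: z[OF that] HBX.multilin_add[OF hochXD(3)[OF g]])
  have 1: "g as x bs = 0" if "shdeg (grd A) k as" for k as x bs
    using gspM CX[of x] by (induction x rule: gtot_induct) (simp_all add: 0[OF that] hochX_add_x[OF g])
  show ?thesis
    using A.gsp A.tot_eq
    by (induction as rule: homog_list_induct) (simp_all add: 1 HAX.multilin_add[OF hochXD(1)[OF g]])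
qed

text \<open>The space of maps of fixed arities in A and B, used as coefficients for cochains in
  further parameters. It is uncurried so that its elements are functions of one argument, as
  \<open>graded_space_fun\<close> expects.\<close>

definition fib :: "nat \<Rightarrow> nat \<Rightarrow> ('k, 'a list \<times> 'x \<times> 'b list \<Rightarrow> 'x) dgspace" where
  "fib p q = \<lparr>scl = (\<lambda>c \<phi> t. scl X c (\<phi> t)),
     grd = (\<lambda>m. {\<phi>. (\<lambda>as x bs. \<phi> (as, x, bs)) \<in> hochX_pqr A X B p q m}), dif = undefined\<rparr>"

lemma fib_simps: "scl (fib p q) = (\<lambda>c \<phi> t. scl X c (\<phi> t))"
  "\<phi> \<in> grd (fib p q) m \<longleftrightarrow> hochX (m + int p + int q + 1) (\<lambda>as x bs. \<phi> (as, x, bs)) \<and>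
     (\<forall>as x bs. length as \<noteq> p \<or> length bs \<noteq> q \<longrightarrow> \<phi> (as, x, bs) = 0)"
  by (simp_all add: fib_def hochX_pqr_iff)

lemma hochX_scl: "hochX n g \<Longrightarrow> hochX n (\<lambda>as x bs. scl X c (g as x bs))"
proof -
  interpret X: vector_space "scl X" by (rule graded_spaceD[OF gspM])
  assume g: "hochX n g"
  obtain P where P: "\<And>as x bs. length as + length bs > P \<Longrightarrow> g as x bs = 0" by (rule hochX_bounded[OF g]) blast
  have "\<exists>P. \<forall>as x bs. length as + length bs > P \<longrightarrow> scl X c (g as x bs) = 0"
    using P by (intro exI[of _ P]) simp
  with g show ?thesis unfolding hochX_def multilin_def
    by (simp add: X.scale_right_distrib grd_scl[OF gspM] mult.commute)
qed

lemma graded_space_fib: "graded_space (fib p q)"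
proof (rule graded_space_fun[OF gspM fib_simps(1),
      where S = "{(as, x, bs). \<exists>k m l. shdeg (grd A) k as \<and> x \<in> grd X m \<and> shdeg (grd B) l bs}"
      and \<delta> = "\<lambda>(as, x, bs). SOME d. \<exists>k m l. shdeg (grd A) k as \<and> x \<in> grd X m \<and> shdeg (grd B) l bs \<and> d = k + m + l + int p + int q"])
  show "0 \<in> grd (fib p q) r" for r using hochX_zero by (simp add: fib_simps zero_fun_apply)
  show "f + g \<in> grd (fib p q) r" if "f \<in> grd (fib p q) r" "g \<in> grd (fib p q) r" for r f g
    using that hochX_add by (simp add: fib_simps plus_fun_apply)
  show "(\<lambda>x. scl X c (f x)) \<in> grd (fib p q) r" if "f \<in> grd (fib p q) r" for r f c
    using that hochX_scl by (simp add: fib_simps scl_0[OF gspM])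
  fix r f assume f: "f \<in> grd (fib p q) r"
  then have h: "hochX (r + int p + int q + 1) (\<lambda>as x bs. f (as, x, bs))" by (simp add: fib_simps)
  show "f t \<in> grd X ((\<lambda>(as, x, bs). SOME d. \<exists>k m l. shdeg (grd A) k as \<and> x \<in> grd X m \<and> shdeg (grd B) l bs
      \<and> d = k + m + l + int p + int q) t + r)"
    if t: "t \<in> {(as, x, bs). \<exists>k m l. shdeg (grd A) k as \<and> x \<in> grd X m \<and> shdeg (grd B) l bs}" for t
  proof -
    obtain as x bs where e: "t = (as, x, bs)" by (cases t)
    let ?P = "\<lambda>d. \<exists>k m l. shdeg (grd A) k as \<and> x \<in> grd X m \<and> shdeg (grd B) l bs \<and> d = k + m + l + int p + int q"
    have "\<exists>d. ?P d" using t e by auto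
    then have "?P (SOME d. ?P d)" by (rule someI_ex)
    then obtain k m l where kml: "shdeg (grd A) k as" "x \<in> grd X m" "shdeg (grd B) l bs"
      and d: "(SOME d. ?P d) = k + m + l + int p + int q" by blast
    have "f t \<in> grd X ((SOME d. ?P d) + r)"
      using hochXD(4)[OF h kml] unfolding d e by (simp add: algebra_simps)
    then show ?thesis by (simp add: e)
  qed
  show "f = 0" if z: "\<And>t. t \<in> {(as, x, bs). \<exists>k m l. shdeg (grd A) k as \<and> x \<in> grd X m \<and> shdeg (grd B) l bs} \<Longrightarrow> f t = 0"
  proof
    fix t :: "'a list \<times> 'x \<times> 'b list"
    obtain as x bs where "t = (as, x, bs)" by (cases t)
    then show "f t = 0 t" using hochX_eq_0I[OF h, of as x bs] z by (auto simp: zero_fun_apply)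
  qed
qed

text \<open>These conditions are additive, so they pass from the graded pieces to the total space,
  where values at inhomogeneous parameters lie.\<close>

lemma fib_gtot:
  assumes "\<phi> \<in> gtot (grd (fib p q))"
  shows "multilin (scl A) (scl X) (\<lambda>as. \<phi> (as, x, bs)) \<and> multilin (scl B) (scl X) (\<lambda>bs. \<phi> (as, x, bs)) \<and>
    \<phi> (as, scl X c x + y, bs) = scl X c (\<phi> (as, x, bs)) + \<phi> (as, y, bs) \<and>
    (length as \<noteq> p \<or> length bs \<noteq> q \<longrightarrow> \<phi> (as, x, bs) = 0)"
  using graded_space_fib assms
proof (induction \<phi> arbitrary: as x y bs c rule: gtot_induct)
  case (hom n \<phi>)
  then have h: "hochX (n + int p + int q + 1) (\<lambda>as x bs. \<phi> (as, x, bs))"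
    and z: "length as \<noteq> p \<or> length bs \<noteq> q \<Longrightarrow> \<phi> (as, x, bs) = 0" for as x bs by (simp_all add: fib_simps)
  show ?case using hochXD[OF h] z by simp
next
  case (add \<phi> \<psi>)
  then show ?case by (simp add: multilin_def plus_fun_apply scl_add[OF gspM])
qed

sublocale HBF: two_graded B "fib p q" for p q
  by standard (rule B.gsp, rule graded_space_fib, rule B.tot_eq)
sublocale HAF: two_graded A "fib p q" for p q
  by standard (rule A.gsp, rule graded_space_fib, rule A.tot_eq)

text \<open>Currying at fixed arity p in A: the list \<open>bs\<close> becomes the parameters and
  the B-slot of the coefficients stays empty. Degree m in \<open>fib p 0\<close> is total degree m +
  p + 1, hence n - 1 - p.\<close>

lemma hochX_to_fibB:
  assumes f: "hochX n f" and s: "\<And>as x bs. length as \<noteq> p \<Longrightarrow> f as x bs = 0"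
  shows "HBF.hoch p 0 (n - 1 - int p) (\<lambda>bs (as, x, bs'). if bs' = [] then f as x bs else 0)"
proof -
  let ?F = "\<lambda>bs (as, x, bs'). if bs' = [] then f as x bs else 0"
  have "multilin (scl B) (scl (fib p 0)) ?F"
    unfolding multilin_def using multilinD[OF hochXD(3)[OF f]]
    by (auto simp: fun_eq_iff plus_fun_apply fib_simps(1) scl_0[OF gspM])
  moreover have "has_deg (grd B) (grd (fib p 0)) (n - 1 - int p) ?F"
    unfolding has_deg_def
  proof (intro allI impI)
    fix l bs assume l: "shdeg (grd B) l bs"
    have "hochX (l + n) (\<lambda>as x bs'. if bs' = [] then f as x bs else 0)"
    proof (rule hochXI)
      show "multilin (scl A) (scl X) (\<lambda>as. if bs' = [] then f as x bs else 0)" for x and bs' :: "'b list"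
        using hochXD(1)[OF f, of x bs] by (auto simp: multilin_def scl_0[OF gspM])
      show "multilin (scl B) (scl X) (\<lambda>bs'. if bs' = [] then f as x bs else 0)" for as x
        by (simp add: multilin_def scl_0[OF gspM])
      show "(if bs' = [] then f as (scl X c x + y) bs else 0)
          = scl X c (if bs' = [] then f as x bs else 0) + (if bs' = [] then f as y bs else 0)" for as c x y and bs' :: "'b list"
        using hochXD(2)[OF f] by (simp add: scl_0[OF gspM])
      show "(if bs' = [] then f as x bs else 0) \<in> grd X (k + m + l' + (l + n) - 1)"
        if "shdeg (grd A) k as" "x \<in> grd X m" "shdeg (grd B) l' bs'" for k as m x l' bs'
      proof (cases bs')
        case Nil
        with that(3) have "l' = 0" by (auto elim: shdeg.cases)
        then show ?thesis using hochXD(4)[OF f that(1,2) l] by (simp add: Nil algebra_simps)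
      qed (simp add: grd_0[OF gspM])
      show "\<exists>P. \<forall>as x (bs' :: 'b list). length as + length bs' > P \<longrightarrow> (if bs' = [] then f as x bs else 0) = 0"
        by (rule exI[of _ p]) (auto intro: s)
    qed
    then show "?F bs \<in> grd (fib p 0) (l + (n - 1 - int p))"
      using s by (simp add: fib_simps algebra_simps)
  qed
  moreover have "bounded_arity ?F"
  proof -
    obtain P where P: "\<And>as x bs. length as + length bs > P \<Longrightarrow> f as x bs = 0" by (rule hochX_bounded[OF f]) blast
    show ?thesis unfolding bounded_arity_def
      by (rule exI[of _ P]) (auto simp: fun_eq_iff zero_fun_apply P)
  qed
  ultimately show ?thesis by (simp add: HBF.hoch_def)
qed

text \<open>Uncurrying. Linearity in \<open>as\<close> and x holds at arbitrary parameters by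
  \<open>fib_gtot\<close>; the degree is read off at homogeneous ones.\<close>

lemma fibB_to_hochX:
  assumes G: "HBF.hoch p 0 m G"
  shows "hochX (m + 1 + int p) (\<lambda>as x bs. G bs (as, x, []))"
    and "length as \<noteq> p \<Longrightarrow> G bs (as, x, []) = 0"
proof -
  have Gt: "G bs \<in> gtot (grd (fib p 0))" for bs by (rule HBF.hoch_gtot[OF G])
  have t: "multilin (scl A) (scl X) (\<lambda>as. G bs (as, x, bs')) \<and> multilin (scl B) (scl X) (\<lambda>bs'. G bs (as, x, bs')) \<and>
    G bs (as, scl X c x + y, bs') = scl X c (G bs (as, x, bs')) + G bs (as, y, bs') \<and>
    (length as \<noteq> p \<or> length bs' \<noteq> 0 \<longrightarrow> G bs (as, x, bs') = 0)" for as c x y bs bs'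
    by (rule fib_gtot[OF Gt])
  show z: "length as \<noteq> p \<Longrightarrow> G bs (as, x, []) = 0" for as bs x using t by blast
  show "hochX (m + 1 + int p) (\<lambda>as x bs. G bs (as, x, []))"
  proof (rule hochXI)
    show "multilin (scl A) (scl X) (\<lambda>as. G bs (as, x, []))" for x bs using t by blast
    show "G bs (as, scl X c x + y, []) = scl X c (G bs (as, x, [])) + G bs (as, y, [])" for as c x y bs
      using t by blast
    show "multilin (scl B) (scl X) (\<lambda>bs. G bs (as, x, []))" for as x
      unfolding multilin_def
    proof (intro allI)
      fix bs c b b' and bs' :: "'b list"
      have "multilin (scl B) (scl (fib p 0)) G" using G by (simp add: HBF.hoch_def)
      from multilinD[OF this, of bs c b b' bs']
      show "G (bs @ (scl B c b + b') # bs') (as, x, []) = scl X c (G (bs @ b # bs') (as, x, [])) + G (bs @ b' # bs') (as, x, [])"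
        by (simp add: fib_simps(1) plus_fun_apply)
    qed
    show "G bs (as, x, []) \<in> grd X (k + j + l + (m + 1 + int p) - 1)"
      if "shdeg (grd A) k as" "x \<in> grd X j" "shdeg (grd B) l bs" for k as j x l bs
    proof -
      have "G bs \<in> grd (fib p 0) (l + m)" using G that(3) by (simp add: HBF.hoch_def has_deg_def)
      then have "hochX (l + m + int p + 1) (\<lambda>as x bs'. G bs (as, x, bs'))" by (simp add: fib_simps)
      from hochXD(4)[OF this that(1,2) shdeg.Nil] show ?thesis by (simp add: algebra_simps)
    qed
    obtain P where P: "\<And>bs. length bs > P \<Longrightarrow> G bs = 0" using G by (auto simp: HBF.hoch_def bounded_arity_def)
    show "\<exists>P. \<forall>as x bs. length as + length bs > P \<longrightarrow> G bs (as, x, []) = 0"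
    proof (intro exI allI impI)
      fix as :: "'a list" and x and bs :: "'b list" assume l: "length as + length bs > P + p"
      show "G bs (as, x, []) = 0"
      proof (cases "length as = p")
        case True
        then have "G bs = 0" using l by (intro P) simp
        then show ?thesis by (simp add: zero_fun_apply)
      qed (rule z)
    qed
  qed
qed

text \<open>The same currying with the roles exchanged: \<open>as\<close> becomes the parameters,
  and the A-slot of the coefficients stays empty.\<close>

lemma hochX_to_fibA:
  assumes f: "hochX n f" and s: "\<And>as x bs. length bs \<noteq> q \<Longrightarrow> f as x bs = 0"
  shows "HAF.hoch 0 q (n - 1 - int q) (\<lambda>as (as', x, bs). if as' = [] then f as x bs else 0)"
proof -
  let ?F = "\<lambda>as (as', x, bs). if as' = [] then f as x bs else 0"
  have "multilin (scl A) (scl (fib 0 q)) ?F"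
    unfolding multilin_def using multilinD[OF hochXD(1)[OF f]]
    by (auto simp: fun_eq_iff plus_fun_apply fib_simps(1) scl_0[OF gspM])
  moreover have "has_deg (grd A) (grd (fib 0 q)) (n - 1 - int q) ?F"
    unfolding has_deg_def
  proof (intro allI impI)
    fix k as assume k: "shdeg (grd A) k as"
    have "hochX (k + n) (\<lambda>as' x bs. if as' = [] then f as x bs else 0)"
    proof (rule hochXI)
      show "multilin (scl B) (scl X) (\<lambda>bs. if as' = [] then f as x bs else 0)" for x and as' :: "'a list"
        using hochXD(3)[OF f, of as x] by (auto simp: multilin_def scl_0[OF gspM])
      show "multilin (scl A) (scl X) (\<lambda>as'. if as' = [] then f as x bs else 0)" for bs x
        by (simp add: multilin_def scl_0[OF gspM])
      show "(if as' = [] then f as (scl X c x + y) bs else 0)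
          = scl X c (if as' = [] then f as x bs else 0) + (if as' = [] then f as y bs else 0)" for c x y bs and as' :: "'a list"
        using hochXD(2)[OF f] by (simp add: scl_0[OF gspM])
      show "(if as' = [] then f as x bs else 0) \<in> grd X (k' + m + l + (k + n) - 1)"
        if "shdeg (grd A) k' as'" "x \<in> grd X m" "shdeg (grd B) l bs" for k' as' m x l bs
      proof (cases as')
        case Nil
        with that(1) have "k' = 0" by (auto elim: shdeg.cases)
        then show ?thesis using hochXD(4)[OF f k that(2,3)] by (simp add: Nil algebra_simps)
      qed (simp add: grd_0[OF gspM])
      show "\<exists>P. \<forall>(as' :: 'a list) x bs. length as' + length bs > P \<longrightarrow> (if as' = [] then f as x bs else 0) = 0"
        by (rule exI[of _ q]) (auto intro: s)
    qed
    then show "?F as \<in> grd (fib 0 q) (k + (n - 1 - int q))"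
      using s by (simp add: fib_simps algebra_simps)
  qed
  moreover have "bounded_arity ?F"
  proof -
    obtain P where P: "\<And>as x bs. length as + length bs > P \<Longrightarrow> f as x bs = 0" by (rule hochX_bounded[OF f]) blast
    show ?thesis unfolding bounded_arity_def
      by (rule exI[of _ P]) (auto simp: fun_eq_iff zero_fun_apply P)
  qed
  ultimately show ?thesis by (simp add: HAF.hoch_def)
qed

lemma fibA_to_hochX:
  assumes G: "HAF.hoch 0 q m G"
  shows "hochX (m + 1 + int q) (\<lambda>as x bs. G as ([], x, bs))"
    and "length bs \<noteq> q \<Longrightarrow> G as ([], x, bs) = 0"
proof -
  have Gt: "G as \<in> gtot (grd (fib 0 q))" for as by (rule HAF.hoch_gtot[OF G])
  have t: "multilin (scl A) (scl X) (\<lambda>as'. G as (as', x, bs)) \<and> multilin (scl B) (scl X) (\<lambda>bs. G as (as', x, bs)) \<and>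
    G as (as', scl X c x + y, bs) = scl X c (G as (as', x, bs)) + G as (as', y, bs) \<and>
    (length as' \<noteq> 0 \<or> length bs \<noteq> q \<longrightarrow> G as (as', x, bs) = 0)" for as as' c x y bs
    by (rule fib_gtot[OF Gt])
  show z: "length bs \<noteq> q \<Longrightarrow> G as ([], x, bs) = 0" for as bs x using t by blast
  show "hochX (m + 1 + int q) (\<lambda>as x bs. G as ([], x, bs))"
  proof (rule hochXI)
    show "multilin (scl B) (scl X) (\<lambda>bs. G as ([], x, bs))" for x as using t by blast
    show "G as ([], scl X c x + y, bs) = scl X c (G as ([], x, bs)) + G as ([], y, bs)" for as c x y bs
      using t by blast
    show "multilin (scl A) (scl X) (\<lambda>as. G as ([], x, bs))" for bs x
      unfolding multilin_def
    proof (intro allI)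
      fix as c a a' and as' :: "'a list"
      have "multilin (scl A) (scl (fib 0 q)) G" using G by (simp add: HAF.hoch_def)
      from multilinD[OF this, of as c a a' as']
      show "G (as @ (scl A c a + a') # as') ([], x, bs) = scl X c (G (as @ a # as') ([], x, bs)) + G (as @ a' # as') ([], x, bs)"
        by (simp add: fib_simps(1) plus_fun_apply)
    qed
    show "G as ([], x, bs) \<in> grd X (k + j + l + (m + 1 + int q) - 1)"
      if "shdeg (grd A) k as" "x \<in> grd X j" "shdeg (grd B) l bs" for k as j x l bs
    proof -
      have "G as \<in> grd (fib 0 q) (k + m)" using G that(1) by (simp add: HAF.hoch_def has_deg_def)
      then have "hochX (k + m + int q + 1) (\<lambda>as' x bs. G as (as', x, bs))" by (simp add: fib_simps)
      from hochXD(4)[OF this shdeg.Nil that(2,3)] show ?thesis by (simp add: algebra_simps)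
    qed
    obtain P where P: "\<And>as. length as > P \<Longrightarrow> G as = 0" using G by (auto simp: HAF.hoch_def bounded_arity_def)
    show "\<exists>P. \<forall>as x bs. length as + length bs > P \<longrightarrow> G as ([], x, bs) = 0"
    proof (intro exI allI impI)
      fix as :: "'a list" and x and bs :: "'b list" assume l: "length as + length bs > P + q"
      show "G as ([], x, bs) = 0"
      proof (cases "length bs = q")
        case True
        then have "G as = 0" using l by (intro P) simp
        then show ?thesis by (simp add: zero_fun_apply)
      qed (rule z)
    qed
  qed
qed

subsection \<open>The two exactness hypotheses\<close>

text \<open>
  \<open>dL' s\<close> is, up to sign, \<open>d\<^sub>L\<close> with the Koszul sign of the left action taken from \<open>s\<close> instead of the degree of the map.
\<close>

definition dL' :: "int \<Rightarrow> ('a list \<times> 'x \<times> 'b list \<Rightarrow> 'x) \<Rightarrow> 'a list \<times> 'x \<times> 'b list \<Rightarrow> 'x" where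
  "dL' s \<phi> = (\<lambda>(as, x, bs). (case as of [] \<Rightarrow> 0 | a # as' \<Rightarrow> lact X (A.tau s a) (\<phi> (as', x, bs)))
     - exL (\<lambda>as x bs. \<phi> (as, x, bs)) as x bs)"

text \<open>No sign parameter as in \<open>dL'\<close>: apart from an overall sign, d_R does not
  depend on the degree of the map.\<close>

definition dR' :: "('a list \<times> 'x \<times> 'b list \<Rightarrow> 'x) \<Rightarrow> 'a list \<times> 'x \<times> 'b list \<Rightarrow> 'x" where
  "dR' \<phi> = (\<lambda>(as, x, bs). exR (\<lambda>as x bs. \<phi> (as, x, bs)) as x bs)"

sublocale RX: right_action "UNIV :: 'x set" "ract X" by standard (simp_all add: ract_add_left)

sublocale RL: right_action "UNIV :: ('x \<Rightarrow> 'x) set" "\<lambda>\<phi> a x. \<phi> (lact X a x)"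
  by standard (simp_all add: plus_fun_def)

lemma exL_add: "exL (\<lambda>as x bs. f as x bs + g as x bs) as x bs = exL f as x bs + exL g as x bs"
  using RL.hE_add[of "\<lambda>as x. f as x bs" "\<lambda>as x. g as x bs" "mul A" as]
  by (simp add: exL_def plus_fun_def)

lemma exL_post:
  assumes "\<And>x y. \<tau> (x - y) = \<tau> x - \<tau> y"
  shows "exL (\<lambda>as x bs. \<tau> (f as x bs)) as x bs = \<tau> (exL f as x bs)"
  using RL.hE_post[of "\<lambda>as x. f as x bs" "\<lambda>_ \<phi> x. \<tau> (\<phi> x)" "\<lambda>\<phi> a x. \<phi> (lact X a x)" "mul A" as]
  by (simp add: exL_def fun_diff_def assms)

lemma exR_add: "exR (\<lambda>as x bs. f as x bs + g as x bs) as x bs = exR f as x bs + exR g as x bs"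
  using RX.hE_add[of "f as x" "g as x" "mul B" bs] by (cases bs) (simp_all add: exR_def)

lemma exR_post:
  assumes "\<And>x y. \<tau> (x - y) = \<tau> x - \<tau> y" "\<And>x b. \<tau> (ract X x b) = ract X (\<tau> x) b"
  shows "exR (\<lambda>as x bs. \<tau> (f as x bs)) as x bs = \<tau> (exR f as x bs)"
  using RX.hE_post[of "f as x" "\<lambda>_. \<tau>" "ract X" "mul B" bs] assms(1)[of 0 0]
  by (cases bs) (simp_all add: exR_def assms)

lemma exL_eq_0: "(\<And>as'. length as' + 1 = length as \<Longrightarrow> (\<lambda>x. g as' x bs) = (\<lambda>x. 0)) \<Longrightarrow> exL g as x bs = 0"
  using RL.hE_eq_0[of as "\<lambda>as x. g as x bs" "mul A"] by (simp add: exL_def zero_fun_def)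

lemma exR_eq_0: "(\<And>x bs'. length bs' + 1 = length bs \<Longrightarrow> g as x bs' = 0) \<Longrightarrow> exR g as x bs = 0"
  using RX.hE_eq_0[of bs "g as x" "mul B"] by (cases bs) (simp_all add: exR_def)

lemma dL'_add: "dL' s (\<phi> + \<psi>) = dL' s \<phi> + dL' s \<psi>"
  by (auto simp: fun_eq_iff dL'_def plus_fun_apply exL_add lact_add_right split: list.splits)

lemma dL'_scl: "dL' s (scl (fib p q) c \<phi>) = scl (fib p' q') c (dL' s \<phi>)"
  by (auto simp: fun_eq_iff dL'_def fib_simps(1) exL_post[of "scl X c"] scl_diff[OF gspM] lact_scl_right scl_0[OF gspM] split: list.splits)

lemma dR'_add: "dR' (\<phi> + \<psi>) = dR' \<phi> + dR' \<psi>"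
  by (auto simp: fun_eq_iff dR'_def plus_fun_apply exR_add)

lemma dR'_scl: "dR' (scl (fib p q) c \<phi>) = scl (fib p' q') c (dR' \<phi>)"
  by (auto simp: fun_eq_iff dR'_def fib_simps(1) exR_post[of "scl X c"] scl_diff[OF gspM] ract_scl_left)

text \<open>A twist of the values passes through the left action by twisting a as well, so it
  conjugates one choice of Koszul sign into another.\<close>

lemma dL'_tw: "dL' (s + k) (\<lambda>t. tw (grd X) k (\<phi> t)) = (\<lambda>t. tw (grd X) k (dL' s \<phi> t))"
proof -
  have d: "tw (grd X) k (x - y) = tw (grd X) k x - tw (grd X) k y" for x y
    by (rule additive_diff[OF gspM _ CX CX]) (rule tau_X_add)
  have "lact X (A.tau (s + k) a) (tw (grd X) k y) = tw (grd X) k (lact X (A.tau s a) y)" for a y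
    by (simp add: tau_X_lact tw_tw[OF A.gsp] add.commute)
  then show ?thesis
    by (auto simp: fun_eq_iff dL'_def exL_post[of "tw (grd X) k"] d tw_zero[OF gspM] split: list.splits)
qed

lemma dL_eq:
  assumes g: "\<phi> \<in> grd (fib p 0) r"
  shows "dL A X p r (\<lambda>as x bs. \<phi> (as, x, bs)) = (\<lambda>as x bs. sg (int p + r) (dL' r \<phi> (as, x, bs)))"
proof (intro ext)
  fix as x bs
  have z: "length as \<noteq> p \<or> bs \<noteq> [] \<Longrightarrow> \<phi> (as, x, bs) = 0" for as x bs using g by (simp add: fib_simps)
  show "dL A X p r (\<lambda>as x bs. \<phi> (as, x, bs)) as x bs = sg (int p + r) (dL' r \<phi> (as, x, bs))"
  proof (cases "length as = p + 1 \<and> bs = []")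
    case True
    then obtain a as' where as: "as = a # as'" "length as' = p" "bs = []" by (cases as) auto
    have 1: "lext (grd A) (\<lambda>n a. sg (int p + r + r * n) (lact X a (\<phi> (as', x, [])))) a
        = sg (int p + r) (lact X (A.tau r a) (\<phi> (as', x, [])))"
      using lext_tw[OF A.gsp A.tot, of "\<lambda>a. lact X a (\<phi> (as', x, []))" r "int p + r" a]
      by (simp add: lact_add_left add.commute)
    have 2: "exL (\<lambda>as x bs. \<phi> (as, x, bs)) as x [] = (\<Sum>i<p. sg (int i) (\<phi> (contract (mul A) i as, x, [])))
        + sg (int p) (\<phi> (butlast as, lact X (last as) x, []))"
      using hE_sum[of as "mul A" "\<lambda>\<phi> a x. \<phi> (lact X a x)" "\<lambda>as x. \<phi> (as, x, [])"] as
      by (simp add: exL_def plus_fun_apply sum_fun_apply sg_fun del: hE.simps)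
    have "(\<Sum>i<p. sg (int p + r + int i + 1) (\<phi> (contract (mul A) i as, x, []))) =
        - sg (int p + r) (\<Sum>i<p. sg (int i) (\<phi> (contract (mul A) i as, x, [])))"
      unfolding sg_sum sum_negf[symmetric] by (rule sum.cong) (simp_all add: sg_def)
    moreover have "sg (r + 1) y = - sg (int p + r) (sg (int p) y)" for y :: 'x by (simp add: sg_def)
    ultimately show ?thesis using True 1 as
      by (simp add: dL_def dL'_def 2[unfolded as(1)] sg_diff sg_add del: butlast.simps last.simps)
  next
    case False
    then have "exL (\<lambda>as x bs. \<phi> (as, x, bs)) as x bs = 0"
      by (intro exL_eq_0) (auto simp: fun_eq_iff intro!: z)
    with False show ?thesis
      by (auto simp: dL_def dL'_def z act_zero split: list.splits)
  qed
qed

lemma dR_eq: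
  assumes g: "\<phi> \<in> grd (fib 0 q) r"
  shows "dR X B q r (\<lambda>as x bs. \<phi> (as, x, bs)) = (\<lambda>as x bs. sg (int q + r - 1) (dR' \<phi> (as, x, bs)))"
proof (intro ext)
  fix as x bs
  have z: "as \<noteq> [] \<or> length bs \<noteq> q \<Longrightarrow> \<phi> (as, x, bs) = 0" for as x bs using g by (simp add: fib_simps)
  show "dR X B q r (\<lambda>as x bs. \<phi> (as, x, bs)) as x bs = sg (int q + r - 1) (dR' \<phi> (as, x, bs))"
  proof (cases "as = [] \<and> length bs = q + 1")
    case True
    then obtain b bs' where bs: "bs = b # bs'" "length bs' = q" "as = []" by (cases bs) auto
    have "(\<Sum>j<q. sg (int q + r + int j) (\<phi> ([], x, contract (mul B) j bs))) =
        - sg (int q + r - 1) (\<Sum>j<q. sg (int j) (\<phi> ([], x, contract (mul B) j bs)))"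
      unfolding sg_sum sum_negf[symmetric] by (rule sum.cong) (simp_all add: sg_def)
    moreover have "sg r y = - sg (int q + r - 1) (sg (int q) y)" for y :: 'x by (simp add: sg_def)
    ultimately show ?thesis
      using True bs hE_sum[of bs "mul B" "ract X" "\<lambda>bs. \<phi> ([], x, bs)"]
      by (simp add: dR_def dR'_def exR_def sg_diff sg_add del: butlast.simps last.simps hE.simps)
  next
    case False
    then have "exR (\<lambda>as x bs. \<phi> (as, x, bs)) as x bs = 0"
      by (intro exR_eq_0) (auto intro!: z)
    with False show ?thesis by (auto simp: dR_def dR'_def)
  qed
qed

lemma fib_uncurry: "g \<in> hochX_pqr A X B p q r \<longleftrightarrow> (\<lambda>(as, x, bs). g as x bs) \<in> grd (fib p q) r"
  by (simp add: fib_def)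

lemma case_prod_eta3: "(\<lambda>(as, x, bs). f (as, x, bs)) = f"
  by (auto simp: fun_eq_iff)

lemma fib_sg: "\<phi> \<in> grd (fib p q) r \<Longrightarrow> (\<lambda>t. sg k (\<phi> t)) \<in> grd (fib p q) r"
  using grd_sg[OF graded_space_fib] by (simp add: sg_fun)

lemma exact_L':
  assumes ex: "exact_L A X B"
  shows "{\<phi> \<in> grd (fib (p + 1) 0) r. dL' r \<phi> = 0} = dL' r ` grd (fib p 0) r"
proof -
  have e: "{f \<in> hochX_pqr A X B (p + 1) 0 r. dL A X (p + 1) r f = 0} = dL A X p r ` hochX_pqr A X B p 0 r"
    using ex by (simp add: exact_L_def)
  show ?thesis
  proof (intro equalityI subsetI)
    fix \<phi> assume "\<phi> \<in> {\<phi> \<in> grd (fib (p + 1) 0) r. dL' r \<phi> = 0}"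
    then have \<phi>: "\<phi> \<in> grd (fib (p + 1) 0) r" "dL' r \<phi> = 0" by auto
    then have "(\<lambda>as x bs. \<phi> (as, x, bs)) \<in> {f \<in> hochX_pqr A X B (p + 1) 0 r. dL A X (p + 1) r f = 0}"
      using dL_eq[OF \<phi>(1)] by (simp add: fib_uncurry zero_fun_def)
    then obtain g where g: "g \<in> hochX_pqr A X B p 0 r" "(\<lambda>as x bs. \<phi> (as, x, bs)) = dL A X p r g" unfolding e by blast
    let ?\<psi> = "\<lambda>t. sg (int p + r) ((\<lambda>(as, x, bs). g as x bs) t)"
    have g': "(\<lambda>(as, x, bs). g as x bs) \<in> grd (fib p 0) r" using g(1) by (simp add: fib_uncurry)
    have "?\<psi> \<in> grd (fib p 0) r" by (rule fib_sg[OF g'])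
    moreover have "dL' r ?\<psi> = \<phi>"
    proof
      fix t :: "'a list \<times> 'x \<times> 'b list"
      obtain as x bs where t: "t = (as, x, bs)" by (cases t)
      have "dL' r ?\<psi> t = sg (int p + r) (dL' r (\<lambda>(as, x, bs). g as x bs) t)"
        using exL_post[of "sg (int p + r)" g as x bs] by (simp add: t dL'_def sg_diff lact_sg split: list.splits)
      also have "\<dots> = dL A X p r g as x bs" using dL_eq[OF g'] by (simp add: t)
      also have "\<dots> = \<phi> t" using fun_cong[OF fun_cong[OF fun_cong[OF g(2), of as], of x], of bs] by (simp add: t)
      finally show "dL' r ?\<psi> t = \<phi> t" .
    qed
    ultimately show "\<phi> \<in> dL' r ` grd (fib p 0) r" by (metis image_eqI)
  next
    fix \<psi> assume "\<psi> \<in> dL' r ` grd (fib p 0) r"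
    then obtain \<phi> where \<phi>: "\<phi> \<in> grd (fib p 0) r" "\<psi> = dL' r \<phi>" by blast
    then have "dL A X p r (\<lambda>as x bs. \<phi> (as, x, bs)) \<in> {f \<in> hochX_pqr A X B (p + 1) 0 r. dL A X (p + 1) r f = 0}"
      unfolding e by (intro imageI) (simp add: fib_uncurry)
    then have h: "(\<lambda>t. sg (int p + r) (\<psi> t)) \<in> grd (fib (p + 1) 0) r"
      and z: "dL A X (p + 1) r (\<lambda>as x bs. sg (int p + r) (\<psi> (as, x, bs))) = 0"
      unfolding dL_eq[OF \<phi>(1)] \<phi>(2) by (simp_all add: fib_uncurry case_prod_eta3[of "\<lambda>t. sg k (f t)" for k f])
    have "\<psi> \<in> grd (fib (p + 1) 0) r" using fib_sg[OF h, of "int p + r"] by (simp add: sg_even)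
    moreover have "dL' r \<psi> = 0"
    proof
      fix t :: "'a list \<times> 'x \<times> 'b list"
      obtain as x bs where t: "t = (as, x, bs)" by (cases t)
      have "dL' r (\<lambda>t. sg (int p + r) (\<psi> t)) t = sg (int p + r) (dL' r \<psi> t)"
        using exL_post[of "sg (int p + r)" "\<lambda>as x bs. \<psi> (as, x, bs)" as x bs]
        by (simp add: t dL'_def sg_diff lact_sg split: list.splits)
      moreover have "sg (int (p + 1) + r) (dL' r (\<lambda>t. sg (int p + r) (\<psi> t)) t) = 0"
        using z dL_eq[OF h] t by (simp add: fun_eq_iff zero_fun_apply)
      ultimately show "dL' r \<psi> t = 0 t" by (simp add: zero_fun_apply)
    qed
    ultimately show "\<psi> \<in> {\<phi> \<in> grd (fib (p + 1) 0) r. dL' r \<phi> = 0}" by simp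
  qed
qed

lemma fib_tw:
  assumes "\<phi> \<in> grd (fib p q) r" shows "(\<lambda>t. tw (grd X) k (\<phi> t)) \<in> grd (fib p q) r"
proof -
  have h: "hochX (r + int p + int q + 1) (\<lambda>as x bs. \<phi> (as, x, bs))"
    and z: "\<And>as x bs. length as \<noteq> p \<or> length bs \<noteq> q \<Longrightarrow> \<phi> (as, x, bs) = 0" using assms by (simp_all add: fib_simps)
  have "hochX (r + int p + int q + 1) (\<lambda>as x bs. tw (grd X) k (\<phi> (as, x, bs)))"
  proof (rule hochXI)
    show "multilin (scl A) (scl X) (\<lambda>as. tw (grd X) k (\<phi> (as, x, bs)))" for x bs
      unfolding multilin_def by (simp add: multilinD[OF hochXD(1)[OF h]] tau_X_add tau_X_scl)
    show "multilin (scl B) (scl X) (\<lambda>bs. tw (grd X) k (\<phi> (as, x, bs)))" for as x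
      unfolding multilin_def by (simp add: multilinD[OF hochXD(3)[OF h]] tau_X_add tau_X_scl)
    show "\<exists>P. \<forall>as x bs. length as + length bs > P \<longrightarrow> tw (grd X) k (\<phi> (as, x, bs)) = 0"
      by (rule exI[of _ "p + q"]) (auto simp: z tw_zero[OF gspM])
    show "tw (grd X) k (\<phi> (as, x, bs)) \<in> grd X (ka + m + l + (r + int p + int q + 1) - 1)"
      if s: "shdeg (grd A) ka as" "x \<in> grd X m" "shdeg (grd B) l bs" for ka as m x l bs
      by (rule tw_grd[OF gspM hochXD(4)[OF h s]])
  qed (simp add: hochXD(2)[OF h] tau_X_add tau_X_scl)
  then show ?thesis by (simp add: fib_simps z tw_zero[OF gspM])
qed

text \<open>At fixed parameters the degree r of a value contains the degree of the parameters, while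
  the sign s of the left action does not. Twisting the values by r - s carries the exactness
  hypothesis, which has s = r, to any s.\<close>

lemma exact_L'':
  assumes ex: "exact_L A X B"
  shows "{\<phi> \<in> grd (fib (p + 1) 0) r. dL' s \<phi> = 0} = dL' s ` grd (fib p 0) r"
proof -
  define k where "k = r - s"
  let ?t = "\<lambda>\<phi> (t :: 'a list \<times> 'x \<times> 'b list). tw (grd X) k (\<phi> t)"
  have tt: "?t (?t \<phi>) = \<phi>" for \<phi> by (simp add: tau_X_tau tw_even[OF gspM])
  have d: "dL' r (?t \<phi>) = ?t (dL' s \<phi>)" for \<phi> using dL'_tw[of s k \<phi>] by (simp add: k_def)
  have d': "dL' s (?t \<phi>) = ?t (dL' r \<phi>)" for \<phi> by (metis d tt)
  have z: "?t 0 = 0" by (simp add: fun_eq_iff zero_fun_apply tw_zero[OF gspM])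
  note e = exact_L'[OF ex, of p r]
  show ?thesis
  proof (intro equalityI subsetI)
    fix \<phi> assume "\<phi> \<in> {\<phi> \<in> grd (fib (p + 1) 0) r. dL' s \<phi> = 0}"
    then have "?t \<phi> \<in> {\<phi> \<in> grd (fib (p + 1) 0) r. dL' r \<phi> = 0}" using fib_tw z by (auto simp: d)
    then obtain \<psi> where \<psi>: "\<psi> \<in> grd (fib p 0) r" "?t \<phi> = dL' r \<psi>" unfolding e by blast
    have "?t \<psi> \<in> grd (fib p 0) r" by (rule fib_tw[OF \<psi>(1)])
    moreover have "\<phi> = dL' s (?t \<psi>)" by (simp only: d' \<psi>(2)[symmetric] tt)
    ultimately show "\<phi> \<in> dL' s ` grd (fib p 0) r" by blast
  next
    fix \<psi> assume "\<psi> \<in> dL' s ` grd (fib p 0) r"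
    then obtain \<phi> where \<phi>: "\<phi> \<in> grd (fib p 0) r" "\<psi> = dL' s \<phi>" by blast
    have m: "?t \<psi> \<in> {\<phi> \<in> grd (fib (p + 1) 0) r. dL' r \<phi> = 0}"
      unfolding \<phi>(2) d[symmetric] e by (rule imageI[OF fib_tw[OF \<phi>(1)]])
    note h = m[THEN CollectD, THEN conjunct1] m[THEN CollectD, THEN conjunct2]
    have "\<psi> \<in> grd (fib (p + 1) 0) r" using fib_tw[OF h(1), of k] by (simp only: tt)
    moreover have "dL' s \<psi> = 0" using tt[of "dL' s \<psi>"] z unfolding h(2)[unfolded d] fun_cong[OF h(2)[unfolded d]] by simp
    ultimately show "\<psi> \<in> {\<phi> \<in> grd (fib (p + 1) 0) r. dL' s \<phi> = 0}" by simp
  qed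
qed

lemma exact_R':
  assumes ex: "exact_R A X B"
  shows "{\<phi> \<in> grd (fib 0 (q + 1)) r. dR' \<phi> = 0} = dR' ` grd (fib 0 q) r"
proof -
  have e: "{f \<in> hochX_pqr A X B 0 (q + 1) r. dR X B (q + 1) r f = 0} = dR X B q r ` hochX_pqr A X B 0 q r"
    using ex by (simp add: exact_R_def)
  have s: "dR' (\<lambda>t. sg k (\<phi> t)) = (\<lambda>t. sg k (dR' \<phi> t))" for k \<phi>
    using exR_post[of "sg k"] by (auto simp: fun_eq_iff dR'_def sg_diff ract_sg)
  show ?thesis
  proof (intro equalityI subsetI)
    fix \<phi> assume "\<phi> \<in> {\<phi> \<in> grd (fib 0 (q + 1)) r. dR' \<phi> = 0}"
    then have \<phi>: "\<phi> \<in> grd (fib 0 (q + 1)) r" "dR' \<phi> = 0" by auto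
    then have "(\<lambda>as x bs. \<phi> (as, x, bs)) \<in> {f \<in> hochX_pqr A X B 0 (q + 1) r. dR X B (q + 1) r f = 0}"
      using dR_eq[OF \<phi>(1)] by (simp add: fib_uncurry zero_fun_def)
    then obtain g where g: "g \<in> hochX_pqr A X B 0 q r" "(\<lambda>as x bs. \<phi> (as, x, bs)) = dR X B q r g" unfolding e by blast
    have g': "(\<lambda>(as, x, bs). g as x bs) \<in> grd (fib 0 q) r" using g(1) by (simp add: fib_uncurry)
    let ?\<psi> = "\<lambda>t. sg (int q + r - 1) ((\<lambda>(as, x, bs). g as x bs) t)"
    have "dR' ?\<psi> = \<phi>"
    proof
      fix t :: "'a list \<times> 'x \<times> 'b list"
      obtain as x bs where t: "t = (as, x, bs)" by (cases t)
      show "dR' ?\<psi> t = \<phi> t" unfolding s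
        using dR_eq[OF g'] fun_cong[OF fun_cong[OF fun_cong[OF g(2), of as], of x], of bs] by (simp add: t)
    qed
    with fib_sg[OF g'] show "\<phi> \<in> dR' ` grd (fib 0 q) r" by (metis image_eqI)
  next
    fix \<psi> assume "\<psi> \<in> dR' ` grd (fib 0 q) r"
    then obtain \<phi> where \<phi>: "\<phi> \<in> grd (fib 0 q) r" "\<psi> = dR' \<phi>" by blast
    then have "dR X B q r (\<lambda>as x bs. \<phi> (as, x, bs)) \<in> {f \<in> hochX_pqr A X B 0 (q + 1) r. dR X B (q + 1) r f = 0}"
      unfolding e by (intro imageI) (simp add: fib_uncurry)
    then have h: "(\<lambda>t. sg (int q + r - 1) (\<psi> t)) \<in> grd (fib 0 (q + 1)) r"
      and z: "dR X B (q + 1) r (\<lambda>as x bs. sg (int q + r - 1) (\<psi> (as, x, bs))) = 0"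
      unfolding dR_eq[OF \<phi>(1)] \<phi>(2) by (simp_all add: fib_uncurry case_prod_eta3[of "\<lambda>t. sg k (f t)" for k f])
    have "\<psi> \<in> grd (fib 0 (q + 1)) r" using fib_sg[OF h, of "int q + r - 1"] by (simp add: sg_even)
    moreover have "dR' \<psi> = 0"
    proof
      fix t :: "'a list \<times> 'x \<times> 'b list"
      obtain as x bs where t: "t = (as, x, bs)" by (cases t)
      have "sg (int (q + 1) + r - 1) (dR' (\<lambda>t. sg (int q + r - 1) (\<psi> t)) t) = 0"
        using z dR_eq[OF h] t by (simp add: fun_eq_iff zero_fun_apply)
      then show "dR' \<psi> t = 0 t" unfolding s by (simp add: zero_fun_apply)
    qed
    ultimately show "\<psi> \<in> {\<phi> \<in> grd (fib 0 (q + 1)) r. dR' \<phi> = 0}" by simp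
  qed
qed

end

section \<open>Removing the components of positive arity\<close>

context triple
begin

lemma exL_cong: "(\<And>as' x. length as' + 1 = length as \<Longrightarrow> g as' x bs = g' as' x bs) \<Longrightarrow> exL g as x bs = exL g' as x bs"
  using exL_add[of "\<lambda>as x bs. g as x bs - g' as x bs" g' as x bs]
    exL_eq_0[of as "\<lambda>as x bs. g as x bs - g' as x bs" bs x] by (simp add: fun_eq_iff)

lemma exR_cong: "(\<And>x bs'. length bs' + 1 = length bs \<Longrightarrow> g as x bs' = g' as x bs') \<Longrightarrow> exR g as x bs = exR g' as x bs"
  using exR_add[of "\<lambda>as x bs. g as x bs - g' as x bs" g' as x bs]
    exR_eq_0[of bs "\<lambda>as x bs. g as x bs - g' as x bs" as x] by simp

lemma lamX_cong: "(\<And>as' x. length as' + 1 = length as \<Longrightarrow> g as' x bs = g' as' x bs) \<Longrightarrow> lamX n g as x bs = lamX n g' as x bs"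
  by (cases as) (simp_all add: lamX_def)

lemma DX_eq_0:
  assumes "\<And>as' x bs'. length as' = length as \<Longrightarrow> length bs' = length bs \<Longrightarrow> g as' x bs' = 0"
  shows "DX g as x bs = 0"
  using hD_eq_0[of as "\<lambda>as. g as x bs" "A.tau 1" "dif A"] hD_eq_0[of bs "g (map (A.tau 1) as) (tw (grd X) 1 x)" "B.tau 1" "dif B"]
  by (simp add: DX_def assms)

lemma delX_eq_0:
  assumes "\<And>as' x bs'. length as' = length as \<Longrightarrow> length bs' = length bs \<Longrightarrow> g as' x bs' = 0"
  shows "delX n g as x bs = 0"
  using DX_eq_0[of as bs g x] by (simp add: delX_def assms difM_0)

lemma dX_add: "dX n (\<lambda>as x bs. g as x bs + g' as x bs) as x bs = dX n g as x bs + dX n g' as x bs"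
proof -
  have 1: "lamX n (\<lambda>as x bs. g as x bs + g' as x bs) as x bs = lamX n g as x bs + lamX n g' as x bs"
    by (cases as) (simp_all add: lamX_def lact_add_right)
  have 2: "exX (\<lambda>as x bs. g as x bs + g' as x bs) as x bs = exX g as x bs + exX g' as x bs"
    by (simp add: exX_def exL_add exR_add sg_add)
  have 3: "DX (\<lambda>as x bs. g as x bs + g' as x bs) as x bs = DX g as x bs + DX g' as x bs"
    by (simp add: DX_def hD_add)
  show ?thesis by (simp add: dX_def delX_def 1 2 3 difM_add sg_add sg_diff)
qed

lemma dX_diff: "dX n (\<lambda>as x bs. g as x bs - g' as x bs) as x bs = dX n g as x bs - dX n g' as x bs"
  using dX_add[of n "\<lambda>as x bs. g as x bs - g' as x bs" g' as x bs] by simp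

lemma dT_emb_dX:
  assumes g: "hochX n g"
  shows "PA.HT.dT n (emb (\<lambda>_. 0) g (\<lambda>_. 0)) = emb (\<lambda>_. 0) (dX n g) (\<lambda>_. 0)"
proof -
  have "actA (\<lambda>_. 0) as x bs = 0" "actB n (\<lambda>_. 0) as x bs = 0" for as x bs
    by (simp_all add: actA_def actB_def act_zero)
  moreover have "PA.HA.dT n (\<lambda>_. 0) = (\<lambda>_. 0)" "PB.HA.dT n (\<lambda>_. 0) = (\<lambda>_. 0)"
    by (intro ext PA.HA.dT_0 PB.HA.dT_0)+
  ultimately show ?thesis
    using dT_emb[of g n "\<lambda>_. 0" "\<lambda>_. 0"] hochX_add_x[OF g] by simp
qed

lemma emb_hochT: "hochX n g \<Longrightarrow> hochT n (emb (\<lambda>_. 0) g (\<lambda>_. 0))"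
  by (rule hochT_emb[OF PA.HA.hoch_zero _ PB.HA.hoch_zero])

text \<open>The middle component of the differential of an embedded cochain of the triangular
  algebra; linearity, degree and bounded arity are read off there.\<close>

lemma hochX_dX: assumes g: "hochX n g" shows "hochX (n + 1) (dX n g)"
proof -
  have "prX (emb (\<lambda>_. 0) (dX n g) (\<lambda>_. 0)) = dX n g"
    by (rule prX_emb) (rule dX_0_x, rule hochX_0_x[OF g])
  then show ?thesis using hochT_prX[OF PA.HT.hoch_dT[OF emb_hochT[OF g]]] by (simp add: dT_emb_dX[OF g])
qed

text \<open>Inherited from the square of the differential of the triangular algebra, since the
  embedding determines its middle component.\<close>

lemma dX_dX: assumes g: "hochX n g" shows "dX (n + 1) (dX n g) as x bs = 0"
proof -
  have "emb (\<lambda>_. 0) (dX (n + 1) (dX n g)) (\<lambda>_. 0) ts = 0" for ts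
    using PA.HT.dT_dT[OF emb_hochT[OF g], of ts] by (simp add: dT_emb_dX[OF g] dT_emb_dX[OF hochX_dX[OF g]])
  then have "prX (emb (\<lambda>_. 0) (dX (n + 1) (dX n g)) (\<lambda>_. 0)) as x bs = 0" by (simp add: prX_def)
  moreover have "prX (emb (\<lambda>_. 0) (dX (n + 1) (dX n g)) (\<lambda>_. 0)) = dX (n + 1) (dX n g)"
    by (rule prX_emb) (rule dX_0_x, rule hochX_0_x[OF hochX_dX[OF g]])
  ultimately show ?thesis by simp
qed

text \<open>The sign separates even from odd arities in A, each of which is cut out by
  \<open>hochX_part\<close>.\<close>

lemma hochX_sg_length: "hochX n g \<Longrightarrow> hochX n (\<lambda>as x bs. sg (k + int (length as)) (g as x bs))"
proof -
  assume g: "hochX n g"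
  let ?e = "\<lambda>p (q :: nat). even (k + int p)"
  have "(\<lambda>as x bs. sg (k + int (length as)) (g as x bs)) = (\<lambda>as x bs. (if ?e (length as) (length bs) then g as x bs else 0)
      - (if \<not> ?e (length as) (length bs) then g as x bs else 0))"
    by (auto simp: fun_eq_iff sg_def)
  moreover have "hochX n (\<lambda>as x bs. (if ?e (length as) (length bs) then g as x bs else 0)
      - (if \<not> ?e (length as) (length bs) then g as x bs else 0))"
    by (rule hochX_diff[OF hochX_part[OF g] hochX_part[OF g]])
  ultimately show ?thesis by simp
qed

text \<open>With \<open>bs\<close> as parameters, the equation for g is one equation for
  \<open>dL'\<close> at every value of \<open>bs\<close>, to be solved multilinearly in
  \<open>bs\<close>.\<close>

lemma L_lift:
  assumes ex: "exact_L A X B" and f: "hochX n f" and s: "\<And>as x bs. length as \<noteq> P + 1 \<Longrightarrow> f as x bs = 0"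
    and z: "\<And>as x bs. lamX n f as x bs - exL f as x bs = 0"
  shows "\<exists>g. hochX (n - 1) g \<and> (\<forall>as x bs. length as \<noteq> P \<longrightarrow> g as x bs = 0) \<and>
    (\<forall>as x bs. lamX (n - 1) g as x bs - exL g as x bs = f as x bs)"
proof -
  let ?F = "\<lambda>bs (as, x, bs'). if bs' = [] then f as x bs else 0"
  \<comment> \<open>The exponent of the left action on f at arities (P + 1, q), and equally on g, of
    degree n - 1, at arities (P, q); a single sign parameter serves both.\<close>
  let ?s = "\<lambda>q. n - int P - 2 - int q"
  have F: "HBF.hoch (P + 1) 0 (n - 1 - int (P + 1)) ?F" by (rule hochX_to_fibB[OF f]) (rule s)
  have e: "dL' (?s q) ` grd (fib P 0) m = {\<phi> \<in> grd (fib (P + 1) 0) m. dL' (?s q) \<phi> = 0}" for q m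
    using exact_L''[OF ex] by simp
  have "\<exists>G. HBF.hoch P 0 (n - 1 - int (P + 1)) G \<and> (\<forall>bs. dL' (?s (length bs)) (G bs) = ?F bs)"
  proof (rule lift_with_parameters[where d = "\<lambda>q. dL' (?s q)", OF B.gsp B.tot_eq graded_space_fib graded_space_fib dL'_add dL'_scl _ F])
    show "dL' (?s q) x \<in> grd (fib (P + 1) 0) m" if "x \<in> grd (fib P 0) m" for q m x
      using imageI[OF that, of "dL' (?s q)"] e by simp
    fix k bs assume k: "shdeg (grd B) k bs"
    have "?F bs \<in> grd (fib (P + 1) 0) (k + (n - 1 - int (P + 1)))" using F k by (simp add: HBF.hoch_def has_deg_def)
    moreover have "dL' (?s (length bs)) (?F bs) = 0"
    proof
      fix t :: "'a list \<times> 'x \<times> 'b list"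
      obtain as x bs' where t: "t = (as, x, bs')" by (cases t)
      show "dL' (?s (length bs)) (?F bs) t = 0 t"
      proof (cases "bs' = []")
        case True
        have "exL (\<lambda>as x bs'. ?F bs (as, x, bs')) as x [] = exL f as x bs" by (simp add: exL_def)
        moreover have "(case as of [] \<Rightarrow> 0 | a # as' \<Rightarrow> lact X (A.tau (?s (length bs)) a) (f as' x bs)) = lamX n f as x bs"
        proof (cases as)
          case (Cons a as')
          show ?thesis
          proof (cases "length as' = P + 1")
            case True
            then have "?s (length bs) = n - (int (length as') + 1 + int (length bs))" by simp
            then show ?thesis by (simp only: Cons lamX_def list.case)
          qed (simp add: Cons lamX_def s act_zero)
        qed (simp add: lamX_def)
        ultimately show ?thesis using z by (simp add: t True dL'_def zero_fun_apply cong: list.case_cong)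
      next
        case False
        then have "exL (\<lambda>as x bs'. ?F bs (as, x, bs')) as x bs' = 0" by (intro exL_eq_0) simp
        with False show ?thesis by (simp add: t dL'_def zero_fun_apply act_zero split: list.splits)
      qed
    qed
    ultimately show "?F bs \<in> dL' (?s (length bs)) ` grd (fib P 0) (k + (n - 1 - int (P + 1)))" unfolding e by simp
  qed
  then obtain G where G: "HBF.hoch P 0 (n - 1 - int (P + 1)) G" "\<And>bs. dL' (?s (length bs)) (G bs) = ?F bs" by blast
  let ?g = "\<lambda>as x bs. G bs (as, x, [])"
  have g0: "?g as x bs = 0" if "length as \<noteq> P" for as x bs by (rule fibB_to_hochX(2)[OF G(1) that])
  have "lamX (n - 1) ?g as x bs - exL ?g as x bs = f as x bs" for as x bs
  proof -
    have "lamX (n - 1) ?g as x bs = (case as of [] \<Rightarrow> 0 | a # as' \<Rightarrow> lact X (A.tau (?s (length bs)) a) (?g as' x bs))"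
    proof (cases as)
      case (Cons a as')
      show ?thesis
      proof (cases "length as' = P")
        case True
        then have "?s (length bs) = n - 1 - (int (length as') + 1 + int (length bs))" by simp
        then show ?thesis by (simp only: Cons lamX_def list.case)
      qed (simp add: Cons lamX_def g0 act_zero)
    qed (simp add: lamX_def)
    moreover have "exL (\<lambda>as x bs'. G bs (as, x, bs')) as x [] = exL ?g as x bs" by (simp add: exL_def)
    ultimately show ?thesis using fun_cong[OF G(2), of bs "(as, x, [])"] by (simp add: dL'_def)
  qed
  moreover have "hochX (n - 1) ?g" using fibB_to_hochX(1)[OF G(1)] by simp
  ultimately show ?thesis using g0 by blast
qed

text \<open>The counterpart for the right sequence, with \<open>as\<close> as parameters; as
  \<open>exR\<close> ignores the degrees of \<open>as\<close>, one map \<open>dR'\<close> works for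
  all of them.\<close>

lemma R_lift:
  assumes ex: "exact_R A X B" and f: "hochX n f" and s: "\<And>as x bs. length bs \<noteq> Q + 1 \<Longrightarrow> f as x bs = 0"
    and z: "\<And>as x bs. exR f as x bs = 0"
  shows "\<exists>g. hochX (n - 1) g \<and> (\<forall>as x bs. length bs \<noteq> Q \<longrightarrow> g as x bs = 0) \<and> (\<forall>as x bs. exR g as x bs = f as x bs)"
proof -
  let ?F = "\<lambda>as (as', x, bs). if as' = [] then f as x bs else 0"
  have F: "HAF.hoch 0 (Q + 1) (n - 1 - int (Q + 1)) ?F" by (rule hochX_to_fibA[OF f]) (rule s)
  have e: "dR' ` grd (fib 0 Q) m = {\<phi> \<in> grd (fib 0 (Q + 1)) m. dR' \<phi> = 0}" for m
    using exact_R'[OF ex] by simp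
  have "\<exists>G. HAF.hoch 0 Q (n - 1 - int (Q + 1)) G \<and> (\<forall>as. dR' (G as) = ?F as)"
  proof (rule lift_with_parameters[where d = "\<lambda>_. dR'", OF A.gsp A.tot_eq graded_space_fib graded_space_fib dR'_add dR'_scl _ F])
    show "dR' x \<in> grd (fib 0 (Q + 1)) m" if "x \<in> grd (fib 0 Q) m" for m x
      using imageI[OF that, of dR'] e by simp
    fix k as assume k: "shdeg (grd A) k as"
    have "?F as \<in> grd (fib 0 (Q + 1)) (k + (n - 1 - int (Q + 1)))" using F k by (simp add: HAF.hoch_def has_deg_def)
    moreover have "dR' (?F as) = 0"
    proof
      fix t :: "'a list \<times> 'x \<times> 'b list"
      obtain as' x bs where t: "t = (as', x, bs)" by (cases t)
      show "dR' (?F as) t = 0 t"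
      proof (cases "as' = []")
        case True
        have "exR (\<lambda>as' x bs. ?F as (as', x, bs)) [] x bs = exR f as x bs" by (cases bs) (simp_all add: exR_def)
        then show ?thesis using z by (simp add: t True dR'_def zero_fun_apply)
      next
        case False
        then have "exR (\<lambda>as' x bs. ?F as (as', x, bs)) as' x bs = 0" by (intro exR_eq_0) simp
        then show ?thesis by (simp add: t dR'_def zero_fun_apply)
      qed
    qed
    ultimately show "?F as \<in> dR' ` grd (fib 0 Q) (k + (n - 1 - int (Q + 1)))" unfolding e by simp
  qed
  then obtain G where G: "HAF.hoch 0 Q (n - 1 - int (Q + 1)) G" "\<And>as. dR' (G as) = ?F as" by blast
  let ?g = "\<lambda>as x bs. G as ([], x, bs)"
  have g0: "?g as x bs = 0" if "length bs \<noteq> Q" for as x bs by (rule fibA_to_hochX(2)[OF G(1) that])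
  have "exR ?g as x bs = f as x bs" for as x bs
  proof -
    have "exR (\<lambda>as' x bs. G as (as', x, bs)) [] x bs = exR ?g as x bs" by (simp add: exR_def)
    then show ?thesis using fun_cong[OF G(2), of as "([], x, bs)"] by (simp add: dR'_def)
  qed
  moreover have "hochX (n - 1) ?g" using fibA_to_hochX(1)[OF G(1)] by simp
  ultimately show ?thesis using g0 by blast
qed

text \<open>Exactness of the left sequence removes the component of top arity \<open>P + 1\<close> in \<open>A\<close>; induct downwards.\<close>

lemma peel_L:
  assumes ex: "exact_L A X B" and g: "hochX n g" and z: "\<And>as x bs. as \<noteq> [] \<Longrightarrow> dX n g as x bs = 0"
  shows "\<exists>g'. hochX (n - 1) g' \<and> (\<forall>as x bs. as \<noteq> [] \<longrightarrow> dX (n - 1) g' as x bs = g as x bs)"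
proof -
  have "\<exists>g'. hochX (n - 1) g' \<and> (\<forall>as x bs. as \<noteq> [] \<longrightarrow> dX (n - 1) g' as x bs = g as x bs)"
    if "hochX n g" "\<And>as x bs. as \<noteq> [] \<Longrightarrow> dX n g as x bs = 0" "\<And>as x bs. length as > P \<Longrightarrow> g as x bs = 0" for P g
    using that
  proof (induction P arbitrary: g)
    case 0
    then have "\<forall>as x bs. as \<noteq> [] \<longrightarrow> dX (n - 1) (\<lambda>_ _ _. 0) as x bs = g as x bs"
      using dX_diff[of "n - 1" "\<lambda>_ _ _. 0" "\<lambda>_ _ _. 0"] by simp
    then show ?case using hochX_zero by blast
  next
    case (Suc P)
    note g = Suc.prems(1) and z = Suc.prems(2) and top = Suc.prems(3)
    let ?f = "\<lambda>as x bs. if length as = P + 1 then g as x bs else 0"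
    have f: "hochX n ?f" using hochX_part[OF g, of "\<lambda>p _. p = P + 1"] by simp
    \<comment> \<open>At arity P + 2 in A only \<open>lamX\<close> and \<open>exL\<close> of the top
      component contribute to \<open>dX n g\<close>: the other terms preserve the arity in A and g
      vanishes there.\<close>
    have "lamX n ?f as x bs - exL ?f as x bs = 0" for as x bs
    proof (cases "length as = P + 2")
      case True
      then have l: "as \<noteq> []" "length as > Suc P" by auto
      have "delX n g as x bs = 0" by (rule delX_eq_0) (use top l in simp)
      moreover have "exR g as x bs = 0" by (rule exR_eq_0) (use top l in simp)
      ultimately have "sg (n - 1) (lamX n g as x bs - exL g as x bs) = 0"
        using z[OF l(1), of x bs] by (simp add: dX_def exX_def)
      then have "lamX n g as x bs - exL g as x bs = 0" by (simp add: sg_def split: if_splits)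
      moreover have "lamX n ?f as x bs = lamX n g as x bs" by (rule lamX_cong) (use True in simp)
      moreover have "exL ?f as x bs = exL g as x bs" by (rule exL_cong) (use True in simp)
      ultimately show ?thesis by simp
    next
      case False
      have "lamX n ?f as x bs = 0" using False by (cases as) (auto simp: lamX_def act_zero)
      moreover have "exL ?f as x bs = 0" by (rule exL_eq_0) (use False in auto)
      ultimately show ?thesis by simp
    qed
    with L_lift[OF ex f, of P] obtain g1 where g1: "hochX (n - 1) g1" "\<And>as x bs. length as \<noteq> P \<Longrightarrow> g1 as x bs = 0"
      and e: "\<And>as x bs. lamX (n - 1) g1 as x bs - exL g1 as x bs = ?f as x bs" by (auto cong: if_cong)
    \<comment> \<open>The sign cancels the prefactor (-1)^(n - 2) of
      \<open>dX (n - 1)\<close>.\<close>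
    let ?h = "\<lambda>as x bs. sg n (g1 as x bs)"
    have h: "hochX (n - 1) ?h" by (rule hochX_sg[OF g1(1)])
    have "dX (n - 1) ?h as x bs = g as x bs" if l: "length as > P" for as x bs
    proof -
      have "lamX (n - 1) ?h as x bs = sg n (lamX (n - 1) g1 as x bs)" by (cases as) (simp_all add: lamX_def lact_sg)
      moreover have "exL ?h as x bs = sg n (exL g1 as x bs)" by (rule exL_post) (rule sg_diff)
      moreover have "delX (n - 1) ?h as x bs = 0" by (rule delX_eq_0) (use g1(2) l in simp)
      moreover have "exR ?h as x bs = 0" by (rule exR_eq_0) (use g1(2) l in simp)
      ultimately have "dX (n - 1) ?h as x bs = sg (n - 2) (sg n (lamX (n - 1) g1 as x bs - exL g1 as x bs))"
        by (simp add: dX_def exX_def sg_diff)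
      also have "\<dots> = g as x bs" unfolding e using top[of as x bs] l by (simp add: sg_def)
      finally show ?thesis .
    qed
    moreover have "hochX n (\<lambda>as x bs. g as x bs - dX (n - 1) ?h as x bs)"
      using hochX_diff[OF g] hochX_dX[OF h] by simp
    moreover have "dX n (\<lambda>as x bs. g as x bs - dX (n - 1) ?h as x bs) as x bs = 0" if "as \<noteq> []" for as x bs
      using dX_dX[OF h, of as x bs] z[OF that] by (simp add: dX_diff)
    ultimately obtain g2 where g2: "hochX (n - 1) g2"
      "\<And>as x bs. as \<noteq> [] \<Longrightarrow> dX (n - 1) g2 as x bs = g as x bs - dX (n - 1) ?h as x bs"
      using Suc.IH[of "\<lambda>as x bs. g as x bs - dX (n - 1) ?h as x bs"] by auto
    have "hochX (n - 1) (\<lambda>as x bs. g2 as x bs + ?h as x bs)" by (rule hochX_add[OF g2(1) h])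
    moreover have "dX (n - 1) (\<lambda>as x bs. g2 as x bs + ?h as x bs) as x bs = g as x bs" if "as \<noteq> []" for as x bs
      unfolding dX_add g2(2)[OF that] by simp
    ultimately show ?case by blast
  qed
  moreover obtain P where P: "\<And>as x bs. length as + length bs > P \<Longrightarrow> g as x bs = 0" by (rule hochX_bounded[OF g]) blast
  have "g as x bs = 0" if "length as > P" for as x bs by (rule P) (use that in simp)
  ultimately show ?thesis using g z by blast
qed

text \<open>Downward induction on the top arity in B. A top component is closed for
  \<open>exR\<close> alone, because every other term of \<open>dX\<close> preserves the arity in
  B.\<close>

lemma peel_R:
  assumes ex: "exact_R A X B" and g: "hochX n g" and z: "\<And>as x bs. bs \<noteq> [] \<Longrightarrow> dX n g as x bs = 0"
  shows "\<exists>g'. hochX (n - 1) g' \<and> (\<forall>as x bs. bs \<noteq> [] \<longrightarrow> dX (n - 1) g' as x bs = g as x bs)"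
proof -
  have "\<exists>g'. hochX (n - 1) g' \<and> (\<forall>as x bs. bs \<noteq> [] \<longrightarrow> dX (n - 1) g' as x bs = g as x bs)"
    if "hochX n g" "\<And>as x bs. bs \<noteq> [] \<Longrightarrow> dX n g as x bs = 0" "\<And>as x bs. length bs > Q \<Longrightarrow> g as x bs = 0" for Q g
    using that
  proof (induction Q arbitrary: g)
    case 0
    then have "\<forall>as x bs. bs \<noteq> [] \<longrightarrow> dX (n - 1) (\<lambda>_ _ _. 0) as x bs = g as x bs"
      using dX_diff[of "n - 1" "\<lambda>_ _ _. 0" "\<lambda>_ _ _. 0"] by simp
    then show ?case using hochX_zero by blast
  next
    case (Suc Q)
    note g = Suc.prems(1) and z = Suc.prems(2) and top = Suc.prems(3)
    let ?f = "\<lambda>as x bs. if length bs = Q + 1 then g as x bs else 0"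
    have f: "hochX n ?f" using hochX_part[OF g, of "\<lambda>_ q. q = Q + 1"] by simp
    have "exR ?f as x bs = 0" for as x bs
    proof (cases "length bs = Q + 2")
      case True
      then have l: "bs \<noteq> []" "length bs > Suc Q" by auto
      have "delX n g as x bs = 0" by (rule delX_eq_0) (use top l in simp)
      moreover have "exL g as x bs = 0" by (rule exL_eq_0) (use top l in simp)
      moreover have "lamX n g as x bs = 0" by (cases as) (simp_all add: lamX_def top l act_zero)
      ultimately have "sg (n - 1) (- sg (int (length as)) (exR g as x bs)) = 0"
        using z[OF l(1), of as x] by (simp add: dX_def exX_def)
      then have "exR g as x bs = 0" by (simp add: sg_def split: if_splits)
      moreover have "exR ?f as x bs = exR g as x bs" by (rule exR_cong) (use True in simp)
      ultimately show ?thesis by simp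
    next
      case False
      show ?thesis by (rule exR_eq_0) (use False in auto)
    qed
    with R_lift[OF ex f, of Q] obtain g1 where g1: "hochX (n - 1) g1" "\<And>as x bs. length bs \<noteq> Q \<Longrightarrow> g1 as x bs = 0"
      and e: "\<And>as x bs. exR g1 as x bs = ?f as x bs" by (auto cong: if_cong)
    \<comment> \<open>In \<open>dX (n - 1)\<close> the term \<open>exR\<close> carries the factor
      -(-1)^(n - 2 + p) with p the arity in A; this sign cancels it.\<close>
    let ?h = "\<lambda>as x bs. sg (n + 1 + int (length as)) (g1 as x bs)"
    have h: "hochX (n - 1) ?h" by (rule hochX_sg_length[OF g1(1)])
    have "dX (n - 1) ?h as x bs = g as x bs" if l: "length bs > Q" for as x bs
    proof -
      have "exR ?h as x bs = exR (\<lambda>as' x bs. sg (n + 1 + int (length as)) (g1 as' x bs)) as x bs" by (simp add: exR_def)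
      also have "\<dots> = sg (n + 1 + int (length as)) (exR g1 as x bs)" by (rule exR_post) (simp_all add: sg_diff ract_sg)
      finally have "exR ?h as x bs = sg (n + 1 + int (length as)) (exR g1 as x bs)" .
      moreover have "lamX (n - 1) ?h as x bs = 0" using g1(2) l by (cases as) (simp_all add: lamX_def act_zero)
      moreover have "exL ?h as x bs = 0" by (rule exL_eq_0) (use g1(2) l in simp)
      moreover have "delX (n - 1) ?h as x bs = 0" by (rule delX_eq_0) (use g1(2) l in simp)
      ultimately have "dX (n - 1) ?h as x bs = exR g1 as x bs"
        by (simp add: dX_def exX_def) (simp add: sg_def)
      then show ?thesis unfolding e using top[of bs as x] l by simp
    qed
    moreover have "hochX n (\<lambda>as x bs. g as x bs - dX (n - 1) ?h as x bs)"
      using hochX_diff[OF g] hochX_dX[OF h] by simp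
    moreover have "dX n (\<lambda>as x bs. g as x bs - dX (n - 1) ?h as x bs) as x bs = 0" if "bs \<noteq> []" for as x bs
      using dX_dX[OF h, of as x bs] z[OF that] by (simp add: dX_diff)
    ultimately obtain g2 where g2: "hochX (n - 1) g2"
      "\<And>as x bs. bs \<noteq> [] \<Longrightarrow> dX (n - 1) g2 as x bs = g as x bs - dX (n - 1) ?h as x bs"
      using Suc.IH[of "\<lambda>as x bs. g as x bs - dX (n - 1) ?h as x bs"] by auto
    have "hochX (n - 1) (\<lambda>as x bs. g2 as x bs + ?h as x bs)" by (rule hochX_add[OF g2(1) h])
    moreover have "dX (n - 1) (\<lambda>as x bs. g2 as x bs + ?h as x bs) as x bs = g as x bs" if "bs \<noteq> []" for as x bs
      unfolding dX_add g2(2)[OF that] by simp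
    ultimately show ?case by blast
  qed
  moreover obtain P where P: "\<And>as x bs. length as + length bs > P \<Longrightarrow> g as x bs = 0" by (rule hochX_bounded[OF g]) blast
  have "g as x bs = 0" if "length bs > P" for as x bs by (rule P) (use that in simp)
  ultimately show ?thesis using g z by blast
qed

end

section \<open>Cochains with values in the endomorphism bimodules\<close>

text \<open>The commutator sign becomes a twist of f inside the endomorphism space, so the formula
  holds for inhomogeneous f.\<close>

lemma (in endo_space) U_dif_tw:
  assumes "f \<in> gtot (grd U)"
  shows "dif U f x = dif X (f x) - tw (grd U) 1 f (dif X x)"
  using gspU assms
proof (induction f rule: gtot_induct)
  case (hom r f)
  then show ?case by (simp add: U_dif_hom comm_def U_tw_hom)
next
  case (add f g)
  then show ?case unfolding U_dif_add[OF add(1,2)] tw_add[OF gspU add(1,2)] by (simp add: plus_fun_apply difM_add)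
qed

lemma (in endo_space) U_x: "f \<in> gtot (grd U) \<Longrightarrow> f (scl X c x + y) = scl X c (f x) + f y"
  by (simp add: U_additive U_linear)

section \<open>Right linear endomorphisms as coefficients\<close>

context triple
begin

sublocale HR: hoch_coeff A ER by (rule hoch_coeff.intro) (rule dg_bimod_ER)
sublocale HL: hoch_coeff B EL by (rule hoch_coeff.intro) (rule dg_bimod_EL)

lemma ER_ract_gtot_apply: "f \<in> gtot (grd ER) \<Longrightarrow> f (ract X x b) = ract X (f x) b"
  using ER.gspU by (induction f rule: gtot_induct) (simp_all add: ER_ract plus_fun_apply ract_add_left)

lemma hE_ract_ER: "hE (mul A) (ract ER) F as x = hE (mul A) (\<lambda>\<phi> a x. \<phi> (lact X a x)) F as x"
  by (simp add: ER_simps(4)[abs_def])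

text \<open>Embeds Hoch(A, End(X)) as the cochains without arguments from B. The sign (-1)^p makes
  it commute with the differentials and turns the map induced by \<open>rhoA\<close> into
  \<open>actA\<close>.\<close>

definition of_ER :: "('a list \<Rightarrow> 'x \<Rightarrow> 'x) \<Rightarrow> 'a list \<Rightarrow> 'x \<Rightarrow> 'b list \<Rightarrow> 'x" where
  "of_ER \<gamma> as x bs = (if bs = [] then sg (int (length as)) (\<gamma> as x) else 0)"

lemma hochX_of_ER:
  assumes \<gamma>: "HR.hoch N \<gamma>" shows "hochX (N + 1) (of_ER \<gamma>)"
proof (rule hochXI)
  have ml: "multilin (scl A) (scl ER) \<gamma>" using \<gamma> by (simp add: HR.hoch_def)
  show "multilin (scl A) (scl X) (\<lambda>as. of_ER \<gamma> as x bs)" for x bs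
    unfolding multilin_def of_ER_def using multilinD[OF ml]
    by (simp add: ER_simps(1) plus_fun_apply sg_add scl_sg[OF gspM] scl_0[OF gspM])
  show "multilin (scl B) (scl X) (of_ER \<gamma> as x)" for as x
    by (simp add: multilin_def of_ER_def scl_0[OF gspM])
  show "of_ER \<gamma> as (scl X c x + y) bs = scl X c (of_ER \<gamma> as x bs) + of_ER \<gamma> as y bs" for as c x y bs
    by (simp add: of_ER_def ER.U_x[OF HR.hoch_gtot[OF \<gamma>]] sg_add scl_sg[OF gspM] scl_0[OF gspM])
  show "of_ER \<gamma> as x bs \<in> grd X (k + m + l + (N + 1) - 1)"
    if s: "shdeg (grd A) k as" "x \<in> grd X m" "shdeg (grd B) l bs" for k as m x l bs
  proof (cases bs)
    case Nil
    with s(3) have l: "l = 0" by (auto elim: shdeg.cases)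
    have "\<gamma> as \<in> grd ER (k + N)" using \<gamma> s(1) by (simp add: HR.hoch_def has_deg_def)
    from lin_degX(3)[OF ER.U_lin[OF this] s(2)] show ?thesis
      by (simp add: of_ER_def Nil l grd_sg[OF gspM] algebra_simps)
  qed (simp add: of_ER_def grd_0[OF gspM])
  obtain P where "\<And>as. length as > P \<Longrightarrow> \<gamma> as = 0" using \<gamma> by (auto simp: HR.hoch_def bounded_arity_def)
  then show "\<exists>P. \<forall>as x bs. length as + length bs > P \<longrightarrow> of_ER \<gamma> as x bs = 0"
    by (intro exI[of _ P]) (auto simp: of_ER_def zero_fun_apply)
qed

text \<open>With no entry from B the two differentials agree term by term. With one entry, what
  remains is the failure of right linearity, which is 0; with more, no term survives for reasons of
  arity.\<close>

lemma dX_of_ER: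
  assumes \<gamma>: "HR.hoch N \<gamma>" shows "dX (N + 1) (of_ER \<gamma>) as x bs = of_ER (HR.dT N \<gamma>) as x bs"
proof (cases "bs = []")
  case True
  note C = HR.hoch_gtot[OF \<gamma>]
  let ?g = "\<lambda>as. of_ER \<gamma> as x []"
  have 1: "lamX (N + 1) (of_ER \<gamma>) as x [] = - sg (int (length as)) (HR.lam N \<gamma> as x)"
    by (cases as) (simp_all add: lamX_def of_ER_def ER_simps(3) lact_sg sg_Suc zero_fun_apply)
  have "hE (mul A) (\<lambda>\<phi> a x. \<phi> (lact X a x)) (\<lambda>as x. sg (int (length as)) (\<gamma> as x)) as
      = (\<lambda>x. sg (int (length as) - 1) (hE (mul A) (\<lambda>\<phi> a x. \<phi> (lact X a x)) \<gamma> as x))"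
    using RL.hE_post[of \<gamma> "\<lambda>k \<phi> x. sg k (\<phi> x)" "\<lambda>\<phi> a x. \<phi> (lact X a x)" "mul A" as]
    by (simp add: fun_eq_iff sg_diff)
  then have 2: "exX (of_ER \<gamma>) as x [] = - sg (int (length as)) (hE (mul A) (ract ER) \<gamma> as x)"
    by (simp add: exX_def exL_def exR_def of_ER_def hE_ract_ER) (simp add: sg_def)
  have "hD (A.tau 1) (dif A) (\<lambda>as. sg (int (length as)) (\<gamma> as x)) as = sg (int (length as)) (hD (A.tau 1) (dif A) \<gamma> as x)"
    using hD_post[of UNIV \<gamma> "\<lambda>k \<phi>. sg k (\<phi> x)" "A.tau 1" "dif A" as] by (simp add: sg_add plus_fun_apply)
  then have 3: "DX (of_ER \<gamma>) as x [] = sg (int (length as)) (hD (A.tau 1) (dif A) \<gamma> as x + \<gamma> (map (A.tau 1) as) (dif X x))"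
    by (simp add: DX_def of_ER_def sg_add)
  \<comment> \<open>\<open>hoch_map_tw\<close> moves the commutator sign onto \<open>as\<close>; the
    second summand is then the term of \<open>DX\<close> that differentiates x.\<close>
  have "dif ER (\<gamma> as) x = dif X (\<gamma> as x) - sg (N - int (length as)) (\<gamma> (map (A.tau 1) as) (dif X x))"
    using HR.hoch_map_tw[OF \<gamma>, of 1 as] by (simp add: ER.U_dif_tw[OF C] sg_fun)
  then have "HR.dT N \<gamma> as x = sg (N - 1) (HR.lam N \<gamma> as x - hE (mul A) (ract ER) \<gamma> as x) + dif X (\<gamma> as x)
     - sg (N - int (length as)) (\<gamma> (map (A.tau 1) as) (dif X x)) - sg (N - int (length as)) (hD (A.tau 1) (dif A) \<gamma> as x)"
    by (simp add: HR.dT_def HR.dH_def HR.del_def plus_fun_apply fun_diff_def sg_fun)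
  then show ?thesis
    using 1 2 3 True by (simp add: of_ER_def dX_def delX_def difM_sg) (simp add: sg_def)
next
  case False
  have 1: "lamX (N + 1) (of_ER \<gamma>) as x bs = 0" using False by (cases as) (simp_all add: lamX_def of_ER_def act_zero)
  have 2: "exL (of_ER \<gamma>) as x bs = 0" by (rule exL_eq_0) (simp add: of_ER_def False)
  have 3: "delX (N + 1) (of_ER \<gamma>) as x bs = 0" by (rule delX_eq_0) (use False in \<open>auto simp: of_ER_def\<close>)
  note rl = ER_ract_gtot_apply[OF HR.hoch_gtot[OF \<gamma>]]
  have 4: "exR (of_ER \<gamma>) as x bs = 0"
  proof (cases "tl bs = []")
    case True
    then obtain b where "bs = [b]" using False by (cases bs) auto
    then show ?thesis by (simp add: exR_def of_ER_def rl ract_sg)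
  qed (rule exR_eq_0, cases bs, auto simp: of_ER_def)
  show ?thesis using False by (simp add: dX_def exX_def 1 2 3 4 of_ER_def)
qed

text \<open>For a cochain without arguments from B, the component of the differential with exactly
  one such argument measures the failure of right linearity; its vanishing puts the values into
  \<open>ER\<close>.\<close>

lemma ER_of_hochX:
  assumes g: "hochX n g" and b: "\<And>as x bs. bs \<noteq> [] \<Longrightarrow> g as x bs = 0" and z: "\<And>as x b. dX n g as x [b] = 0"
  shows "\<exists>\<gamma>. HR.hoch (n - 1) \<gamma> \<and> g = of_ER \<gamma>"
proof (intro exI conjI)
  let ?\<gamma> = "\<lambda>as x. sg (int (length as)) (g as x [])"
  show "g = of_ER ?\<gamma>" by (auto simp: fun_eq_iff of_ER_def sg_even b)
  have rl: "g as (ract X x b) [] = ract X (g as x []) b" for as x b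
  proof -
    have "lamX n g as x [b] = 0" by (cases as) (simp_all add: lamX_def assms(2) act_zero)
    moreover have "exL g as x [b] = 0" by (rule exL_eq_0) (simp add: assms(2))
    moreover have "delX n g as x [b] = 0" by (rule delX_eq_0, rule assms(2)) auto
    ultimately show ?thesis
      using z[of as x b] by (simp add: dX_def exX_def exR_def sg_def split: if_splits)
  qed
  have "multilin (scl A) (scl ER) ?\<gamma>"
    unfolding multilin_def using multilinD[OF hochXD(1)[OF g]]
    by (simp add: ER_simps(1) fun_eq_iff plus_fun_apply sg_add scl_sg[OF gspM])
  moreover have "has_deg (grd A) (grd ER) (n - 1) ?\<gamma>"
    unfolding has_deg_def
  proof (intro allI impI)
    fix k as assume k: "shdeg (grd A) k as"
    have "lin_deg X X (k + (n - 1)) (?\<gamma> as)"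
      unfolding lin_deg_def using hochXD(4)[OF g k _ shdeg.Nil]
      by (auto simp: hochX_add_x[OF g] hochX_scl_x[OF g] sg_add scl_sg[OF gspM] grd_sg[OF gspM] algebra_simps)
    then show "?\<gamma> as \<in> grd ER (k + (n - 1))" by (simp add: ER_simps(2) end_r_deg_def rl ract_sg)
  qed
  moreover have "bounded_arity ?\<gamma>"
  proof -
    obtain P where P: "\<And>as x bs. length as + length bs > P \<Longrightarrow> g as x bs = 0" by (rule hochX_bounded[OF g]) blast
    show ?thesis unfolding bounded_arity_def
      by (rule exI[of _ P]) (auto simp: fun_eq_iff zero_fun_apply P)
  qed
  ultimately show "HR.hoch (n - 1) ?\<gamma>" by (simp add: HR.hoch_def)
qed

lemma of_ER_inject: assumes "\<And>as x bs. of_ER \<gamma> as x bs = of_ER \<delta> as x bs" shows "\<gamma> as = \<delta> as"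
proof
  fix x show "\<gamma> as x = \<delta> as x" using assms[of as x "[]"] by (simp add: of_ER_def sg_def split: if_splits)
qed

text \<open>After peeling, the rest of g is a cochain with values in right linear endomorphisms
  whose differential is the image of a multiple of f under \<open>rhoA\<close>. This is the input of
  \<open>weakly_cone_nilpotent_exact\<close>.\<close>

theorem kernel_B_acyclic:
  assumes ex: "exact_R A X B" and mor: "bimod_mor (regular_bimod A) ER (rhoA X)"
    and nil: "weakly_cone_nilpotent A (regular_bimod A) ER (rhoA X)"
    and f: "PA.HA.hoch n f" "\<And>as. PA.HA.dT n f as = 0" and g: "hochX n g"
    and z: "\<And>as x bs. dX n g as x bs - sg (n - 1) (actA f as x bs) = 0"
  shows "\<exists>f' g'. PA.HA.hoch (n - 1) f' \<and> hochX (n - 1) g' \<and> (\<forall>as. PA.HA.dT (n - 1) f' as = f as) \<and>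
    (\<forall>as x bs. dX (n - 1) g' as x bs - sg (n - 2) (actA f' as x bs) = g as x bs)"
proof -
  interpret R: hoch_morphism A "regular_bimod A" ER "rhoA X"
    by (intro hoch_morphism.intro hoch_morphism_axioms.intro PA.HA.hoch_coeff_axioms HR.hoch_coeff_axioms mor)
  have "dX n g as x bs = 0" if "bs \<noteq> []" for as x bs using z[of as x bs] that by (simp add: actA_def)
  from peel_R[OF ex g this] obtain g0 where g0: "hochX (n - 1) g0"
    "\<And>as x bs. bs \<noteq> [] \<Longrightarrow> dX (n - 1) g0 as x bs = g as x bs" by blast
  let ?g2 = "\<lambda>as x bs. g as x bs - dX (n - 1) g0 as x bs"
  have g2: "hochX n ?g2" using hochX_diff[OF g] hochX_dX[OF g0(1)] by simp
  have dg2: "dX n ?g2 as x bs = sg (n - 1) (actA f as x bs)" for as x bs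
    using z[of as x bs] dX_dX[OF g0(1), of as x bs] by (simp add: dX_diff)
  have "\<exists>\<gamma>. HR.hoch (n - 1) \<gamma> \<and> ?g2 = of_ER \<gamma>"
    by (rule ER_of_hochX[OF g2]) (simp_all add: g0(2) dg2 actA_def)
  then obtain \<gamma> where \<gamma>: "HR.hoch (n - 1) \<gamma>" "?g2 = of_ER \<gamma>" by blast
  \<comment> \<open>The sign with which \<open>actA\<close> enters the middle component of the
    differential.\<close>
  let ?u = "\<lambda>as. sg (n - 1) (f as)"
  have u: "PA.HA.hoch n ?u" "PA.HA.dT n ?u as = 0" for as
    using PA.HA.hoch_sg[OF f(1)] PA.HA.dT_sg[of f n "n - 1" as] f(2) by simp_all
  have "rhoA X (?u as) = HR.dT (n - 1) \<gamma> as" for as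
  proof (rule of_ER_inject)
    fix as x bs
    have "of_ER (\<lambda>as. rhoA X (?u as)) as x bs = sg (n - 1) (actA f as x bs)"
      by (simp add: actA_def of_ER_def rhoA_def lact_sg_left add.commute)
    also have "\<dots> = of_ER (HR.dT (n - 1) \<gamma>) as x bs"
      using dg2[of as x bs] dX_of_ER[OF \<gamma>(1), of as x bs] by (simp add: \<gamma>(2))
    finally show "of_ER (\<lambda>as. rhoA X (?u as)) as x bs = of_ER (HR.dT (n - 1) \<gamma>) as x bs" .
  qed
  from R.weakly_cone_nilpotent_exact[OF nil u \<gamma>(1) this] obtain u' v' where
    u': "PA.HA.hoch (n - 1) u'" "\<And>as. PA.HA.dT (n - 1) u' as = ?u as" and v': "HR.hoch (n - 2) v'"
    and e: "\<And>as. rhoA X (u' as) = \<gamma> as + HR.dT (n - 2) v' as" by blast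
  \<comment> \<open>The minus sign before \<open>of_ER v'\<close> reflects the relation solved for
    the remainder: it is the image of u' minus the boundary of v'.\<close>
  let ?f' = "\<lambda>as. sg (n - 1) (u' as)" and ?g' = "\<lambda>as x bs. g0 as x bs - of_ER v' as x bs"
  have "PA.HA.dT (n - 1) ?f' as = f as" for as
    using PA.HA.dT_sg[of u' "n - 1" "n - 1" as] u'(2) by (simp add: sg_even)
  moreover have "hochX (n - 1) ?g'" using hochX_diff[OF g0(1)] hochX_of_ER[OF v'] by simp
  moreover have "dX (n - 1) ?g' as x bs - sg (n - 2) (actA ?f' as x bs) = g as x bs" for as x bs
  proof -
    have "sg (n - 2) (actA ?f' as x bs) = - of_ER (\<lambda>as. rhoA X (u' as)) as x bs"
      by (simp add: actA_def of_ER_def rhoA_def lact_sg_left) (simp add: sg_def)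
    also have "of_ER (\<lambda>as. rhoA X (u' as)) as x bs = of_ER \<gamma> as x bs + of_ER (HR.dT (n - 2) v') as x bs"
      unfolding e by (simp add: of_ER_def plus_fun_apply sg_add)
    also have "of_ER (HR.dT (n - 2) v') as x bs = dX (n - 1) (of_ER v') as x bs"
      using dX_of_ER[OF v', of as x bs] by simp
    also have "of_ER \<gamma> as x bs = g as x bs - dX (n - 1) g0 as x bs" using \<gamma>(2) by (simp add: fun_eq_iff)
    finally show ?thesis by (simp add: dX_diff)
  qed
  ultimately show ?thesis using PA.HA.hoch_sg[OF u'(1), of "n - 1"] by blast
qed

end

text \<open>Each summand applies d to exactly one entry, so a constant sign on d can be taken out of
  the sum.\<close>

lemma hD_sg_right:
  assumes "\<And>as a bs. f (as @ sg k a # bs) = sg k (f (as @ a # bs))"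
  shows "hD t (\<lambda>a. sg k (d a)) f as = sg k (hD t d f as)"
  using assms
proof (induction as arbitrary: f)
  case (Cons a as)
  have "hD t (\<lambda>a. sg k (d a)) (\<lambda>bs. f (t a # bs)) as = sg k (hD t d (\<lambda>bs. f (t a # bs)) as)"
    by (rule Cons.IH) (use Cons.prems[of "t a # cs" for cs] in simp)
  then show ?case using Cons.prems[of "[]" "d a" as] by (simp add: sg_add)
qed (simp add: sg_def)

section \<open>Left linear endomorphisms as coefficients\<close>

context triple
begin

text \<open>The Koszul sign of moving \<open>x\<close> past \<open>bs\<close>.\<close>

definition koszul :: "('x \<Rightarrow> 'b list \<Rightarrow> 'x) \<Rightarrow> 'x \<Rightarrow> 'b list \<Rightarrow> 'x" where
  "koszul G x bs = lext (grd X) (\<lambda>m x. G x (map (B.tau m) bs)) x"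

context
  fixes G :: "'x \<Rightarrow> 'b list \<Rightarrow> 'x"
  assumes Gx: "\<And>c x y bs. G (scl X c x + y) bs = scl X c (G x bs) + G y bs"
begin

lemma G_add: "G (x + y) bs = G x bs + G y bs"
  using Gx[of 1 x y bs] by (simp add: scl_1[OF gspM])

lemma G_0: "G 0 bs = 0"
  using G_add[of 0 0 bs] by simp

lemma G_scl: "G (scl X c x) bs = scl X c (G x bs)"
  using Gx[of c x 0 bs] by (simp add: G_0)

lemma koszul_hom: "x \<in> grd X m \<Longrightarrow> koszul G x bs = G x (map (B.tau m) bs)"
  unfolding koszul_def by (rule lext_homogeneous[OF gspM]) (simp_all add: G_0)

lemma koszul_add: "koszul G (x + y) bs = koszul G x bs + koszul G y bs"
  unfolding koszul_def by (rule lext_add[OF gspM CX CX]) (rule G_add)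

lemma koszul_scl: "koszul G (scl X c x) bs = scl X c (koszul G x bs)"
  unfolding koszul_def by (rule lext_scl[OF gspM CX]) (simp_all add: G_scl scl_add[OF gspM] G_0)

lemma koszul_x: "koszul G (scl X c x + y) bs = scl X c (koszul G x bs) + koszul G y bs"
  by (simp add: koszul_add koszul_scl)

lemma multilin_koszul: assumes "\<And>x. multilin (scl B) (scl X) (G x)" shows "multilin (scl B) (scl X) (koszul G x)"
proof -
  have "koszul G x (as @ (scl B c b + b') # bs) = scl X c (koszul G x (as @ b # bs)) + koszul G x (as @ b' # bs)" for as c b b' bs
    using gspM CX[of x]
  proof (induction x rule: gtot_induct)
    case (hom m x)
    then show ?case using multilinD[OF assms]
      by (simp add: koszul_hom tw_add[OF B.gsp] tw_scl[OF B.gsp])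
  next
    case (add x y)
    then show ?case by (simp add: koszul_add scl_add[OF gspM])
  qed
  then show ?thesis by (simp add: multilin_def)
qed

end

lemma map_tau_tau: "map (B.tau k) (map (B.tau m) bs) = map (B.tau (k + m)) bs"
  by (simp add: tw_tw[OF B.gsp])

lemma map_tau_even: "even k \<Longrightarrow> map (B.tau k) bs = bs"
  by (simp add: tw_even[OF B.gsp] map_idI)

text \<open>For homogeneous x the entries are twisted twice by the degree of x, which is an even
  twist; so reordering is an involution.\<close>

lemma koszul_koszul:
  assumes "\<And>c x y bs. G (scl X c x + y) bs = scl X c (G x bs) + G y bs"
  shows "koszul (koszul G) x bs = G x bs"
proof -
  note k = koszul_x[OF assms]
  show ?thesis using gspM CX[of x]
  proof (induction x rule: gtot_induct)
    case (hom m x)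
    then show ?case by (simp only: koszul_hom[OF k hom] koszul_hom[OF assms hom] map_tau_tau) (simp add: map_tau_even)
  qed (simp add: koszul_add[OF k] G_add[of G, OF assms])
qed

text \<open>In Hoch(A,X,B) the element x precedes \<open>bs\<close>, whereas an endomorphism-valued
  cochain takes \<open>bs\<close> before x; \<open>koszul\<close> supplies the sign of the
  exchange.\<close>

definition of_EL :: "('b list \<Rightarrow> 'x \<Rightarrow> 'x) \<Rightarrow> 'a list \<Rightarrow> 'x \<Rightarrow> 'b list \<Rightarrow> 'x" where
  "of_EL \<gamma> as x bs = (if as = [] then koszul (\<lambda>x bs. \<gamma> bs x) x bs else 0)"

lemma shdeg_tau: "shdeg (grd B) l bs \<Longrightarrow> shdeg (grd B) l (map (B.tau m) bs)"
  by (rule shdeg_map) (rule tw_grd[OF B.gsp])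

lemma EL_x: "HL.hoch N \<gamma> \<Longrightarrow> \<gamma> bs (scl X c x + y) = scl X c (\<gamma> bs x) + \<gamma> bs y"
  by (rule EL.U_x[OF HL.hoch_gtot])

lemma of_EL_hom: "HL.hoch N \<gamma> \<Longrightarrow> x \<in> grd X m \<Longrightarrow> of_EL \<gamma> [] x bs = \<gamma> (map (B.tau m) bs) x"
  unfolding of_EL_def using koszul_hom[of "\<lambda>x bs. \<gamma> bs x"] EL_x by simp

lemma hochX_of_EL:
  assumes \<gamma>: "HL.hoch N \<gamma>" shows "hochX (N + 1) (of_EL \<gamma>)"
proof (rule hochXI)
  have ml: "multilin (scl B) (scl EL) \<gamma>" using \<gamma> by (simp add: HL.hoch_def)
  show "multilin (scl A) (scl X) (\<lambda>as. of_EL \<gamma> as x bs)" for x bs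
    by (simp add: multilin_def of_EL_def scl_0[OF gspM])
  have "multilin (scl B) (scl X) (\<lambda>bs. \<gamma> bs x)" for x
    unfolding multilin_def by (simp add: multilinD[OF ml] EL_simps(1) plus_fun_apply)
  then have "multilin (scl B) (scl X) (koszul (\<lambda>x bs. \<gamma> bs x) x)" for x
    using multilin_koszul[of "\<lambda>x bs. \<gamma> bs x"] EL_x[OF \<gamma>] by blast
  then show "multilin (scl B) (scl X) (of_EL \<gamma> as x)" for as x
    by (auto simp: multilin_def of_EL_def scl_0[OF gspM])
  show "of_EL \<gamma> as (scl X c x + y) bs = scl X c (of_EL \<gamma> as x bs) + of_EL \<gamma> as y bs" for as c x y bs
    using koszul_x[of "\<lambda>x bs. \<gamma> bs x"] EL_x[OF \<gamma>] by (simp add: of_EL_def scl_0[OF gspM])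
  show "of_EL \<gamma> as x bs \<in> grd X (k + m + l + (N + 1) - 1)"
    if s: "shdeg (grd A) k as" "x \<in> grd X m" "shdeg (grd B) l bs" for k as m x l bs
  proof (cases as)
    case Nil
    with s(1) have k: "k = 0" by (auto elim: shdeg.cases)
    have "\<gamma> (map (B.tau m) bs) \<in> grd EL (l + N)" using \<gamma> shdeg_tau[OF s(3), of m] by (simp add: HL.hoch_def has_deg_def)
    from lin_degX(3)[OF EL.U_lin[OF this] s(2)] show ?thesis
      by (simp add: of_EL_hom[OF \<gamma> s(2)] Nil k algebra_simps)
  qed (simp add: of_EL_def grd_0[OF gspM])
  obtain P where P: "\<And>as. length as > P \<Longrightarrow> \<gamma> as = 0" using \<gamma> by (auto simp: HL.hoch_def bounded_arity_def)
  show "\<exists>P. \<forall>as x bs. length as + length bs > P \<longrightarrow> of_EL \<gamma> as x bs = 0"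
    by (rule exI[of _ P]) (auto simp: of_EL_def koszul_def P zero_fun_apply lext_def)
qed

lemma EL_lact_gtot_apply: "f \<in> gtot (grd EL) \<Longrightarrow> a \<in> grd A i \<Longrightarrow> f (lact X a x) = lact X a (tw (grd EL) i f x)"
  using EL.gspU
proof (induction f rule: gtot_induct)
  case (hom r f)
  then show ?case by (simp add: EL_lact EL.U_tw_hom lact_sg mult.commute)
next
  case (add f g)
  then show ?case unfolding tw_add[OF EL.gspU add(1,2)] by (simp add: plus_fun_apply lact_add_right)
qed

text \<open>The sign in the right action on \<open>EL\<close> is that of moving b past x, and the
  twist from \<open>koszul\<close> undoes it.\<close>

lemma EL_ract_tau:
  assumes f: "f \<in> gtot (grd EL)" and x: "x \<in> grd X m"
  shows "ract EL f (B.tau m b) x = ract X (f x) b"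
  using B.gsp B.tot[of b]
proof (induction b rule: gtot_induct)
  case (hom i b)
  have "ract EL f (B.tau m b) x = ract X (f (sg (i * m) x)) (sg (m * i) b)"
    unfolding EL_ract_hom[OF f tw_grd[OF B.gsp hom]] by (simp add: tw_hom[OF gspM x] tw_hom[OF B.gsp hom])
  also have "\<dots> = ract X (f x) b" by (simp add: EL.U_sg[OF f] ract_sg ract_sg_right mult.commute sg_even)
  finally show ?case .
qed (simp add: tw_add[OF B.gsp] EL_ract_add[OF f] plus_fun_apply ract_add_right)

text \<open>The left action of B on \<open>EL\<close> corresponds to the term where the head of
  \<open>bs\<close> multiplies x. All signs are accounted for because x b has the degrees of both x
  and b in \<open>of_EL\<close>.\<close>

lemma EL_lact_tau:
  assumes \<gamma>: "HL.hoch N \<gamma>" and x: "x \<in> grd X m"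
  shows "lact EL (B.tau (N - int (length bs)) (B.tau m b)) (\<gamma> (map (B.tau m) bs)) x = of_EL \<gamma> [] (ract X x b) bs"
  using B.gsp B.tot[of b]
proof (induction b rule: gtot_induct)
  case (hom j b)
  let ?k = "N - int (length bs)" and ?\<phi> = "\<gamma> (map (B.tau m) bs)"
  note f = HL.hoch_gtot[OF \<gamma>, of "map (B.tau m) bs"]
  have "lact EL (B.tau ?k (B.tau m b)) ?\<phi> x = tw (grd EL) j ?\<phi> (ract X (sg (j * m) x) (sg (?k * j) (sg (m * j) b)))"
    by (simp add: tw_hom[OF B.gsp hom] tw_sg[OF B.gsp B.tot] EL_lact_hom[OF f grd_sg[OF B.gsp hom]] tw_hom[OF gspM x] add.commute)
  also have "\<dots> = sg (?k * j) (tw (grd EL) j ?\<phi> (ract X x b))"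
    by (simp add: ract_sg ract_sg_right EL.U_sg[OF tw_gtot[OF EL.gspU f]]) (simp add: sg_def)
  also have "\<dots> = \<gamma> (map (B.tau j) (map (B.tau m) bs)) (ract X x b)"
    using HL.hoch_map_tw[OF \<gamma>, of j "map (B.tau m) bs"] by (simp add: sg_fun mult.commute sg_even)
  also have "\<dots> = of_EL \<gamma> [] (ract X x b) bs"
    unfolding map_tau_tau of_EL_hom[OF \<gamma> ract_grd[OF x hom]] by (simp add: add.commute)
  finally show ?case .
next
  case (add b b')
  then show ?case
    using hochX_add_x[OF hochX_of_EL[OF \<gamma>]]
    by (simp add: tw_add[OF B.gsp] EL_lact_add[OF HL.hoch_gtot[OF \<gamma>]] plus_fun_apply ract_add_right)
qed

text \<open>With no entry from A, \<open>exR\<close> gives both actions of B on the coefficients.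
  With one entry, \<open>lamX\<close> and \<open>exL\<close> differ by the failure of left
  linearity, which is 0; with more, every term vanishes.\<close>

lemma dX_of_EL:
  assumes \<gamma>: "HL.hoch N \<gamma>" shows "dX (N + 1) (of_EL \<gamma>) as x bs = of_EL (HL.dT N \<gamma>) as x bs"
proof -
  note C = HL.hoch_gtot[OF \<gamma>] and g = hochX_of_EL[OF \<gamma>]
  have ml: "multilin (scl B) (scl EL) \<gamma>" using \<gamma> by (simp add: HL.hoch_def)
  have h: "dX (N + 1) (of_EL \<gamma>) as x bs = of_EL (HL.dT N \<gamma>) as x bs" if x: "x \<in> grd X m" for x m
  proof (cases as)
    case Nil
    let ?p = "B.tau m" and ?k = "N - int (length bs)"
    have R: "of_EL \<gamma> [] x = (\<lambda>bs. \<gamma> (map ?p bs) x)" by (rule ext) (rule of_EL_hom[OF \<gamma> x])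
    have "hE (mul B) (ract X) (of_EL \<gamma> [] x) bs = hE (mul B) (ract EL) \<gamma> (map ?p bs) x
        \<and> hE (mul B) (ract EL) \<gamma> (map ?p bs) \<in> gtot (grd EL)"
      by (rule hE_rel[where R = "\<lambda>y z. y = z x \<and> z \<in> gtot (grd EL)" and p = ?p])
        (auto simp: R B.tau_mul zero_fun_apply EL_ract_tau[OF _ x] C intro: HL.CI)
    then have 1: "exX (of_EL \<gamma>) [] x bs = HL.lam N \<gamma> (map ?p bs) x - hE (mul B) (ract EL) \<gamma> (map ?p bs) x"
      by (cases bs) (simp_all add: exX_def exL_def exR_def EL_lact_tau[OF \<gamma> x] zero_fun_apply)
    \<comment> \<open>Pulling the differential of B through the twist by m costs (-1)^m; the twist
      of x by \<open>tw (grd X) 1\<close> in \<open>DX\<close> supplies the same sign again.\<close>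
    have "hD (B.tau 1) (dif B) (of_EL \<gamma> [] x) bs = hD (B.tau 1) (\<lambda>b. sg m (dif B b)) \<gamma> (map ?p bs) x"
      by (rule hD_rel[where R = "\<lambda>y z. y = z x" and p = ?p])
        (simp_all add: R zero_fun_apply plus_fun_apply B.tau_dif tw_tw[OF B.gsp] add.commute)
    also have "\<dots> = sg m (hD (B.tau 1) (dif B) \<gamma> (map ?p bs)) x"
      by (simp only: hD_sg_right[of \<gamma>, OF HL.multilin_sg[OF ml]])
    finally have "hD (B.tau 1) (dif B) (of_EL \<gamma> [] x) bs = sg m (hD (B.tau 1) (dif B) \<gamma> (map ?p bs)) x" .
    moreover have "of_EL \<gamma> [] (tw (grd X) 1 x) = (\<lambda>bs. sg m (of_EL \<gamma> [] x bs))"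
    proof
      fix bs
      show "of_EL \<gamma> [] (tw (grd X) 1 x) bs = sg m (of_EL \<gamma> [] x bs)"
        using additive_sg[OF gspM hochX_add_x[OF g, of "[]" _ _ bs] CX] by (simp add: tw_hom[OF gspM x])
    qed
    moreover have "hD (B.tau 1) (dif B) (\<lambda>bs. sg m (of_EL \<gamma> [] x bs)) bs = sg m (hD (B.tau 1) (dif B) (of_EL \<gamma> [] x) bs)"
      using hD_post[of UNIV "of_EL \<gamma> [] x" "\<lambda>_. sg m" "B.tau 1" "dif B" bs] by (simp add: sg_add)
    ultimately have 2: "hD (B.tau 1) (dif B) (of_EL \<gamma> [] (tw (grd X) 1 x)) bs = hD (B.tau 1) (dif B) \<gamma> (map ?p bs) x"
      by (simp add: sg_fun sg_even)
    have 3: "DX (of_EL \<gamma>) [] x bs = \<gamma> (map (B.tau 1) (map ?p bs)) (dif X x) + hD (B.tau 1) (dif B) \<gamma> (map ?p bs) x"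
      using 2 of_EL_hom[OF \<gamma> difM_grd[OF x], of bs] by (simp add: DX_def map_tau_tau[unfolded map_map] add.commute)
    have "dif EL (\<gamma> (map ?p bs)) x = dif X (\<gamma> (map ?p bs) x) - sg ?k (\<gamma> (map (B.tau 1) (map ?p bs)) (dif X x))"
      using HL.hoch_map_tw[OF \<gamma>, of 1 "map ?p bs"] by (simp add: EL.U_dif_tw[OF C] sg_fun)
    then have "HL.dT N \<gamma> (map ?p bs) x = sg (N - 1) (HL.lam N \<gamma> (map ?p bs) x - hE (mul B) (ract EL) \<gamma> (map ?p bs) x)
       + (dif X (\<gamma> (map ?p bs) x) - sg ?k (\<gamma> (map (B.tau 1) (map ?p bs)) (dif X x)))
       - sg ?k (hD (B.tau 1) (dif B) \<gamma> (map ?p bs) x)"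
      by (simp add: HL.dT_def HL.dH_def HL.del_def plus_fun_apply fun_diff_def sg_fun)
    then show ?thesis
      using 1 3 of_EL_hom[OF \<gamma> x, of bs] of_EL_hom[OF HL.hoch_dT[OF \<gamma>] x, of bs]
      by (simp add: Nil dX_def delX_def lamX_def sg_add) (simp add: sg_def)
  next
    case (Cons a as')
    have 3: "delX (N + 1) (of_EL \<gamma>) as x bs = 0" by (rule delX_eq_0) (use Cons in \<open>auto simp: of_EL_def\<close>)
    have 2: "exR (of_EL \<gamma>) as x bs = 0" by (rule exR_eq_0) (simp add: of_EL_def Cons)
    have "lamX (N + 1) (of_EL \<gamma>) as x bs - exL (of_EL \<gamma>) as x bs = 0"
    proof (cases as')
      case Nil
      let ?k = "N - int (length bs)"
      \<comment> \<open>Left linearity of the values has the sign of the degree of the value, which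
        contains that of \<open>bs\<close>; the twist of \<open>bs\<close> by the degree of a
        cancels this part and leaves the internal degree ?k.\<close>
      have "of_EL \<gamma> [] (lact X a x) bs = lact X (A.tau ?k a) (of_EL \<gamma> [] x bs)"
        using A.gsp A.tot[of a]
      proof (induction a rule: gtot_induct)
        case (hom i a)
        have "of_EL \<gamma> [] (lact X a x) bs = lact X a (tw (grd EL) i (\<gamma> (map (B.tau (i + m)) bs)) x)"
          unfolding of_EL_hom[OF \<gamma> lact_grd[OF hom x]] by (rule EL_lact_gtot_apply[OF C hom])
        also have "tw (grd EL) i (\<gamma> (map (B.tau (i + m)) bs)) x = sg (i * ?k) (\<gamma> (map (B.tau (i + (i + m))) bs) x)"
          using HL.hoch_map_tw[OF \<gamma>, of i "map (B.tau (i + m)) bs"] unfolding map_tau_tau by (simp add: sg_fun)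
        also have "map (B.tau (i + (i + m))) bs = map (B.tau m) bs"
          by (rule map_cong[OF refl]) (rule tw_parity[OF B.gsp B.tot], simp)
        finally show ?case by (simp add: of_EL_hom[OF \<gamma> x] tw_hom[OF A.gsp hom] lact_sg lact_sg_left mult.commute)
      next
        case (add a a')
        then show ?case using hochX_add_x[OF g] by (simp add: tw_add[OF A.gsp] lact_add_left)
      qed
      then show ?thesis by (simp add: Cons Nil lamX_def exL_def)
    next
      case (Cons a' as'')
      have "exL (of_EL \<gamma>) as x bs = 0" by (rule exL_eq_0, rule ext) (auto simp: of_EL_def \<open>as = a # as'\<close> Cons)
      then show ?thesis by (simp add: \<open>as = a # as'\<close> Cons lamX_def of_EL_def act_zero)
    qed
    with 2 3 show ?thesis by (simp add: dX_def exX_def) (simp add: of_EL_def Cons sg_def)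
  qed
  show ?thesis
    using gspM CX[of x]
    by (induction x rule: gtot_induct)
      (simp_all add: h hochX_add_x[OF hochX_dX[OF g]] hochX_add_x[OF hochX_of_EL[OF HL.hoch_dT[OF \<gamma>]]])
qed

text \<open>Here the component of the differential with one argument from A measures the failure of
  graded left linearity. Undoing \<open>koszul\<close> adds the degree of \<open>bs\<close> to the
  sign, as the degree of the value requires.\<close>

lemma EL_of_hochX:
  assumes g: "hochX n g" and b: "\<And>as x bs. as \<noteq> [] \<Longrightarrow> g as x bs = 0" and z: "\<And>a x bs. dX n g [a] x bs = 0"
  shows "\<exists>\<gamma>. HL.hoch (n - 1) \<gamma> \<and> g = of_EL \<gamma>"
proof (intro exI conjI)
  let ?\<gamma> = "\<lambda>bs x. koszul (g []) x bs"
  note gx = hochXD(2)[OF g, of "[]"]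
  show "g = of_EL ?\<gamma>" by (auto simp: fun_eq_iff of_EL_def koszul_koszul[OF gx] b)
  \<comment> \<open>The exponent is the internal degree of g on x and \<open>bs\<close>, one less
    than n - q because of the shift in the total degree.\<close>
  have rl: "g [] (lact X a x) bs = lact X (A.tau (n - 1 - int (length bs)) a) (g [] x bs)" for a x bs
  proof -
    have "exR g [a] x bs = 0" by (rule exR_eq_0) (simp add: b)
    moreover have "delX n g [a] x bs = 0" by (rule delX_eq_0, rule b) auto
    ultimately have "sg (n - 1) (lamX n g [a] x bs - exL g [a] x bs) = 0"
      using z[of a x bs] by (simp add: dX_def exX_def)
    then show ?thesis by (simp add: lamX_def exL_def sg_def algebra_simps split: if_splits)
  qed
  have "multilin (scl B) (scl EL) ?\<gamma>"
    unfolding multilin_def using multilinD[OF multilin_koszul[of "g []", OF gx hochXD(3)[OF g]]]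
    by (simp add: EL_simps(1) fun_eq_iff plus_fun_apply)
  moreover have "has_deg (grd B) (grd EL) (n - 1) ?\<gamma>"
    unfolding has_deg_def
  proof (intro allI impI)
    fix l bs assume l: "shdeg (grd B) l bs"
    have d: "g [] x (map (B.tau m) bs) \<in> grd X (m + l + n - 1)" if "x \<in> grd X m" for m x
      using hochXD(4)[OF g shdeg.Nil that shdeg_tau[OF l]] by simp
    have "lin_deg X X (l + (n - 1)) (?\<gamma> bs)"
      unfolding lin_deg_def using d
      by (auto simp: koszul_add[of "g []", OF gx] koszul_scl[of "g []", OF gx] koszul_hom[of "g []", OF gx] algebra_simps)
    moreover have "?\<gamma> bs (lact X a x) = sg ((l + (n - 1)) * i) (lact X a (?\<gamma> bs x))" if a: "a \<in> grd A i" for a i x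
      using gspM CX[of x]
    proof (induction x rule: gtot_induct)
      case (hom m x)
      let ?bs = "map (B.tau m) bs"
      have "?\<gamma> bs (lact X a x) = g [] (lact X a x) (map (B.tau i) ?bs)"
        unfolding map_tau_tau by (rule koszul_hom[of "g []", OF gx lact_grd[OF a hom]])
      also have "\<dots> = lact X (A.tau (n - 1 - int (length bs)) a) (g [] x (map (B.tau i) ?bs))"
        unfolding rl by simp
      also have "g [] x (map (B.tau i) ?bs) = sg (i * (l + int (length bs))) (g [] x ?bs)"
        using HBX.multilin_map_tw[OF shdeg_tau[OF l] hochXD(3)[OF g], of "[]" x i m] by simp
      also have "lact X (A.tau (n - 1 - int (length bs)) a) (sg (i * (l + int (length bs))) (g [] x ?bs))
          = sg ((n - 1 - int (length bs)) * i + i * (l + int (length bs))) (lact X a (g [] x ?bs))"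
        by (simp add: tw_hom[OF A.gsp a] lact_sg lact_sg_left add.commute)
      also have "\<dots> = sg ((l + (n - 1)) * i) (lact X a (g [] x ?bs))"
        by (rule sg_parity) auto
      finally show ?case by (simp add: koszul_hom[of "g []", OF gx hom])
    next
      case (add x y)
      then show ?case by (simp add: koszul_add[of "g []", OF gx] lact_add_right sg_add)
    qed
    ultimately show "?\<gamma> bs \<in> grd EL (l + (n - 1))" by (simp add: EL_simps(2) end_l_deg_def)
  qed
  moreover have "bounded_arity ?\<gamma>"
  proof -
    obtain P where P: "\<And>as x bs. length as + length bs > P \<Longrightarrow> g as x bs = 0" by (rule hochX_bounded[OF g]) blast
    show ?thesis unfolding bounded_arity_def
      by (rule exI[of _ P]) (auto simp: fun_eq_iff zero_fun_apply koszul_def lext_def P)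
  qed
  ultimately show "HL.hoch (n - 1) ?\<gamma>" by (simp add: HL.hoch_def)
qed

lemma rhoB_hom:
  assumes x: "x \<in> grd X m" shows "rhoB X B b x = ract X x (B.tau m b)"
proof -
  have "lext (grd X) (\<lambda>n x'. sg (n * i) (ract X x' b')) x = sg (m * i + 0) (ract X x b')" for i b'
    using lext_homogeneous[OF gspM x, of "\<lambda>n x'. sg (n * i) (ract X x' b')"] by (simp add: act_zero sg_def)
  then have "rhoB X B b x = lext (grd B) (\<lambda>i b'. sg (m * i + 0) (ract X x b')) b" by (simp only: rhoB_def)
  also have "\<dots> = ract X x (B.tau m b)"
    using lext_tw[OF B.gsp B.tot, of "ract X x" m 0 b] by (simp add: ract_add_right sg_def)
  finally show ?thesis .
qed

text \<open>Reordering contributes the degree of x times that of \<open>bs\<close>, and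
  \<open>rhoB\<close> the degree of x times that of the value of h. The difference is the internal
  degree n - q of h, which is the twist in \<open>actB\<close>.\<close>

lemma actB_of_EL:
  assumes h: "PB.HA.hoch n h" and r: "HL.hoch n (\<lambda>bs. rhoB X B (h bs))"
  shows "actB n h as x bs = of_EL (\<lambda>bs. rhoB X B (h bs)) as x bs"
  using gspM CX[of x]
proof (induction x rule: gtot_induct)
  case (hom m x)
  let ?k = "n - int (length bs)"
  have "rhoB X B (h (map (B.tau m) bs)) x = ract X x (sg (m * ?k) (h (map (B.tau 0) bs)))"
    using PB.HA.hoch_map_tw[OF h, of m "map (B.tau m) bs"] map_tau_tau[of m m bs] map_tau_even[of "m + m" bs]
    by (simp add: rhoB_hom[OF hom] map_tau_even)
  then show ?case
    using of_EL_hom[OF r hom, of bs]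
    by (cases "as = []") (simp_all add: actB_def of_EL_def tw_hom[OF gspM hom] map_tau_even ract_sg ract_sg_right mult.commute)
next
  case (add x y)
  have "actB n h as (x + y) bs = actB n h as x bs + actB n h as y bs"
    by (simp add: actB_def tau_X_add ract_add_left)
  then show ?case using add hochX_add_x[OF hochX_of_EL[OF r]] by simp
qed

lemma of_EL_inject:
  assumes \<gamma>: "HL.hoch n \<gamma>" and \<delta>: "HL.hoch n' \<delta>" and e: "\<And>as x bs. of_EL \<gamma> as x bs = of_EL \<delta> as x bs"
  shows "\<gamma> bs = \<delta> bs"
proof (rule EL.U_eqI[OF HL.hoch_gtot[OF \<gamma>] HL.hoch_gtot[OF \<delta>]])
  fix m x assume x: "x \<in> grd X m"
  show "\<gamma> bs x = \<delta> bs x"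
    using e[of "[]" x "map (B.tau m) bs"]
    unfolding of_EL_hom[OF \<gamma> x] of_EL_hom[OF \<delta> x] map_tau_tau by (simp add: map_tau_even)
qed

lemma of_EL_add: "of_EL (\<lambda>bs. \<gamma> bs + \<delta> bs) as x bs = of_EL \<gamma> as x bs + of_EL \<delta> as x bs"
  by (simp add: of_EL_def koszul_def lext_def plus_fun_apply sum.distrib)

lemma of_EL_sg: "of_EL (\<lambda>bs. sg k (\<gamma> bs)) as x bs = sg k (of_EL \<gamma> as x bs)"
  by (simp add: of_EL_def koszul_def lext_def sg_fun sg_sum)

text \<open>After peeling, the rest of g takes left linear values, and its differential is the image
  of a multiple of h under \<open>rhoB\<close>; that pair is a cocycle of the cone to which
  nilpotency applies.\<close>

theorem kernel_A_acyclic: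
  assumes ex: "exact_L A X B" and mor: "bimod_mor (regular_bimod B) EL (rhoB X B)"
    and nil: "weakly_cone_nilpotent B (regular_bimod B) EL (rhoB X B)"
    and h: "PB.HA.hoch n h" "\<And>bs. PB.HA.dT n h bs = 0" and g: "hochX n g"
    and z: "\<And>as x bs. dX n g as x bs + sg (n - 1) (actB n h as x bs) = 0"
  shows "\<exists>h' g'. PB.HA.hoch (n - 1) h' \<and> hochX (n - 1) g' \<and> (\<forall>bs. PB.HA.dT (n - 1) h' bs = h bs) \<and>
    (\<forall>as x bs. dX (n - 1) g' as x bs + sg (n - 2) (actB (n - 1) h' as x bs) = g as x bs)"
proof -
  interpret R: hoch_morphism B "regular_bimod B" EL "rhoB X B"
    by (intro hoch_morphism.intro hoch_morphism_axioms.intro PB.HA.hoch_coeff_axioms HL.hoch_coeff_axioms mor)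
  have rsg: "rhoB X B (sg k b) = sg k (rhoB X B b)" for k b using R.mor_sg[of b k] by simp
  have "dX n g as x bs = 0" if "as \<noteq> []" for as x bs using z[of as x bs] that by (simp add: actB_def)
  from peel_L[OF ex g this] obtain g0 where g0: "hochX (n - 1) g0"
    "\<And>as x bs. as \<noteq> [] \<Longrightarrow> dX (n - 1) g0 as x bs = g as x bs" by blast
  let ?g2 = "\<lambda>as x bs. g as x bs - dX (n - 1) g0 as x bs"
  have g2: "hochX n ?g2" using hochX_diff[OF g] hochX_dX[OF g0(1)] by simp
  have dg2: "dX n ?g2 as x bs = - sg (n - 1) (actB n h as x bs)" for as x bs
    using z[of as x bs] dX_dX[OF g0(1), of as x bs] by (simp add: dX_diff eq_neg_iff_add_eq_0)
  have "\<exists>\<gamma>. HL.hoch (n - 1) \<gamma> \<and> ?g2 = of_EL \<gamma>"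
    by (rule EL_of_hochX[OF g2]) (simp_all add: g0(2) dg2 actB_def)
  then obtain \<gamma> where \<gamma>: "HL.hoch (n - 1) \<gamma>" "?g2 = of_EL \<gamma>" by blast
  \<comment> \<open>The exponent is n and not n - 1, because \<open>actB\<close> enters the middle
    component with the sign opposite to that of \<open>actA\<close>.\<close>
  let ?u = "\<lambda>bs. sg n (h bs)"
  have u: "PB.HA.hoch n ?u" "PB.HA.dT n ?u bs = 0" for bs
    using PB.HA.hoch_sg[OF h(1)] PB.HA.dT_sg[of h n n bs] h(2) by simp_all
  have "rhoB X B (?u bs) = HL.dT (n - 1) \<gamma> bs" for bs
  proof (rule of_EL_inject[OF R.hoch_mor[OF u(1)] HL.hoch_dT[OF \<gamma>(1)]])
    fix as x bs
    have "of_EL (\<lambda>bs. rhoB X B (?u bs)) as x bs = sg n (actB n h as x bs)"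
      by (simp only: rsg of_EL_sg actB_of_EL[OF h(1) R.hoch_mor[OF h(1)]])
    also have "\<dots> = - sg (n - 1) (actB n h as x bs)" by (simp add: sg_def)
    also have "\<dots> = of_EL (HL.dT (n - 1) \<gamma>) as x bs"
      using dg2[of as x bs] dX_of_EL[OF \<gamma>(1), of as x bs] by (simp add: \<gamma>(2))
    finally show "of_EL (\<lambda>bs. rhoB X B (?u bs)) as x bs = of_EL (HL.dT (n - 1) \<gamma>) as x bs" .
  qed
  from R.weakly_cone_nilpotent_exact[OF nil u \<gamma>(1) this] obtain u' v' where
    u': "PB.HA.hoch (n - 1) u'" "\<And>bs. PB.HA.dT (n - 1) u' bs = ?u bs" and v': "HL.hoch (n - 2) v'"
    and e: "\<And>bs. rhoB X B (u' bs) = \<gamma> bs + HL.dT (n - 2) v' bs" by blast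
  let ?h' = "\<lambda>bs. sg n (u' bs)" and ?g' = "\<lambda>as x bs. g0 as x bs - of_EL v' as x bs"
  have h': "PB.HA.hoch (n - 1) ?h'" by (rule PB.HA.hoch_sg[OF u'(1)])
  have "PB.HA.dT (n - 1) ?h' bs = h bs" for bs
    using PB.HA.dT_sg[of u' "n - 1" n bs] u'(2) by (simp add: sg_even)
  moreover have "hochX (n - 1) ?g'" using hochX_diff[OF g0(1)] hochX_of_EL[OF v'] by simp
  moreover have "dX (n - 1) ?g' as x bs + sg (n - 2) (actB (n - 1) ?h' as x bs) = g as x bs" for as x bs
  proof -
    have "sg (n - 2) (actB (n - 1) ?h' as x bs) = sg (n - 2) (sg n (of_EL (\<lambda>bs. rhoB X B (u' bs)) as x bs))"
      by (simp only: actB_of_EL[OF h' R.hoch_mor[OF h']] rsg of_EL_sg)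
    also have "\<dots> = of_EL (\<lambda>bs. rhoB X B (u' bs)) as x bs" by (simp add: sg_def)
    also have "\<dots> = of_EL \<gamma> as x bs + of_EL (HL.dT (n - 2) v') as x bs"
      by (simp only: e of_EL_add)
    also have "of_EL (HL.dT (n - 2) v') as x bs = dX (n - 1) (of_EL v') as x bs"
      using dX_of_EL[OF v', of as x bs] by simp
    also have "of_EL \<gamma> as x bs = g as x bs - dX (n - 1) g0 as x bs" using \<gamma>(2) by (simp add: fun_eq_iff)
    finally show ?thesis by (simp add: dX_diff)
  qed
  ultimately show ?thesis using h' by blast
qed

end

section \<open>Acyclic kernels and the two isomorphisms\<close>

context triple
begin

lemma emb_eq_0D:
  assumes "\<And>as bs. g as 0 bs = 0" and "emb f g h = 0"
  shows "f as = 0" "g as x bs = 0" "h bs = 0"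
proof -
  have "f = (\<lambda>_. 0)" using prA_emb'[of f g h] by (simp add: assms(2) prA_def[abs_def] zero_fun_apply)
  moreover have "g = (\<lambda>_ _ _. 0)" using prX_emb[of g f h] assms by (simp add: prX_def[abs_def] zero_fun_apply)
  moreover have "h = (\<lambda>_. 0)" using prB_emb'[of f g h] by (simp add: assms(2) prB_def[abs_def] zero_fun_apply)
  ultimately show "f as = 0" "g as x bs = 0" "h bs = 0" by simp_all
qed

text \<open>The embedding is injective on triples vanishing at x = 0, so the cocycle equation splits
  into its three components.\<close>

lemma cocycleD:
  assumes g: "hochX n g" and F: "emb f g h \<in> grd V n" "dif V (emb f g h) = 0"
  shows "PA.HA.dT n f as = 0" "PB.HA.dT n h bs = 0"
    "dX n g as x bs + sg (n - 1) (actB n h as x bs - actA f as x bs) = 0"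
proof -
  have 1: "emb (PA.HA.dT n f) (\<lambda>as x bs. dX n g as x bs + sg (n - 1) (actB n h as x bs - actA f as x bs)) (PB.HA.dT n h) = 0"
    using F(2) dT_emb[of g n f h] hochX_add_x[OF g] by (simp add: dif_V[OF F(1)])
  have 0: "dX n g as 0 bs + sg (n - 1) (actB n h as 0 bs - actA f as 0 bs) = 0" for as bs
    using dX_0_x[of g] hochX_0_x[OF g] by (simp add: actA_def actB_def act_zero tau_zero)
  note e = emb_eq_0D[of "\<lambda>as x bs. dX n g as x bs + sg (n - 1) (actB n h as x bs - actA f as x bs)", OF 0 1]
  show "PA.HA.dT n f as = 0" "PB.HA.dT n h bs = 0"
    "dX n g as x bs + sg (n - 1) (actB n h as x bs - actA f as x bs) = 0"
    by (rule e)+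
qed

theorem projections_gerstenhaber_iso:
  assumes A: "bimod_mor (regular_bimod A) ER (rhoA X)" "weakly_cone_nilpotent A (regular_bimod A) ER (rhoA X)" "exact_R A X B"
    and B: "bimod_mor (regular_bimod B) EL (rhoB X B)" "weakly_cone_nilpotent B (regular_bimod B) EL (rhoB X B)" "exact_L A X B"
  shows "(cochain_map V (Hoch A) prA \<and> gerstenhaber_iso (HH V) (HH (Hoch A)) (coh_map (Hoch A) prA)) \<and>
    cochain_map V (Hoch B) prB \<and> gerstenhaber_iso (HH V) (HH (Hoch B)) (coh_map (Hoch B) prB)"
\<comment> \<open>Both goals ask for a primitive inside the kernel of a projection and share the
  decomposition of F, so one block proves the two of them.\<close>
proof (rule conjI[OF prA_iso prB_iso])
  fix n F assume F: "F \<in> grd V n" "dif V F = 0"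
  obtain f g h where fgh: "PA.HA.hoch n f" "hochX n g" "PB.HA.hoch n h" and e: "F = emb f g h" using F(1) unfolding grd_V by blast
  note c = cocycleD[OF fgh(2) F[unfolded e]]
  have zero: "actA (\<lambda>_. 0) as x bs = 0" "actB k (\<lambda>_. 0) as x bs = 0" for as x bs k
    by (simp_all add: actA_def actB_def act_zero)
  {
    assume "prA F = 0"
    then have f: "f = (\<lambda>_. 0)" by (simp add: e prA_emb' zero_fun_def)
    have "dX n g as x bs + sg (n - 1) (actB n h as x bs) = 0" for as x bs
      using c(3)[of as x bs] by (simp add: f zero)
    from kernel_A_acyclic[OF B(3,1,2) fgh(3) c(2) fgh(2) this] obtain h' g'
      where h': "PB.HA.hoch (n - 1) h'" "\<And>bs. PB.HA.dT (n - 1) h' bs = h bs" and g': "hochX (n - 1) g'"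
        and d: "\<And>as x bs. dX (n - 1) g' as x bs + sg (n - 2) (actB (n - 1) h' as x bs) = g as x bs" by blast
    let ?G = "emb (\<lambda>_. 0) g' h'"
    have G: "?G \<in> grd V (n - 1)" unfolding grd_V using PA.HA.hoch_zero g' h'(1) by blast
    have "PA.HA.dT (n - 1) (\<lambda>_. 0) = (\<lambda>_. 0)" by (rule ext) (rule PA.HA.dT_0)
    moreover have "PB.HA.dT (n - 1) h' = h" by (rule ext) (rule h'(2))
    ultimately have "dif V ?G = F"
      using dT_emb[of g' "n - 1" "\<lambda>_. 0" h'] hochX_add_x[OF g'] by (simp add: dif_V[OF G] d e f zero)
    then show "\<exists>G\<in>grd V (n - 1). prA G = 0 \<and> dif V G = F"
      using G by (intro bexI[of _ ?G]) (simp_all add: prA_emb' zero_fun_def)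
  next
    assume "prB F = 0"
    then have h: "h = (\<lambda>_. 0)" by (simp add: e prB_emb' zero_fun_def)
    have "dX n g as x bs - sg (n - 1) (actA f as x bs) = 0" for as x bs
      using c(3)[of as x bs] by (simp add: h zero sg_minus)
    from kernel_B_acyclic[OF A(3,1,2) fgh(1) c(1) fgh(2) this] obtain f' g'
      where f': "PA.HA.hoch (n - 1) f'" "\<And>as. PA.HA.dT (n - 1) f' as = f as" and g': "hochX (n - 1) g'"
        and d: "\<And>as x bs. dX (n - 1) g' as x bs - sg (n - 2) (actA f' as x bs) = g as x bs" by blast
    let ?G = "emb f' g' (\<lambda>_. 0)"
    have G: "?G \<in> grd V (n - 1)" unfolding grd_V using PB.HA.hoch_zero g' f'(1) by blast
    have "PB.HA.dT (n - 1) (\<lambda>_. 0) = (\<lambda>_. 0)" by (rule ext) (rule PB.HA.dT_0)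
    moreover have "PA.HA.dT (n - 1) f' = f" by (rule ext) (rule f'(2))
    ultimately have "dif V ?G = F"
      using dT_emb[of g' "n - 1" f' "\<lambda>_. 0"] hochX_add_x[OF g'] by (simp add: dif_V[OF G] d e h zero sg_minus)
    then show "\<exists>G\<in>grd V (n - 1). prB G = 0 \<and> dif V G = F"
      using G by (intro bexI[of _ ?G]) (simp_all add: prB_emb' zero_fun_def)
  }
qed

end

theorem theoremA:
  fixes A :: "('k::real_or_complex, 'a::ab_group_add) dgalg"
    and B :: "('k, 'b::ab_group_add) dgalg"
    and X :: "('k, 'x::ab_group_add, 'a, 'b) bimod"
  assumes "keller_admissible A X B"
  shows "cochain_map (Hoch_bimod A X B) (Hoch A) prA \<and>
     gerstenhaber_iso (HH (Hoch_bimod A X B)) (HH (Hoch A)) (coh_map (Hoch A) prA) \<and>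
     cochain_map (Hoch_bimod A X B) (Hoch B) prB \<and>
     gerstenhaber_iso (HH (Hoch_bimod A X B)) (HH (Hoch B)) (coh_map (Hoch B) prB)"
proof -
  interpret triple A B X
    using assms by unfold_locales (simp_all add: keller_admissible_def)
  show ?thesis using projections_gerstenhaber_iso assms by (simp add: keller_admissible_def)
qed

end
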